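(* Let $K$ be an algebraically closed field of characteristic not equal to two and let $B$ be a block algebra of a Hecke algebra of classical type (type $A$, $B$ or $D$) over $K$, which is of tame and not of finite representation type; $B$ is a cellular algebra. Order the simple modules according to the vertices $1,2$ of the quivers given for $A(2,1,2)$, $A(2,2,1)$, $A(2,2,2)$. If $B$ is Morita equivalent to $A(2,1,2)$, $A(2,2,1)$ or $A(2,2,2)$, then its Cartan matrix is respectively $$\begin{pmatrix}3&1\\1&3\end{pmatrix},\quad \begin{pmatrix}4&2\\2&3\end{pmatrix},\quad \begin{pmatrix}4&2\\2&4\end{pmatrix},$$ and its decomposition matrix (rows: cell modules, columns: simple modules) is, up to permutation of the rows, respectively $$\begin{pmatrix}1&0\\1&0\\1&1\\0&1\\0&1\end{pmatrix},\quad \begin{pmatrix}1&0\\1&0\\1&1\\1&1\\0&1\end{pmatrix},\quad \begin{pmatrix}1&0\\1&0\\1&1\\1&1\\0&1\\0&1\end{pmatrix}.$$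
   Context: Hecke algebras over $K$, with $1\ne q\in K^\times$ and $Q\in K^\times$. Type $A$: $H^A_n(q)$ has generators $T_1,\dots,T_{n-1}$ with $(T_i-q)(T_i+1)=0$ and the type $A$ braid relations. Type $B$: $H_n(q,Q)$ has generators $T_0,\dots,T_{n-1}$ with $(T_0-Q)(T_0+1)=0$, $(T_i-q)(T_i+1)=0$ for $i\ge1$ and the type $B$ braid relations ($(T_0T_1)^2=(T_1T_0)^2$). Type $D$: $H^D_n(q)$ $(n\ge3)$ has generators $T_0,\dots,T_{n-1}$ with $(T_i-q)(T_i+1)=0$ for all $i$ and the type $D$ braid relations ($T_0T_2T_0=T_2T_0T_2$, $T_0$ commuting with $T_i$ for $i\ne2$). Block algebras of these Hecke algebras are cellular (in the sense of Graham and Lehrer) by known results of Dipper, James, Murphy and Geck; the decomposition matrix records the composition multiplicities of the simple modules in the cell modules. The algebras (paths composed from left to right): - $A(2,2,2)$: quiver with vertices $1,2$, loops $\alpha$ at $1$ and $\beta$ at $2$, arrows $\mu:1\to2$, $\nu:2\to1$; relations $\alpha\mu=\mu\beta=\beta\nu=\nu\alpha=0$, $\alpha^2=(\mu\nu)^2$, $\beta^2=(\nu\mu)^2$. - $A(2,1,2)$: the same quiver; relations $\alpha\mu=\mu\beta=\beta\nu=\nu\alpha=0$, $\alpha^2=\mu\nu$, $\beta^2=\nu\mu$. - $A(2,2,1)$: quiver with vertices $1,2$, a loop $\alpha$ at $1$, arrows $\mu:1\to2$, $\nu:2\to1$; relations $\alpha\mu=\mu\nu\mu\nu\mu=\nu\mu\nu\mu\nu=\nu\alpha=0$,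 $\alpha^2=(\mu\nu)^2$. *)

theory Defs
  imports
    "HOL-Computational_Algebra.Computational_Algebra"
    "Graph_Theory.Arc_Walk"
    "Jordan_Normal_Form.Matrix"
    "HOL-Algebra.QuotRing"
begin

text \<open>
  \<open>K\<close> is a type \<open>'k\<close> of class \<^class>\<open>field\<close>. A \<open>K\<close>-algebra is a record of type
  \<open>('k, 'a) module\<close>, whose ring fields carry the (not necessarily commutative) ring structure and
  whose scalar multiplication is the action of \<open>K\<close>. A module over it is a record of type
  \<open>('a, 'm) module\<close>, of which the multiplicative fields are not used, exactly as for
  \<^locale>\<open>module\<close>. All modules are left modules. The library locale \<^locale>\<open>module\<close> cannot be used
  because it asks for a commutative ring.
\<close>

section \<open>Modules over an algebra\<close>

locale left_module = R?: ring R + M?: abelian_group M for R (structure) and M (structure) +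
  assumes smult_closed:
      "\<lbrakk>a \<in> carrier R; x \<in> carrier M\<rbrakk> \<Longrightarrow> a \<odot>\<^bsub>M\<^esub> x \<in> carrier M"
    and smult_l_distr:
      "\<lbrakk>a \<in> carrier R; b \<in> carrier R; x \<in> carrier M\<rbrakk> \<Longrightarrow>
        (a \<oplus> b) \<odot>\<^bsub>M\<^esub> x = a \<odot>\<^bsub>M\<^esub> x \<oplus>\<^bsub>M\<^esub> b \<odot>\<^bsub>M\<^esub> x"
    and smult_r_distr:
      "\<lbrakk>a \<in> carrier R; x \<in> carrier M; y \<in> carrier M\<rbrakk> \<Longrightarrow>
        a \<odot>\<^bsub>M\<^esub> (x \<oplus>\<^bsub>M\<^esub> y) = a \<odot>\<^bsub>M\<^esub> x \<oplus>\<^bsub>M\<^esub> a \<odot>\<^bsub>M\<^esub> y"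
    and smult_assoc1:
      "\<lbrakk>a \<in> carrier R; b \<in> carrier R; x \<in> carrier M\<rbrakk> \<Longrightarrow>
        (a \<otimes> b) \<odot>\<^bsub>M\<^esub> x = a \<odot>\<^bsub>M\<^esub> (b \<odot>\<^bsub>M\<^esub> x)"
    and smult_one:
      "x \<in> carrier M \<Longrightarrow> \<one> \<odot>\<^bsub>M\<^esub> x = x"

text \<open>Homomorphisms are extensional functions, so that equal homomorphisms are equal in HOL.\<close>

definition module_hom :: "('k, 'a) module \<Rightarrow> ('a, 'm) module \<Rightarrow> ('a, 'n) module \<Rightarrow> ('m \<Rightarrow> 'n) set"
  where "module_hom A M N = {f \<in> carrier M \<rightarrow>\<^sub>E carrier N.
    (\<forall>x\<in>carrier M. \<forall>y\<in>carrier M. f (x \<oplus>\<^bsub>M\<^esub> y) = f x \<oplus>\<^bsub>N\<^esub> f y) \<and>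
    (\<forall>a\<in>carrier A. \<forall>x\<in>carrier M. f (a \<odot>\<^bsub>M\<^esub> x) = a \<odot>\<^bsub>N\<^esub> f x)}"

definition module_iso :: "('k, 'a) module \<Rightarrow> ('a, 'm) module \<Rightarrow> ('a, 'n) module \<Rightarrow> bool"
  where "module_iso A M N \<longleftrightarrow> (\<exists>f\<in>module_hom A M N. bij_betw f (carrier M) (carrier N))"

definition factor_module :: "('a, 'm) module \<Rightarrow> 'm set \<Rightarrow> ('a, 'm set) module"
  where "factor_module M U =
    \<lparr>carrier = a_rcosets\<^bsub>M\<^esub> U, mult = undefined, one = undefined, zero = U, add = set_add M,
     smult = (\<lambda>a X. \<Union>x\<in>X. U +>\<^bsub>M\<^esub> (a \<odot>\<^bsub>M\<^esub> x))\<rparr>"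

definition simple_module :: "('k, 'a) module \<Rightarrow> ('a, 'm) module \<Rightarrow> bool"
  where "simple_module A M \<longleftrightarrow> left_module A M \<and> carrier M \<noteq> {\<zero>\<^bsub>M\<^esub>} \<and>
    (\<forall>U. submodule U A M \<longrightarrow> U = {\<zero>\<^bsub>M\<^esub>} \<or> U = carrier M)"

definition indecomposable_module :: "('k, 'a) module \<Rightarrow> ('a, 'm) module \<Rightarrow> bool"
  where "indecomposable_module A M \<longleftrightarrow> left_module A M \<and> carrier M \<noteq> {\<zero>\<^bsub>M\<^esub>} \<and>
    (\<forall>U V. submodule U A M \<and> submodule V A M \<and> U \<inter> V = {\<zero>\<^bsub>M\<^esub>} \<and> U <+>\<^bsub>M\<^esub> V = carrier M \<longrightarrow>
      U = {\<zero>\<^bsub>M\<^esub>} \<or> V = {\<zero>\<^bsub>M\<^esub>})"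

definition composition_factor :: "('a, 'm) module \<Rightarrow> 'm set list \<Rightarrow> nat \<Rightarrow> ('a, 'm set) module"
  where "composition_factor M Us i = factor_module (M\<lparr>carrier := Us ! Suc i\<rparr>) (Us ! i)"

definition composition_series :: "('k, 'a) module \<Rightarrow> ('a, 'm) module \<Rightarrow> 'm set list \<Rightarrow> bool"
  where "composition_series A M Us \<longleftrightarrow>
    Us \<noteq> [] \<and> hd Us = {\<zero>\<^bsub>M\<^esub>} \<and> last Us = carrier M \<and> (\<forall>U\<in>set Us. submodule U A M) \<and>
    (\<forall>i. Suc i < length Us \<longrightarrow>
      Us ! i \<subseteq> Us ! Suc i \<and> simple_module A (composition_factor M Us i))"

text \<open>
  The composition multiplicity of \<open>S\<close> in \<open>M\<close>; by the Jordan-Hoelder theorem it does not depend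
  on the series.
\<close>

definition comp_mult :: "('k, 'a) module \<Rightarrow> ('a, 'm) module \<Rightarrow> ('a, 'n) module \<Rightarrow> nat"
  where "comp_mult A M S = (THE k. \<exists>Us. composition_series A M Us \<and>
    k = card {i. Suc i < length Us \<and> module_iso A (composition_factor M Us i) S})"


section \<open>Finite-dimensional modules\<close>

definition lincomb :: "('k, 'm) module \<Rightarrow> ('i \<Rightarrow> 'm) \<Rightarrow> 'i set \<Rightarrow> ('i \<Rightarrow> 'k) \<Rightarrow> 'm"
  where "lincomb V v I c = (\<Oplus>\<^bsub>V\<^esub>i\<in>I. c i \<odot>\<^bsub>V\<^esub> v i)"

definition finite_basis :: "('k, 'm) module \<Rightarrow> ('i \<Rightarrow> 'm) \<Rightarrow> 'i set \<Rightarrow> bool"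
  where "finite_basis V v I \<longleftrightarrow> finite I \<and> v ` I \<subseteq> carrier V \<and>
    bij_betw (lincomb V v I) (I \<rightarrow>\<^sub>E UNIV) (carrier V)"

definition restrict_scalars :: "('k, 'a) module \<Rightarrow> ('a, 'm) module \<Rightarrow> ('k, 'm) module"
  where "restrict_scalars A M =
    \<lparr>carrier = carrier M, mult = undefined, one = undefined, zero = \<zero>\<^bsub>M\<^esub>, add = add M,
     smult = (\<lambda>c x. (c \<odot>\<^bsub>A\<^esub> \<one>\<^bsub>A\<^esub>) \<odot>\<^bsub>M\<^esub> x)\<rparr>"

definition has_dim :: "('k, 'a) module \<Rightarrow> ('a, 'm) module \<Rightarrow> nat \<Rightarrow> bool"
  where "has_dim A M d \<longleftrightarrow> (\<exists>v. finite_basis (restrict_scalars A M) v {..<d})"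

text \<open>
  The category of finite-dimensional modules. Every finite-dimensional module has an isomorphic
  copy on a subset of the type \<open>'k vec\<close>, for example on \<open>carrier_vec d\<close>.
\<close>

definition fd_modules :: "('k::field, 'a) module \<Rightarrow> ('a, 'k vec) module set"
  where "fd_modules A = {M. left_module A M \<and> (\<exists>d. has_dim A M d)}"

definition complete_simples :: "('k::field, 'a) module \<Rightarrow> ('a, 'k vec) module list \<Rightarrow> bool"
  where "complete_simples A Ss \<longleftrightarrow>
    (\<forall>S\<in>set Ss. S \<in> fd_modules A \<and> simple_module A S) \<and>
    (\<forall>i<length Ss. \<forall>j<length Ss. i \<noteq> j \<longrightarrow> \<not> module_iso A (Ss ! i) (Ss ! j)) \<and>
    (\<forall>T\<in>fd_modules A. simple_module A T \<longrightarrow> (\<exists>S\<in>set Ss. module_iso A T S))"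

text \<open>
  Projectivity in the category \<open>fd_modules A\<close>. For finite-dimensional \<open>A\<close> this is projectivity in
  the category of all modules, since a finite-dimensional module is a quotient of some \<open>A\<^sup>n\<close>.
\<close>

definition projective_module :: "('k::field, 'a) module \<Rightarrow> ('a, 'k vec) module \<Rightarrow> bool"
  where "projective_module A P \<longleftrightarrow> P \<in> fd_modules A \<and>
    (\<forall>M\<in>fd_modules A. \<forall>N\<in>fd_modules A. \<forall>g\<in>module_hom A M N. \<forall>f\<in>module_hom A P N.
      g ` carrier M = carrier N \<longrightarrow> (\<exists>h\<in>module_hom A P M. compose (carrier P) g h = f))"

text \<open>The last condition says that the kernel of \<open>p\<close> is superfluous.\<close>

definition is_projective_cover ::
  "('k::field, 'a) module \<Rightarrow> ('a, 'k vec) module \<Rightarrow> ('a, 'k vec) module \<Rightarrow> bool"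
  where "is_projective_cover A P S \<longleftrightarrow> projective_module A P \<and>
    (\<exists>p\<in>module_hom A P S. p ` carrier P = carrier S \<and>
      (\<forall>U. submodule U A P \<and> p ` U = carrier S \<longrightarrow> U = carrier P))"

definition projective_cover ::
  "('k::field, 'a) module \<Rightarrow> ('a, 'k vec) module \<Rightarrow> ('a, 'k vec) module"
  where "projective_cover A S = (SOME P. is_projective_cover A P S)"

definition cartan_matrix :: "('k::field, 'a) module \<Rightarrow> ('a, 'k vec) module list \<Rightarrow> nat mat"
  where "cartan_matrix A Ss = mat (length Ss) (length Ss)
    (\<lambda>(i, j). comp_mult A (projective_cover A (Ss ! i)) (Ss ! j))"


section \<open>Representation type\<close>

definition finite_representation_type :: "('k::field, 'a) module \<Rightarrow> bool"
  where "finite_representation_type A \<longleftrightarrow> (\<exists>\<M>. finite \<M> \<and> \<M> \<subseteq> fd_modules A \<and>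
    (\<forall>M\<in>fd_modules A. indecomposable_module A M \<longrightarrow> (\<exists>N\<in>\<M>. module_iso A M N)))"

text \<open>
  An \<open>A\<close>-\<open>K[X]\<close>-bimodule that is free of rank \<open>d\<close> over \<open>K[X]\<close>, given after a choice of basis by an
  algebra homomorphism to the matrix algebra over \<open>K[X]\<close>. Its tensor product with
  \<open>K[X]/(X - c)\<close> is obtained by evaluating all matrix entries at \<open>c\<close>.
\<close>

definition one_parameter_family ::
  "('k::field, 'a) module \<Rightarrow> nat \<Rightarrow> ('a \<Rightarrow> 'k poly mat) \<Rightarrow> bool"
  where "one_parameter_family A d \<rho> \<longleftrightarrow>
    (\<forall>a\<in>carrier A. \<rho> a \<in> carrier_mat d d) \<and> \<rho> \<one>\<^bsub>A\<^esub> = 1\<^sub>m d \<and>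
    (\<forall>a\<in>carrier A. \<forall>b\<in>carrier A. \<rho> (a \<oplus>\<^bsub>A\<^esub> b) = \<rho> a + \<rho> b) \<and>
    (\<forall>a\<in>carrier A. \<forall>b\<in>carrier A. \<rho> (a \<otimes>\<^bsub>A\<^esub> b) = \<rho> a * \<rho> b) \<and>
    (\<forall>c. \<forall>a\<in>carrier A. \<rho> (c \<odot>\<^bsub>A\<^esub> a) = [:c:] \<cdot>\<^sub>m \<rho> a)"

definition specialization ::
  "nat \<Rightarrow> ('a \<Rightarrow> 'k::field poly mat) \<Rightarrow> 'k \<Rightarrow> ('a, 'k vec) module"
  where "specialization d \<rho> c =
    \<lparr>carrier = carrier_vec d, mult = undefined, one = undefined, zero = 0\<^sub>v d, add = (+),
     smult = (\<lambda>a v. map_mat (\<lambda>p. poly p c) (\<rho> a) *\<^sub>v v)\<rparr>"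

text \<open>Tameness in the sense of Drozd; algebras of finite representation type are tame.\<close>

definition tame :: "('k::field, 'a) module \<Rightarrow> bool"
  where "tame A \<longleftrightarrow> (\<forall>d. \<exists>\<R> \<M>. finite \<R> \<and> (\<forall>\<rho>\<in>\<R>. one_parameter_family A d \<rho>) \<and>
    finite \<M> \<and> \<M> \<subseteq> fd_modules A \<and>
    (\<forall>M\<in>fd_modules A. has_dim A M d \<and> indecomposable_module A M \<longrightarrow>
      (\<exists>\<rho>\<in>\<R>. \<exists>c. module_iso A M (specialization d \<rho> c)) \<or> (\<exists>N\<in>\<M>. module_iso A M N)))"


section \<open>Path algebras, quotient algebras and blocks\<close>

text \<open>
  A quiver is a library digraph. A path is a pair of its starting vertex and its list of arrows, in
  the order in which they are traversed (composition from left to right). Elements of the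
  path algebra are finitely supported functions on paths.
\<close>

definition paths :: "('v, 'e) pre_digraph \<Rightarrow> ('v \<times> 'e list) set"
  where "paths Q = {(u, es). \<exists>v. pre_digraph.awalk Q u es v}"

definition path_algebra ::
  "('v, 'e) pre_digraph \<Rightarrow> ('k::field, 'v \<times> 'e list \<Rightarrow> 'k) module"
  where "path_algebra Q =
    \<lparr>carrier = {f. finite {p. f p \<noteq> 0} \<and> {p. f p \<noteq> 0} \<subseteq> paths Q},
     mult = (\<lambda>f g (u, es). \<Sum>k\<le>length es.
       f (u, take k es) * g (last (pre_digraph.awalk_verts Q u (take k es)), drop k es)),
     one = (\<lambda>(u, es). if u \<in> verts Q \<and> es = [] then 1 else 0),
     zero = (\<lambda>_. 0),
     add = (\<lambda>f g p. f p + g p),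
     smult = (\<lambda>c f p. c * f p)\<rparr>"

definition path_elem :: "'v \<Rightarrow> 'e list \<Rightarrow> ('v \<times> 'e list \<Rightarrow> 'k::field)"
  where "path_elem u es = (\<lambda>p. if p = (u, es) then 1 else 0)"

definition quotient_algebra :: "('k, 'a) module \<Rightarrow> 'a set \<Rightarrow> ('k, 'a set) module"
  where "quotient_algebra A I =
    \<lparr>carrier = carrier (A Quot I), mult = mult (A Quot I), one = one (A Quot I),
     zero = zero (A Quot I), add = add (A Quot I),
     smult = (\<lambda>c X. \<Union>x\<in>X. I +>\<^bsub>A\<^esub> (c \<odot>\<^bsub>A\<^esub> x))\<rparr>"

definition central_idempotent :: "('k, 'a) module \<Rightarrow> 'a \<Rightarrow> bool"
  where "central_idempotent A e \<longleftrightarrow> e \<in> carrier A \<and> e \<otimes>\<^bsub>A\<^esub> e = e \<and>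
    (\<forall>x\<in>carrier A. e \<otimes>\<^bsub>A\<^esub> x = x \<otimes>\<^bsub>A\<^esub> e)"

definition primitive_central_idempotent :: "('k, 'a) module \<Rightarrow> 'a \<Rightarrow> bool"
  where "primitive_central_idempotent A e \<longleftrightarrow> central_idempotent A e \<and> e \<noteq> \<zero>\<^bsub>A\<^esub> \<and>
    \<not> (\<exists>f g. central_idempotent A f \<and> central_idempotent A g \<and> f \<noteq> \<zero>\<^bsub>A\<^esub> \<and> g \<noteq> \<zero>\<^bsub>A\<^esub> \<and>
      f \<otimes>\<^bsub>A\<^esub> g = \<zero>\<^bsub>A\<^esub> \<and> e = f \<oplus>\<^bsub>A\<^esub> g)"

definition block_algebras :: "('k, 'a) module \<Rightarrow> ('k, 'a) module set"
  where "block_algebras A =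
    {A\<lparr>carrier := (\<lambda>x. e \<otimes>\<^bsub>A\<^esub> x) ` carrier A, one := e\<rparr> |e. primitive_central_idempotent A e}"


section \<open>Hecke algebras of classical type\<close>

text \<open>The free algebra on the set \<open>I\<close> is the path algebra of the quiver with one vertex and loops \<open>I\<close>.\<close>

definition one_vertex_quiver :: "nat set \<Rightarrow> (unit, nat) pre_digraph"
  where "one_vertex_quiver I = \<lparr>verts = {()}, arcs = I, tail = (\<lambda>_. ()), head = (\<lambda>_. ())\<rparr>"

type_synonym 'k free = "unit \<times> nat list \<Rightarrow> 'k"

definition free_algebra :: "nat set \<Rightarrow> ('k::field, 'k free) module"
  where "free_algebra I = path_algebra (one_vertex_quiver I)"

abbreviation gen :: "nat \<Rightarrow> 'k::field free"
  where "gen i \<equiv> path_elem () [i]"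

definition quadratic_rel :: "('k::field, 'k free) module \<Rightarrow> 'k \<Rightarrow> nat \<Rightarrow> 'k free"
  where "quadratic_rel F c i = (gen i \<ominus>\<^bsub>F\<^esub> c \<odot>\<^bsub>F\<^esub> \<one>\<^bsub>F\<^esub>) \<otimes>\<^bsub>F\<^esub> (gen i \<oplus>\<^bsub>F\<^esub> \<one>\<^bsub>F\<^esub>)"

definition commuting_rel :: "('k::field, 'k free) module \<Rightarrow> nat \<Rightarrow> nat \<Rightarrow> 'k free"
  where "commuting_rel F i j = gen i \<otimes>\<^bsub>F\<^esub> gen j \<ominus>\<^bsub>F\<^esub> gen j \<otimes>\<^bsub>F\<^esub> gen i"

definition braid_rel :: "('k::field, 'k free) module \<Rightarrow> nat \<Rightarrow> nat \<Rightarrow> 'k free"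
  where "braid_rel F i j =
    gen i \<otimes>\<^bsub>F\<^esub> gen j \<otimes>\<^bsub>F\<^esub> gen i \<ominus>\<^bsub>F\<^esub> gen j \<otimes>\<^bsub>F\<^esub> gen i \<otimes>\<^bsub>F\<^esub> gen j"

definition braid4_rel :: "('k::field, 'k free) module \<Rightarrow> nat \<Rightarrow> nat \<Rightarrow> 'k free"
  where "braid4_rel F i j =
    gen i \<otimes>\<^bsub>F\<^esub> gen j \<otimes>\<^bsub>F\<^esub> gen i \<otimes>\<^bsub>F\<^esub> gen j \<ominus>\<^bsub>F\<^esub> gen j \<otimes>\<^bsub>F\<^esub> gen i \<otimes>\<^bsub>F\<^esub> gen j \<otimes>\<^bsub>F\<^esub> gen i"

text \<open>The relations between \<open>gen 1, \<dots>, gen (n - 1)\<close>, which are common to the three types.\<close>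

definition type_A_rels :: "('k::field, 'k free) module \<Rightarrow> 'k \<Rightarrow> nat \<Rightarrow> 'k free set"
  where "type_A_rels F q n =
    {quadratic_rel F q i |i. 1 \<le> i \<and> i < n} \<union>
    {braid_rel F i (i + 1) |i. 1 \<le> i \<and> i + 1 < n} \<union>
    {commuting_rel F i j |i j. 1 \<le> i \<and> i + 2 \<le> j \<and> j < n}"

definition hecke_A :: "'k::field \<Rightarrow> nat \<Rightarrow> ('k, 'k free set) module"
  where "hecke_A q n = (let F = free_algebra {1..<n} in
    quotient_algebra F (genideal F (type_A_rels F q n)))"

definition hecke_B :: "'k::field \<Rightarrow> 'k \<Rightarrow> nat \<Rightarrow> ('k, 'k free set) module"
  where "hecke_B q Q n = (let F = free_algebra {0..<n} in
    quotient_algebra F (genideal F (type_A_rels F q n \<union> {quadratic_rel F Q 0} \<union>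
      {braid4_rel F 0 i |i. i = 1 \<and> i < n} \<union> {commuting_rel F 0 j |j. 2 \<le> j \<and> j < n})))"

definition hecke_D :: "'k::field \<Rightarrow> nat \<Rightarrow> ('k, 'k free set) module"
  where "hecke_D q n = (let F = free_algebra {0..<n} in
    quotient_algebra F (genideal F (type_A_rels F q n \<union> {quadratic_rel F q 0} \<union>
      {braid_rel F 0 2} \<union> {commuting_rel F 0 j |j. 1 \<le> j \<and> j < n \<and> j \<noteq> 2})))"

definition classical_hecke_algebras :: "('k::field, 'k free set) module set"
  where "classical_hecke_algebras =
    {hecke_A q n |q n. q \<noteq> 0 \<and> q \<noteq> 1 \<and> n \<ge> 1} \<union>
    {hecke_B q Q n |q Q n. q \<noteq> 0 \<and> q \<noteq> 1 \<and> Q \<noteq> 0 \<and> n \<ge> 1} \<union>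
    {hecke_D q n |q n. q \<noteq> 0 \<and> q \<noteq> 1 \<and> n \<ge> 3}"


section \<open>Bound quiver algebras and Morita equivalence\<close>

definition bound_quiver_algebra ::
  "('v, 'e) pre_digraph \<Rightarrow> ('v \<times> 'e list \<Rightarrow> 'k::field) set \<Rightarrow> ('k, ('v \<times> 'e list \<Rightarrow> 'k) set) module"
  where "bound_quiver_algebra Q R =
    quotient_algebra (path_algebra Q) (genideal (path_algebra Q) R)"

definition path_class ::
  "('v, 'e) pre_digraph \<Rightarrow> ('v \<times> 'e list \<Rightarrow> 'k::field) set \<Rightarrow> 'v \<Rightarrow> 'e list \<Rightarrow>
    ('v \<times> 'e list \<Rightarrow> 'k) set"
  where "path_class Q R u es =
    genideal (path_algebra Q) R +>\<^bsub>path_algebra Q :: ('k, _) module\<^esub> path_elem u es"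

text \<open>The simple module at the vertex \<open>v\<close>: \<open>K\<close> at \<open>v\<close>, zero elsewhere, and all arrows act by zero.\<close>

definition simple_at ::
  "('v, 'e) pre_digraph \<Rightarrow> ('v \<times> 'e list \<Rightarrow> 'k::field) set \<Rightarrow> 'v \<Rightarrow>
    (('v \<times> 'e list \<Rightarrow> 'k) set, 'm) module \<Rightarrow> bool"
  where "simple_at Q R v S \<longleftrightarrow>
    left_module (bound_quiver_algebra Q R) S \<and> has_dim (bound_quiver_algebra Q R) S 1 \<and>
    (\<forall>w\<in>verts Q. \<forall>x\<in>carrier S.
      path_class Q R w [] \<odot>\<^bsub>S\<^esub> x = (if w = v then x else \<zero>\<^bsub>S\<^esub>)) \<and>
    (\<forall>a\<in>arcs Q. \<forall>x\<in>carrier S. path_class Q R (tail Q a) [a] \<odot>\<^bsub>S\<^esub> x = \<zero>\<^bsub>S\<^esub>)"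

text \<open>
  A \<open>K\<close>-linear equivalence between the categories of finite-dimensional modules: a \<open>K\<close>-linear
  functor (\<open>Fo\<close> on objects, \<open>Fm M N\<close> on homomorphisms from \<open>M\<close> to \<open>N\<close>) that is full, faithful
  and essentially surjective.
\<close>

definition morita_equivalence ::
  "('k::field, 'b) module \<Rightarrow> ('k, 'a) module \<Rightarrow> (('b, 'k vec) module \<Rightarrow> ('a, 'k vec) module) \<Rightarrow>
    (('b, 'k vec) module \<Rightarrow> ('b, 'k vec) module \<Rightarrow> ('k vec \<Rightarrow> 'k vec) \<Rightarrow> 'k vec \<Rightarrow> 'k vec) \<Rightarrow> bool"
  where "morita_equivalence B A Fo Fm \<longleftrightarrow>
    (\<forall>M\<in>fd_modules B. Fo M \<in> fd_modules A) \<and>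
    (\<forall>M\<in>fd_modules B. Fm M M (\<lambda>x\<in>carrier M. x) = (\<lambda>x\<in>carrier (Fo M). x)) \<and>
    (\<forall>L\<in>fd_modules B. \<forall>M\<in>fd_modules B. \<forall>N\<in>fd_modules B.
      \<forall>f\<in>module_hom B L M. \<forall>g\<in>module_hom B M N.
        Fm L N (compose (carrier L) g f) = compose (carrier (Fo L)) (Fm M N g) (Fm L M f)) \<and>
    (\<forall>M\<in>fd_modules B. \<forall>N\<in>fd_modules B. \<forall>f\<in>module_hom B M N. \<forall>g\<in>module_hom B M N.
      Fm M N (\<lambda>x\<in>carrier M. f x \<oplus>\<^bsub>N\<^esub> g x) =
        (\<lambda>x\<in>carrier (Fo M). Fm M N f x \<oplus>\<^bsub>Fo N\<^esub> Fm M N g x)) \<and>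
    (\<forall>M\<in>fd_modules B. \<forall>N\<in>fd_modules B. \<forall>f\<in>module_hom B M N. \<forall>c.
      Fm M N (\<lambda>x\<in>carrier M. (c \<odot>\<^bsub>B\<^esub> \<one>\<^bsub>B\<^esub>) \<odot>\<^bsub>N\<^esub> f x) =
        (\<lambda>x\<in>carrier (Fo M). (c \<odot>\<^bsub>A\<^esub> \<one>\<^bsub>A\<^esub>) \<odot>\<^bsub>Fo N\<^esub> Fm M N f x)) \<and>
    (\<forall>M\<in>fd_modules B. \<forall>N\<in>fd_modules B.
      bij_betw (Fm M N) (module_hom B M N) (module_hom A (Fo M) (Fo N))) \<and>
    (\<forall>N\<in>fd_modules A. \<exists>M\<in>fd_modules B. module_iso A (Fo M) N)"

text \<open>
  \<open>B\<close> is Morita equivalent to the bound quiver algebra of \<open>(Q, R)\<close> in such a way that the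
  \<open>B\<close>-modules \<open>Ss\<close> correspond to the simple modules at the vertices \<open>vs\<close>.
\<close>

definition morita_equivalent_ordered ::
  "('k::field, 'b) module \<Rightarrow> ('v, 'e) pre_digraph \<Rightarrow> ('v \<times> 'e list \<Rightarrow> 'k) set \<Rightarrow>
    'v list \<Rightarrow> ('b, 'k vec) module list \<Rightarrow> bool"
  where "morita_equivalent_ordered B Q R vs Ss \<longleftrightarrow>
    (\<exists>Fo Fm. morita_equivalence B (bound_quiver_algebra Q R) Fo Fm \<and>
      list_all2 (\<lambda>v S. S \<in> fd_modules B \<and> simple_at Q R v (Fo S)) vs Ss)"

datatype arrow = Alpha | Beta | Mu | Nu

primrec arrow_tail :: "arrow \<Rightarrow> nat" where
  "arrow_tail Alpha = 1" | "arrow_tail Beta = 2" | "arrow_tail Mu = 1" | "arrow_tail Nu = 2"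

primrec arrow_head :: "arrow \<Rightarrow> nat" where
  "arrow_head Alpha = 1" | "arrow_head Beta = 2" | "arrow_head Mu = 2" | "arrow_head Nu = 1"

definition two_loop_quiver :: "(nat, arrow) pre_digraph"
  where "two_loop_quiver =
    \<lparr>verts = {1, 2}, arcs = {Alpha, Beta, Mu, Nu}, tail = arrow_tail, head = arrow_head\<rparr>"

definition one_loop_quiver :: "(nat, arrow) pre_digraph"
  where "one_loop_quiver =
    \<lparr>verts = {1, 2}, arcs = {Alpha, Mu, Nu}, tail = arrow_tail, head = arrow_head\<rparr>"

definition rels_222 :: "(nat \<times> arrow list \<Rightarrow> 'k::field) set"
  where "rels_222 = (let P = path_algebra two_loop_quiver :: ('k, _) module in
    {path_elem 1 [Alpha, Mu], path_elem 1 [Mu, Beta],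
     path_elem 2 [Beta, Nu], path_elem 2 [Nu, Alpha],
     path_elem 1 [Alpha, Alpha] \<ominus>\<^bsub>P\<^esub> path_elem 1 [Mu, Nu, Mu, Nu],
     path_elem 2 [Beta, Beta] \<ominus>\<^bsub>P\<^esub> path_elem 2 [Nu, Mu, Nu, Mu]})"

definition rels_212 :: "(nat \<times> arrow list \<Rightarrow> 'k::field) set"
  where "rels_212 = (let P = path_algebra two_loop_quiver :: ('k, _) module in
    {path_elem 1 [Alpha, Mu], path_elem 1 [Mu, Beta],
     path_elem 2 [Beta, Nu], path_elem 2 [Nu, Alpha],
     path_elem 1 [Alpha, Alpha] \<ominus>\<^bsub>P\<^esub> path_elem 1 [Mu, Nu],
     path_elem 2 [Beta, Beta] \<ominus>\<^bsub>P\<^esub> path_elem 2 [Nu, Mu]})"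

definition rels_221 :: "(nat \<times> arrow list \<Rightarrow> 'k::field) set"
  where "rels_221 = (let P = path_algebra one_loop_quiver :: ('k, _) module in
    {path_elem 1 [Alpha, Mu], path_elem 1 [Mu, Nu, Mu, Nu, Mu],
     path_elem 2 [Nu, Mu, Nu, Mu, Nu], path_elem 2 [Nu, Alpha],
     path_elem 1 [Alpha, Alpha] \<ominus>\<^bsub>P\<^esub> path_elem 1 [Mu, Nu, Mu, Nu]})"


section \<open>Cellular algebras\<close>

record ('l, 't, 'a) cell_structure =
  cells :: "'l set"
  cell_order :: "('l \<times> 'l) set"
  tableaux :: "'l \<Rightarrow> 't set"
  cell_basis :: "'l \<Rightarrow> 't \<Rightarrow> 't \<Rightarrow> 'a"
  star :: "'a \<Rightarrow> 'a"

definition lower_span :: "('k, 'a) module \<Rightarrow> ('l, 't, 'a) cell_structure \<Rightarrow> 'l \<Rightarrow> 'a set"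
  where "lower_span A D l = (let I = {(m, s, t). m \<in> cells D \<and> (m, l) \<in> cell_order D \<and> m \<noteq> l \<and>
      s \<in> tableaux D m \<and> t \<in> tableaux D m} in
    lincomb A (\<lambda>(m, s, t). cell_basis D m s t) I ` (I \<rightarrow>\<^sub>E UNIV))"

text \<open>
  \<open>r s' s\<close> is the coefficient \<open>r\<^sub>a(s', s)\<close> of Graham and Lehrer; it does not depend on the
  second index \<open>t\<close>.
\<close>

definition cell_coeffs ::
  "('k, 'a) module \<Rightarrow> ('l, 't, 'a) cell_structure \<Rightarrow> 'l \<Rightarrow> 'a \<Rightarrow> ('t \<Rightarrow> 't \<Rightarrow> 'k) \<Rightarrow> bool"
  where "cell_coeffs A D l a r \<longleftrightarrow> (\<forall>s\<in>tableaux D l. \<forall>t\<in>tableaux D l.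
    a \<otimes>\<^bsub>A\<^esub> cell_basis D l s t \<ominus>\<^bsub>A\<^esub> lincomb A (\<lambda>s'. cell_basis D l s' t) (tableaux D l) (\<lambda>s'. r s' s)
      \<in> lower_span A D l)"

text \<open>
  Index sets \<open>tableaux D l\<close> are required to be nonempty, since a cell with an empty index set
  contributes nothing to the basis but would contribute a zero row to the decomposition matrix.
\<close>

definition cell_datum :: "('k, 'a) module \<Rightarrow> ('l, 't, 'a) cell_structure \<Rightarrow> bool"
  where "cell_datum A D \<longleftrightarrow>
    finite (cells D) \<and> partial_order_on (cells D) (cell_order D) \<and>
    (\<forall>l\<in>cells D. finite (tableaux D l) \<and> tableaux D l \<noteq> {}) \<and>
    finite_basis A (\<lambda>(l, s, t). cell_basis D l s t)
      (SIGMA l:cells D. tableaux D l \<times> tableaux D l) \<and>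
    (\<forall>a\<in>carrier A. star D a \<in> carrier A \<and> star D (star D a) = a \<and>
      (\<forall>c. star D (c \<odot>\<^bsub>A\<^esub> a) = c \<odot>\<^bsub>A\<^esub> star D a)) \<and>
    (\<forall>a\<in>carrier A. \<forall>b\<in>carrier A. star D (a \<oplus>\<^bsub>A\<^esub> b) = star D a \<oplus>\<^bsub>A\<^esub> star D b \<and>
      star D (a \<otimes>\<^bsub>A\<^esub> b) = star D b \<otimes>\<^bsub>A\<^esub> star D a) \<and>
    (\<forall>l\<in>cells D. \<forall>s\<in>tableaux D l. \<forall>t\<in>tableaux D l.
      star D (cell_basis D l s t) = cell_basis D l t s) \<and>
    (\<forall>l\<in>cells D. \<forall>a\<in>carrier A. \<exists>r. cell_coeffs A D l a r)"

text \<open>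
  The left cell module: the vector space with basis \<open>tableaux D l\<close>, realised as functions supported
  there. For a cell datum the chosen coefficients are uniquely determined on \<open>tableaux D l\<close>.
\<close>

definition cell_module ::
  "('k::field, 'a) module \<Rightarrow> ('l, 't, 'a) cell_structure \<Rightarrow> 'l \<Rightarrow> ('a, 't \<Rightarrow> 'k) module"
  where "cell_module A D l =
    \<lparr>carrier = {x. \<forall>s. s \<notin> tableaux D l \<longrightarrow> x s = 0}, mult = undefined, one = undefined,
     zero = (\<lambda>_. 0), add = (\<lambda>x y s. x s + y s),
     smult = (\<lambda>a x s'. if s' \<in> tableaux D l
       then \<Sum>s\<in>tableaux D l. (SOME r. cell_coeffs A D l a r) s' s * x s else 0)\<rparr>"

text \<open>The rows are indexed by the list \<open>ls\<close> of cells, the columns by the list \<open>Ss\<close> of simple modules.\<close>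

definition decomposition_matrix ::
  "('k::field, 'a) module \<Rightarrow> ('l, 't, 'a) cell_structure \<Rightarrow> 'l list \<Rightarrow> ('a, 'k vec) module list \<Rightarrow>
    nat mat"
  where "decomposition_matrix A D ls Ss = mat (length ls) (length Ss)
    (\<lambda>(i, j). comp_mult A (cell_module A D (ls ! i)) (Ss ! j))"

definition has_decomposition_matrix ::
  "('k::field, 'a) module \<Rightarrow> ('l, 't, 'a) cell_structure \<Rightarrow> ('a, 'k vec) module list \<Rightarrow>
    nat mat \<Rightarrow> bool"
  where "has_decomposition_matrix A D Ss X \<longleftrightarrow>
    (\<exists>ls. distinct ls \<and> set ls = cells D \<and> decomposition_matrix A D ls Ss = X)"

end

theory Submission
 imports Defs "HOL-Library.Function_Algebras"
begin

text \<open>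
  Over a block \<open>B\<close> that is Morita equivalent to one of the three algebras, the Cartan numbers are the
  dimensions of the corners \<open>e\<^sub>i A e\<^sub>j\<close> of the quiver algebra, which has an explicit basis of paths.
  On the cellular side, let \<open>e\<^sub>i\<close> be a primitive idempotent of \<open>B\<close> belonging to the simple module \<open>S\<^sub>i\<close>.
  Filtering \<open>e\<^sub>i B e\<^sub>j\<close> by the cell ideals shows that its dimension is the sum over all cells \<open>l\<close> of
  \<open>dim (e\<^sub>i W\<^sub>l) dim (e\<^sub>j\<^sup>* W\<^sub>l)\<close>, where \<open>dim (e\<^sub>i W\<^sub>l)\<close> is the decomposition number. The number
  \<open>dim (e\<^sub>j\<^sup>* W\<^sub>l)\<close> is a combination of the decomposition numbers in row \<open>l\<close> with coefficients at
  most one, and comparison with the given Cartan numbers forces it to be \<open>dim (e\<^sub>j W\<^sub>l)\<close>. So the columns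
  of the decomposition matrix are vectors of natural numbers with known scalar products; each has an
  entry one, by an argument on the rank of a basis element \<open>C\<^sub>s\<^sub>t\<close>, and no row vanishes. This determines
  the matrix up to the order of its rows.
\<close>


text \<open>The coefficients are at most one because \<open>e\<^sub>j B e\<^sub>j\<close> acts on
  the line \<open>e\<^sub>j S\<^sub>j\<close> by scalars, and an element \<open>M\<close> that acts
  as zero makes \<open>e\<^sub>j - M\<close> a unit. The involution carries this to
  \<open>e\<^sub>j\<^sup>*\<close>, which therefore fixes at most a line in each simple module. That
  \<open>e\<^sub>j\<^sup>*\<close> belongs to \<open>S\<^sub>j\<close> again is not derived from
  bilinear forms on cell modules but from the numbers: the off-diagonal Cartan number is smaller
  than both diagonal ones, and the remaining alternative, an exchange of the two simple modules,
  violates 2xy \<le> xx + yy. The entry one matters because a column of square sum 4 could otherwise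
  consist of a single 2. A constant obstacle is the type of module elements. Projectivity and
  completeness of the simple modules refer to modules on \<open>'k vec\<close>, while factor modules
  have sets and cell modules have functions as elements, so copies are made throughout.
  Homomorphisms out of a cyclic module are represented by their values at a generator, which form a
  subspace of the target with an ordinary dimension.\<close>

abbreviation (input) smult_of ("(_ *'[_']/ _)" [70, 0, 71] 70) where "a *[M] x \<equiv> smult M a x"
abbreviation (input) add_of ("(_ +'[_']/ _)" [65, 0, 66] 65) where "x +[M] y \<equiv> add M x y"
abbreviation (input) mult_of ("(_ **'[_']/ _)" [70, 0, 71] 70) where "x **[M] y \<equiv> mult M x y"
abbreviation (input) zero_of ("\<zero>'[_']") where "\<zero>[M] \<equiv> zero M"
abbreviation (input) one_of ("\<one>'[_']") where "\<one>[M] \<equiv> one M"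


section \<open>Dimensions of vector spaces\<close>

text \<open>The functions from \<open>nat\<close> to the field serve as one ambient vector space on
  a type. Modules are records on carrier sets, so their dimension is measured after an embedding
  into this space.\<close>

definition fun_scale :: "'k::field \<Rightarrow> (nat \<Rightarrow> 'k) \<Rightarrow> nat \<Rightarrow> 'k"
 where "fun_scale c f = (\<lambda>i. c * f i)"

lemmas fun_apply = plus_fun_apply zero_fun_apply
declare fun_apply [simp del]

interpretation fs: vector_space "fun_scale :: 'k::field \<Rightarrow> _"
 by unfold_locales (auto simp: fun_apply fun_scale_def fun_eq_iff algebra_simps)

interpretation fs2: vector_space_pair "fun_scale :: 'k::field \<Rightarrow> _" "fun_scale :: 'k::field \<Rightarrow> _" ..

definition coord_space :: "nat \<Rightarrow> (nat \<Rightarrow> 'k::field) set"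
 where "coord_space n = {f. \<forall>i\<ge>n. f i = 0}"

definition unit_fun :: "nat \<Rightarrow> nat \<Rightarrow> 'k::field"
 where "unit_fun i j = (if j = i then 1 else 0)"

lemma coord_space_sum:
 assumes "f \<in> coord_space n"
 shows "f = (\<Sum>i<n. fun_scale (f i) (unit_fun i))"
proof
 fix j
 have "(\<Sum>i<n. fun_scale (f i) (unit_fun i)) j = (\<Sum>i<n. f i * unit_fun i j)"
  by (induction n) (auto simp: fun_apply fun_scale_def)
 also have "\<dots> = (\<Sum>i<n. if j = i then f i else 0)"
  by (rule sum.cong) (auto simp: unit_fun_def)
 also have "\<dots> = f j" using assms by (auto simp: coord_space_def)
 finally show "f j = (\<Sum>i<n. fun_scale (f i) (unit_fun i)) j" by simp
qed

lemma coord_space_subset_span: "coord_space n \<subseteq> fs.span (unit_fun ` {..<n})"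
proof
 fix f :: "nat \<Rightarrow> 'a" assume "f \<in> coord_space n"
 then have "f = (\<Sum>i<n. fun_scale (f i) (unit_fun i))" by (rule coord_space_sum)
 also have "\<dots> \<in> fs.span (unit_fun ` {..<n})"
  by (intro fs.span_sum fs.span_scale fs.span_base) auto
 finally show "f \<in> fs.span (unit_fun ` {..<n})" .
qed

lemma independent_coord_space_finite:
 assumes "fs.independent B" "B \<subseteq> coord_space n"
 shows "finite B"
 using fs.independent_span_bound[of "unit_fun ` {..<n}" B] assms coord_space_subset_span by fastforce

lemma dim_coord_space: "fs.dim (coord_space n :: (nat \<Rightarrow> 'k::field) set) = n"
proof -
 have inj: "inj_on (unit_fun :: nat \<Rightarrow> nat \<Rightarrow> 'k) {..<n}"
  by (auto simp: inj_on_def unit_fun_def fun_eq_iff split: if_splits)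
 have ind: "fs.independent (unit_fun ` {..<n} :: (nat \<Rightarrow> 'k) set)"
 proof (rule fs.independent_if_scalars_zero)
  fix c :: "(nat \<Rightarrow> 'k) \<Rightarrow> 'k" and x :: "nat \<Rightarrow> 'k"
  assume 0: "(\<Sum>x\<in>unit_fun ` {..<n}. fun_scale (c x) x) = 0" and x: "x \<in> unit_fun ` {..<n}"
  then obtain j where j: "j < n" "x = unit_fun j" by auto
  have "0 = (\<Sum>x\<in>unit_fun ` {..<n}. fun_scale (c x) x) j" using 0 by (simp add: fun_apply)
  also have "\<dots> = (\<Sum>i<n. fun_scale (c (unit_fun i)) (unit_fun i)) j"
   by (subst sum.reindex[OF inj]) simp
  also have "\<dots> = (\<Sum>i<n. c (unit_fun i) * unit_fun i j)"
   by (induction n) (auto simp: fun_apply fun_scale_def)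
  also have "\<dots> = (\<Sum>i<n. if j = i then c (unit_fun i) else 0)"
   by (rule sum.cong) (auto simp: unit_fun_def)
  also have "\<dots> = c x" using j by simp
  finally show "c x = 0" by simp
 qed auto
 have "card (unit_fun ` {..<n} :: (nat \<Rightarrow> 'k) set) = fs.dim (coord_space n :: (nat \<Rightarrow> 'k) set)"
  by (rule fs.basis_card_eq_dim[OF _ coord_space_subset_span ind])
   (auto simp: coord_space_def unit_fun_def)
 then show ?thesis using inj by (simp add: card_image)
qed

text \<open>\<open>g\<close> is linear on \<open>S\<close> only. A linear \<open>h\<close> on the
  whole ambient space that agrees with \<open>g\<close> on a basis of \<open>S\<close> agrees with
  it on \<open>S\<close>, and an injective linear map carries a basis to a basis.\<close>

lemma dim_linear_image_inj:
 assumes S: "fs.subspace S" and add: "\<And>x y. x \<in> S ==> y \<in> S ==> g (x + y) = g x + g y"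
  and scale: "\<And>c x. x \<in> S ==> g (fun_scale c x) = fun_scale c (g x)" and inj: "inj_on g S"
 shows "fs.dim (g ` S) = fs.dim S"
proof -
 obtain B where B: "B \<subseteq> S" "fs.independent B" "S \<subseteq> fs.span B" "card B = fs.dim S"
  using fs.basis_exists by metis
 obtain h where h: "Vector_Spaces.linear fun_scale fun_scale h" "\<And>x. x \<in> B ==> h x = g x"
  using fs2.linear_independent_extend[OF B(2), of g] by blast
 interpret h: Vector_Spaces.linear fun_scale fun_scale h by (rule h)
 have BS: "fs.span B = S" using B S by (metis fs.span_minimal subset_antisym)
 have hg: "h x = g x" if "x \<in> S" for x
 proof -
  have "x \<in> fs.span B" using that BS by simp
  then have "x \<in> S \<and> h x = g x"
  proof (induction rule: fs.span_induct_alt)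
   case base
   have "g 0 = 0" using scale[of 0 0] S by (simp add: fs.subspace_0)
   then show ?case using S by (simp add: fs.subspace_0 h.zero)
  next
   case (step c x y)
   then show ?case
    using B S h(2) scale add by (auto simp: h.add h.scale fs.subspace_scale fs.subspace_add subset_iff)
  qed
  then show ?thesis by simp
 qed
 have inj': "inj_on h (fs.span B)" using inj BS hg by (simp add: inj_on_def)
 have "g ` S = h ` S" using hg by simp
 moreover have "h ` S = fs.span (h ` B)" using BS h.span_image by metis
 moreover have "fs.independent (h ` B)" using h.independent_injective_image[OF B(2) inj'] .
 moreover have "card (h ` B) = card B"
  using inj' by (meson card_image fs.span_superset inj_on_subset)
 ultimately show ?thesis using B(4) fs.dim_span_eq_card_independent by metis
qed

text \<open>A basis \<open>B0\<close> of \<open>U\<close> is extended to a basis \<open>B\<close> of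
  \<open>S\<close>; \<open>p\<close> kills \<open>B0\<close> and fixes the rest. The image of
  \<open>p\<close> stands in for the quotient of \<open>S\<close> by \<open>U\<close>, so that
  quotients also stay inside the ambient space.\<close>

lemma complement_projection:
 assumes S: "fs.subspace S" "S \<subseteq> coord_space n" and U: "fs.subspace U" "U \<subseteq> S"
 obtains p where "Vector_Spaces.linear fun_scale fun_scale p" "p ` S \<subseteq> S" "{x \<in> S. p x = 0} = U"
  "fs.dim S = fs.dim U + fs.dim (p ` S)"
proof -
 obtain B0 where B0: "B0 \<subseteq> U" "fs.independent B0" "U \<subseteq> fs.span B0" "card B0 = fs.dim U"
  using fs.basis_exists by metis
 have B0U: "fs.span B0 = U" using B0 U by (metis fs.span_minimal subset_antisym)
 obtain B where B: "B0 \<subseteq> B" "B \<subseteq> S" "fs.independent B" "S \<subseteq> fs.span B"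
  using fs.maximal_independent_subset_extend[of B0 S] B0 U by blast
 have BS: "fs.span B = S" using B S by (metis fs.span_minimal subset_antisym)
 have fin: "finite B" using independent_coord_space_finite B S by blast
 obtain p where p: "Vector_Spaces.linear fun_scale fun_scale p"
   "\<And>x. x \<in> B ==> p x = (if x \<in> B0 then 0 else x)"
  using fs2.linear_independent_extend[OF B(3), of "\<lambda>x. if x \<in> B0 then 0 else x"] by blast
 interpret p: Vector_Spaces.linear fun_scale fun_scale p by (rule p)
 let ?C = "B - B0"
 have pC: "p x = x" if "x \<in> fs.span ?C" for x
  using that
 proof (induction rule: fs.span_induct_alt)
  case (step c x y)
  then show ?case using p(2)[of x] by (simp add: p.add p.scale)
 qed (rule p.zero)
 have p0: "p x = 0" if "x \<in> fs.span B0" for x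
  using that
 proof (induction rule: fs.span_induct_alt)
  case (step c x y)
  then show ?case using p(2)[of x] B by (auto simp: p.add p.scale)
 qed (rule p.zero)
 have img: "p ` S = fs.span ?C"
 proof -
  have "B = B0 \<union> ?C" using B by blast
  then have *: "S = {x + y |x y. x \<in> fs.span B0 \<and> y \<in> fs.span ?C}"
   using BS fs.span_Un[of B0 ?C] by simp
  show ?thesis
  proof
   show "p ` S \<subseteq> fs.span ?C" using * p0 pC by (auto simp: p.add)
   have "fs.span ?C \<subseteq> S" using BS by (metis Diff_subset fs.span_mono)
   show "fs.span ?C \<subseteq> p ` S"
   proof
    fix x assume "x \<in> fs.span ?C"
    then show "x \<in> p ` S" using pC[of x] \<open>fs.span ?C \<subseteq> S\<close> by (intro image_eqI[of _ _ x]) auto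
   qed
  qed
 qed
 have ker: "x \<in> U" if "x \<in> S" "p x = 0" for x
 proof -
  have "B = B0 \<union> ?C" using B by blast
  then have "x \<in> {x + y |x y. x \<in> fs.span B0 \<and> y \<in> fs.span ?C}"
   using that BS fs.span_Un[of B0 ?C] by simp
  then obtain y z where yz: "x = y + z" "y \<in> fs.span B0" "z \<in> fs.span ?C" by blast
  then have "z = 0" using that p0 pC by (simp add: p.add)
  then show ?thesis using yz B0U by simp
 qed
 show thesis
 proof
  show "p ` S \<subseteq> S" using img BS by (metis Diff_subset fs.span_mono)
  show "{x \<in> S. p x = 0} = U" using ker p0 B0U U by blast
  have indC: "fs.independent ?C" using fs.independent_mono B(3) by blast
  have "fs.dim S = card B" using B BS fs.dim_span_eq_card_independent by metis
  also have "\<dots> = card B0 + card ?C" using fin B(1)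
   by (metis card_Diff_subset card_mono finite_subset le_add_diff_inverse)
  also have "card ?C = fs.dim (p ` S)" using img fs.dim_span_eq_card_independent[OF indC] by simp
  finally show "fs.dim S = fs.dim U + fs.dim (p ` S)" using B0(4) by simp
 qed (rule p(1))
qed

section \<open>Vector spaces on carrier sets\<close>

locale kspace = abelian_group V for V :: "('k::field, 'v) module" (structure) +
 assumes scale_closed [simp, intro]: "x \<in> carrier V ==> c \<odot> x \<in> carrier V"
  and scale_l_distr: "x \<in> carrier V ==> (c + d) \<odot> x = c \<odot> x \<oplus> d \<odot> x"
  and scale_r_distr: "[|x \<in> carrier V; y \<in> carrier V|] ==> c \<odot> (x \<oplus> y) = c \<odot> x \<oplus> c \<odot> y"
  and scale_assoc: "x \<in> carrier V ==> (c * d) \<odot> x = c \<odot> (d \<odot> x)"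
  and scale_one [simp]: "x \<in> carrier V ==> 1 \<odot> x = x"
begin

lemma scale_zero [simp]: assumes "x \<in> carrier V" shows "0 \<odot> x = \<zero>"
proof -
 have "0 \<odot> x \<oplus> 0 \<odot> x = 0 \<odot> x" using scale_l_distr[OF assms, of 0 0] by simp
 then show ?thesis using assms by (metis add.r_cancel_one scale_closed)
qed

lemma scale_zero_right [simp]: "c \<odot> \<zero> = \<zero>"
 by (metis add.r_cancel_one scale_closed scale_r_distr zero_closed r_zero)

lemma scale_minus_one: assumes "x \<in> carrier V" shows "(- 1) \<odot> x = \<ominus> x"
proof -
 have "(- 1) \<odot> x \<oplus> x = \<zero>" using scale_l_distr[OF assms, of "- 1" 1] assms by simp
 then show ?thesis using assms by (metis minus_equality scale_closed)
qed

lemma scale_minus: assumes "x \<in> carrier V" shows "(- c) \<odot> x = \<ominus> (c \<odot> x)"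
 using scale_assoc[OF assms, of "- 1" c] scale_minus_one[of "c \<odot> x"] assms by simp

lemma kspace_subset:
 assumes "U \<subseteq> carrier V" "\<zero> \<in> U" "\<And>x y. [|x \<in> U; y \<in> U|] ==> x \<oplus> y \<in> U"
  "\<And>c x. x \<in> U ==> c \<odot> x \<in> U"
 shows "kspace (V\<lparr>carrier := U\<rparr>)"
proof -
 have Uc: "x \<in> carrier V" if "x \<in> U" for x using that assms(1) by blast
 have "abelian_group (V\<lparr>carrier := U\<rparr>)"
 proof (rule abelian_groupI)
  fix x assume x: "x \<in> carrier (V\<lparr>carrier := U\<rparr>)"
  have "(- 1) \<odot> x \<in> U" using assms(4) x by simp
  moreover have "(- 1) \<odot> x \<oplus> x = \<zero>" using x Uc by (simp add: scale_minus_one l_neg)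
  ultimately show "\<exists>y\<in>carrier (V\<lparr>carrier := U\<rparr>). y +[V\<lparr>carrier := U\<rparr>] x = \<zero>[V\<lparr>carrier := U\<rparr>]" by auto
 qed (use assms Uc in \<open>simp_all add: a_ac\<close>)
 then show ?thesis
  unfolding kspace_def kspace_axioms_def using assms(4) Uc
  by (simp add: scale_l_distr scale_r_distr scale_assoc)
qed

lemma scale_eq_zero: assumes "x \<in> carrier V" "c \<odot> x = \<zero>" shows "c = 0 \<or> x = \<zero>"
proof (cases "c = 0")
 case False
 then have "x = (inverse c * c) \<odot> x" using assms by simp
 also have "\<dots> = \<zero>" using scale_assoc[OF assms(1), of "inverse c" c] assms(2) by simp
 finally show ?thesis ..
qed simp

end

definition klinear :: "('k::field, 'v) module \<Rightarrow> ('k, 'w) module \<Rightarrow> ('v \<Rightarrow> 'w) \<Rightarrow> bool"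
 where "klinear V W f \<longleftrightarrow> f ` carrier V \<subseteq> carrier W \<and>
  (\<forall>x\<in>carrier V. \<forall>y\<in>carrier V. f (x +[V] y) = f x +[W] f y) \<and>
  (\<forall>c. \<forall>x\<in>carrier V. f (c *[V] x) = c *[W] f x)"

text \<open>The bound \<open>n\<close> on the support is what makes an embedded space
  finite-dimensional.\<close>

definition kembedding :: "('k::field, 'v) module \<Rightarrow> nat \<Rightarrow> ('v \<Rightarrow> nat \<Rightarrow> 'k) \<Rightarrow> bool"
 where "kembedding V n f \<longleftrightarrow> f ` carrier V \<subseteq> coord_space n \<and> inj_on f (carrier V) \<and>
  (\<forall>x\<in>carrier V. \<forall>y\<in>carrier V. f (x +[V] y) = f x + f y) \<and>
  (\<forall>c. \<forall>x\<in>carrier V. f (c *[V] x) = fun_scale c (f x))"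

definition kfin :: "('k::field, 'v) module \<Rightarrow> bool"
 where "kfin V \<longleftrightarrow> (\<exists>n f. kembedding V n f)"

text \<open>Independent of the chosen embedding by \<open>kdim_eq_dim_image\<close>. Without any
  embedding the value is arbitrary, so \<open>kfin\<close> accompanies it.\<close>

definition kdim :: "('k::field, 'v) module \<Rightarrow> nat"
 where "kdim V = fs.dim ((SOME f. \<exists>n. kembedding V n f) ` carrier V)"

lemma klinear_zero:
 assumes "kspace V" "kspace W" "klinear V W f"
 shows "f \<zero>[V] = \<zero>[W]"
proof -
 interpret V: kspace V by fact
 interpret W: kspace W by fact
 have "f (0 *[V] \<zero>[V]) = 0 *[W] f \<zero>[V]" using assms(3) unfolding klinear_def by blast
 moreover have "f \<zero>[V] \<in> carrier W" using assms(3) unfolding klinear_def by blast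
 ultimately show ?thesis by simp
qed

lemma klinear_inj_iff:
 assumes "kspace V" "kspace W" "klinear V W f"
 shows "inj_on f (carrier V) \<longleftrightarrow> (\<forall>x\<in>carrier V. f x = \<zero>[W] --> x = \<zero>[V])"
proof -
 interpret V: kspace V by fact
 interpret W: kspace W by fact
 have z: "f \<zero>[V] = \<zero>[W]" by (rule klinear_zero[OF assms])
 show ?thesis
 proof
  assume "inj_on f (carrier V)"
  then show "\<forall>x\<in>carrier V. f x = \<zero>[W] --> x = \<zero>[V]" using z by (metis inj_onD V.zero_closed)
 next
  assume k: "\<forall>x\<in>carrier V. f x = \<zero>[W] --> x = \<zero>[V]"
  show "inj_on f (carrier V)"
  proof (rule inj_onI)
   fix x y assume xy: "x \<in> carrier V" "y \<in> carrier V" "f x = f y"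
   have fc: "f y \<in> carrier W" using assms(3) xy by (auto simp: klinear_def)
   have "f (x +[V] (- 1) *[V] y) = f x +[W] (- 1) *[W] f y"
    using assms(3) xy by (simp add: klinear_def)
   also have "\<dots> = \<zero>[W]" using xy fc by (simp add: W.scale_minus_one W.r_neg)
   finally have "x +[V] \<ominus>\<^bsub>V\<^esub> y = \<zero>[V]" using k xy by (simp add: V.scale_minus_one)
   then show "x = y" using xy by (metis V.minus_equality V.minus_minus V.a_inv_closed)
  qed
 qed
qed

lemma kembedding_subspace:
 assumes "kspace V" "kembedding V n f"
 shows "fs.subspace (f ` carrier V)"
proof -
 interpret V: kspace V by fact
 have *: "f (x +[V] y) = f x + f y" "f (c *[V] x) = fun_scale c (f x)"
  if "x \<in> carrier V" "y \<in> carrier V" for x y c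
  using assms(2) that by (auto simp: kembedding_def)
 have "f \<zero>[V] = 0" using *(2)[of "\<zero>[V]" "\<zero>[V]" 0] by simp
 then have "0 \<in> f ` carrier V" by (metis V.zero_closed imageI)
 moreover have "f x + f y \<in> f ` carrier V" if "x \<in> carrier V" "y \<in> carrier V" for x y
  using *(1)[OF that, symmetric] that by auto
 moreover have "fun_scale c (f x) \<in> f ` carrier V" if "x \<in> carrier V" for x c
  using *(2)[OF that that, symmetric] that by auto
 ultimately show ?thesis unfolding fs.subspace_def by blast
qed

text \<open>If \<open>f\<close> and \<open>g\<close> are two embeddings, \<open>g\<close> after the
  inverse of \<open>f\<close> is a linear bijection between their images.\<close>

lemma kdim_eq_dim_image:
 assumes V: "kspace V" and f: "kembedding V n f"
 shows "kdim V = fs.dim (f ` carrier V)"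
proof -
 define g where "g = (SOME f. \<exists>n. kembedding V n f)"
 have "\<exists>n. kembedding V n g" unfolding g_def using f by (intro someI[of "\<lambda>f. \<exists>n. kembedding V n f" f]) blast
 then obtain m where g: "kembedding V m g" by blast
 interpret V: kspace V by fact
 define h where "h = g \<circ> the_inv_into (carrier V) f"
 have inj: "inj_on f (carrier V)" using f by (simp add: kembedding_def)
 have hf: "h (f x) = g x" if "x \<in> carrier V" for x
  using that inj by (simp add: h_def the_inv_into_f_f)
 have "fs.dim (h ` (f ` carrier V)) = fs.dim (f ` carrier V)"
 proof (rule dim_linear_image_inj[OF kembedding_subspace[OF V f]])
  fix x y assume "x \<in> f ` carrier V" "y \<in> f ` carrier V"
  then obtain a b where ab: "x = f a" "y = f b" "a \<in> carrier V" "b \<in> carrier V" by blast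
  have "h (x + y) = h (f (a +[V] b))" using f ab by (simp add: kembedding_def)
  also have "\<dots> = g a + g b" using g ab by (simp add: hf kembedding_def)
  finally show "h (x + y) = h x + h y" using ab hf by simp
 next
  fix c x assume "x \<in> f ` carrier V"
  then obtain a where a: "x = f a" "a \<in> carrier V" by blast
  have "h (fun_scale c x) = h (f (c *[V] a))" using f a by (simp add: kembedding_def)
  also have "\<dots> = fun_scale c (g a)" using g a by (simp add: hf kembedding_def)
  finally show "h (fun_scale c x) = fun_scale c (h x)" using a hf by simp
 next
  show "inj_on h (f ` carrier V)" using g by (auto simp: inj_on_def hf kembedding_def)
 qed
 moreover have "h ` (f ` carrier V) = g ` carrier V" unfolding image_image using hf by (intro image_cong) auto
 ultimately show ?thesis by (simp add: kdim_def g_def)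
qed

lemma kfin_inj:
 assumes "klinear V W f" "inj_on f (carrier V)" "kfin W"
 shows "kfin V"
proof -
 obtain n g where g: "kembedding W n g" using assms(3) by (auto simp: kfin_def)
 have "kembedding V n (g \<circ> f)"
  unfolding kembedding_def
 proof (intro conjI ballI allI)
  have fc: "f x \<in> carrier W" if "x \<in> carrier V" for x using assms(1) that by (auto simp: klinear_def)
  show "(g \<circ> f) ` carrier V \<subseteq> coord_space n" using fc g by (auto simp: kembedding_def)
  show "inj_on (g \<circ> f) (carrier V)"
   using assms(2) g fc by (auto simp: kembedding_def inj_on_def)
  show "(g \<circ> f) (x +[V] y) = (g \<circ> f) x + (g \<circ> f) y" if "x \<in> carrier V" "y \<in> carrier V" for x y
   using assms(1) g fc that by (simp add: kembedding_def klinear_def)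
  show "(g \<circ> f) (c *[V] x) = fun_scale c ((g \<circ> f) x)" if "x \<in> carrier V" for c x
   using assms(1) g fc that by (simp add: kembedding_def klinear_def)
 qed
 then show ?thesis by (auto simp: kfin_def)
qed

text \<open>The embedding of \<open>V\<close> followed by the projection along the image of the
  kernel has the same fibres as \<open>f\<close>. It therefore descends to an embedding of
  \<open>W\<close>, and the count is that of \<open>complement_projection\<close>.\<close>

lemma rank_nullity:
 assumes V: "kspace V" and W: "kspace W" and f: "klinear V W f" and surj: "f ` carrier V = carrier W"
  and fin: "kfin V"
 shows "kfin W" and "kdim V = kdim (V\<lparr>carrier := {x \<in> carrier V. f x = \<zero>[W]}\<rparr>) + kdim W"
proof -
 interpret V: kspace V by fact
 interpret W: kspace W by fact
 obtain n \<phi> where \<phi>: "kembedding V n \<phi>" using fin by (auto simp: kfin_def)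
 have f_add: "f (x +[V] y) = f x +[W] f y" if "x \<in> carrier V" "y \<in> carrier V" for x y
  using f that by (simp add: klinear_def)
 have f_scale: "f (c *[V] x) = c *[W] f x" if "x \<in> carrier V" for x c
  using f that by (simp add: klinear_def)
 have fc: "f x \<in> carrier W" if "x \<in> carrier V" for x using f that by (auto simp: klinear_def)
 have f0: "f \<zero>[V] = \<zero>[W]" by (rule klinear_zero[OF V W f])
 have \<phi>n: "\<phi> ` carrier V \<subseteq> coord_space n" using \<phi> by (simp add: kembedding_def)
 have pre: "\<exists>a. a \<in> carrier V \<and> x = f a" if "x \<in> carrier W" for x
  using that by (auto simp flip: surj)
 have \<phi>_add: "\<phi> (x +[V] y) = \<phi> x + \<phi> y" if "x \<in> carrier V" "y \<in> carrier V" for x y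
  using \<phi> that by (simp add: kembedding_def)
 have \<phi>_scale: "\<phi> (c *[V] x) = fun_scale c (\<phi> x)" if "x \<in> carrier V" for x c
  using \<phi> that by (simp add: kembedding_def)
 let ?K = "{x \<in> carrier V. f x = \<zero>[W]}"
 let ?VK = "V\<lparr>carrier := ?K\<rparr>"
 have \<phi>K: "kembedding ?VK n \<phi>" using \<phi> by (auto simp: kembedding_def inj_on_def)
 have subS: "fs.subspace (\<phi> ` carrier V)" by (rule kembedding_subspace[OF V \<phi>])
 have Kc: "\<zero>[V] \<in> ?K" "\<And>x y. x \<in> ?K ==> y \<in> ?K ==> x +[V] y \<in> ?K"
  "\<And>c x. x \<in> ?K ==> c *[V] x \<in> ?K"
  by (auto simp: f0 f_add f_scale)
 have VK: "kspace ?VK"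
  by (rule V.kspace_subset) (use Kc in auto)
 have subU: "fs.subspace (\<phi> ` ?K)" using kembedding_subspace[OF VK \<phi>K] by simp
 obtain p where p: "Vector_Spaces.linear fun_scale fun_scale p" "p ` (\<phi> ` carrier V) \<subseteq> \<phi> ` carrier V"
   "{x \<in> \<phi> ` carrier V. p x = 0} = \<phi> ` ?K"
   "fs.dim (\<phi> ` carrier V) = fs.dim (\<phi> ` ?K) + fs.dim (p ` \<phi> ` carrier V)"
  using complement_projection[OF subS _ subU, of n] \<phi>[unfolded kembedding_def] by auto
 interpret p: Vector_Spaces.linear fun_scale fun_scale p by (rule p)
 have injV: "inj_on \<phi> (carrier V)" using \<phi> by (simp add: kembedding_def)
 have p0: "p (\<phi> x) = 0 \<longleftrightarrow> f x = \<zero>[W]" if "x \<in> carrier V" for x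
 proof -
  have "p (\<phi> x) = 0 \<longleftrightarrow> \<phi> x \<in> \<phi> ` ?K" using p(3) that by blast
  also have "\<dots> \<longleftrightarrow> x \<in> ?K" using inj_on_image_mem_iff[OF injV that, of ?K] by auto
  finally show ?thesis using that by simp
 qed
 have eq: "p (\<phi> x) = p (\<phi> y) \<longleftrightarrow> f x = f y" if xy: "x \<in> carrier V" "y \<in> carrier V" for x y
 proof -
  let ?d = "x +[V] (- 1) *[V] y"
  have d: "?d \<in> carrier V" using xy by simp
  have s: "fun_scale (- 1) u + u = 0" for u by (auto simp: fun_scale_def fun_eq_iff fun_apply)
  have "p (\<phi> ?d) = p (\<phi> x) + fun_scale (- 1) (p (\<phi> y))"
   using xy by (simp only: \<phi>_add \<phi>_scale p.add p.scale V.scale_closed)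
  also have "fun_scale (- 1) (p (\<phi> y)) = - p (\<phi> y)" using s[of "p (\<phi> y)"] by (simp add: eq_neg_iff_add_eq_0)
  finally have "p (\<phi> ?d) = 0 \<longleftrightarrow> p (\<phi> x) = p (\<phi> y)"
   by (simp only: eq_iff_diff_eq_0[of "p (\<phi> x)"] diff_conv_add_uminus)
  moreover have "f ?d = f x \<ominus>\<^bsub>W\<^esub> f y"
   using xy by (simp add: f_add f_scale fc W.scale_minus_one W.minus_eq)
  then have "f ?d = \<zero>[W] \<longleftrightarrow> f x = f y" using fc[OF xy(1)] fc[OF xy(2)]
   by (simp add: W.minus_eq) (metis W.add.inv_closed W.add.inv_inv W.minus_equality W.r_neg)
  ultimately show ?thesis using p0[OF d] by simp
 qed
 \<comment> \<open>The value does not depend on the chosen preimage of \<open>w\<close>, by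
   \<open>eq\<close>.\<close>
 define \<psi> where "\<psi> = (\<lambda>w. p (\<phi> (SOME v. v \<in> carrier V \<and> f v = w)))"
 have \<psi>f: "\<psi> (f v) = p (\<phi> v)" if "v \<in> carrier V" for v
 proof -
  have "(SOME v'. v' \<in> carrier V \<and> f v' = f v) \<in> carrier V \<and> f (SOME v'. v' \<in> carrier V \<and> f v' = f v) = f v"
   by (rule someI[of _ v]) (use that in simp)
  then show ?thesis using eq that by (simp add: \<psi>_def)
 qed
 have \<psi>: "kembedding W n \<psi>"
  unfolding kembedding_def
 proof (intro conjI ballI allI)
  show "\<psi> ` carrier W \<subseteq> coord_space n"
  proof
   fix y assume "y \<in> \<psi> ` carrier W"
   then obtain v where "v \<in> carrier V" "y = p (\<phi> v)" unfolding surj[symmetric] using \<psi>f by auto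
   then have "y \<in> \<phi> ` carrier V" using p(2) by auto
   then show "y \<in> coord_space n" using \<phi>n by auto
  qed
  show "inj_on \<psi> (carrier W)"
  proof (rule inj_onI)
   fix x y assume "x \<in> carrier W" "y \<in> carrier W" "\<psi> x = \<psi> y"
   moreover from this obtain a b where "a \<in> carrier V" "b \<in> carrier V" "x = f a" "y = f b"
    unfolding surj[symmetric] by blast
   ultimately show "x = y" using \<psi>f eq by metis
  qed
  show "\<psi> (x +[W] y) = \<psi> x + \<psi> y" if xW: "x \<in> carrier W" and yW: "y \<in> carrier W" for x y
  proof -
   obtain a where a: "a \<in> carrier V" "x = f a" using pre[OF xW] by blast
   obtain b where b: "b \<in> carrier V" "y = f b" using pre[OF yW] by blast
   note ab = a(1) b(1) a(2) b(2)
   then have "\<psi> (x +[W] y) = \<psi> (f (a +[V] b))" by (simp only: f_add)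
   also have "\<dots> = p (\<phi> (a +[V] b))" using ab by (intro \<psi>f) simp
   also have "\<dots> = p (\<phi> a) + p (\<phi> b)" using ab by (simp only: \<phi>_add p.add)
   finally show ?thesis using ab \<psi>f by (simp only:)
  qed
  show "\<psi> (c *[W] x) = fun_scale c (\<psi> x)" if xW: "x \<in> carrier W" for x c
  proof -
   obtain a where a: "a \<in> carrier V" "x = f a" using pre[OF xW] by blast
   then have "\<psi> (c *[W] x) = \<psi> (f (c *[V] a))" by (simp only: f_scale)
   also have "\<dots> = p (\<phi> (c *[V] a))" using a by (intro \<psi>f) simp
   also have "\<dots> = fun_scale c (p (\<phi> a))" using a by (simp only: \<phi>_scale p.scale)
   finally show ?thesis using a \<psi>f by (simp only:)
  qed
 qed
 then show "kfin W" by (auto simp: kfin_def)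
 have "\<psi> ` carrier W = p ` \<phi> ` carrier V"
  unfolding surj[symmetric] image_image using \<psi>f by (intro image_cong) auto
 then show "kdim V = kdim ?VK + kdim W"
  using p(4) kdim_eq_dim_image[OF V \<phi>] kdim_eq_dim_image[OF VK \<phi>K] kdim_eq_dim_image[OF W \<psi>] by simp
qed

lemma kdim_iso:
 assumes "kspace V" "kspace W" "klinear V W f" "bij_betw f (carrier V) (carrier W)" "kfin V"
 shows "kfin W" "kdim V = kdim W"
proof -
 have img: "f ` carrier V = carrier W" and inj: "inj_on f (carrier V)"
  using assms(4) by (auto simp: bij_betw_def)
 show "kfin W" by (rule rank_nullity(1)[OF assms(1-3) img assms(5)])
 obtain n \<phi> where \<phi>: "kembedding W n \<phi>" using \<open>kfin W\<close> by (auto simp: kfin_def)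
 have fc: "f x \<in> carrier W" if "x \<in> carrier V" for x using img that by auto
 have "kembedding V n (\<phi> \<circ> f)"
  unfolding kembedding_def
 proof (intro conjI ballI allI)
  show "(\<phi> \<circ> f) ` carrier V \<subseteq> coord_space n" using fc \<phi> by (auto simp: kembedding_def)
  show "inj_on (\<phi> \<circ> f) (carrier V)" using inj \<phi> fc by (auto simp: kembedding_def inj_on_def)
  show "(\<phi> \<circ> f) (x +[V] y) = (\<phi> \<circ> f) x + (\<phi> \<circ> f) y"
   if "x \<in> carrier V" "y \<in> carrier V" for x y
   using assms(3) \<phi> fc that by (simp add: kembedding_def klinear_def)
  show "(\<phi> \<circ> f) (c *[V] x) = fun_scale c ((\<phi> \<circ> f) x)" if "x \<in> carrier V" for c x
   using assms(3) \<phi> fc that by (simp add: kembedding_def klinear_def)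
 qed
 then have "kdim V = fs.dim ((\<phi> \<circ> f) ` carrier V)" by (rule kdim_eq_dim_image[OF assms(1)])
 then show "kdim V = kdim W" using kdim_eq_dim_image[OF assms(2) \<phi>] by (simp add: img[symmetric] image_image)
qed

lemma kembedding_lincomb:
 assumes V: "kspace V" and f: "kembedding V n f" and I: "finite I" "v ` I \<subseteq> carrier V"
 shows "lincomb V v I c \<in> carrier V" "f (lincomb V v I c) = (\<Sum>i\<in>I. fun_scale (c i) (f (v i)))"
proof -
 interpret V: kspace V by fact
 have add: "f (x +[V] y) = f x + f y" if "x \<in> carrier V" "y \<in> carrier V" for x y
  using f that by (simp add: kembedding_def)
 have scale: "f (a *[V] x) = fun_scale a (f x)" if "x \<in> carrier V" for a x
  using f that by (simp add: kembedding_def)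
 have f0: "f \<zero>[V] = 0" using scale[of "\<zero>[V]" 0] by (simp add: fun_scale_def zero_fun_def)
 have "lincomb V v I c \<in> carrier V \<and> f (lincomb V v I c) = (\<Sum>i\<in>I. fun_scale (c i) (f (v i)))"
  using I
 proof (induction I rule: finite_induct)
  case (insert i I)
  have "lincomb V v (insert i I) c = c i *[V] v i +[V] lincomb V v I c"
   unfolding lincomb_def using insert by (subst V.finsum_insert) auto
  then show ?case using insert by (simp add: add scale)
 qed (simp add: lincomb_def f0)
 then show "lincomb V v I c \<in> carrier V" "f (lincomb V v I c) = (\<Sum>i\<in>I. fun_scale (c i) (f (v i)))"
  by auto
qed

definition basis_coeff :: "('k, 'v) module \<Rightarrow> ('i \<Rightarrow> 'v) \<Rightarrow> 'i set \<Rightarrow> 'v \<Rightarrow> 'i \<Rightarrow> 'k"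
 where "basis_coeff V v I = the_inv_into (I \<rightarrow>\<^sub>E UNIV) (lincomb V v I)"

context
 fixes V :: "('k::field, 'v) module" and v :: "'i \<Rightarrow> 'v" and I :: "'i set"
 assumes V: "kspace V" and basis: "finite_basis V v I"
begin

interpretation V: kspace V by (rule V)

lemma basis_finite: "finite I" and basis_closed: "i \<in> I ==> v i \<in> carrier V"
 using basis by (auto simp: finite_basis_def)

lemma lincomb_closed: "lincomb V v I c \<in> carrier V"
 unfolding lincomb_def by (rule V.finsum_closed) (auto simp: basis_closed)

lemma lincomb_cong: "(\<And>i. i \<in> I ==> c i = d i) ==> lincomb V v I c = lincomb V v I d"
 unfolding lincomb_def by (rule V.finsum_cong') (auto simp: basis_closed)

lemma lincomb_add: "lincomb V v I (\<lambda>i. c i + d i) = lincomb V v I c +[V] lincomb V v I d"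
proof -
 have "lincomb V v I (\<lambda>i. c i + d i) = (\<Oplus>\<^bsub>V\<^esub>i\<in>I. c i *[V] v i +[V] d i *[V] v i)"
  unfolding lincomb_def by (rule V.finsum_cong') (auto simp: basis_closed V.scale_l_distr)
 also have "\<dots> = lincomb V v I c +[V] lincomb V v I d"
  unfolding lincomb_def by (rule V.finsum_addf) (auto simp: basis_closed)
 finally show ?thesis .
qed

lemma lincomb_scale: "lincomb V v I (\<lambda>i. a * c i) = a *[V] lincomb V v I c"
proof -
 have "lincomb V v J (\<lambda>i. a * c i) = a *[V] lincomb V v J c \<and> lincomb V v J c \<in> carrier V"
  if "finite J" "J \<subseteq> I" for J
  using that
 proof (induction J rule: finite_induct)
  case (insert i J)
  have "lincomb V v (insert i J) d = d i *[V] v i +[V] lincomb V v J d" for d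
   unfolding lincomb_def using insert by (subst V.finsum_insert) (auto simp: basis_closed subset_iff)
  then show ?case using insert by (simp add: basis_closed V.scale_r_distr V.scale_assoc)
 qed (simp add: lincomb_def)
 then show ?thesis using basis_finite by blast
qed

lemma lincomb_basis_coeff: "x \<in> carrier V ==> lincomb V v I (basis_coeff V v I x) = x"
 unfolding basis_coeff_def using basis
 by (intro f_the_inv_into_f[of "lincomb V v I"]) (auto simp: finite_basis_def bij_betw_def)

lemma basis_coeff_lincomb: assumes "i \<in> I" shows "basis_coeff V v I (lincomb V v I c) i = c i"
proof -
 have "lincomb V v I c = lincomb V v I (restrict c I)" by (rule lincomb_cong) simp
 moreover have "basis_coeff V v I (lincomb V v I (restrict c I)) = restrict c I"
  unfolding basis_coeff_def using basis
  by (intro the_inv_into_f_f[of "lincomb V v I"]) (auto simp: finite_basis_def bij_betw_def)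
 ultimately show ?thesis using assms by simp
qed

lemma basis_coeff_add:
 assumes "x \<in> carrier V" "y \<in> carrier V" "i \<in> I"
 shows "basis_coeff V v I (x +[V] y) i = basis_coeff V v I x i + basis_coeff V v I y i"
proof -
 have "x +[V] y = lincomb V v I (\<lambda>i. basis_coeff V v I x i + basis_coeff V v I y i)"
  using lincomb_basis_coeff assms by (simp add: lincomb_add)
 then show ?thesis using basis_coeff_lincomb[OF assms(3)] by simp
qed

lemma basis_coeff_scale:
 assumes "x \<in> carrier V" "i \<in> I"
 shows "basis_coeff V v I (a *[V] x) i = a * basis_coeff V v I x i"
proof -
 have "a *[V] x = lincomb V v I (\<lambda>i. a * basis_coeff V v I x i)"
  using lincomb_basis_coeff assms by (simp add: lincomb_scale)
 then show ?thesis using basis_coeff_lincomb[OF assms(2)] by simp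
qed

lemma basis_coeff_eqI:
 assumes "x \<in> carrier V" "y \<in> carrier V" "\<And>i. i \<in> I ==> basis_coeff V v I x i = basis_coeff V v I y i"
 shows "x = y"
proof -
 have "lincomb V v I (basis_coeff V v I x) = lincomb V v I (basis_coeff V v I y)"
  by (rule lincomb_cong) (rule assms(3))
 then show ?thesis using lincomb_basis_coeff assms(1,2) by simp
qed

text \<open>An enumeration of \<open>I\<close> turns the coordinates into an embedding onto
  \<open>coord_space (card I)\<close>.\<close>

lemma kdim_basis: "kfin V" "kdim V = card I"
proof -
 obtain h where h: "bij_betw h {..<card I} I"
  using basis_finite bij_betw_from_nat_into_finite by blast
 have hsurj: "\<exists>j<card I. i = h j" if "i \<in> I" for i
 proof -
  have "i \<in> h ` {..<card I}" using that bij_betw_imp_surj_on[OF h] by simp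
  then show ?thesis by auto
 qed
 define \<phi> where "\<phi> = (\<lambda>x i. if i < card I then basis_coeff V v I x (h i) else 0)"
 have hI: "h i \<in> I" if "i < card I" for i using h that by (auto simp: bij_betw_def)
 have \<phi>: "kembedding V (card I) \<phi>"
  unfolding kembedding_def
 proof (intro conjI ballI allI)
  show "\<phi> ` carrier V \<subseteq> coord_space (card I)" by (auto simp: \<phi>_def coord_space_def)
  show "inj_on \<phi> (carrier V)"
  proof (rule inj_onI)
   fix x y assume xy: "x \<in> carrier V" "y \<in> carrier V" "\<phi> x = \<phi> y"
   show "x = y"
   proof (rule basis_coeff_eqI[OF xy(1,2)])
    fix i assume "i \<in> I"
    then obtain j where j: "j < card I" "i = h j" using hsurj by blast
    show "basis_coeff V v I x i = basis_coeff V v I y i" using fun_cong[OF xy(3), of j] j by (simp add: \<phi>_def)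
   qed
  qed
  show "\<phi> (x +[V] y) = \<phi> x + \<phi> y" if "x \<in> carrier V" "y \<in> carrier V" for x y
   using that hI by (auto simp: \<phi>_def fun_eq_iff basis_coeff_add fun_apply)
  show "\<phi> (c *[V] x) = fun_scale c (\<phi> x)" if "x \<in> carrier V" for c x
   using that hI by (auto simp: \<phi>_def fun_eq_iff basis_coeff_scale fun_scale_def)
 qed
 have "coord_space (card I) \<subseteq> \<phi> ` carrier V"
 proof
  fix f :: "nat \<Rightarrow> 'k" assume f: "f \<in> coord_space (card I)"
  define g where "g = the_inv_into {..<card I} h"
  have "f = \<phi> (lincomb V v I (\<lambda>j. f (g j)))"
  proof
   fix i
   show "f i = \<phi> (lincomb V v I (\<lambda>j. f (g j))) i"
   proof (cases "i < card I")
    case True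
    then have "g (h i) = i" unfolding g_def using h by (intro the_inv_into_f_f) (auto simp: bij_betw_def)
    then show ?thesis using True hI basis_coeff_lincomb[of "h i"] by (simp add: \<phi>_def)
   qed (use f in \<open>auto simp: \<phi>_def coord_space_def\<close>)
  qed
  then show "f \<in> \<phi> ` carrier V" using lincomb_closed by blast
 qed
 moreover have "\<phi> ` carrier V \<subseteq> coord_space (card I)" using \<phi> by (simp add: kembedding_def)
 ultimately have "\<phi> ` carrier V = coord_space (card I)" by (rule equalityI[rotated])
 then show "kdim V = card I" using kdim_eq_dim_image[OF V \<phi>] dim_coord_space by simp
 show "kfin V" using \<phi> by (auto simp: kfin_def)
qed

end

text \<open>A basis of the image under an embedding is pulled back to \<open>V\<close>.\<close>

lemma kfin_finite_basis:
 fixes V :: "('k::field, 'v) module"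
 assumes V: "kspace V" and fin: "kfin V"
 shows "\<exists>v. finite_basis V v {..<kdim V}"
proof -
 interpret V: kspace V by fact
 obtain n \<phi> where \<phi>: "kembedding V n \<phi>" using fin by (auto simp: kfin_def)
 obtain B where B: "B \<subseteq> \<phi> ` carrier V" "fs.independent B" "\<phi> ` carrier V \<subseteq> fs.span B"
   "card B = fs.dim (\<phi> ` carrier V)"
  using fs.basis_exists by metis
 have d: "card B = kdim V" using B(4) kdim_eq_dim_image[OF V \<phi>] by simp
 have "finite B" using independent_coord_space_finite[OF B(2), of n] B(1) \<phi> by (auto simp: kembedding_def)
 then obtain h where h: "bij_betw h {..<kdim V} B" using bij_betw_from_nat_into_finite d by metis
 have inj: "inj_on \<phi> (carrier V)" using \<phi> by (simp add: kembedding_def)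
 have hB: "h i \<in> B" if "i < kdim V" for i using h that by (auto simp: bij_betw_def)
 define v where "v = (\<lambda>i. the_inv_into (carrier V) \<phi> (h i))"
 have v: "v i \<in> carrier V" "\<phi> (v i) = h i" if "i < kdim V" for i
  using the_inv_into_into[OF inj, of "h i" "carrier V"] f_the_inv_into_f[OF inj, of "h i"] hB[OF that] B(1)
  by (auto simp: v_def)
 have vc: "v ` {..<kdim V} \<subseteq> carrier V" using v by auto
 let ?L = "lincomb V v {..<kdim V}"
 have L: "?L c \<in> carrier V" "\<phi> (?L c) = (\<Sum>i<kdim V. fun_scale (c i) (h i))" for c
  using kembedding_lincomb[OF V \<phi> _ vc, of c] v by (auto intro!: sum.cong)
 have "bij_betw ?L ({..<kdim V} \<rightarrow>\<^sub>E UNIV) (carrier V)"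
  unfolding bij_betw_def
 proof
  show "inj_on ?L ({..<kdim V} \<rightarrow>\<^sub>E UNIV)"
  proof (rule inj_onI)
   fix c d :: "nat \<Rightarrow> 'k" assume cd: "c \<in> {..<kdim V} \<rightarrow>\<^sub>E UNIV" "d \<in> {..<kdim V} \<rightarrow>\<^sub>E UNIV" "?L c = ?L d"
   have "c i = d i" if i: "i < kdim V" for i
   proof -
    define g where "g = the_inv_into {..<kdim V} h"
    have gh: "g (h j) = j" if "j < kdim V" for j
     unfolding g_def using h that by (intro the_inv_into_f_f) (auto simp: bij_betw_def)
    have "(\<Sum>x\<in>B. fun_scale (c (g x) - d (g x)) x) = (\<Sum>j<kdim V. fun_scale (c (g (h j)) - d (g (h j))) (h j))"
     by (rule sum.reindex_bij_betw[OF h, symmetric])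
    also have "\<dots> = (\<Sum>j<kdim V. fun_scale (c j) (h j) - fun_scale (d j) (h j))"
     by (rule sum.cong) (auto simp: gh fs.scale_left_diff_distrib)
    also have "\<dots> = \<phi> (?L c) - \<phi> (?L d)" unfolding L by (rule sum_subtractf)
    also have "\<dots> = 0" unfolding cd(3) by (rule diff_self)
    finally have *: "(\<Sum>x\<in>B. fun_scale (c (g x) - d (g x)) x) = 0" .
    have "c (g (h i)) - d (g (h i)) = 0"
     by (rule fs.independentD[OF B(2) \<open>finite B\<close> subset_refl * hB[OF i]])
    then show ?thesis using gh[OF i] by simp
   qed
   then show "c = d" by (intro PiE_ext[OF cd(1,2)]) simp
  qed
  show "?L ` ({..<kdim V} \<rightarrow>\<^sub>E UNIV) = carrier V"
  proof (intro equalityI subsetI)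
   fix x assume x: "x \<in> carrier V"
   then have "\<phi> x \<in> fs.span B" by (intro subsetD[OF B(3)] imageI)
   then have "\<exists>u. \<phi> x = (\<Sum>b\<in>B. fun_scale (u b) b)"
    unfolding fs.span_finite[OF \<open>finite B\<close>] image_iff by simp
   then obtain u where "\<phi> x = (\<Sum>b\<in>B. fun_scale (u b) b)" ..
   also have "\<dots> = (\<Sum>i<kdim V. fun_scale (u (h i)) (h i))"
    by (rule sum.reindex_bij_betw[OF h, symmetric])
   also have "\<dots> = (\<Sum>i<kdim V. fun_scale (restrict (\<lambda>i. u (h i)) {..<kdim V} i) (h i))"
    by (rule sum.cong) auto
   also have "\<dots> = \<phi> (?L (restrict (\<lambda>i. u (h i)) {..<kdim V}))" unfolding L ..
   finally have "x = ?L (restrict (\<lambda>i. u (h i)) {..<kdim V})"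
    using inj_onD[OF inj _ x L(1)] by simp
   then show "x \<in> ?L ` ({..<kdim V} \<rightarrow>\<^sub>E UNIV)"
    by (intro image_eqI[of x ?L]) (auto simp only: PiE_def Pi_def restrict_extensional)
  qed (use L(1) in auto)
 qed
 then show ?thesis using vc unfolding finite_basis_def by auto
qed

lemma (in abelian_group) minus_eq_zero_iff:
 assumes "x \<in> carrier G" "y \<in> carrier G"
 shows "x \<ominus> y = \<zero> \<longleftrightarrow> x = y"
proof
 assume "x \<ominus> y = \<zero>"
 then have "\<ominus> (\<ominus> y) = x" using assms by (intro minus_equality) (simp_all add: minus_eq)
 then show "x = y" using assms by simp
qed (use assms in \<open>simp add: minus_eq r_neg\<close>)

section \<open>Algebras and their finite-dimensional modules\<close>

text \<open>The last two axioms make \<open>c \<odot> \<one>\<close> central, so that the field acts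
  on modules through these elements, as \<open>restrict_scalars\<close> prescribes.\<close>

locale kalg = ring A for A :: "('k::field, 'a) module" (structure) +
 assumes scal_closed [simp, intro]: "a \<in> carrier A ==> c \<odot> a \<in> carrier A"
  and scal_l_distr: "a \<in> carrier A ==> (c + d) \<odot> a = c \<odot> a \<oplus> d \<odot> a"
  and scal_r_distr: "[|a \<in> carrier A; b \<in> carrier A|] ==> c \<odot> (a \<oplus> b) = c \<odot> a \<oplus> c \<odot> b"
  and scal_assoc: "a \<in> carrier A ==> (c * d) \<odot> a = c \<odot> (d \<odot> a)"
  and scal_one [simp]: "a \<in> carrier A ==> 1 \<odot> a = a"
  and scal_mult_l: "[|a \<in> carrier A; b \<in> carrier A|] ==> (c \<odot> a) \<otimes> b = c \<odot> (a \<otimes> b)"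
  and scal_mult_r: "[|a \<in> carrier A; b \<in> carrier A|] ==> a \<otimes> (c \<odot> b) = c \<odot> (a \<otimes> b)"

sublocale kalg \<subseteq> kspace A
 by unfold_locales (auto simp: scal_l_distr scal_r_distr scal_assoc)

lemma (in kalg) scal_one_mult: "a \<in> carrier A ==> (c \<odot> \<one>) \<otimes> a = c \<odot> a"
 and mult_scal_one: "a \<in> carrier A ==> a \<otimes> (c \<odot> \<one>) = c \<odot> a"
 by (simp_all add: scal_mult_l scal_mult_r)

lemma restrict_scalars_simps [simp]:
 "carrier (restrict_scalars A M) = carrier M" "zero (restrict_scalars A M) = zero M"
 "add (restrict_scalars A M) = add M"
 "smult (restrict_scalars A M) = (\<lambda>c x. (c *[A] \<one>[A]) *[M] x)"
 by (simp_all add: restrict_scalars_def)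

lemma restrict_scalars_carrier: "restrict_scalars A (M\<lparr>carrier := U\<rparr>) = (restrict_scalars A M)\<lparr>carrier := U\<rparr>"
 by (simp add: restrict_scalars_def)

context left_module
begin

lemma zero_smult [simp]: assumes "x \<in> carrier M" shows "\<zero> *[M] x = \<zero>[M]"
proof -
 have "\<zero> *[M] x +[M] \<zero> *[M] x = \<zero> *[M] x"
  using smult_l_distr[of \<zero> \<zero> x] assms by simp
 then show ?thesis using smult_closed[of \<zero> x] assms by (simp add: M.add.r_cancel_one)
qed

lemma smult_zero [simp]: assumes "a \<in> carrier R" shows "a *[M] \<zero>[M] = \<zero>[M]"
proof -
 have "a *[M] \<zero>[M] +[M] a *[M] \<zero>[M] = a *[M] \<zero>[M]"
  using smult_r_distr[of a "\<zero>[M]" "\<zero>[M]"] assms by simp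
 then show ?thesis using smult_closed[of a "\<zero>[M]"] assms by (simp add: M.add.r_cancel_one)
qed

lemma minus_one_smult: assumes "x \<in> carrier M" shows "(\<ominus> \<one>) *[M] x = \<ominus>\<^bsub>M\<^esub> x"
proof -
 have "(\<ominus> \<one>) *[M] x +[M] x = \<zero>[M]"
  using smult_l_distr[of "\<ominus> \<one>" \<one> x] assms smult_one[OF assms] by (simp add: R.l_neg)
 then show ?thesis using assms smult_closed[of "\<ominus> \<one>" x] by (simp add: M.minus_equality)
qed

lemma submodule_iff:
 "submodule U R M \<longleftrightarrow> U \<subseteq> carrier M \<and> \<zero>[M] \<in> U \<and> (\<forall>x\<in>U. \<forall>y\<in>U. x +[M] y \<in> U) \<and>
  (\<forall>a\<in>carrier R. \<forall>x\<in>U. a *[M] x \<in> U)" (is "_ \<longleftrightarrow> ?r")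
proof
 assume "submodule U R M"
 then interpret U: submodule U R M .
 show ?r using U.subset U.one_closed U.m_closed U.smult_closed by auto
next
 assume r: ?r
 show "submodule U R M"
 proof (intro submodule.intro subgroup.intro)
  fix x assume x: "x \<in> U"
  then have "(\<ominus> \<one>) *[M] x \<in> U" using r by simp
  then have "\<ominus>\<^bsub>M\<^esub> x \<in> U" using x r by (subst (asm) minus_one_smult) auto
  then show "inv\<^bsub>add_monoid M\<^esub> x \<in> U" by (simp add: a_inv_def)
 qed (use r in \<open>auto simp: submodule_axioms_def\<close>)
qed

lemma submodule_left_module:
 assumes "submodule U R M"
 shows "left_module R (M\<lparr>carrier := U\<rparr>)"
proof -
 have U: "U \<subseteq> carrier M" "\<zero>[M] \<in> U" "\<And>x y. [|x \<in> U; y \<in> U|] ==> x +[M] y \<in> U"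
  "\<And>a x. [|a \<in> carrier R; x \<in> U|] ==> a *[M] x \<in> U"
  using assms by (auto simp: submodule_iff)
 have Uc: "x \<in> carrier M" if "x \<in> U" for x using that U by blast
 have "abelian_group (M\<lparr>carrier := U\<rparr>)"
 proof (rule abelian_groupI)
  fix x assume x: "x \<in> carrier (M\<lparr>carrier := U\<rparr>)"
  have "(\<ominus> \<one>) *[M] x \<in> U" using U x by simp
  moreover have "(\<ominus> \<one>) *[M] x +[M] x = \<zero>[M]" using x Uc by (simp add: minus_one_smult M.l_neg)
  ultimately show "\<exists>y\<in>carrier (M\<lparr>carrier := U\<rparr>). y +[M\<lparr>carrier := U\<rparr>] x = \<zero>[M\<lparr>carrier := U\<rparr>]" by auto
 qed (use U Uc in \<open>simp_all add: M.a_ac\<close>)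
 then show ?thesis
  unfolding left_module_def left_module_axioms_def using U Uc R.ring_axioms
  by (simp add: smult_l_distr smult_r_distr smult_assoc1 smult_one)
qed

lemma submodule_trans:
 assumes "submodule U R M" "W \<subseteq> U"
 shows "submodule W R (M\<lparr>carrier := U\<rparr>) \<longleftrightarrow> submodule W R M"
proof -
 interpret U: left_module R "M\<lparr>carrier := U\<rparr>" by (rule submodule_left_module) fact
 show ?thesis using assms by (auto simp: submodule_iff U.submodule_iff)
qed

lemma submodule_zero: "submodule {\<zero>[M]} R M" and submodule_carrier: "submodule (carrier M) R M"
 by (auto simp: submodule_iff smult_closed)

end

text \<open>\<open>N\<close> is only a record of operations; a surjection that respects them hands
  down every module axiom. Factor modules and copies of modules on other types are obtained in this
  way.\<close>

lemma left_module_image: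
 assumes M: "left_module A M" and q: "q ` carrier M = carrier N"
  and add: "\<And>x y. [|x \<in> carrier M; y \<in> carrier M|] ==> q (x +[M] y) = q x +[N] q y"
  and smult: "\<And>a x. [|a \<in> carrier A; x \<in> carrier M|] ==> q (a *[M] x) = a *[N] q x"
  and zero: "q \<zero>[M] = \<zero>[N]"
 shows "left_module A N"
proof -
 interpret M: left_module A M by fact
 have ex: "\<exists>x\<in>carrier M. u = q x" if "u \<in> carrier N" for u using that by (auto simp flip: q)
 have qc: "q x \<in> carrier N" if "x \<in> carrier M" for x using that by (auto simp flip: q)
 have "abelian_group N"
 proof (rule abelian_groupI)
  fix u v assume "u \<in> carrier N" "v \<in> carrier N"
  then obtain x y where x: "x \<in> carrier M" "u = q x" and y: "y \<in> carrier M" "v = q y" using ex by meson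
  show "u +[N] v \<in> carrier N" using qc[of "x +[M] y"] x y add by simp
  show "u +[N] v = v +[N] u" using x y by (simp flip: add add: M.M.a_comm)
 next
  fix u v w assume "u \<in> carrier N" "v \<in> carrier N" "w \<in> carrier N"
  then obtain x y z where "x \<in> carrier M" "u = q x" "y \<in> carrier M" "v = q y" "z \<in> carrier M" "w = q z"
   using ex by meson
  then show "u +[N] v +[N] w = u +[N] (v +[N] w)" by (simp flip: add add: M.M.a_assoc)
 next
  show "\<zero>[N] \<in> carrier N" using qc[of "\<zero>[M]"] zero by simp
  fix u assume "u \<in> carrier N"
  then obtain x where x: "x \<in> carrier M" "u = q x" using ex by meson
  show "\<zero>[N] +[N] u = u" using x by (simp flip: add zero)
  have "q (\<ominus>\<^bsub>M\<^esub> x) +[N] u = \<zero>[N]" using x by (simp flip: add zero add: M.M.l_neg)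
  then show "\<exists>v\<in>carrier N. v +[N] u = \<zero>[N]" using qc[of "\<ominus>\<^bsub>M\<^esub> x"] x by auto
 qed
 moreover have "left_module_axioms A N"
 proof
  fix a b u assume a: "a \<in> carrier A" and b: "b \<in> carrier A" and "u \<in> carrier N"
  then obtain x where x: "x \<in> carrier M" "u = q x" using ex by meson
  show "a *[N] u \<in> carrier N" using qc[of "a *[M] x"] x a smult M.smult_closed by simp
  show "(a +[A] b) *[N] u = a *[N] u +[N] b *[N] u"
   using x a b by (simp flip: add smult add: M.smult_l_distr M.smult_closed)
  show "(a **[A] b) *[N] u = a *[N] (b *[N] u)"
   using x a b by (simp flip: smult add: M.smult_assoc1 M.smult_closed)
 next
  fix a u v assume a: "a \<in> carrier A" and "u \<in> carrier N" "v \<in> carrier N"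
  then obtain x y where x: "x \<in> carrier M" "u = q x" and y: "y \<in> carrier M" "v = q y" using ex by meson
  show "a *[N] (u +[N] v) = a *[N] u +[N] a *[N] v"
   using x y a by (simp flip: add smult add: M.smult_r_distr M.smult_closed)
 next
  fix u assume "u \<in> carrier N"
  then obtain x where x: "x \<in> carrier M" "u = q x" using ex by meson
  show "\<one>[A] *[N] u = u" using x by (simp flip: smult add: M.smult_one)
 qed
 ultimately show ?thesis unfolding left_module_def using M.R.ring_axioms by simp
qed

lemma module_homD:
 assumes "f \<in> module_hom A M N"
 shows "x \<in> carrier M ==> f x \<in> carrier N"
  and "[|x \<in> carrier M; y \<in> carrier M|] ==> f (x +[M] y) = f x +[N] f y"
  and "[|a \<in> carrier A; x \<in> carrier M|] ==> f (a *[M] x) = a *[N] f x"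
  and "f \<in> extensional (carrier M)"
 using assms by (auto simp: module_hom_def PiE_def)

lemma module_homI:
 assumes "\<And>x. x \<in> carrier M ==> f x \<in> carrier N"
  and "\<And>x y. [|x \<in> carrier M; y \<in> carrier M; x +[M] y \<in> carrier M|] ==> f (x +[M] y) = f x +[N] f y"
  and "\<And>a x. [|a \<in> carrier A; x \<in> carrier M; a *[M] x \<in> carrier M|] ==> f (a *[M] x) = a *[N] f x"
  and "left_module A M"
 shows "restrict f (carrier M) \<in> module_hom A M N"
proof -
 interpret left_module A M by fact
 show ?thesis unfolding module_hom_def using assms(1-3) by (auto simp: smult_closed)
qed

lemma module_hom_zero:
 assumes "f \<in> module_hom A M N" "left_module A M" "left_module A N"
 shows "f \<zero>[M] = \<zero>[N]"
proof -
 interpret M: left_module A M by fact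
 interpret N: left_module A N by fact
 have "f (\<zero>[A] *[M] \<zero>[M]) = \<zero>[A] *[N] f \<zero>[M]" by (rule module_homD(3)[OF assms(1)]) auto
 then show ?thesis using module_homD(1)[OF assms(1), of "\<zero>[M]"] by simp
qed

lemma module_hom_compose:
 assumes "f \<in> module_hom A L M" "g \<in> module_hom A M N" "left_module A L"
 shows "compose (carrier L) g f \<in> module_hom A L N"
proof -
 interpret left_module A L by fact
 show ?thesis
  unfolding module_hom_def
  using module_homD[OF assms(1)] module_homD[OF assms(2)]
  by (auto simp: compose_def smult_closed)
qed

lemma module_hom_id: "left_module A M ==> (\<lambda>x\<in>carrier M. x) \<in> module_hom A M M"
 by (rule module_homI) auto

lemma module_hom_eqI:
 assumes "f \<in> module_hom A M N" "g \<in> module_hom A M N" "\<And>x. x \<in> carrier M ==> f x = g x"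
 shows "f = g"
 using module_homD(4)[OF assms(1)] module_homD(4)[OF assms(2)] assms(3) by (rule extensionalityI)

lemma module_hom_zero_map:
 assumes "left_module A M" "left_module A N"
 shows "(\<lambda>x\<in>carrier M. \<zero>[N]) \<in> module_hom A M N"
proof -
 interpret N: left_module A N by fact
 show ?thesis by (rule module_homI[OF _ _ _ assms(1)]) auto
qed

lemma module_hom_image_submodule:
 assumes f: "f \<in> module_hom A M N" and M: "left_module A M" and N: "left_module A N" and U: "submodule U A M"
 shows "submodule (f ` U) A N"
proof -
 interpret M: left_module A M by fact
 interpret N: left_module A N by fact
 have U': "U \<subseteq> carrier M" "\<zero>[M] \<in> U" "\<And>x y. [|x \<in> U; y \<in> U|] ==> x +[M] y \<in> U"
  "\<And>a x. [|a \<in> carrier A; x \<in> U|] ==> a *[M] x \<in> U"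
  using U by (auto simp: M.submodule_iff)
 have Uc: "x \<in> carrier M" if "x \<in> U" for x using that U' by blast
 show ?thesis
  unfolding N.submodule_iff
 proof (intro conjI ballI)
  show "f ` U \<subseteq> carrier N" using Uc module_homD(1)[OF f] by auto
  show "\<zero>[N] \<in> f ` U" using module_hom_zero[OF f M N] U'(2) by (metis imageI)
 next
  fix u v assume "u \<in> f ` U" "v \<in> f ` U"
  then obtain x y where xy: "x \<in> U" "u = f x" "y \<in> U" "v = f y" by blast
  then have "u +[N] v = f (x +[M] y)" using module_homD(2)[OF f] Uc by simp
  then show "u +[N] v \<in> f ` U" using U'(3) xy by simp
 next
  fix a u assume "a \<in> carrier A" "u \<in> f ` U"
  then obtain x where x: "a \<in> carrier A" "x \<in> U" "u = f x" by blast
  then have "a *[N] u = f (a *[M] x)" using module_homD(3)[OF f] Uc by simp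
  then show "a *[N] u \<in> f ` U" using U'(4) x by simp
 qed
qed

lemma module_hom_vimage_submodule:
 assumes f: "f \<in> module_hom A M N" and M: "left_module A M" and N: "left_module A N" and U: "submodule U A N"
 shows "submodule {x \<in> carrier M. f x \<in> U} A M"
proof -
 interpret M: left_module A M by fact
 interpret N: left_module A N by fact
 show ?thesis
  using U module_hom_zero[OF f M N] unfolding M.submodule_iff N.submodule_iff
  by (auto simp: module_homD[OF f] M.smult_closed)
qed

lemma module_hom_kernel_submodule:
 assumes f: "f \<in> module_hom A M N" and M: "left_module A M" and N: "left_module A N"
 shows "submodule {x \<in> carrier M. f x = \<zero>[N]} A M"
 using module_hom_vimage_submodule[OF assms left_module.submodule_zero[OF N]] by simp

lemma module_hom_eq_iff:
 assumes f: "f \<in> module_hom A M N" and M: "left_module A M" and N: "left_module A N"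
  and "x \<in> carrier M" "y \<in> carrier M"
 shows "f x = f y \<longleftrightarrow> f (x \<ominus>\<^bsub>M\<^esub> y) = \<zero>[N]"
proof -
 interpret M: left_module A M by fact
 interpret N: left_module A N by fact
 have "x \<ominus>\<^bsub>M\<^esub> y = x +[M] (\<ominus>\<^bsub>A\<^esub> \<one>[A]) *[M] y" using assms(5) by (simp add: M.minus_one_smult M.M.minus_eq)
 then have "f (x \<ominus>\<^bsub>M\<^esub> y) = f x +[N] (\<ominus>\<^bsub>A\<^esub> \<one>[A]) *[N] f y"
  using assms(4,5) module_homD(2,3)[OF f] by (simp add: M.smult_closed)
 then have *: "f (x \<ominus>\<^bsub>M\<^esub> y) = f x \<ominus>\<^bsub>N\<^esub> f y"
  using module_homD(1)[OF f assms(5)] by (simp add: N.minus_one_smult N.M.minus_eq)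
 show ?thesis
  unfolding * using module_homD(1)[OF f assms(4)] module_homD(1)[OF f assms(5)]
  by (simp add: N.M.minus_eq_zero_iff)
qed

lemma module_hom_inj_iff:
 assumes f: "f \<in> module_hom A M N" and M: "left_module A M" and N: "left_module A N"
 shows "inj_on f (carrier M) \<longleftrightarrow> {x \<in> carrier M. f x = \<zero>[N]} = {\<zero>[M]}"
proof -
 interpret M: left_module A M by fact
 interpret N: left_module A N by fact
 have z: "f \<zero>[M] = \<zero>[N]" by (rule module_hom_zero[OF assms])
 show ?thesis
 proof
  assume inj: "inj_on f (carrier M)"
  have "x = \<zero>[M]" if "x \<in> carrier M" "f x = \<zero>[N]" for x
   by (rule inj_onD[OF inj]) (simp_all add: that z)
  then show "{x \<in> carrier M. f x = \<zero>[N]} = {\<zero>[M]}" using z by auto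
 next
  assume k: "{x \<in> carrier M. f x = \<zero>[N]} = {\<zero>[M]}"
  show "inj_on f (carrier M)"
  proof (rule inj_onI)
   fix x y assume xy: "x \<in> carrier M" "y \<in> carrier M" "f x = f y"
   then have "x \<ominus>\<^bsub>M\<^esub> y \<in> {x \<in> carrier M. f x = \<zero>[N]}" using module_hom_eq_iff[OF assms] by simp
   then have "x \<ominus>\<^bsub>M\<^esub> y = \<zero>[M]" unfolding k by simp
   then show "x = y" using xy by (simp add: M.M.minus_eq_zero_iff)
  qed
 qed
qed

text \<open>The homomorphism theorem: two elements of a fibre of \<open>p\<close> differ by an
  element of its kernel, where \<open>f\<close> vanishes, so \<open>f\<close> may be evaluated at
  any preimage.\<close>

lemma module_hom_factor:
 assumes f: "f \<in> module_hom A P T" and p: "p \<in> module_hom A P S"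
  and P: "left_module A P" and T: "left_module A T" and S: "left_module A S"
  and surj: "p ` carrier P = carrier S"
  and ker: "\<And>x. x \<in> {x \<in> carrier P. p x = \<zero>[S]} ==> f x = \<zero>[T]"
 shows "\<exists>g\<in>module_hom A S T. \<forall>x\<in>carrier P. g (p x) = f x"
proof -
 interpret P: left_module A P by fact
 define g0 where "g0 = (\<lambda>s. f (SOME x. x \<in> carrier P \<and> p x = s))"
 have g0: "g0 (p x) = f x" if x: "x \<in> carrier P" for x
 proof -
  define y where "y = (SOME y. y \<in> carrier P \<and> p y = p x)"
  have y: "y \<in> carrier P \<and> p y = p x" unfolding y_def by (rule someI[of _ x]) (use x in simp)
  then have "f (y \<ominus>\<^bsub>P\<^esub> x) = \<zero>[T]"
   using ker[of "y \<ominus>\<^bsub>P\<^esub> x"] module_hom_eq_iff[OF p P S, of y x] x by simp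
  then show ?thesis using module_hom_eq_iff[OF f P T] x y by (simp add: g0_def flip: y_def)
 qed
 have ex: "\<exists>x\<in>carrier P. s = p x" if "s \<in> carrier S" for s using that by (auto simp flip: surj)
 have "restrict g0 (carrier S) \<in> module_hom A S T"
 proof (rule module_homI[OF _ _ _ S])
  fix s assume "s \<in> carrier S"
  then obtain x where "x \<in> carrier P" "s = p x" using ex by meson
  then show "g0 s \<in> carrier T" by (simp add: g0 module_homD(1)[OF f])
 next
  fix s t assume "s \<in> carrier S" "t \<in> carrier S"
  then obtain x y where "x \<in> carrier P" "s = p x" "y \<in> carrier P" "t = p y" using ex by meson
  then show "g0 (s +[S] t) = g0 s +[T] g0 t"
   by (simp flip: module_homD(2)[OF p] add: g0 module_homD(2)[OF f])
 next
  fix a s assume "a \<in> carrier A" "s \<in> carrier S"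
  then obtain x where "a \<in> carrier A" "x \<in> carrier P" "s = p x" using ex by meson
  then show "g0 (a *[S] s) = a *[T] g0 s"
   by (simp flip: module_homD(3)[OF p] add: g0 module_homD(3)[OF f] P.smult_closed)
 qed
 moreover have "\<forall>x\<in>carrier P. restrict g0 (carrier S) (p x) = f x"
  by (simp add: g0 module_homD(1)[OF p])
 ultimately show ?thesis by blast
qed

lemma module_iso_refl: "left_module A M ==> module_iso A M M"
 unfolding module_iso_def by (rule bexI[OF _ module_hom_id]) (auto simp: bij_betw_def inj_on_def)

text \<open>The inverse is the identity of \<open>M\<close> factored through \<open>f\<close>, whose
  kernel is zero.\<close>

lemma module_hom_inverse:
 assumes "f \<in> module_hom A M N" "bij_betw f (carrier M) (carrier N)" "left_module A M" "left_module A N"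
 obtains g where "g \<in> module_hom A N M" "bij_betw g (carrier N) (carrier M)"
  "\<And>x. x \<in> carrier M ==> g (f x) = x" "\<And>y. y \<in> carrier N ==> f (g y) = y"
proof -
 interpret M: left_module A M by fact
 have surj: "f ` carrier M = carrier N" and inj: "inj_on f (carrier M)"
  using assms(2) by (auto simp: bij_betw_def)
 have "\<exists>g\<in>module_hom A N M. \<forall>x\<in>carrier M. g (f x) = (\<lambda>x\<in>carrier M. x) x"
 proof (rule module_hom_factor[OF module_hom_id[OF assms(3)] assms(1,3,3,4) surj])
  fix x assume "x \<in> {x \<in> carrier M. f x = \<zero>[N]}"
  then have "x = \<zero>[M]"
   using inj_onD[OF inj, of x "\<zero>[M]"] module_hom_zero[OF assms(1,3,4)] by simp
  then show "(\<lambda>x\<in>carrier M. x) x = \<zero>[M]" by simp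
 qed
 then obtain g where g: "g \<in> module_hom A N M" "\<forall>x\<in>carrier M. g (f x) = (\<lambda>x\<in>carrier M. x) x" ..
 have gf: "g (f x) = x" if "x \<in> carrier M" for x using g(2) that by simp
 have fg: "f (g y) = y" if "y \<in> carrier N" for y
  using that unfolding surj[symmetric] by (auto simp: gf)
 have "bij_betw g (carrier N) (carrier M)"
  by (rule bij_betw_byWitness[of _ f])
   (auto simp: gf fg module_homD(1)[OF g(1)] module_homD(1)[OF assms(1)])
 then show thesis using that g(1) gf fg by blast
qed

lemma module_iso_sym:
 assumes "module_iso A M N" "left_module A M" "left_module A N"
 shows "module_iso A N M"
proof -
 obtain f where f: "f \<in> module_hom A M N" "bij_betw f (carrier M) (carrier N)"
  using assms(1) unfolding module_iso_def by (elim bexE)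
 show ?thesis
  by (rule module_hom_inverse[OF f assms(2,3)]) (auto simp: module_iso_def)
qed

lemma module_iso_trans:
 assumes "module_iso A L M" "module_iso A M N" "left_module A L"
 shows "module_iso A L N"
proof -
 obtain f g where f: "f \<in> module_hom A L M" "bij_betw f (carrier L) (carrier M)"
  and g: "g \<in> module_hom A M N" "bij_betw g (carrier M) (carrier N)"
  using assms(1,2) unfolding module_iso_def by (elim bexE)
 have "bij_betw (compose (carrier L) g f) (carrier L) (carrier N)"
 proof (rule bij_betw_cong[THEN iffD1, OF _ bij_betw_trans[OF f(2) g(2)]])
  fix x assume "x \<in> carrier L"
  then show "(g \<circ> f) x = compose (carrier L) g f x" by (simp add: compose_def)
 qed
 then show ?thesis using module_hom_compose[OF f(1) g(1) assms(3)] unfolding module_iso_def by (rule bexI)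
qed

lemma module_iso_by_surj:
 assumes f: "f \<in> module_hom A M N" and M: "left_module A M" and N: "left_module A N"
  and "f ` carrier M = carrier N" "\<And>x. [|x \<in> carrier M; f x = \<zero>[N]|] ==> x = \<zero>[M]"
 shows "module_iso A M N"
proof -
 interpret M: left_module A M by fact
 have "{x \<in> carrier M. f x = \<zero>[N]} = {\<zero>[M]}" using assms(5) module_hom_zero[OF f M N] by auto
 then have "bij_betw f (carrier M) (carrier N)"
  using module_hom_inj_iff[OF f M N] assms(4) by (simp add: bij_betw_def)
 then show ?thesis using f unfolding module_iso_def by blast
qed

lemma factor_module_simps [simp]:
 "zero (factor_module M U) = U" "add (factor_module M U) = set_add M"
 "carrier (factor_module M U) = (\<lambda>x. U +>\<^bsub>M\<^esub> x) ` carrier M"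
 unfolding factor_module_def by (auto simp: A_RCOSETS_def')

context
 fixes A :: "('k, 'a) module" and M :: "('a, 'm) module" and U
 assumes M: "left_module A M" and U: "submodule U A M"
begin

interpretation left_module A M by (rule M)

interpretation U: abelian_subgroup U M
proof (rule abelian_subgroupI3)
 interpret U: submodule U A M by (rule U)
 show "additive_subgroup U M" by (rule additive_subgroup.intro) (rule U.subgroup_axioms)
 show "abelian_group M" by (rule M.abelian_group_axioms)
qed

lemma mem_coset_iff:
 assumes "x \<in> carrier M" "y \<in> carrier M"
 shows "x \<in> U +>\<^bsub>M\<^esub> y \<longleftrightarrow> x \<ominus>\<^bsub>M\<^esub> y \<in> U"
proof -
 have "x \<in> U +>\<^bsub>M\<^esub> y \<longleftrightarrow> (\<exists>u\<in>U. x = u +[M] y)" by (simp add: a_r_coset_def')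
 also have "\<dots> \<longleftrightarrow> x \<ominus>\<^bsub>M\<^esub> y \<in> U"
 proof
  assume "\<exists>u\<in>U. x = u +[M] y"
  then obtain u where u: "u \<in> U" "x = u +[M] y" ..
  then have "u \<in> carrier M" using U.a_subset by blast
  then have "x \<ominus>\<^bsub>M\<^esub> y = u" using assms u by (simp add: M.minus_eq M.a_assoc M.r_neg)
  then show "x \<ominus>\<^bsub>M\<^esub> y \<in> U" using u by simp
 next
  assume "x \<ominus>\<^bsub>M\<^esub> y \<in> U"
  moreover have "x = (x \<ominus>\<^bsub>M\<^esub> y) +[M] y" using assms by (simp add: M.minus_eq M.a_assoc M.l_neg)
  ultimately show "\<exists>u\<in>U. x = u +[M] y" by blast
 qed
 finally show ?thesis .
qed

lemma coset_eq_iff: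
 assumes "x \<in> carrier M" "y \<in> carrier M"
 shows "U +>\<^bsub>M\<^esub> x = U +>\<^bsub>M\<^esub> y \<longleftrightarrow> x \<ominus>\<^bsub>M\<^esub> y \<in> U"
proof
 assume eq: "U +>\<^bsub>M\<^esub> x = U +>\<^bsub>M\<^esub> y"
 have "x \<in> U +>\<^bsub>M\<^esub> x" using assms(1) by (rule U.a_rcos_self)
 then show "x \<ominus>\<^bsub>M\<^esub> y \<in> U" using assms by (simp only: eq mem_coset_iff)
next
 assume "x \<ominus>\<^bsub>M\<^esub> y \<in> U"
 then have "x \<in> U +>\<^bsub>M\<^esub> y" using assms by (simp only: mem_coset_iff)
 then show "U +>\<^bsub>M\<^esub> x = U +>\<^bsub>M\<^esub> y" using M.a_repr_independence[OF _ assms(2) U.a_subgroup] by simp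
qed

lemma coset_zero: "U +>\<^bsub>M\<^esub> \<zero>[M] = U"
 by (rule M.a_coset_add_zero[OF U.a_subset])

lemma coset_eq_zero_iff: "x \<in> carrier M ==> U +>\<^bsub>M\<^esub> x = U \<longleftrightarrow> x \<in> U"
 using coset_eq_iff[of x "\<zero>[M]"] coset_zero M.minus_equality[of "\<zero>[M]" "\<zero>[M]"]
 by (simp add: M.minus_eq)

text \<open>All members \<open>y\<close> of the coset give the same coset of
  \<open>a *[M] y\<close>, so the union that defines the action on \<open>factor_module\<close> has
  only one distinct member.\<close>

lemma coset_smult:
 assumes a: "a \<in> carrier A" and x: "x \<in> carrier M"
 shows "a *[factor_module M U] (U +>\<^bsub>M\<^esub> x) = U +>\<^bsub>M\<^esub> (a *[M] x)"
proof -
 have "U +>\<^bsub>M\<^esub> (a *[M] y) = U +>\<^bsub>M\<^esub> (a *[M] x)" if y: "y \<in> U +>\<^bsub>M\<^esub> x" for y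
 proof -
  have "\<exists>u\<in>U. y = u +[M] x" using y by (simp add: a_r_coset_def')
  then obtain u where u: "u \<in> U" "y = u +[M] x" by blast
  have uc: "u \<in> carrier M" "a *[M] u \<in> U" "a *[M] u \<in> carrier M"
   using u U a by (auto simp: submodule_iff)
  have cl: "a *[M] x \<in> carrier M" using a x by (rule smult_closed)
  have "a *[M] y = a *[M] u +[M] a *[M] x" using u uc a x by (simp add: smult_r_distr)
  then have "a *[M] y \<ominus>\<^bsub>M\<^esub> a *[M] x = a *[M] u"
   using uc cl by (simp add: M.minus_eq M.a_assoc M.r_neg)
  moreover have "y \<in> carrier M" using u uc x by simp
  ultimately show ?thesis using coset_eq_iff[of "a *[M] y" "a *[M] x"] uc a x by (simp add: smult_closed)
 qed
 then have "(\<Union>y\<in>U +>\<^bsub>M\<^esub> x. U +>\<^bsub>M\<^esub> (a *[M] y)) = (\<Union>y\<in>U +>\<^bsub>M\<^esub> x. U +>\<^bsub>M\<^esub> (a *[M] x))"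
  by (rule SUP_cong[OF refl])
 also have "\<dots> = U +>\<^bsub>M\<^esub> (a *[M] x)"
  using U.a_rcos_self[OF x] by (subst SUP_const) blast+
 finally show ?thesis by (simp only: factor_module_def module.simps)
qed

lemma left_module_factor: "left_module A (factor_module M U)"
proof (rule left_module_image[OF M, where q = "\<lambda>x. U +>\<^bsub>M\<^esub> x"])
 show "U +>\<^bsub>M\<^esub> (x +[M] y) = (U +>\<^bsub>M\<^esub> x) +[factor_module M U] (U +>\<^bsub>M\<^esub> y)"
  if "x \<in> carrier M" "y \<in> carrier M" for x y
  using U.a_rcos_sum[OF that] by (simp only: factor_module_simps)
qed (simp_all add: coset_smult coset_zero)

lemma coset_hom: "(\<lambda>x\<in>carrier M. U +>\<^bsub>M\<^esub> x) \<in> module_hom A M (factor_module M U)"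
proof (rule module_homI[OF _ _ _ M])
 show "U +>\<^bsub>M\<^esub> (x +[M] y) = (U +>\<^bsub>M\<^esub> x) +[factor_module M U] (U +>\<^bsub>M\<^esub> y)"
  if "x \<in> carrier M" "y \<in> carrier M" for x y
  using U.a_rcos_sum[OF that] by (simp only: factor_module_simps)
qed (simp_all add: coset_smult)

lemma coset_hom_surj: "(\<lambda>x\<in>carrier M. U +>\<^bsub>M\<^esub> x) ` carrier M = carrier (factor_module M U)"
 by simp

lemma coset_hom_kernel:
 "{x \<in> carrier M. (\<lambda>x\<in>carrier M. U +>\<^bsub>M\<^esub> x) x = \<zero>[factor_module M U]} = U"
proof (rule Set.set_eqI)
 fix x
 show "x \<in> {x \<in> carrier M. (\<lambda>x\<in>carrier M. U +>\<^bsub>M\<^esub> x) x = \<zero>[factor_module M U]} \<longleftrightarrow> x \<in> U"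
 proof (cases "x \<in> carrier M")
  case True
  then show ?thesis by (simp add: coset_eq_zero_iff)
 next
  case False
  then show ?thesis using U.a_subset by auto
 qed
qed

end

section \<open>Finite-dimensional modules and composition series\<close>

text \<open>Unlike \<open>fd_modules\<close>, this applies to modules with elements of any type,
  such as factor modules, whose elements are sets, and cell modules, whose elements are functions.
  On \<open>'k vec\<close> the two agree by \<open>fd_modules_iff\<close>.\<close>

definition fdm :: "('k::field, 'a) module \<Rightarrow> ('a, 'm) module \<Rightarrow> bool"
 where "fdm A M \<longleftrightarrow> left_module A M \<and> kfin (restrict_scalars A M)"

definition mdim :: "('k::field, 'a) module \<Rightarrow> ('a, 'm) module \<Rightarrow> nat"
 where "mdim A M = kdim (restrict_scalars A M)"

lemma kdim_zero_space:
 assumes "kspace V" "carrier V = {\<zero>[V]}"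
 shows "kfin V" "kdim V = 0"
proof -
 interpret V: kspace V by fact
 have "finite_basis V (\<lambda>_. \<zero>[V]) ({} :: nat set)"
  unfolding finite_basis_def using assms(2) by (auto simp: bij_betw_def lincomb_def)
 from kdim_basis[OF assms(1) this] show "kfin V" "kdim V = 0" by auto
qed

lemma kdim_eq_zero:
 assumes "kspace V" "kfin V" "kdim V = 0"
 shows "carrier V = {\<zero>[V]}"
proof -
 interpret V: kspace V by fact
 obtain v where "finite_basis V v {..<0::nat}" using kfin_finite_basis[OF assms(1,2)] assms(3) by auto
 then have "carrier V = lincomb V v {..<0::nat} ` ({..<0} \<rightarrow>\<^sub>E UNIV)"
  by (simp add: finite_basis_def bij_betw_def)
 also have "\<dots> = {\<zero>[V]}" by (simp add: lincomb_def)
 finally show ?thesis .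
qed

context kalg
begin

lemma scal_one_closed [simp]: "c \<odot> \<one> \<in> carrier A" by simp

lemma kspace_restrict_scalars:
 assumes "left_module A M"
 shows "kspace (restrict_scalars A M)"
proof -
 interpret M: left_module A M by fact
 have "abelian_group (restrict_scalars A M)"
  by (rule abelian_groupI) (auto simp: M.M.a_ac intro: bexI[of _ "\<ominus>\<^bsub>M\<^esub> _"] M.M.l_neg)
 then show ?thesis
  unfolding kspace_def kspace_axioms_def
  by (simp add: M.smult_closed scal_l_distr M.smult_l_distr M.smult_r_distr M.smult_one
    scal_one_mult flip: M.smult_assoc1) (simp add: scal_assoc)
qed

lemma module_hom_klinear:
 assumes "f \<in> module_hom A M N"
 shows "klinear (restrict_scalars A M) (restrict_scalars A N) f"
 using module_homD[OF assms] by (auto simp: klinear_def)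

lemma fd_modules_iff: "M \<in> fd_modules A \<longleftrightarrow> fdm A M"
 using kdim_basis(1)[OF kspace_restrict_scalars] kfin_finite_basis[OF kspace_restrict_scalars]
 unfolding fd_modules_def fdm_def has_dim_def by blast

lemma fdm_iso:
 assumes "fdm A M" "left_module A N" "module_iso A M N"
 shows "fdm A N" "mdim A N = mdim A M"
proof -
 obtain f where f: "f \<in> module_hom A M N" "bij_betw f (carrier M) (carrier N)"
  using assms(3) unfolding module_iso_def by (elim bexE)
 have M: "left_module A M" "kfin (restrict_scalars A M)" using assms(1) by (auto simp: fdm_def)
 note k = kdim_iso[OF kspace_restrict_scalars[OF M(1)] kspace_restrict_scalars[OF assms(2)]
   module_hom_klinear[OF f(1)] _ M(2)]
 show "fdm A N" "mdim A N = mdim A M" using k f(2) assms(2) by (auto simp: fdm_def mdim_def)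
qed

lemma fdm_submodule:
 assumes "fdm A M" "submodule U A M"
 shows "fdm A (M\<lparr>carrier := U\<rparr>)"
proof -
 interpret M: left_module A M using assms(1) by (simp add: fdm_def)
 have "U \<subseteq> carrier M" using assms(2) by (simp add: M.submodule_iff)
 then have "klinear ((restrict_scalars A M)\<lparr>carrier := U\<rparr>) (restrict_scalars A M) (\<lambda>x. x)"
  by (simp add: klinear_def)
 then have "kfin ((restrict_scalars A M)\<lparr>carrier := U\<rparr>)"
  by (rule kfin_inj) (use assms(1) in \<open>simp_all add: fdm_def\<close>)
 then show ?thesis
  using M.submodule_left_module[OF assms(2)] by (simp add: fdm_def restrict_scalars_carrier)
qed

lemma mdim_exact:
 assumes M: "fdm A M" and N: "left_module A N" and g: "g \<in> module_hom A M N"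
  and surj: "g ` carrier M = carrier N"
 shows "fdm A N" "mdim A M = mdim A (M\<lparr>carrier := {x \<in> carrier M. g x = \<zero>[N]}\<rparr>) + mdim A N"
proof -
 have M': "left_module A M" "kfin (restrict_scalars A M)" using M by (auto simp: fdm_def)
 note rn = rank_nullity[OF kspace_restrict_scalars[OF M'(1)] kspace_restrict_scalars[OF N]
   module_hom_klinear[OF g] _ M'(2)]
 show "fdm A N" using rn(1) surj N by (simp add: fdm_def)
 show "mdim A M = mdim A (M\<lparr>carrier := {x \<in> carrier M. g x = \<zero>[N]}\<rparr>) + mdim A N"
  using rn(2) surj by (simp add: mdim_def restrict_scalars_carrier)
qed

lemma fdm_factor:
 assumes "fdm A M" "submodule U A M"
 shows "fdm A (factor_module M U)" "mdim A M = mdim A (M\<lparr>carrier := U\<rparr>) + mdim A (factor_module M U)"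
proof -
 have M: "left_module A M" using assms(1) by (simp add: fdm_def)
 note e = mdim_exact[OF assms(1) left_module_factor[OF M assms(2)] coset_hom[OF M assms(2)]
   coset_hom_surj[OF M assms(2)]]
 show "fdm A (factor_module M U)" by (rule e(1))
 show "mdim A M = mdim A (M\<lparr>carrier := U\<rparr>) + mdim A (factor_module M U)"
  using e(2) unfolding coset_hom_kernel[OF M assms(2)] .
qed

text \<open>If the dimensions agreed, the factor module would have dimension zero and hence a single
  element.\<close>

lemma mdim_submodule_less:
 assumes "fdm A M" "submodule U A M" "U \<noteq> carrier M"
 shows "mdim A (M\<lparr>carrier := U\<rparr>) < mdim A M"
proof (rule ccontr)
 assume "\<not> ?thesis"
 then have 0: "mdim A (factor_module M U) = 0" using fdm_factor(2)[OF assms(1,2)] by simp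
 interpret M: left_module A M using assms(1) by (simp add: fdm_def)
 have M: "left_module A M" by unfold_locales
 have "carrier (factor_module M U) = {U}"
  using kdim_eq_zero[OF kspace_restrict_scalars[OF left_module_factor[OF M assms(2)]]]
   fdm_factor(1)[OF assms(1,2)] 0 by (simp add: fdm_def mdim_def)
 then have "x \<in> U" if "x \<in> carrier M" for x
  using coset_eq_zero_iff[OF M assms(2) that] that by auto
 then show False using assms(2,3) by (auto simp: M.submodule_iff)
qed

text \<open>Projectivity and completeness of a list of simple modules are statements about modules
  on \<open>'k vec\<close>; this copy makes them available for modules on other types. An embedding
  into \<open>coord_space n\<close> is read as a vector of length \<open>n\<close>, and the
  operations are transported along it.\<close>

lemma fd_modules_copy:
 assumes "fdm A M"
 obtains N f where "N \<in> fd_modules A" "f \<in> module_hom A M N" "bij_betw f (carrier M) (carrier N)"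
proof -
 interpret M: left_module A M using assms by (simp add: fdm_def)
 have M: "left_module A M" by unfold_locales
 obtain n \<phi> where \<phi>: "kembedding (restrict_scalars A M) n \<phi>" using assms by (auto simp: fdm_def kfin_def)
 define f where "f = (\<lambda>x. vec n (\<phi> x))"
 have inj: "inj_on f (carrier M)"
 proof (rule inj_onI)
  fix x y assume xy: "x \<in> carrier M" "y \<in> carrier M" "f x = f y"
  have "\<phi> x i = \<phi> y i" for i
  proof (cases "i < n")
   case True
   then have "\<phi> x i = f x $ i" "\<phi> y i = f y $ i" by (simp_all add: f_def)
   then show ?thesis using xy by simp
  next
   case False
   have "\<phi> ` carrier M \<subseteq> coord_space n" using \<phi> by (simp add: kembedding_def)
   then have "\<phi> x \<in> coord_space n" "\<phi> y \<in> coord_space n" using xy by auto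
   then show ?thesis using False by (simp add: coord_space_def)
  qed
  then have "\<phi> x = \<phi> y" by (rule ext)
  moreover have "inj_on \<phi> (carrier M)" using \<phi> by (simp add: kembedding_def)
  ultimately show "x = y" using xy(1,2) by (simp add: inj_on_eq_iff)
 qed
 define g where "g = the_inv_into (carrier M) f"
 have gf: "g (f x) = x" if "x \<in> carrier M" for x using the_inv_into_f_f[OF inj that] by (simp add: g_def)
 define N :: "('a, 'k vec) module" where "N = \<lparr>carrier = f ` carrier M, mult = undefined, one = undefined,
  zero = f \<zero>[M], add = (\<lambda>u v. f (g u +[M] g v)), smult = (\<lambda>a u. f (a *[M] g u))\<rparr>"
 have N: "left_module A N"
  by (rule left_module_image[OF M, of f]) (auto simp: N_def gf)
 have hom: "restrict f (carrier M) \<in> module_hom A M N"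
  by (rule module_homI[OF _ _ _ M]) (auto simp: N_def gf)
 have bij: "bij_betw (restrict f (carrier M)) (carrier M) (carrier N)"
  using inj by (simp add: bij_betw_def N_def inj_on_restrict_eq)
 have "module_iso A M N" unfolding module_iso_def using hom bij by blast
 then have "N \<in> fd_modules A" using fdm_iso(1)[OF assms N] fd_modules_iff by blast
 then show thesis using hom bij by (rule that)
qed

text \<open>Among the proper submodules above \<open>W\<close>, whose dimensions are bounded by that
  of \<open>M\<close>, one of greatest dimension is maximal.\<close>

lemma exists_maximal_submodule:
 assumes "fdm A M" "submodule W A M" "W \<noteq> carrier M"
 shows "\<exists>U. submodule U A M \<and> W \<subseteq> U \<and> U \<noteq> carrier M \<and>
  (\<forall>V. submodule V A M --> U \<subseteq> V --> V \<noteq> carrier M --> V = U)"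
proof -
 interpret M: left_module A M using assms by (simp add: fdm_def)
 let ?P = "\<lambda>U. submodule U A M \<and> W \<subseteq> U \<and> U \<noteq> carrier M"
 let ?d = "\<lambda>U. mdim A (M\<lparr>carrier := U\<rparr>)"
 have P: "?P W" using assms by simp
 have bound: "\<forall>U. ?P U --> ?d U < mdim A M" using mdim_submodule_less[OF assms(1)] by blast
 have "\<exists>U. ?P U \<and> (\<forall>V. ?P V --> ?d V \<le> ?d U)"
  using ex_has_greatest_nat[where P = ?P and k = W and f = ?d and b = "mdim A M"] P bound by simp
 then obtain U where U0: "?P U \<and> (\<forall>V. ?P V --> ?d V \<le> ?d U)" ..
 then have U: "?P U" "\<And>V. ?P V ==> ?d V \<le> ?d U" by simp_all
 show ?thesis
 proof (intro exI[of _ U] conjI allI impI)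
  show "submodule U A M" "W \<subseteq> U" "U \<noteq> carrier M" using U(1) by auto
  fix V assume V: "submodule V A M" "U \<subseteq> V" "V \<noteq> carrier M"
  show "V = U"
  proof (rule ccontr)
   assume "V \<noteq> U"
   have "mdim A ((M\<lparr>carrier := V\<rparr>)\<lparr>carrier := U\<rparr>) < mdim A (M\<lparr>carrier := V\<rparr>)"
    by (rule mdim_submodule_less[OF fdm_submodule[OF assms(1) V(1)]])
     (use M.submodule_trans[OF V(1,2)] U(1) \<open>V \<noteq> U\<close> in auto)
   moreover have "?d V \<le> ?d U" by (rule U(2)) (use U(1) V in auto)
   ultimately show False by simp
  qed
 qed
qed

text \<open>Submodules of the factor module pull back to submodules of \<open>M\<close> above
  \<open>U\<close>, and there are only two of these.\<close>

lemma simple_factor_maximal: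
 assumes M: "left_module A M" and U: "submodule U A M" "U \<noteq> carrier M"
  and max: "\<And>V. [|submodule V A M; U \<subseteq> V; V \<noteq> carrier M|] ==> V = U"
 shows "simple_module A (factor_module M U)"
 unfolding simple_module_def
proof (intro conjI allI impI)
 interpret M: left_module A M by fact
 note F = left_module_factor[OF M U(1)]
 interpret F: left_module A "factor_module M U" by (rule F)
 show "left_module A (factor_module M U)" by (rule F)
 have Uc: "U \<subseteq> carrier M" using U(1) by (simp add: M.submodule_iff)
 show "carrier (factor_module M U) \<noteq> {\<zero>[factor_module M U]}"
 proof
  assume eq: "carrier (factor_module M U) = {\<zero>[factor_module M U]}"
  have "x \<in> U" if "x \<in> carrier M" for x
  proof -
   have "U +>\<^bsub>M\<^esub> x \<in> carrier (factor_module M U)" using that by simp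
   then have "U +>\<^bsub>M\<^esub> x = U" unfolding eq by simp
   then show ?thesis using coset_eq_zero_iff[OF M U(1) that] by simp
  qed
  then show False using Uc U(2) by blast
 qed
 fix X assume X: "submodule X A (factor_module M U)"
 let ?q = "\<lambda>x\<in>carrier M. U +>\<^bsub>M\<^esub> x"
 have Xc: "X \<subseteq> carrier (factor_module M U)" "U \<in> X" using X by (auto simp: F.submodule_iff)
 define V where "V = {x \<in> carrier M. ?q x \<in> X}"
 have V: "submodule V A M" unfolding V_def by (rule module_hom_vimage_submodule[OF coset_hom[OF M U(1)] M F X])
 have XV: "X = ?q ` V"
 proof
  show "X \<subseteq> ?q ` V"
  proof
   fix y assume y: "y \<in> X"
   then have "y \<in> (\<lambda>x. U +>\<^bsub>M\<^esub> x) ` carrier M" using Xc(1) by auto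
   then obtain x where "y = U +>\<^bsub>M\<^esub> x" "x \<in> carrier M" by (rule imageE)
   then show "y \<in> ?q ` V" using y by (intro image_eqI[of y ?q x]) (simp_all add: V_def)
  qed
  show "?q ` V \<subseteq> X" by (auto simp: V_def)
 qed
 have "U \<subseteq> V"
 proof
  fix x assume "x \<in> U"
  then have "x \<in> carrier M" using Uc by blast
  moreover from this have "U +>\<^bsub>M\<^esub> x = U" using coset_eq_zero_iff[OF M U(1)] \<open>x \<in> U\<close> by simp
  ultimately show "x \<in> V" using Xc(2) by (simp add: V_def)
 qed
 then consider "V = U" | "V = carrier M" using max[OF V] by blast
 then show "X = {\<zero>[factor_module M U]} \<or> X = carrier (factor_module M U)"
 proof cases
  case 1
  have "?q x = U" if "x \<in> U" for x
  proof -
   have "x \<in> carrier M" using that Uc by blast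
   then show ?thesis using coset_eq_zero_iff[OF M U(1)] that by simp
  qed
  moreover have "U \<noteq> {}" using U(1) by (auto simp: M.submodule_iff)
  ultimately have "?q ` U = {U}" by (intro equalityI subsetI) (auto simp: image_iff)
  then show ?thesis using XV 1 by simp
 next
  case 2
  then have "X = carrier (factor_module M U)" using XV coset_hom_surj[OF M U(1)] by simp
  then show ?thesis ..
 qed
qed

text \<open>Induction on the dimension: a series of a maximal submodule is extended by
  \<open>M\<close>.\<close>

lemma exists_composition_series:
 assumes "fdm A M"
 shows "\<exists>Us. composition_series A M Us"
 using assms
proof (induction "mdim A M" arbitrary: M rule: less_induct)
 case less
 interpret M: left_module A M using less.prems by (simp add: fdm_def)
 have M: "left_module A M" by unfold_locales
 show ?case
 proof (cases "carrier M = {\<zero>[M]}")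
  case True
  then have "composition_series A M [{\<zero>[M]}]"
   using M.submodule_zero by (simp add: composition_series_def)
  then show ?thesis ..
 next
  case False
  obtain U where U': "submodule U A M \<and> {\<zero>[M]} \<subseteq> U \<and> U \<noteq> carrier M \<and>
    (\<forall>V. submodule V A M --> U \<subseteq> V --> V \<noteq> carrier M --> V = U)"
   using exists_maximal_submodule[OF less.prems M.submodule_zero not_sym[OF False]] ..
  have U1: "submodule U A M" using U' by (elim conjE)
  have U2: "U \<noteq> carrier M" using U' by (elim conjE)
  have U3: "V = U" if "submodule V A M" "U \<subseteq> V" "V \<noteq> carrier M" for V
  proof -
   have "\<forall>V. submodule V A M --> U \<subseteq> V --> V \<noteq> carrier M --> V = U" using U' by (elim conjE)
   from this[rule_format, OF that] show ?thesis .
  qed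
  note U = U1 U2 U3
  have Uc: "U \<subseteq> carrier M" using U(1) by (simp add: M.submodule_iff)
  obtain Us where Us: "composition_series A (M\<lparr>carrier := U\<rparr>) Us"
   using less.hyps[OF mdim_submodule_less[OF less.prems U(1,2)] fdm_submodule[OF less.prems U(1)]] ..
  have sub: "submodule X A M" if "X \<in> set Us" for X
  proof -
   interpret U: left_module A "M\<lparr>carrier := U\<rparr>" by (rule M.submodule_left_module[OF U(1)])
   have X: "submodule X A (M\<lparr>carrier := U\<rparr>)" using Us that by (auto simp: composition_series_def)
   then have "X \<subseteq> U" by (simp add: U.submodule_iff)
   then show ?thesis using X M.submodule_trans[OF U(1)] by blast
  qed
  have ne: "Us \<noteq> []" and hd: "hd Us = {\<zero>[M]}" and last: "last Us = U"
   using Us by (auto simp: composition_series_def)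
  have "composition_series A M (Us @ [carrier M])"
   unfolding composition_series_def
  proof (intro conjI allI impI ballI)
   show "hd (Us @ [carrier M]) = {\<zero>[M]}" using ne hd by simp
   show "submodule X A M" if "X \<in> set (Us @ [carrier M])" for X
    using that sub M.submodule_carrier by auto
   fix i assume i: "Suc i < length (Us @ [carrier M])"
   show "(Us @ [carrier M]) ! i \<subseteq> (Us @ [carrier M]) ! Suc i"
    and "simple_module A (composition_factor M (Us @ [carrier M]) i)"
   proof -
    consider "Suc i < length Us" | "Suc i = length Us" using i by (auto simp: less_Suc_eq)
    then have "(Us @ [carrier M]) ! i \<subseteq> (Us @ [carrier M]) ! Suc i \<and>
     simple_module A (composition_factor M (Us @ [carrier M]) i)"
    proof cases
     case 1
     then have "Us ! i \<subseteq> Us ! Suc i \<and> simple_module A (composition_factor (M\<lparr>carrier := U\<rparr>) Us i)"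
      using Us by (simp add: composition_series_def)
     then show ?thesis using 1 by (simp add: composition_factor_def nth_append)
    next
     case 2
     then have "i = length Us - 1" by simp
     then have "Us ! i = U" using last last_conv_nth[OF ne] by simp
     then show ?thesis
      using 2 Uc simple_factor_maximal[OF M U1 U2 U3]
      by (simp add: composition_factor_def nth_append)
    qed
    then show "(Us @ [carrier M]) ! i \<subseteq> (Us @ [carrier M]) ! Suc i"
     "simple_module A (composition_factor M (Us @ [carrier M]) i)" by auto
   qed
  qed simp_all
  then show ?thesis ..
 qed
qed

text \<open>A function \<open>h\<close> on submodules that grows by one exactly at the factors
  isomorphic to \<open>S\<close> counts these factors along any series. All composition series thus
  give the same number; this takes the place of the Jordan-Hoelder theorem and justifies the
  \<open>THE\<close> in \<open>comp_mult\<close>.\<close>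

lemma comp_mult_eqI:
 assumes M: "fdm A M" and h0: "h {\<zero>[M]} = 0"
  and step: "\<And>U V. [|submodule U A M; submodule V A M; U \<subseteq> V; simple_module A (factor_module (M\<lparr>carrier := V\<rparr>) U)|]
   ==> h V = h U + (if module_iso A (factor_module (M\<lparr>carrier := V\<rparr>) U) S then 1 else 0)"
 shows "comp_mult A M S = h (carrier M)"
proof -
 have count: "card {i. Suc i < length Us \<and> module_iso A (composition_factor M Us i) S} = h (carrier M)"
  if Us: "composition_series A M Us" for Us
 proof -
  have "h (Us ! n) = card {i. i < n \<and> module_iso A (composition_factor M Us i) S}" if "n < length Us" for n
   using that
  proof (induction n)
   case 0
   then have "Us ! 0 = {\<zero>[M]}" using Us by (simp add: composition_series_def hd_conv_nth)
   then show ?case using h0 by simp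
  next
   case (Suc n)
   have *: "Us ! n \<subseteq> Us ! Suc n" "simple_module A (composition_factor M Us n)"
    "submodule (Us ! n) A M" "submodule (Us ! Suc n) A M"
    using Us Suc.prems by (auto simp: composition_series_def)
   have "h (Us ! Suc n) = h (Us ! n) + (if module_iso A (composition_factor M Us n) S then 1 else 0)"
    using step[OF *(3,4,1)] *(2) unfolding composition_factor_def by blast
   moreover have "{i. i < Suc n \<and> module_iso A (composition_factor M Us i) S} =
    (if module_iso A (composition_factor M Us n) S then insert n else id)
     {i. i < n \<and> module_iso A (composition_factor M Us i) S}"
    by (auto simp: less_Suc_eq)
   ultimately show ?case using Suc by simp
  qed
  note eq = this
  have ne: "Us \<noteq> []" and "last Us = carrier M" using Us by (auto simp: composition_series_def)
  then have "Us ! (length Us - 1) = carrier M" by (simp add: last_conv_nth)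
  then have "h (carrier M) = card {i. i < length Us - 1 \<and> module_iso A (composition_factor M Us i) S}"
   using eq[of "length Us - 1"] ne by simp
  moreover have "{i. i < length Us - 1 \<and> module_iso A (composition_factor M Us i) S} =
    {i. Suc i < length Us \<and> module_iso A (composition_factor M Us i) S}" by auto
  ultimately show ?thesis by simp
 qed
 obtain Us where Us: "composition_series A M Us" using exists_composition_series[OF M] ..
 show ?thesis
  unfolding comp_mult_def
 proof (rule the_equality)
  show "\<exists>Us. composition_series A M Us \<and>
    h (carrier M) = card {i. Suc i < length Us \<and> module_iso A (composition_factor M Us i) S}"
   by (intro exI[of _ Us] conjI Us count[OF Us, symmetric])
  fix k assume "\<exists>Us. composition_series A M Us \<and>
    k = card {i. Suc i < length Us \<and> module_iso A (composition_factor M Us i) S}"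
  then show "k = h (carrier M)" using count by auto
 qed
qed

end

section \<open>Projective covers compute composition multiplicities\<close>

definition hom_values :: "('k, 'a) module \<Rightarrow> ('a, 'p) module \<Rightarrow> 'p \<Rightarrow> ('a, 'm) module \<Rightarrow> 'm set"
 where "hom_values A P x M = (\<lambda>f. f x) ` module_hom A P M"

text \<open>
 For a module \<open>P\<close> generated by \<open>x\<close>, evaluation at \<open>x\<close> identifies \<open>Hom(P, M)\<close> with a subspace
 of \<open>M\<close>; this gives its dimension without a vector space structure on sets of functions.
\<close>

definition hom_dim :: "('k::field, 'a) module \<Rightarrow> ('a, 'p) module \<Rightarrow> 'p \<Rightarrow> ('a, 'm) module \<Rightarrow> nat"
 where "hom_dim A P x M = kdim ((restrict_scalars A M)\<lparr>carrier := hom_values A P x M\<rparr>)"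

definition cyclic :: "('k, 'a) module \<Rightarrow> ('a, 'p) module \<Rightarrow> 'p \<Rightarrow> bool"
 where "cyclic A P x \<longleftrightarrow> x \<in> carrier P \<and> carrier P \<subseteq> (\<lambda>a. a *[P] x) ` carrier A"

text \<open>The conclusion of Schur's lemma over an algebraically closed field. It is inherited from
  the one-dimensional simple modules of the quiver algebras.\<close>

definition scalar_endomorphisms :: "('k, 'a) module \<Rightarrow> ('a, 'm) module \<Rightarrow> bool"
 where "scalar_endomorphisms A S \<longleftrightarrow>
  (\<forall>f\<in>module_hom A S S. \<exists>c. \<forall>s\<in>carrier S. f s = (c *[A] \<one>[A]) *[S] s)"

text \<open>Projectivity against a single pair of modules, whose elements may be of any type;
  \<open>projective_module\<close> quantifies over modules on \<open>'k vec\<close> only.\<close>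

definition lifting :: "('k, 'a) module \<Rightarrow> ('a, 'p) module \<Rightarrow> ('a, 'm) module \<Rightarrow> ('a, 'n) module \<Rightarrow> bool"
 where "lifting A P M N \<longleftrightarrow> (\<forall>g\<in>module_hom A M N. \<forall>f\<in>module_hom A P N.
   g ` carrier M = carrier N --> (\<exists>h\<in>module_hom A P M. compose (carrier P) g h = f))"

lemma simple_moduleD:
 assumes "simple_module A S"
 shows "left_module A S" "carrier S \<noteq> {\<zero>[S]}"
  "submodule U A S ==> U = {\<zero>[S]} \<or> U = carrier S"
 using assms by (auto simp: simple_module_def)

lemma projective_moduleD:
 assumes "projective_module A P" "M \<in> fd_modules A" "N \<in> fd_modules A" "g \<in> module_hom A M N"
  "f \<in> module_hom A P N" "g ` carrier M = carrier N"
 shows "\<exists>h\<in>module_hom A P M. compose (carrier P) g h = f"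
 using assms by (simp add: projective_module_def)

lemma hom_valuesI: "f \<in> module_hom A P M ==> y = f x ==> y \<in> hom_values A P x M"
 unfolding hom_values_def by (rule image_eqI)

lemma hom_valuesE:
 assumes "y \<in> hom_values A P x M"
 obtains f where "f \<in> module_hom A P M" "y = f x"
 using assms unfolding hom_values_def by (auto elim: imageE)

lemma hom_to_simple:
 assumes S: "simple_module A S" and M: "left_module A M" and f: "f \<in> module_hom A M S"
  and x: "x \<in> carrier M" "f x \<noteq> \<zero>[S]"
 shows "f ` carrier M = carrier S"
proof -
 have "submodule (f ` carrier M) A S"
  by (rule module_hom_image_submodule[OF f M simple_moduleD(1)[OF S] left_module.submodule_carrier[OF M]])
 moreover have "f ` carrier M \<noteq> {\<zero>[S]}" using x by auto
 ultimately show ?thesis using simple_moduleD(3)[OF S] by auto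
qed

lemma simple_module_iso:
 assumes S: "simple_module A S" and T: "left_module A T"
  and f: "f \<in> module_hom A S T" "bij_betw f (carrier S) (carrier T)"
 shows "simple_module A T"
 unfolding simple_module_def
proof (intro conjI allI impI)
 have lS: "left_module A S" by (rule simple_moduleD(1)[OF S])
 interpret S: left_module A S by (rule lS)
 interpret T: left_module A T by (rule T)
 have surj: "f ` carrier S = carrier T" and inj: "inj_on f (carrier S)" using f(2) by (auto simp: bij_betw_def)
 have z: "f \<zero>[S] = \<zero>[T]" by (rule module_hom_zero[OF f(1) lS T])
 show "carrier T \<noteq> {\<zero>[T]}"
 proof
  assume "carrier T = {\<zero>[T]}"
  then have eq: "f x = f \<zero>[S]" if "x \<in> carrier S" for x using module_homD(1)[OF f(1) that] z by simp
  have "x = \<zero>[S]" if "x \<in> carrier S" for x by (rule inj_onD[OF inj eq[OF that] that]) simp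
  then have "carrier S = {\<zero>[S]}" using S.M.zero_closed by (intro equalityI subsetI) simp_all
  then show False using simple_moduleD(2)[OF S] by simp
 qed
 fix U assume U: "submodule U A T"
 let ?V = "{x \<in> carrier S. f x \<in> U}"
 have "submodule ?V A S" by (rule module_hom_vimage_submodule[OF f(1) lS T U])
 then have cases: "?V = {\<zero>[S]} \<or> ?V = carrier S" by (rule simple_moduleD(3)[OF S])
 have Uc: "U \<subseteq> f ` carrier S" using U by (simp add: T.submodule_iff surj)
 have UV: "U = f ` ?V"
 proof
  show "U \<subseteq> f ` ?V"
  proof
   fix u assume u: "u \<in> U"
   then have "u \<in> f ` carrier S" using Uc by (rule rev_subsetD)
   then obtain x where "u = f x" "x \<in> carrier S" by (rule imageE)
   then show "u \<in> f ` ?V" using u by (intro image_eqI[of u f x]) simp_all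
  qed
 qed auto
 from cases show "U = {\<zero>[T]} \<or> U = carrier T"
 proof
  assume "?V = {\<zero>[S]}"
  then show ?thesis using UV z by simp
 next
  assume "?V = carrier S"
  then show ?thesis using UV surj by simp
 qed
qed (rule T)

lemma submodule_cyclic:
 assumes "left_module A M" "x \<in> carrier M"
 shows "submodule ((\<lambda>a. a *[M] x) ` carrier A) A M"
proof -
 interpret M: left_module A M by fact
 show ?thesis
  unfolding M.submodule_iff
 proof (intro conjI ballI)
  show "\<zero>[M] \<in> (\<lambda>a. a *[M] x) ` carrier A" using assms(2) by (intro image_eqI[of _ _ "\<zero>[A]"]) auto
  show "(\<lambda>a. a *[M] x) ` carrier A \<subseteq> carrier M" using assms(2) by (auto simp: M.smult_closed)
 next
  fix u v assume "u \<in> (\<lambda>a. a *[M] x) ` carrier A" "v \<in> (\<lambda>a. a *[M] x) ` carrier A"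
  then obtain a b where "a \<in> carrier A" "b \<in> carrier A" "u = a *[M] x" "v = b *[M] x" by blast
  then show "u +[M] v \<in> (\<lambda>a. a *[M] x) ` carrier A"
   using assms(2) by (intro image_eqI[of _ _ "a +[A] b"]) (simp_all add: M.smult_l_distr)
 next
  fix a u assume "a \<in> carrier A" "u \<in> (\<lambda>a. a *[M] x) ` carrier A"
  then obtain b where "a \<in> carrier A" "b \<in> carrier A" "u = b *[M] x" by blast
  then show "a *[M] u \<in> (\<lambda>a. a *[M] x) ` carrier A"
   using assms(2) by (intro image_eqI[of _ _ "a **[A] b"]) (simp_all add: M.smult_assoc1)
 qed
qed

lemma module_hom_submodule_iff:
 assumes "U \<subseteq> carrier M"
 shows "f \<in> module_hom A P (M\<lparr>carrier := U\<rparr>) \<longleftrightarrow> f \<in> module_hom A P M \<and> f ` carrier P \<subseteq> U"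
 using assms by (auto simp: module_hom_def PiE_def Pi_def)

context kalg
begin

lemma kspace_hom_values:
 assumes P: "left_module A P" and M: "left_module A M" and x: "x \<in> carrier P"
 shows "kspace ((restrict_scalars A M)\<lparr>carrier := hom_values A P x M\<rparr>)"
proof -
 interpret P: left_module A P by fact
 interpret M: left_module A M by fact
 interpret V: kspace "restrict_scalars A M" by (rule kspace_restrict_scalars[OF M])
 show ?thesis
 proof (rule V.kspace_subset)
  show "hom_values A P x M \<subseteq> carrier (restrict_scalars A M)"
   using x by (auto elim: hom_valuesE dest: module_homD(1))
  show "\<zero>[restrict_scalars A M] \<in> hom_values A P x M"
   by (rule hom_valuesI[OF module_hom_zero_map[OF P M]]) (simp add: x)
 next
  fix u v assume "u \<in> hom_values A P x M" "v \<in> hom_values A P x M"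
  then obtain f g where f: "f \<in> module_hom A P M" "u = f x" and g: "g \<in> module_hom A P M" "v = g x"
   by (elim hom_valuesE)
  have "(\<lambda>y\<in>carrier P. f y +[M] g y) \<in> module_hom A P M"
   by (rule module_homI[OF _ _ _ P])
    (simp_all add: module_homD[OF f(1)] module_homD[OF g(1)] M.M.a_ac M.smult_r_distr)
  then show "u +[restrict_scalars A M] v \<in> hom_values A P x M"
   by (rule hom_valuesI) (simp add: x f g)
 next
  fix c u assume "u \<in> hom_values A P x M"
  then obtain f where f: "f \<in> module_hom A P M" "u = f x" by (elim hom_valuesE)
  have "(\<lambda>y\<in>carrier P. (c \<odot> \<one>) *[M] f y) \<in> module_hom A P M"
   by (rule module_homI[OF _ _ _ P])
    (simp_all add: module_homD[OF f(1)] M.smult_r_distr M.smult_closed scal_one_mult mult_scal_one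
     flip: M.smult_assoc1)
  then show "c *[restrict_scalars A M] u \<in> hom_values A P x M"
   by (rule hom_valuesI) (simp add: x f)
 qed
qed

lemma kfin_hom_values:
 assumes "fdm A M" "x \<in> carrier P"
 shows "kfin ((restrict_scalars A M)\<lparr>carrier := hom_values A P x M\<rparr>)"
proof (rule kfin_inj[of _ "restrict_scalars A M" "\<lambda>x. x"])
 show "klinear ((restrict_scalars A M)\<lparr>carrier := hom_values A P x M\<rparr>) (restrict_scalars A M) (\<lambda>x. x)"
  using assms(2) by (auto simp: klinear_def elim: hom_valuesE dest: module_homD(1))
qed (use assms(1) in \<open>simp_all add: fdm_def\<close>)

lemma hom_dim_zero:
 assumes P: "left_module A P" and M: "left_module A M" and x: "x \<in> carrier P"
  and 0: "\<And>f. f \<in> module_hom A P M ==> f x = \<zero>[M]"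
 shows "hom_dim A P x M = 0"
proof -
 have "hom_values A P x M \<subseteq> {\<zero>[M]}" using 0 by (auto elim: hom_valuesE)
 moreover have "\<zero>[M] \<in> hom_values A P x M"
  by (rule hom_valuesI[OF module_hom_zero_map[OF P M]]) (simp add: x)
 ultimately have "hom_values A P x M = {\<zero>[M]}" by auto
 then show ?thesis
  unfolding hom_dim_def using kdim_zero_space(2)[OF kspace_hom_values[OF P M x]] by simp
qed

text \<open>Exactness of \<open>Hom(P, -)\<close>. Evaluation at the generator reduces it to rank
  and nullity of \<open>g\<close> on \<open>hom_values A P x M\<close>, and the lifting property
  makes this restriction of \<open>g\<close> onto.\<close>

lemma hom_dim_exact:
 assumes P: "left_module A P" "cyclic A P x" and M: "fdm A M" and N: "left_module A N"
  and g: "g \<in> module_hom A M N" and surj: "g ` carrier M = carrier N" and lift: "lifting A P M N"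
 shows "hom_dim A P x M = hom_dim A P x (M\<lparr>carrier := {y \<in> carrier M. g y = \<zero>[N]}\<rparr>) + hom_dim A P x N"
proof -
 have M': "left_module A M" using M by (simp add: fdm_def)
 interpret P: left_module A P by fact
 interpret M: left_module A M by fact
 have x: "x \<in> carrier P" using P(2) by (simp add: cyclic_def)
 let ?V = "(restrict_scalars A M)\<lparr>carrier := hom_values A P x M\<rparr>"
 let ?W = "(restrict_scalars A N)\<lparr>carrier := hom_values A P x N\<rparr>"
 let ?K = "{y \<in> carrier M. g y = \<zero>[N]}"
 have K: "submodule ?K A M" by (rule module_hom_kernel_submodule[OF g M' N])
 have img: "g ` hom_values A P x M = hom_values A P x N"
 proof (intro equalityI subsetI)
  fix y assume "y \<in> g ` hom_values A P x M"
  then obtain u where u: "u \<in> hom_values A P x M" "y = g u" by blast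
  obtain f where f: "f \<in> module_hom A P M" "u = f x" using u(1) by (rule hom_valuesE)
  then show "y \<in> hom_values A P x N"
   using u x by (intro hom_valuesI[OF module_hom_compose[OF f(1) g P(1)]]) (simp add: compose_def)
 next
  fix y assume "y \<in> hom_values A P x N"
  then obtain f where f: "f \<in> module_hom A P N" "y = f x" by (rule hom_valuesE)
  have "\<exists>h\<in>module_hom A P M. compose (carrier P) g h = f"
   using lift g f(1) surj by (simp add: lifting_def)
  then obtain h where h: "h \<in> module_hom A P M" "compose (carrier P) g h = f" ..
  have "y = g (h x)" using fun_cong[OF h(2), of x] f x by (simp add: compose_def)
  then show "y \<in> g ` hom_values A P x M" by (rule image_eqI) (rule hom_valuesI[OF h(1) refl])
 qed
 have lin: "klinear ?V ?W g"
 proof -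
  have "y \<in> carrier M" if "y \<in> hom_values A P x M" for y
   using that x by (auto elim: hom_valuesE dest: module_homD(1))
  then show ?thesis using img by (simp add: klinear_def module_homD[OF g])
 qed
 \<comment> \<open>A homomorphism that sends the generator \<open>x\<close> into the kernel of
   \<open>g\<close> sends all of \<open>P\<close> there, because \<open>P\<close> is cyclic.\<close>
 have ker: "{y \<in> hom_values A P x M. g y = \<zero>[N]} = hom_values A P x (M\<lparr>carrier := ?K\<rparr>)"
 proof (intro equalityI subsetI)
  fix y assume "y \<in> {y \<in> hom_values A P x M. g y = \<zero>[N]}"
  then have y: "y \<in> hom_values A P x M" "g y = \<zero>[N]" by auto
  obtain f where f: "f \<in> module_hom A P M" "y = f x" using y(1) by (rule hom_valuesE)
  have fx: "f x \<in> ?K" using f y x module_homD(1) by auto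
  have "f ` carrier P \<subseteq> ?K"
  proof
   fix z assume "z \<in> f ` carrier P"
   then obtain p where p: "z = f p" "p \<in> carrier P" by (rule imageE)
   have "p \<in> (\<lambda>a. a *[P] x) ` carrier A" using P(2) p(2) by (auto simp: cyclic_def)
   then obtain a where a: "p = a *[P] x" "a \<in> carrier A" by (rule imageE)
   have "z = a *[M] f x" using a p x module_homD(3)[OF f(1)] by simp
   moreover have "a *[M] f x \<in> ?K" using K a fx unfolding M.submodule_iff by blast
   ultimately show "z \<in> ?K" by simp
  qed
  then have "f \<in> module_hom A P (M\<lparr>carrier := ?K\<rparr>)"
   using f(1) by (subst module_hom_submodule_iff) auto
  then show "y \<in> hom_values A P x (M\<lparr>carrier := ?K\<rparr>)" using f(2) by (rule hom_valuesI)
 next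
  fix y assume "y \<in> hom_values A P x (M\<lparr>carrier := ?K\<rparr>)"
  then obtain f where f: "f \<in> module_hom A P (M\<lparr>carrier := ?K\<rparr>)" "y = f x" by (rule hom_valuesE)
  have f': "f \<in> module_hom A P M \<and> f ` carrier P \<subseteq> ?K"
   using f(1) by (subst (asm) module_hom_submodule_iff) auto
  then have "g y = \<zero>[N]" using f(2) x by auto
  moreover have "y \<in> hom_values A P x M" using f' f(2) by (intro hom_valuesI) auto
  ultimately show "y \<in> {y \<in> hom_values A P x M. g y = \<zero>[N]}" by simp
 qed
 have "kdim ?V = kdim (?V\<lparr>carrier := {y \<in> carrier ?V. g y = \<zero>[?W]}\<rparr>) + kdim ?W"
  by (rule rank_nullity(2)[OF kspace_hom_values[OF P(1) M' x] kspace_hom_values[OF P(1) N x] lin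
     _ kfin_hom_values[OF M x]]) (simp add: img)
 then show ?thesis by (simp add: hom_dim_def restrict_scalars_carrier ker)
qed

text \<open>The lifting problem is moved to copies of \<open>M\<close> and \<open>N\<close> on
  \<open>'k vec\<close>, solved there, and moved back.\<close>

lemma projective_lifting:
 assumes P: "projective_module A P" and M: "fdm A M" and N: "fdm A N"
 shows "lifting A P M N"
 unfolding lifting_def
proof (intro ballI impI)
 fix g f assume g: "g \<in> module_hom A M N" and f: "f \<in> module_hom A P N" and surj: "g ` carrier M = carrier N"
 have lM: "left_module A M" and lN: "left_module A N" and lP: "left_module A P"
  using M N P by (auto simp: fdm_def projective_module_def fd_modules_iff)
 obtain M' \<phi> where M': "M' \<in> fd_modules A" and \<phi>: "\<phi> \<in> module_hom A M M'" "bij_betw \<phi> (carrier M) (carrier M')"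
  using fd_modules_copy[OF M] .
 obtain N' \<psi> where N': "N' \<in> fd_modules A" and \<psi>: "\<psi> \<in> module_hom A N N'" "bij_betw \<psi> (carrier N) (carrier N')"
  using fd_modules_copy[OF N] .
 have lM': "left_module A M'" and lN': "left_module A N'" using M' N' by (auto simp: fd_modules_iff fdm_def)
 have "\<exists>\<phi>'\<in>module_hom A M' M. bij_betw \<phi>' (carrier M') (carrier M)"
  by (rule module_hom_inverse[OF \<phi> lM lM']) blast
 then obtain \<phi>' where \<phi>': "\<phi>' \<in> module_hom A M' M" "bij_betw \<phi>' (carrier M') (carrier M)" ..
 have \<psi>_inj: "inj_on \<psi> (carrier N)" using \<psi>(2) by (simp add: bij_betw_def)
 let ?g = "compose (carrier M') \<psi> (compose (carrier M') g \<phi>')"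
 have g': "?g \<in> module_hom A M' N'"
  by (rule module_hom_compose[OF module_hom_compose[OF \<phi>'(1) g lM'] \<psi>(1) lM'])
 have "?g ` carrier M' = \<psi> ` (g ` (\<phi>' ` carrier M'))"
  unfolding image_image by (rule image_cong) (auto simp: compose_def)
 then have surj': "?g ` carrier M' = carrier N'" using surj \<phi>'(2) \<psi>(2) by (simp add: bij_betw_def)
 have "\<exists>h\<in>module_hom A P M'. compose (carrier P) ?g h = compose (carrier P) \<psi> f"
  by (rule projective_moduleD[OF P M' N' g' module_hom_compose[OF f \<psi>(1) lP] surj'])
 then obtain h where h: "h \<in> module_hom A P M'" "compose (carrier P) ?g h = compose (carrier P) \<psi> f" ..
 have h': "compose (carrier P) \<phi>' h \<in> module_hom A P M" by (rule module_hom_compose[OF h(1) \<phi>'(1) lP])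
 have "compose (carrier P) g (compose (carrier P) \<phi>' h) = f"
 proof (rule module_hom_eqI[OF module_hom_compose[OF h' g lP] f])
  fix x assume x: "x \<in> carrier P"
  have hx: "h x \<in> carrier M'" using module_homD(1)[OF h(1) x] .
  have "\<psi> (g (\<phi>' (h x))) = \<psi> (f x)" using fun_cong[OF h(2), of x] x hx by (simp add: compose_def)
  moreover have "g (\<phi>' (h x)) \<in> carrier N" using module_homD(1)[OF g] module_homD(1)[OF \<phi>'(1)] hx by simp
  ultimately have "g (\<phi>' (h x)) = f x" using inj_onD[OF \<psi>_inj _ _ module_homD(1)[OF f x]] by simp
  then show "compose (carrier P) g (compose (carrier P) \<phi>' h) x = f x" using x by (simp add: compose_def)
 qed
 then show "\<exists>h\<in>module_hom A P M. compose (carrier P) g h = f" using h' by blast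
qed

text \<open>An isomorphism is a surjection with zero kernel, so this is a case of
  \<open>hom_dim_exact\<close>.\<close>

lemma hom_dim_iso:
 assumes P: "projective_module A P" "cyclic A P x" and M: "fdm A M" and N: "left_module A N"
  and iso: "module_iso A M N"
 shows "hom_dim A P x M = hom_dim A P x N"
proof -
 have lM: "left_module A M" and lP: "left_module A P"
  using M P by (auto simp: fdm_def projective_module_def fd_modules_iff)
 interpret M: left_module A M by (rule lM)
 have x: "x \<in> carrier P" using P(2) by (simp add: cyclic_def)
 obtain g where g: "g \<in> module_hom A M N" "bij_betw g (carrier M) (carrier N)"
  using iso unfolding module_iso_def by (elim bexE)
 have k: "{y \<in> carrier M. g y = \<zero>[N]} = {\<zero>[M]}"
  using module_hom_inj_iff[OF g(1) lM N] g(2) by (simp add: bij_betw_def)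
 have "hom_dim A P x M = hom_dim A P x (M\<lparr>carrier := {\<zero>[M]}\<rparr>) + hom_dim A P x N"
  using hom_dim_exact[OF lP P(2) M N g(1) _ projective_lifting[OF P(1) M fdm_iso(1)[OF M N iso]]] g(2)
  unfolding k by (simp add: bij_betw_def)
 moreover have "hom_dim A P x (M\<lparr>carrier := {\<zero>[M]}\<rparr>) = 0"
  by (rule hom_dim_zero[OF lP M.submodule_left_module[OF M.submodule_zero] x])
   (use x in \<open>auto dest: module_homD(1)\<close>)
 ultimately show ?thesis by simp
qed

lemma kdim_one_dimensional:
 assumes V: "kspace V" and t: "t \<in> carrier V" "t \<noteq> \<zero>[V]"
  and ex: "\<And>y. y \<in> carrier V ==> \<exists>c. y = c *[V] t"
 shows "kfin V" "kdim V = 1"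
proof -
 interpret V: kspace V by fact
 have L: "lincomb V (\<lambda>_. t) {0} c = c 0 *[V] t" for c :: "nat \<Rightarrow> _"
  unfolding lincomb_def using t by (subst V.finsum_insert) simp_all
 have "finite_basis V (\<lambda>_. t) {0::nat}"
  unfolding finite_basis_def bij_betw_def
 proof (intro conjI)
  show "inj_on (lincomb V (\<lambda>_. t) {0::nat}) ({0} \<rightarrow>\<^sub>E UNIV)"
  proof (rule inj_onI)
   fix c d :: "nat \<Rightarrow> _" assume cd: "c \<in> {0} \<rightarrow>\<^sub>E UNIV" "d \<in> {0} \<rightarrow>\<^sub>E UNIV"
    and eq: "lincomb V (\<lambda>_. t) {0} c = lincomb V (\<lambda>_. t) {0} d"
   have "(c 0 + - d 0) *[V] t = c 0 *[V] t +[V] \<ominus>\<^bsub>V\<^esub> (d 0 *[V] t)"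
    using t(1) by (simp only: V.scale_l_distr V.scale_minus)
   also have "\<dots> = \<zero>[V]" using eq t(1) by (simp add: L V.r_neg)
   finally have "c 0 + - d 0 = 0 \<or> t = \<zero>[V]" by (rule V.scale_eq_zero[OF t(1)])
   then have "c 0 = d 0" using t(2) by simp
   then show "c = d" by (intro PiE_ext[OF cd]) simp
  qed
  show "lincomb V (\<lambda>_. t) {0::nat} ` ({0} \<rightarrow>\<^sub>E UNIV) = carrier V"
  proof (intro equalityI subsetI)
   fix y assume "y \<in> carrier V"
   then obtain c where "y = c *[V] t" using ex by blast
   then have y: "y = lincomb V (\<lambda>_. t) {0} (\<lambda>i\<in>{0::nat}. c)" by (simp add: L)
   have "(\<lambda>i\<in>{0::nat}. c) \<in> {0} \<rightarrow>\<^sub>E UNIV" by (auto simp only: PiE_def Pi_def restrict_extensional)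
   then show "y \<in> lincomb V (\<lambda>_. t) {0::nat} ` ({0} \<rightarrow>\<^sub>E UNIV)" unfolding y by (rule imageI)
  qed (use t(1) in \<open>auto simp: L\<close>)
 qed (use t(1) in auto)
 from kdim_basis[OF V this] show "kfin V" "kdim V = 1" by simp_all
qed

context
 fixes P S :: "('a, 'k vec) module" and p x
 assumes proj: "projective_module A P" and S: "simple_module A S" and S_end: "scalar_endomorphisms A S"
  and p: "p \<in> module_hom A P S" "p ` carrier P = carrier S"
  and superfluous: "\<And>U. [|submodule U A P; p ` U = carrier S|] ==> U = carrier P"
  and x: "x \<in> carrier P" "p x \<noteq> \<zero>[S]"
begin

lemma cover_left_module: "left_module A P"
 using proj by (simp add: projective_module_def fd_modules_iff fdm_def)

lemma cover_cyclic: "cyclic A P x"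
proof -
 let ?U = "(\<lambda>a. a *[P] x) ` carrier A"
 interpret P: left_module A P by (rule cover_left_module)
 have U: "submodule ?U A P" by (rule submodule_cyclic[OF cover_left_module x(1)])
 have "submodule (p ` ?U) A S"
  by (rule module_hom_image_submodule[OF p(1) cover_left_module simple_moduleD(1)[OF S] U])
 then have "p ` ?U = {\<zero>[S]} \<or> p ` ?U = carrier S" by (rule simple_moduleD(3)[OF S])
 moreover have "x \<in> ?U" using x(1) P.smult_one[OF x(1)] by (intro image_eqI[of _ _ \<one>]) simp_all
 then have "p x \<in> p ` ?U" by (rule imageI)
 ultimately have "p ` ?U = carrier S" using x(2) by fastforce
 then have "?U = carrier P" by (rule superfluous[OF U])
 then show ?thesis using x(1) by (simp add: cyclic_def)
qed

text \<open>The kernel of \<open>f\<close> is proper, so it does not map onto \<open>S\<close> and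
  \<open>p\<close> kills it. If \<open>f\<close> mapped the kernel of \<open>p\<close> onto
  \<open>T\<close>, then \<open>x\<close> would differ from some element of that kernel by an
  element of the kernel of \<open>f\<close>, and \<open>p x\<close> would be zero. So
  \<open>f\<close> maps the kernel of \<open>p\<close> to a proper submodule of the simple module
  \<open>T\<close>.\<close>

lemma cover_hom_kernel:
 assumes T: "simple_module A T" and f: "f \<in> module_hom A P T" and y: "y \<in> carrier P" "f y \<noteq> \<zero>[T]"
  and z: "z \<in> {z \<in> carrier P. p z = \<zero>[S]}"
 shows "f z = \<zero>[T]"
proof -
 have lT: "left_module A T" and lS: "left_module A S" using T S simple_moduleD(1) by auto
 interpret P: left_module A P by (rule cover_left_module)
 let ?Kf = "{z \<in> carrier P. f z = \<zero>[T]}" and ?Kp = "{z \<in> carrier P. p z = \<zero>[S]}"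
 have Kf: "submodule ?Kf A P" by (rule module_hom_kernel_submodule[OF f cover_left_module lT])
 have Kp: "submodule ?Kp A P" by (rule module_hom_kernel_submodule[OF p(1) cover_left_module lS])
 have sub: "p k = \<zero>[S]" if k: "k \<in> ?Kf" for k
 proof -
  have "p ` ?Kf \<noteq> carrier S"
  proof
   assume "p ` ?Kf = carrier S"
   then have "?Kf = carrier P" by (rule superfluous[OF Kf])
   then show False using y by auto
  qed
  then have "p ` ?Kf = {\<zero>[S]}"
   using simple_moduleD(3)[OF S module_hom_image_submodule[OF p(1) cover_left_module lS Kf]] by auto
  then show ?thesis using imageI[OF k, of p] by simp
 qed
 have "f ` ?Kp \<noteq> carrier T"
 proof
  assume eq: "f ` ?Kp = carrier T"
  have "f x \<in> f ` ?Kp" unfolding eq using module_homD(1)[OF f x(1)] .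
  then obtain k where k: "f x = f k" "k \<in> ?Kp" by (rule imageE)
  then have kc: "k \<in> carrier P" "p k = \<zero>[S]" by auto
  have "f (x \<ominus>\<^bsub>P\<^esub> k) = \<zero>[T]" using module_hom_eq_iff[OF f cover_left_module lT x(1) kc(1)] k(1) by simp
  then have "x \<ominus>\<^bsub>P\<^esub> k \<in> ?Kf" using x(1) kc(1) by simp
  then have "p (x \<ominus>\<^bsub>P\<^esub> k) = \<zero>[S]" by (rule sub)
  then have "p x = p k" using module_hom_eq_iff[OF p(1) cover_left_module lS x(1) kc(1)] by simp
  then show False using kc x by simp
 qed
 then have "f ` ?Kp = {\<zero>[T]}"
  using simple_moduleD(3)[OF T module_hom_image_submodule[OF f cover_left_module lT Kp]] by auto
 then show ?thesis using imageI[OF z, of f] by simp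
qed

lemma cover_hom_factor:
 assumes T: "simple_module A T" and f: "f \<in> module_hom A P T" and y: "y \<in> carrier P" "f y \<noteq> \<zero>[T]"
 shows "\<exists>\<theta>\<in>module_hom A S T. (\<forall>z\<in>carrier P. \<theta> (p z) = f z) \<and> bij_betw \<theta> (carrier S) (carrier T)"
proof -
 have lT: "left_module A T" and lS: "left_module A S" using T S simple_moduleD(1) by auto
 have "\<exists>\<theta>\<in>module_hom A S T. \<forall>z\<in>carrier P. \<theta> (p z) = f z"
  by (rule module_hom_factor[OF f p(1) cover_left_module lT lS p(2)]) (rule cover_hom_kernel[OF T f y])
 then obtain \<theta> where \<theta>: "\<theta> \<in> module_hom A S T" "\<forall>z\<in>carrier P. \<theta> (p z) = f z" ..
 have py: "p y \<in> carrier S" "\<theta> (p y) \<noteq> \<zero>[T]" using \<theta>(2) y module_homD(1)[OF p(1)] by auto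
 then have surj: "\<theta> ` carrier S = carrier T" by (rule hom_to_simple[OF T lS \<theta>(1)])
 have "{s \<in> carrier S. \<theta> s = \<zero>[T]} \<noteq> carrier S" using py by auto
 then have "{s \<in> carrier S. \<theta> s = \<zero>[T]} = {\<zero>[S]}"
  using simple_moduleD(3)[OF S module_hom_kernel_submodule[OF \<theta>(1) lS lT]] by auto
 then have "inj_on \<theta> (carrier S)" using module_hom_inj_iff[OF \<theta>(1) lS lT] by simp
 then show ?thesis using \<theta> surj by (intro bexI[OF _ \<theta>(1)]) (simp add: bij_betw_def)
qed

text \<open>Every nonzero homomorphism from \<open>P\<close> to \<open>T\<close> is \<open>p\<close>
  followed by an isomorphism from \<open>S\<close> to \<open>T\<close>, and two such isomorphisms
  differ by an endomorphism of \<open>S\<close>, that is, by a scalar.\<close>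

lemma cover_hom_dim_simple:
 assumes T: "simple_module A T"
 shows "hom_dim A P x T = (if module_iso A T S then 1 else 0)"
proof (cases "module_iso A T S")
 case False
 have lT: "left_module A T" using T simple_moduleD(1) by auto
 have "f x = \<zero>[T]" if f: "f \<in> module_hom A P T" for f
 proof (rule ccontr)
  assume "f x \<noteq> \<zero>[T]"
  then have "module_iso A S T" using cover_hom_factor[OF T f x(1)] unfolding module_iso_def by auto
  then show False using False module_iso_sym[OF _ simple_moduleD(1)[OF S] lT] by auto
 qed
 then show ?thesis using False hom_dim_zero[OF cover_left_module lT x(1)] by simp
next
 case True
 have lT: "left_module A T" and lS: "left_module A S" using T S simple_moduleD(1) by auto
 interpret TT: left_module A T by (rule lT)
 have "module_iso A S T" by (rule module_iso_sym[OF True lT lS])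
 then obtain \<theta> where \<theta>: "\<theta> \<in> module_hom A S T" "bij_betw \<theta> (carrier S) (carrier T)"
  unfolding module_iso_def by (elim bexE)
 have "\<exists>\<theta>'\<in>module_hom A T S. \<forall>y\<in>carrier T. \<theta> (\<theta>' y) = y"
  by (rule module_hom_inverse[OF \<theta> lS lT]) blast
 then obtain \<theta>' where \<theta>': "\<theta>' \<in> module_hom A T S" "\<forall>y\<in>carrier T. \<theta> (\<theta>' y) = y" ..
 define t where "t = \<theta> (p x)"
 have px: "p x \<in> carrier S" by (rule module_homD(1)[OF p(1) x(1)])
 have t: "t \<in> carrier T" unfolding t_def by (rule module_homD(1)[OF \<theta>(1) px])
 have t0: "t \<noteq> \<zero>[T]"
 proof
  assume "t = \<zero>[T]"
  then have "p x \<in> {s \<in> carrier S. \<theta> s = \<zero>[T]}" using px by (simp add: t_def)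
  also have "\<dots> = {\<zero>[S]}" using module_hom_inj_iff[OF \<theta>(1) lS lT] \<theta>(2) by (simp add: bij_betw_def)
  finally show False using x(2) by simp
 qed
 have tv: "t \<in> hom_values A P x T"
  unfolding t_def using x(1)
  by (intro hom_valuesI[OF module_hom_compose[OF p(1) \<theta>(1) cover_left_module]]) (simp add: compose_def)
 have ex: "\<exists>c. y = (c \<odot> \<one>) *[T] t" if yT: "y \<in> hom_values A P x T" for y
 proof -
  obtain f where f: "f \<in> module_hom A P T" "y = f x" using yT by (rule hom_valuesE)
  show ?thesis
  proof (cases "f x = \<zero>[T]")
   case True
   then have "y = (0 \<odot> \<one>) *[T] t" using f t by simp
   then show ?thesis ..
  next
   case False
   obtain \<eta> where \<eta>: "\<eta> \<in> module_hom A S T" "\<forall>z\<in>carrier P. \<eta> (p z) = f z"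
    using cover_hom_factor[OF T f(1) x(1) False] by blast
   have "compose (carrier S) \<theta>' \<eta> \<in> module_hom A S S" by (rule module_hom_compose[OF \<eta>(1) \<theta>'(1) lS])
   then obtain c where c: "\<forall>s\<in>carrier S. compose (carrier S) \<theta>' \<eta> s = (c \<odot> \<one>) *[S] s"
    using S_end unfolding scalar_endomorphisms_def by blast
   have "y = \<theta> (\<theta>' (\<eta> (p x)))" using f \<eta> x(1) \<theta>'(2) module_homD(1)[OF \<eta>(1) px] by simp
   also have "\<theta>' (\<eta> (p x)) = (c \<odot> \<one>) *[S] p x" using bspec[OF c px] px by (simp add: compose_def)
   also have "\<theta> \<dots> = (c \<odot> \<one>) *[T] t" unfolding t_def by (rule module_homD(3)[OF \<theta>(1) scal_one_closed px])
   finally show ?thesis ..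
  qed
 qed
 have "kdim ((restrict_scalars A T)\<lparr>carrier := hom_values A P x T\<rparr>) = 1"
  by (rule kdim_one_dimensional(2)[OF kspace_hom_values[OF cover_left_module lT x(1)], of t])
   (use tv t0 ex in auto)
 then show ?thesis using True by (simp add: hom_dim_def)
qed

text \<open>The dimension of \<open>Hom(P, -)\<close> is additive along factor modules and is one or
  zero on simple modules, as \<open>comp_mult_eqI\<close> demands.\<close>

theorem comp_mult_eq_hom_dim:
 assumes M: "fdm A M"
 shows "comp_mult A M S = hom_dim A P x M"
proof -
 interpret M: left_module A M using M by (simp add: fdm_def)
 have "comp_mult A M S = hom_dim A P x (M\<lparr>carrier := carrier M\<rparr>)"
 proof (rule comp_mult_eqI[OF M, where h = "\<lambda>U. hom_dim A P x (M\<lparr>carrier := U\<rparr>)"])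
  show "hom_dim A P x (M\<lparr>carrier := {\<zero>[M]}\<rparr>) = 0"
   by (rule hom_dim_zero[OF cover_left_module M.submodule_left_module[OF M.submodule_zero] x(1)])
    (use x(1) in \<open>auto dest: module_homD(1)\<close>)
 next
  fix U V assume UV: "submodule U A M" "submodule V A M" "U \<subseteq> V"
   and simple: "simple_module A (factor_module (M\<lparr>carrier := V\<rparr>) U)"
  have V: "fdm A (M\<lparr>carrier := V\<rparr>)" by (rule fdm_submodule[OF M UV(2)])
  have lV: "left_module A (M\<lparr>carrier := V\<rparr>)" using V by (simp add: fdm_def)
  have U: "submodule U A (M\<lparr>carrier := V\<rparr>)" using M.submodule_trans[OF UV(2,3)] UV(1) by simp
  have F: "fdm A (factor_module (M\<lparr>carrier := V\<rparr>) U)" by (rule fdm_factor(1)[OF V U])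
  have "hom_dim A P x (M\<lparr>carrier := V\<rparr>) = hom_dim A P x ((M\<lparr>carrier := V\<rparr>)\<lparr>carrier := U\<rparr>) +
    hom_dim A P x (factor_module (M\<lparr>carrier := V\<rparr>) U)"
   using hom_dim_exact[OF cover_left_module cover_cyclic V left_module_factor[OF lV U] coset_hom[OF lV U]
     coset_hom_surj[OF lV U] projective_lifting[OF proj V F]]
   unfolding coset_hom_kernel[OF lV U] .
  then show "hom_dim A P x (M\<lparr>carrier := V\<rparr>) = hom_dim A P x (M\<lparr>carrier := U\<rparr>) +
    (if module_iso A (factor_module (M\<lparr>carrier := V\<rparr>) U) S then 1 else 0)"
   using cover_hom_dim_simple[OF simple] by simp
 qed
 then show ?thesis by simp
qed

end

lemma projective_cover_unique:
 assumes P: "is_projective_cover A P S" and P': "is_projective_cover A P' S" and S: "S \<in> fd_modules A"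
 shows "module_iso A P P'"
proof -
 obtain p where p: "p \<in> module_hom A P S" "p ` carrier P = carrier S"
   "\<forall>U. submodule U A P \<and> p ` U = carrier S --> U = carrier P"
  using P unfolding is_projective_cover_def by (elim conjE bexE)
 obtain p' where p': "p' \<in> module_hom A P' S" "p' ` carrier P' = carrier S"
   "\<forall>U. submodule U A P' \<and> p' ` U = carrier S --> U = carrier P'"
  using P' unfolding is_projective_cover_def by (elim conjE bexE)
 have pr: "projective_module A P" "projective_module A P'"
  using P P' by (auto simp: is_projective_cover_def)
 then have f: "P \<in> fd_modules A" "P' \<in> fd_modules A" by (auto simp: projective_module_def)
 then have L: "left_module A P" "left_module A P'" by (auto simp: fd_modules_def)
 have "\<exists>h\<in>module_hom A P' P. compose (carrier P') p h = p'"
  by (rule projective_moduleD[OF pr(2) f(1) S p(1) p'(1) p(2)])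
 then obtain h where h: "h \<in> module_hom A P' P" "compose (carrier P') p h = p'" ..
 have ph: "p (h x) = p' x" if "x \<in> carrier P'" for x
  using fun_cong[OF h(2), of x] that by (simp add: compose_def)
 have "p ` (h ` carrier P') = carrier S"
  unfolding image_image p'(2)[symmetric] by (rule image_cong) (auto simp: ph)
 then have h_surj: "h ` carrier P' = carrier P"
  using p(3)[rule_format, of "h ` carrier P'"]
   module_hom_image_submodule[OF h(1) L(2,1) left_module.submodule_carrier[OF L(2)]] by simp
 have "\<exists>s\<in>module_hom A P P'. compose (carrier P) h s = (\<lambda>x\<in>carrier P. x)"
  by (rule projective_moduleD[OF pr(1) f(2,1) h(1) module_hom_id[OF L(1)] h_surj])
 then obtain s where s: "s \<in> module_hom A P P'" "compose (carrier P) h s = (\<lambda>x\<in>carrier P. x)" ..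
 have hs: "h (s x) = x" if "x \<in> carrier P" for x
  using fun_cong[OF s(2), of x] that by (simp add: compose_def)
 have "p' (s x) = p x" if "x \<in> carrier P" for x
  using ph[OF module_homD(1)[OF s(1) that]] hs[OF that] by simp
 then have "p' ` (s ` carrier P) = p ` carrier P" unfolding image_image by (rule image_cong[OF refl])
 then have s_surj: "s ` carrier P = carrier P'"
  using p(2) p'(3)[rule_format, of "s ` carrier P"]
   module_hom_image_submodule[OF s(1) L left_module.submodule_carrier[OF L(1)]] by simp
 have "inj_on s (carrier P)" by (rule inj_on_inverseI[of _ h]) (rule hs)
 then show ?thesis using s(1) s_surj unfolding module_iso_def bij_betw_def by auto
qed

end

section \<open>Regular modules, quotient algebras and blocks\<close>

definition regular_module :: "('k, 'a) module \<Rightarrow> ('a, 'a) module"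
 where "regular_module A = \<lparr>carrier = carrier A, mult = undefined, one = undefined, zero = \<zero>[A],
  add = add A, smult = mult A\<rparr>"

lemma regular_module_simps [simp]:
 "carrier (regular_module A) = carrier A" "zero (regular_module A) = \<zero>[A]"
 "add (regular_module A) = add A" "smult (regular_module A) = mult A"
 by (simp_all add: regular_module_def)

lemma regular_coset: "I +>\<^bsub>regular_module A\<^esub> x = I +>\<^bsub>A\<^esub> x"
 by (simp add: a_r_coset_def r_coset_def)

lemma kalg_image:
 assumes A: "kalg A" and q: "q ` carrier A = carrier N"
  and add: "\<And>x y. [|x \<in> carrier A; y \<in> carrier A|] ==> q (x +[A] y) = q x +[N] q y"
  and mult: "\<And>x y. [|x \<in> carrier A; y \<in> carrier A|] ==> q (x **[A] y) = q x **[N] q y"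
  and smult: "\<And>c x. x \<in> carrier A ==> q (c *[A] x) = c *[N] q x"
  and zero: "q \<zero>[A] = \<zero>[N]" and one: "q \<one>[A] = \<one>[N]"
 shows "kalg N"
proof -
 interpret A: kalg A by fact
 have ex: "\<exists>x\<in>carrier A. u = q x" if "u \<in> carrier N" for u using that by (auto simp flip: q)
 have qc: "q x \<in> carrier N" if "x \<in> carrier A" for x using that by (auto simp flip: q)
 have "abelian_group N"
 proof (rule abelian_groupI)
  fix u v assume "u \<in> carrier N" "v \<in> carrier N"
  then obtain x y where x: "x \<in> carrier A" "u = q x" and y: "y \<in> carrier A" "v = q y" using ex by meson
  show "u +[N] v \<in> carrier N" using qc[of "x +[A] y"] x y add by simp
  show "u +[N] v = v +[N] u" using x y by (simp flip: add add: A.a_comm)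
 next
  fix u v w assume "u \<in> carrier N" "v \<in> carrier N" "w \<in> carrier N"
  then obtain x y z where "x \<in> carrier A" "u = q x" "y \<in> carrier A" "v = q y" "z \<in> carrier A" "w = q z"
   using ex by meson
  then show "u +[N] v +[N] w = u +[N] (v +[N] w)" by (simp flip: add add: A.a_assoc)
 next
  show "\<zero>[N] \<in> carrier N" using qc[of "\<zero>[A]"] zero by simp
  fix u assume "u \<in> carrier N"
  then obtain x where x: "x \<in> carrier A" "u = q x" using ex by meson
  show "\<zero>[N] +[N] u = u" using x by (simp flip: add zero)
  have "q (\<ominus>\<^bsub>A\<^esub> x) +[N] u = \<zero>[N]" using x by (simp flip: add zero add: A.l_neg)
  then show "\<exists>v\<in>carrier N. v +[N] u = \<zero>[N]" using qc[of "\<ominus>\<^bsub>A\<^esub> x"] x by auto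
 qed
 moreover have "monoid N"
 proof (rule monoidI)
  fix u v assume "u \<in> carrier N" "v \<in> carrier N"
  then obtain x y where "x \<in> carrier A" "u = q x" "y \<in> carrier A" "v = q y" using ex by meson
  then show "u **[N] v \<in> carrier N" using qc[of "x **[A] y"] mult by simp
 next
  fix u v w assume "u \<in> carrier N" "v \<in> carrier N" "w \<in> carrier N"
  then obtain x y z where "x \<in> carrier A" "u = q x" "y \<in> carrier A" "v = q y" "z \<in> carrier A" "w = q z"
   using ex by meson
  then show "u **[N] v **[N] w = u **[N] (v **[N] w)" by (simp flip: mult add: A.m_assoc)
 next
  show "\<one>[N] \<in> carrier N" using qc[of "\<one>[A]"] one by simp
  fix u assume "u \<in> carrier N"
  then obtain x where x: "x \<in> carrier A" "u = q x" using ex by meson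
  show "\<one>[N] **[N] u = u" "u **[N] \<one>[N] = u" using x by (simp_all flip: mult one)
 qed
 moreover have "ring_axioms N"
 proof
  fix u v w assume "u \<in> carrier N" "v \<in> carrier N" "w \<in> carrier N"
  then obtain x y z where *: "x \<in> carrier A" "u = q x" "y \<in> carrier A" "v = q y" "z \<in> carrier A" "w = q z"
   using ex by meson
  show "(u +[N] v) **[N] w = u **[N] w +[N] v **[N] w"
   "w **[N] (u +[N] v) = w **[N] u +[N] w **[N] v"
   using * by (simp_all flip: mult add add: A.l_distr A.r_distr)
 qed
 moreover have "kalg_axioms N"
 proof
  fix u v c d assume "u \<in> carrier N" "v \<in> carrier N"
  then obtain x y where x: "x \<in> carrier A" "u = q x" and y: "y \<in> carrier A" "v = q y" using ex by meson
  show "c *[N] (u +[N] v) = c *[N] u +[N] c *[N] v"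
   "(c *[N] u) **[N] v = c *[N] (u **[N] v)" "u **[N] (c *[N] v) = c *[N] (u **[N] v)"
   using x y by (simp_all flip: add mult smult add: A.scal_r_distr A.scal_mult_l A.scal_mult_r)
 next
  fix u c d assume "u \<in> carrier N"
  then obtain x where x: "x \<in> carrier A" "u = q x" using ex by meson
  show "c *[N] u \<in> carrier N" using qc[of "c *[A] x"] x smult by simp
  show "(c + d) *[N] u = c *[N] u +[N] d *[N] u" "(c * d) *[N] u = c *[N] (d *[N] u)"
   "1 *[N] u = u"
   using x by (simp_all flip: add mult smult add: A.scal_l_distr A.scal_assoc)
 qed
 ultimately show ?thesis unfolding kalg_def ring_def by simp
qed

context kalg
begin

lemma left_module_regular: "left_module A (regular_module A)"
proof -
 have "abelian_group (regular_module A)"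
  by (rule abelian_groupI) (auto simp: a_ac l_neg intro: bexI[of _ "\<ominus> _"])
 moreover have "left_module_axioms A (regular_module A)"
  by unfold_locales (auto simp: l_distr r_distr m_assoc)
 ultimately show ?thesis unfolding left_module_def using ring_axioms by simp
qed

lemma submodule_regular_ideal:
 assumes "ideal I A"
 shows "submodule I A (regular_module A)"
proof -
 interpret I: ideal I A by fact
 interpret M: left_module A "regular_module A" by (rule left_module_regular)
 show ?thesis unfolding M.submodule_iff using I.Icarr I.I_l_closed by auto
qed

text \<open>The scalar \<open>c\<close> acts like left multiplication by
  \<open>c \<odot> \<one>\<close>, so the scalar action on the quotient algebra is the module action
  on cosets of the regular module.\<close>

lemma quotient_coset_smult:
 assumes I: "ideal I A" and x: "x \<in> carrier A"
 shows "c *[quotient_algebra A I] (I +> x) = I +> (c \<odot> x)"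
proof -
 interpret I: ideal I A by fact
 have sub: "y \<in> carrier A" if "y \<in> I +> x" for y
  using that a_r_coset_subset_G[OF I.a_subset x] by blast
 have "c *[quotient_algebra A I] (I +> x) = (\<Union>y\<in>I +> x. I +> (c \<odot> y))"
  by (simp add: quotient_algebra_def)
 also have "\<dots> = (\<Union>y\<in>I +> x. I +> ((c \<odot> \<one>) \<otimes> y))"
  by (rule SUP_cong[OF refl]) (simp add: sub scal_one_mult)
 also have "\<dots> = (c \<odot> \<one>) *[factor_module (regular_module A) I] (I +> x)"
  by (simp add: factor_module_def regular_coset)
 also have "\<dots> = I +> ((c \<odot> \<one>) \<otimes> x)"
  using coset_smult[OF left_module_regular submodule_regular_ideal[OF I], of "c \<odot> \<one>" x] x
  by (simp add: regular_coset)
 finally show ?thesis using x by (simp add: scal_one_mult)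
qed

lemma kalg_quotient:
 assumes I: "ideal I A"
 shows "kalg (quotient_algebra A I)"
proof (rule kalg_image[where q = "\<lambda>x. I +> x"])
 interpret I: ideal I A by fact
 show "kalg A" by unfold_locales
 show "(+>) I ` carrier A = carrier (quotient_algebra A I)"
  by (auto simp: quotient_algebra_def FactRing_def A_RCOSETS_def')
 show "I +> (x \<oplus> y) = (I +> x) +[quotient_algebra A I] (I +> y)" if "x \<in> carrier A" "y \<in> carrier A" for x y
  using I.a_rcos_sum[OF that] by (simp add: quotient_algebra_def FactRing_def)
 show "I +> (x \<otimes> y) = (I +> x) **[quotient_algebra A I] (I +> y)" if "x \<in> carrier A" "y \<in> carrier A" for x y
  using I.rcoset_mult_add[OF that] by (simp add: quotient_algebra_def FactRing_def)
 show "I +> (c \<odot> x) = c *[quotient_algebra A I] (I +> x)" if "x \<in> carrier A" for c x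
  using quotient_coset_smult[OF I that] by simp
 show "I +> \<zero> = \<zero>[quotient_algebra A I]"
  using a_coset_add_zero[OF I.a_subset] by (simp add: quotient_algebra_def FactRing_def)
 show "I +> \<one> = \<one>[quotient_algebra A I]" by (simp add: quotient_algebra_def FactRing_def)
qed

text \<open>Left multiplication by the central idempotent \<open>e\<close> is an algebra
  homomorphism onto the block, whose unit is \<open>e\<close>.\<close>

lemma kalg_block:
 assumes "B \<in> block_algebras A"
 shows "kalg B"
proof -
 obtain e where e: "central_idempotent A e" and B: "B = A\<lparr>carrier := (\<lambda>x. e \<otimes> x) ` carrier A, one := e\<rparr>"
  using assms unfolding block_algebras_def primitive_central_idempotent_def by blast
 have ec: "e \<in> carrier A" "e \<otimes> e = e" and comm: "\<And>x. x \<in> carrier A ==> e \<otimes> x = x \<otimes> e"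
  using e by (auto simp: central_idempotent_def)
 have m: "e \<otimes> (x \<otimes> y) = (e \<otimes> x) \<otimes> (e \<otimes> y)" if "x \<in> carrier A" "y \<in> carrier A" for x y
 proof -
  have "(e \<otimes> x) \<otimes> (e \<otimes> y) = e \<otimes> ((x \<otimes> e) \<otimes> y)" using that ec by (simp add: m_assoc)
  also have "\<dots> = e \<otimes> ((e \<otimes> x) \<otimes> y)" using that by (simp add: comm)
  also have "\<dots> = (e \<otimes> e) \<otimes> (x \<otimes> y)" using that ec(1) by (simp add: m_assoc del: ec(2))
  finally show ?thesis using ec(2) by simp
 qed
 show ?thesis
  by (rule kalg_image[of A "\<lambda>x. e \<otimes> x"], unfold_locales) (simp_all add: B r_distr m ec scal_mult_r)
qed

end

section \<open>Path algebras\<close>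

definition path_end :: "('v, 'e) pre_digraph \<Rightarrow> 'v \<Rightarrow> 'e list \<Rightarrow> 'v"
 where "path_end Q u es = (if es = [] then u else head Q (last es))"

primrec is_chain :: "('v, 'e) pre_digraph \<Rightarrow> 'v \<Rightarrow> 'e list \<Rightarrow> bool" where
 "is_chain Q u [] = True"
| "is_chain Q u (e # es) = (tail Q e = u \<and> is_chain Q (head Q e) es)"

lemma last_awalk_verts: "last (pre_digraph.awalk_verts Q u es) = path_end Q u es"
proof (induction es arbitrary: u)
 case Nil
 then show ?case by (simp add: pre_digraph.awalk_verts.simps path_end_def)
next
 case (Cons e es)
 have "pre_digraph.awalk_verts Q v es \<noteq> []" for v
  by (cases es) (simp_all add: pre_digraph.awalk_verts.simps)
 then show ?case using Cons by (simp add: pre_digraph.awalk_verts.simps path_end_def)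
qed

lemma paths_iff: "(u, es) \<in> paths Q \<longleftrightarrow> u \<in> verts Q \<and> set es \<subseteq> arcs Q \<and> is_chain Q u es"
proof -
 have "pre_digraph.cas Q u es v \<longleftrightarrow> is_chain Q u es \<and> v = path_end Q u es" for v
  by (induction es arbitrary: u) (auto simp: pre_digraph.cas.simps path_end_def)
 then have "(\<exists>v. pre_digraph.cas Q u es v) \<longleftrightarrow> is_chain Q u es" by simp
 then show ?thesis unfolding paths_def pre_digraph.awalk_def by simp
qed

lemma path_end_append: "path_end Q (path_end Q u xs) ys = path_end Q u (xs @ ys)"
 by (simp add: path_end_def)

lemma is_chain_append: "is_chain Q u (xs @ ys) \<longleftrightarrow> is_chain Q u xs \<and> is_chain Q (path_end Q u xs) ys"
proof (induction xs arbitrary: u)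
 case (Cons e xs)
 then show ?case by (auto simp: path_end_def)
qed (simp add: path_end_def)

lemma path_algebra_simps [simp]:
 "carrier (path_algebra Q) = {f. finite {p. f p \<noteq> 0} \<and> {p. f p \<noteq> 0} \<subseteq> paths Q}"
 "one (path_algebra Q) = (\<lambda>(u, es). if u \<in> verts Q \<and> es = [] then 1 else 0)"
 "zero (path_algebra Q) = (\<lambda>_. 0)" "add (path_algebra Q) = (\<lambda>f g p. f p + g p)"
 "smult (path_algebra Q) = (\<lambda>c f p. c * f p)"
 by (simp_all add: path_algebra_def)

lemma path_fun_eqI:
 fixes f g :: "'v \<times> 'e list \<Rightarrow> 'k"
 shows "(\<And>u es. f (u, es) = g (u, es)) ==> f = g"
 by (rule ext) auto

lemma path_algebra_mult:
 "(f **[path_algebra Q] g) (u, es) =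
  (\<Sum>k\<le>length es. f (u, take k es) * g (path_end Q u (take k es), drop k es))"
 by (simp add: path_algebra_def last_awalk_verts)

lemma path_algebra_mult_nonzero:
 assumes "(f **[path_algebra Q] g) (u, es) \<noteq> 0"
 obtains xs ys where "es = xs @ ys" "f (u, xs) \<noteq> 0" "g (path_end Q u xs, ys) \<noteq> 0"
proof -
 have "(\<Sum>k\<le>length es. f (u, take k es) * g (path_end Q u (take k es), drop k es)) \<noteq> 0"
  using assms by (simp only: path_algebra_mult not_False_eq_True)
 then obtain k where k: "f (u, take k es) * g (path_end Q u (take k es), drop k es) \<noteq> 0"
  by (metis (no_types, lifting) sum.not_neutral_contains_not_neutral)
 show thesis by (rule that[of "take k es" "drop k es"]) (use k in auto)
qed

context
 fixes Q :: "('v, 'e) pre_digraph"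
 assumes fin: "finite (verts Q)" and heads: "\<And>e. e \<in> arcs Q ==> head Q e \<in> verts Q"
begin

lemma path_end_verts: "(u, es) \<in> paths Q ==> path_end Q u es \<in> verts Q"
 using heads[OF subsetD[OF _ last_in_set]] by (simp add: paths_iff path_end_def)

lemma paths_append:
 "(u, xs @ ys) \<in> paths Q \<longleftrightarrow> (u, xs) \<in> paths Q \<and> (path_end Q u xs, ys) \<in> paths Q"
 using path_end_verts[of u xs] by (auto simp: paths_iff is_chain_append)

lemma path_algebra_mult_closed:
 fixes f g :: "'v \<times> 'e list \<Rightarrow> 'k::field"
 assumes "f \<in> carrier (path_algebra Q)" "g \<in> carrier (path_algebra Q)"
 shows "f **[path_algebra Q] g \<in> carrier (path_algebra Q)"
proof -
 let ?h = "f **[path_algebra Q] g"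
 have f: "finite {p. f p \<noteq> 0}" "{p. f p \<noteq> 0} \<subseteq> paths Q" and g: "finite {p. g p \<noteq> 0}" "{p. g p \<noteq> 0} \<subseteq> paths Q"
  using assms by auto
 let ?F = "(\<lambda>(p, p'). (fst p, snd p @ snd p')) ` ({p. f p \<noteq> 0} \<times> {p. g p \<noteq> 0})"
 have "p \<in> ?F \<inter> paths Q" if hp: "?h p \<noteq> 0" for p
 proof -
  obtain u es where p: "p = (u, es)" by (cases p)
  obtain xs ys where *: "es = xs @ ys" "f (u, xs) \<noteq> 0" "g (path_end Q u xs, ys) \<noteq> 0"
   using hp unfolding p by (rule path_algebra_mult_nonzero)
  have "p \<in> ?F" using * by (intro image_eqI[of _ _ "((u, xs), (path_end Q u xs, ys))"]) (auto simp: p)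
  moreover have "p \<in> paths Q" using * f(2) g(2) unfolding p *(1) paths_append by blast
  ultimately show ?thesis by blast
 qed
 then have "{p. ?h p \<noteq> 0} \<subseteq> ?F" "{p. ?h p \<noteq> 0} \<subseteq> paths Q" by auto
 moreover have "finite ?F" using f g by simp
 ultimately show ?thesis using finite_subset by auto
qed

text \<open>Both sides sum over the ways to cut the path into three pieces, one with the second cut
  as the outer index, the other with the first.\<close>

lemma path_algebra_mult_assoc:
 fixes f g h :: "'v \<times> 'e list \<Rightarrow> 'k::field"
 shows "f **[path_algebra Q] g **[path_algebra Q] h = f **[path_algebra Q] (g **[path_algebra Q] h)"
proof (rule path_fun_eqI)
 fix u :: 'v and es :: "'e list"
 let ?n = "length es"
 let ?t = "\<lambda>j i. f (u, take j es) * g (path_end Q u (take j es), take i (drop j es)) *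
  h (path_end Q u (take (j + i) es), drop (j + i) es)"
 have "(f **[path_algebra Q] g **[path_algebra Q] h) (u, es) =
   (\<Sum>k\<le>?n. (\<Sum>j\<le>k. f (u, take j es) * g (path_end Q u (take j es), drop j (take k es))) *
    h (path_end Q u (take k es), drop k es))"
  unfolding path_algebra_mult by (intro sum.cong refl) (auto intro!: sum.cong simp: min_def)
 also have "\<dots> = (\<Sum>k\<le>?n. \<Sum>j\<le>k. ?t j (k - j))"
  unfolding sum_distrib_right by (intro sum.cong refl) (auto simp: take_drop)
 also have "\<dots> = (\<Sum>(j, i)\<in>{(j, i). j + i \<le> ?n}. ?t j i)"
  by (rule sum.triangle_reindex_eq[symmetric])
 also have "\<dots> = (\<Sum>(j, i)\<in>(SIGMA j:{..?n}. {..?n - j}). ?t j i)"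
  by (rule sum.cong) auto
 also have "\<dots> = (\<Sum>j\<le>?n. \<Sum>i\<le>?n - j. ?t j i)"
  by (rule sum.Sigma[symmetric]) auto
 also have "\<dots> = (f **[path_algebra Q] (g **[path_algebra Q] h)) (u, es)"
  unfolding path_algebra_mult sum_distrib_left
  by (intro sum.cong refl) (auto simp: path_end_append take_add add.commute mult.assoc)
 finally show "(f **[path_algebra Q] g **[path_algebra Q] h) (u, es) =
   (f **[path_algebra Q] (g **[path_algebra Q] h)) (u, es)" .
qed

lemma path_algebra_units:
 fixes f :: "'v \<times> 'e list \<Rightarrow> 'k::field"
 assumes f: "f \<in> carrier (path_algebra Q)"
 shows "\<one>[path_algebra Q] **[path_algebra Q] f = f" "f **[path_algebra Q] \<one>[path_algebra Q] = f"
proof -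
 have fp: "(u, es) \<in> paths Q" if "f (u, es) \<noteq> 0" for u es using f that by auto
 show "\<one>[path_algebra Q] **[path_algebra Q] f = f"
 proof (rule path_fun_eqI)
  fix u :: 'v and es :: "'e list"
  have "(\<one>[path_algebra Q] **[path_algebra Q] f) (u, es) =
    (\<Sum>k\<le>length es. if k = 0 then if u \<in> verts Q then f (u, es) else 0 else 0)"
   unfolding path_algebra_mult by (rule sum.cong) (auto simp: path_end_def)
  then show "(\<one>[path_algebra Q] **[path_algebra Q] f) (u, es) = f (u, es)"
   using fp[of u es] by (auto simp: paths_iff)
 qed
 show "f **[path_algebra Q] \<one>[path_algebra Q] = f"
 proof (rule path_fun_eqI)
  fix u :: 'v and es :: "'e list"
  have "(f **[path_algebra Q] \<one>[path_algebra Q]) (u, es) =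
    (\<Sum>k\<le>length es. if k = length es then if path_end Q u es \<in> verts Q then f (u, es) else 0 else 0)"
   unfolding path_algebra_mult by (rule sum.cong) auto
  then show "(f **[path_algebra Q] \<one>[path_algebra Q]) (u, es) = f (u, es)"
   using fp[of u es] path_end_verts[of u es] by auto
 qed
qed

lemma kalg_path_algebra: "kalg (path_algebra Q :: ('k::field, 'v \<times> 'e list \<Rightarrow> 'k) module)"
proof -
 let ?P = "path_algebra Q :: ('k, 'v \<times> 'e list \<Rightarrow> 'k) module"
 have sup: "{p. f p + g p \<noteq> 0} \<subseteq> {p. f p \<noteq> 0} \<union> {p. g p \<noteq> 0}" for f g :: "'v \<times> 'e list \<Rightarrow> 'k" by auto
 have add_cl: "f +[?P] g \<in> carrier ?P" if "f \<in> carrier ?P" "g \<in> carrier ?P" for f g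
 proof -
  have "finite {p. f p + g p \<noteq> 0}" by (rule finite_subset[OF sup]) (use that in simp)
  moreover have "{p. f p + g p \<noteq> 0} \<subseteq> paths Q" by (rule subset_trans[OF sup]) (use that in simp)
  ultimately show ?thesis by simp
 qed
 have sc: "c *[?P] f \<in> carrier ?P" if "f \<in> carrier ?P" for c f
 proof -
  have "{p. c * f p \<noteq> 0} \<subseteq> {p. f p \<noteq> 0}" by auto
  then show ?thesis using that finite_subset by auto
 qed
 have "abelian_group ?P"
 proof (rule abelian_groupI)
  fix f assume f: "f \<in> carrier ?P"
  show "\<exists>g\<in>carrier ?P. g +[?P] f = \<zero>[?P]"
   using sc[OF f, of "- 1"] by (intro bexI[of _ "(- 1) *[?P] f"]) simp_all
 qed (use add_cl in \<open>auto simp: ac_simps\<close>)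
 moreover have "monoid ?P"
 proof (rule monoidI)
  have sub: "{p. \<one>[?P] p \<noteq> 0} \<subseteq> (\<lambda>u. (u, [])) ` verts Q" by (auto split: if_splits)
  also have "\<dots> \<subseteq> paths Q" by (auto simp: paths_iff)
  finally show "\<one>[?P] \<in> carrier ?P" using finite_subset[OF sub] fin by (simp del: path_algebra_simps(2))
 qed (use path_algebra_mult_closed path_algebra_mult_assoc path_algebra_units in blast)+
 moreover have "ring_axioms ?P"
 proof
  fix f g h
  show "(f +[?P] g) **[?P] h = f **[?P] h +[?P] g **[?P] h"
   by (rule path_fun_eqI) (simp add: path_algebra_mult sum.distrib distrib_right)
  show "h **[?P] (f +[?P] g) = h **[?P] f +[?P] h **[?P] g"
   by (rule path_fun_eqI) (simp add: path_algebra_mult sum.distrib distrib_left)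
 qed
 moreover have "kalg_axioms ?P"
 proof
  fix c f g
  show "(c *[?P] f) **[?P] g = c *[?P] (f **[?P] g)" "f **[?P] (c *[?P] g) = c *[?P] (f **[?P] g)"
   by (rule path_fun_eqI, simp add: path_algebra_mult sum_distrib_left mult_ac)+
 qed (use sc in \<open>simp_all add: algebra_simps\<close>)
 ultimately show ?thesis unfolding kalg_def ring_def by simp
qed

lemma path_elem_closed: "(u, es) \<in> paths Q ==> path_elem u es \<in> carrier (path_algebra Q)"
 by (auto simp: path_elem_def)

lemma path_elem_mult:
 "path_elem u xs **[path_algebra Q] path_elem v ys =
  (if v = path_end Q u xs then path_elem u (xs @ ys) else (\<lambda>_. 0 :: 'k::field))"
proof (rule path_fun_eqI)
 fix w :: 'v and es :: "'e list"
 let ?n = "length xs"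
 have "(path_elem u xs **[path_algebra Q] path_elem v ys) (w, es) =
   (\<Sum>k\<le>length es. if k = ?n then if w = u \<and> es = xs @ ys \<and> v = path_end Q u xs then 1 else 0 else (0::'k))"
  unfolding path_algebra_mult
 proof (rule sum.cong[OF refl])
  fix k assume k: "k \<in> {..length es}"
  show "path_elem u xs (w, take k es) * path_elem v ys (path_end Q w (take k es), drop k es) =
    (if k = ?n then if w = u \<and> es = xs @ ys \<and> v = path_end Q u xs then 1 else 0 else (0::'k))"
  proof (cases "k = ?n")
   case True
   have "es = xs @ ys \<longleftrightarrow> take ?n es = xs \<and> drop ?n es = ys"
    by (metis append_eq_conv_conj append_take_drop_id)
   then show ?thesis using True by (auto simp: path_elem_def)
  next
   case False
   then have "take k es \<noteq> xs" using k by auto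
   then show ?thesis using False by (simp add: path_elem_def)
  qed
 qed
 also have "\<dots> = (if v = path_end Q u xs then path_elem u (xs @ ys) else (\<lambda>_. 0)) (w, es)"
  by (auto simp: path_elem_def)
 finally show "(path_elem u xs **[path_algebra Q] path_elem v ys) (w, es) =
   (if v = path_end Q u xs then path_elem u (xs @ ys) else (\<lambda>_. 0 :: 'k)) (w, es)" .
qed

lemma path_algebra_induct [consumes 1, case_names zero add]:
 fixes f :: "'v \<times> 'e list \<Rightarrow> 'k::field"
 assumes f: "f \<in> carrier (path_algebra Q)"
  and zero: "P (\<lambda>_. 0)"
  and add: "\<And>c u es g. [|(u, es) \<in> paths Q; g \<in> carrier (path_algebra Q); P g; f (u, es) = c; c \<noteq> 0|] ==>
   P ((c *[path_algebra Q] path_elem u es) +[path_algebra Q] g)"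
 shows "P f"
proof -
 have "P (\<lambda>p. if p \<in> F then f p else 0)" if "finite F" "F \<subseteq> {p. f p \<noteq> 0}" for F
  using that
 proof (induction F rule: finite_induct)
  case empty
  then show ?case using zero by simp
 next
  case (insert q F)
  obtain u es where q: "q = (u, es)" by (cases q)
  let ?g = "\<lambda>p. if p \<in> F then f p else 0"
  have sub: "{p. ?g p \<noteq> 0} \<subseteq> {p. f p \<noteq> 0}" by auto
  have "finite {p. ?g p \<noteq> 0}" by (rule finite_subset[OF sub]) (use f in simp)
  moreover have "{p. ?g p \<noteq> 0} \<subseteq> paths Q" by (rule subset_trans[OF sub]) (use f in simp)
  ultimately have g: "?g \<in> carrier (path_algebra Q)" by (simp only: path_algebra_simps(1) mem_Collect_eq simp_thms)
  have "(u, es) \<in> paths Q" "f (u, es) \<noteq> 0" using insert.prems f q by auto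
  then have "P ((f (u, es) *[path_algebra Q] path_elem u es) +[path_algebra Q] ?g)"
   using insert g by (intro add) auto
  moreover have "(f (u, es) *[path_algebra Q] path_elem u es) +[path_algebra Q] ?g =
    (\<lambda>p. if p \<in> insert q F then f p else 0)"
   using insert.hyps by (auto simp: fun_eq_iff path_elem_def q)
  ultimately show ?case by simp
 qed
 moreover have "(\<lambda>p. if p \<in> {p. f p \<noteq> 0} then f p else 0) = f" by auto
 moreover have "finite {p. f p \<noteq> 0}" using f by simp
 ultimately show ?thesis by (metis subset_refl)
qed

end

section \<open>Blocks of Hecke algebras are algebras\<close>

lemma kalg_free_algebra: "kalg (free_algebra I :: ('k::field, 'k free) module)"
 unfolding free_algebra_def by (rule kalg_path_algebra) (simp_all add: one_vertex_quiver_def)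

lemma gen_closed: "i \<in> I ==> gen i \<in> carrier (free_algebra I)"
 unfolding free_algebra_def
 by (rule path_elem_closed) (simp_all add: one_vertex_quiver_def paths_iff)

lemma kalg_free_quotient:
 fixes R :: "'k::field free set"
 assumes "R \<subseteq> carrier (free_algebra I)"
 shows "kalg (quotient_algebra (free_algebra I) (genideal (free_algebra I) R))"
proof -
 interpret F: kalg "free_algebra I :: ('k, 'k free) module" by (rule kalg_free_algebra)
 show ?thesis by (rule F.kalg_quotient[OF F.genideal_ideal[OF assms]])
qed

context
 fixes I :: "nat set" and F :: "('k::field, 'k free) module"
 assumes F: "F = free_algebra I"
begin

interpretation F: kalg F unfolding F by (rule kalg_free_algebra)

lemma hecke_rels_closed:
 "i \<in> I ==> quadratic_rel F c i \<in> carrier F"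
 "[|i \<in> I; j \<in> I|] ==> commuting_rel F i j \<in> carrier F"
 "[|i \<in> I; j \<in> I|] ==> braid_rel F i j \<in> carrier F"
 "[|i \<in> I; j \<in> I|] ==> braid4_rel F i j \<in> carrier F"
 using gen_closed[of _ I, where 'a = 'k, folded F]
 by (simp_all add: quadratic_rel_def commuting_rel_def braid_rel_def braid4_rel_def)

lemma type_A_rels_closed: "{1..<n} \<subseteq> I ==> type_A_rels F q n \<subseteq> carrier F"
 unfolding type_A_rels_def using hecke_rels_closed by (auto simp: subset_iff)

end

lemma kalg_hecke:
 assumes "H \<in> classical_hecke_algebras"
 shows "kalg H"
proof -
 have A: "kalg (hecke_A q n)" for q :: 'a and n
  unfolding hecke_A_def Let_def
  by (intro kalg_free_quotient type_A_rels_closed[OF refl]) simp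
 have B: "kalg (hecke_B q Q n)" if "n \<ge> 1" for q Q :: 'a and n
  unfolding hecke_B_def Let_def
  by (intro kalg_free_quotient Un_least type_A_rels_closed[OF refl])
   (use that in \<open>auto intro!: hecke_rels_closed[OF refl] simp del: path_algebra_simps\<close>)
 have D: "kalg (hecke_D q n)" if "n \<ge> 3" for q :: 'a and n
  unfolding hecke_D_def Let_def
  by (intro kalg_free_quotient Un_least type_A_rels_closed[OF refl])
   (use that in \<open>auto intro!: hecke_rels_closed[OF refl] simp del: path_algebra_simps\<close>)
 show ?thesis using assms A B D unfolding classical_hecke_algebras_def by auto
qed

section \<open>Modules generated by an idempotent\<close>

text \<open>
 The module \<open>P\<close> is generated by \<open>y\<close> in the same way as \<open>A e\<close> is generated by the idempotent \<open>e\<close>.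
\<close>

definition idem_gen :: "('k, 'a) module \<Rightarrow> 'a \<Rightarrow> ('a, 'p) module \<Rightarrow> 'p \<Rightarrow> bool"
 where "idem_gen A e P y \<longleftrightarrow> left_module A P \<and> e \<in> carrier A \<and> e **[A] e = e \<and> cyclic A P y \<and> e *[P] y = y \<and>
  (\<forall>a\<in>carrier A. a *[P] y = \<zero>[P] --> a **[A] e = \<zero>[A])"

lemma cyclicE:
 assumes "cyclic A P y" "z \<in> carrier P"
 obtains a where "a \<in> carrier A" "z = a *[P] y"
proof -
 have "z \<in> (\<lambda>a. a *[P] y) ` carrier A" using assms by (auto simp: cyclic_def)
 then show thesis using that by (auto elim: imageE)
qed

lemma idem_gen_iso:
 assumes P: "idem_gen A e P y" and f: "f \<in> module_hom A P P'" "bij_betw f (carrier P) (carrier P')"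
  and P': "left_module A P'"
 shows "idem_gen A e P' (f y)"
proof -
 have lP: "left_module A P" and e: "e \<in> carrier A" "e **[A] e = e" and cyc: "cyclic A P y" and ey: "e *[P] y = y"
  and ann: "\<And>a. [|a \<in> carrier A; a *[P] y = \<zero>[P]|] ==> a **[A] e = \<zero>[A]"
  using P by (auto simp: idem_gen_def)
 interpret P: left_module A P by (rule lP)
 have y: "y \<in> carrier P" using cyc by (simp add: cyclic_def)
 have surj: "f ` carrier P = carrier P'" and inj: "inj_on f (carrier P)" using f(2) by (auto simp: bij_betw_def)
 have "cyclic A P' (f y)"
  unfolding cyclic_def
 proof (intro conjI subsetI)
  show "f y \<in> carrier P'" by (rule module_homD(1)[OF f(1) y])
  fix z assume "z \<in> carrier P'"
  then have "z \<in> f ` carrier P" by (simp only: surj)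
  then obtain w where w: "z = f w" "w \<in> carrier P" by (rule imageE)
  obtain a where a: "a \<in> carrier A" "w = a *[P] y" using cyc w(2) by (rule cyclicE)
  then have "z = a *[P'] f y" using w y module_homD(3)[OF f(1)] by simp
  then show "z \<in> (\<lambda>a. a *[P'] f y) ` carrier A" using a(1) by (rule image_eqI)
 qed
 moreover have "e *[P'] f y = f y" using module_homD(3)[OF f(1) e(1) y] ey by simp
 moreover have "a **[A] e = \<zero>[A]" if a: "a \<in> carrier A" "a *[P'] f y = \<zero>[P']" for a
 proof (rule ann[OF a(1)])
  have "f (a *[P] y) = \<zero>[P']" using module_homD(3)[OF f(1) a(1) y] a(2) by simp
  then have "f (a *[P] y) = f \<zero>[P]" using module_hom_zero[OF f(1) lP P'] by simp
  then show "a *[P] y = \<zero>[P]" by (rule inj_onD[OF inj]) (simp_all add: P.smult_closed a(1) y)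
 qed
 ultimately show ?thesis using P' e by (simp add: idem_gen_def)
qed

context kalg
begin

lemma module_hom_from_regular:
 assumes M: "left_module A M" and z: "z \<in> carrier M"
 shows "(\<lambda>a\<in>carrier (regular_module A). a *[M] z) \<in> module_hom A (regular_module A) M"
proof -
 interpret M: left_module A M by fact
 show ?thesis
  by (rule module_homI[OF _ _ _ left_module_regular])
   (simp_all add: z M.smult_closed M.smult_l_distr M.smult_assoc1)
qed

text \<open>The map from the regular module that sends \<open>a\<close> to \<open>a *[M] z\<close>
  factors through the one that sends \<open>a\<close> to \<open>a *[P] y\<close>.\<close>

lemma module_hom_from_cyclic:
 assumes P: "left_module A P" "cyclic A P y" and M: "left_module A M" and z: "z \<in> carrier M"
  and ann: "\<And>a. [|a \<in> carrier A; a *[P] y = \<zero>[P]|] ==> a *[M] z = \<zero>[M]"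
 shows "\<exists>f\<in>module_hom A P M. f y = z"
proof -
 interpret P: left_module A P by fact
 interpret M: left_module A M by fact
 have y: "y \<in> carrier P" using P(2) by (simp add: cyclic_def)
 let ?R = "regular_module A"
 let ?p = "\<lambda>a\<in>carrier ?R. a *[P] y" and ?f = "\<lambda>a\<in>carrier ?R. a *[M] z"
 have surj: "?p ` carrier ?R = carrier P"
 proof (intro equalityI subsetI)
  fix w assume "w \<in> carrier P"
  with P(2) obtain a where "a \<in> carrier A" "w = a *[P] y" by (rule cyclicE)
  then show "w \<in> ?p ` carrier ?R" by (intro image_eqI[of _ _ a]) simp_all
 qed (auto simp: P.smult_closed y)
 have "\<exists>g\<in>module_hom A P M. \<forall>a\<in>carrier ?R. g (?p a) = ?f a"
  by (rule module_hom_factor[OF module_hom_from_regular[OF M z] module_hom_from_regular[OF P(1) y]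
     left_module_regular M P(1) surj]) (use ann in auto)
 then obtain g where g: "g \<in> module_hom A P M" "\<forall>a\<in>carrier ?R. g (?p a) = ?f a" ..
 have "g y = z" using bspec[OF g(2), of \<one>] y z by (simp add: P.smult_one M.smult_one)
 then show ?thesis using g(1) by blast
qed

text \<open>The isomorphism of \<open>Hom(A e, M)\<close> with \<open>e M\<close>: an element
  \<open>a\<close> that annihilates \<open>y\<close> satisfies
  \<open>a \<otimes> e = \<zero>\<close>, so it kills every vector fixed by
  \<open>e\<close>.\<close>

lemma hom_values_idem_gen:
 assumes P: "idem_gen A e P y" and M: "left_module A M"
 shows "hom_values A P y M = {z \<in> carrier M. e *[M] z = z}"
proof (intro equalityI subsetI)
 have lP: "left_module A P" and e: "e \<in> carrier A" and cyc: "cyclic A P y" and ey: "e *[P] y = y"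
  and ann: "\<And>a. [|a \<in> carrier A; a *[P] y = \<zero>[P]|] ==> a \<otimes> e = \<zero>"
  using P by (auto simp: idem_gen_def)
 interpret M: left_module A M by fact
 have y: "y \<in> carrier P" using cyc by (simp add: cyclic_def)
 {
  fix z assume "z \<in> hom_values A P y M"
  then obtain f where f: "f \<in> module_hom A P M" "z = f y" by (rule hom_valuesE)
  show "z \<in> {z \<in> carrier M. e *[M] z = z}"
   using module_homD(1)[OF f(1) y] module_homD(3)[OF f(1) e y] f(2) ey by simp
 next
  fix z assume "z \<in> {z \<in> carrier M. e *[M] z = z}"
  then have z: "z \<in> carrier M" "e *[M] z = z" by auto
  have "a *[M] z = \<zero>[M]" if a: "a \<in> carrier A" "a *[P] y = \<zero>[P]" for a
  proof -
   have "a *[M] z = (a \<otimes> e) *[M] z" using M.smult_assoc1[OF a(1) e z(1)] z(2) by simp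
   then show ?thesis using ann[OF a] z(1) by simp
  qed
  then have "\<exists>f\<in>module_hom A P M. f y = z" by (rule module_hom_from_cyclic[OF lP cyc M z(1)])
  then show "z \<in> hom_values A P y M" by (auto intro: hom_valuesI)
 }
qed

text \<open>If \<open>g m = f y\<close>, then \<open>e *[M] m\<close> is another preimage of
  \<open>f y\<close> and is fixed by \<open>e\<close>, hence is the value at \<open>y\<close> of a
  homomorphism.\<close>

lemma lifting_idem_gen:
 assumes P: "idem_gen A e P y" and M: "left_module A M" and N: "left_module A N"
 shows "lifting A P M N"
 unfolding lifting_def
proof (intro ballI impI)
 fix g f assume g: "g \<in> module_hom A M N" and f: "f \<in> module_hom A P N" and surj: "g ` carrier M = carrier N"
 have lP: "left_module A P" and e: "e \<in> carrier A" "e \<otimes> e = e" and cyc: "cyclic A P y" and ey: "e *[P] y = y"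
  using P by (auto simp: idem_gen_def)
 interpret M: left_module A M by fact
 have y: "y \<in> carrier P" using cyc by (simp add: cyclic_def)
 have "f y \<in> g ` carrier M" unfolding surj by (rule module_homD(1)[OF f y])
 then obtain m where m: "f y = g m" "m \<in> carrier M" by (rule imageE)
 have em: "e *[M] m \<in> carrier M" using e(1) m(2) by (rule M.smult_closed)
 have "e *[M] m \<in> {z \<in> carrier M. e *[M] z = z}" using em M.smult_assoc1[OF e(1,1) m(2)] e(2) by simp
 then have "e *[M] m \<in> hom_values A P y M" by (simp only: hom_values_idem_gen[OF P M])
 then obtain h where h: "h \<in> module_hom A P M" "e *[M] m = h y" by (rule hom_valuesE)
 have "compose (carrier P) g h = f"
 proof (rule module_hom_eqI[OF module_hom_compose[OF h(1) g lP] f])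
  fix x assume x: "x \<in> carrier P"
  with cyc obtain a where a: "a \<in> carrier A" "x = a *[P] y" by (rule cyclicE)
  have "g (h y) = e *[N] f y" unfolding h(2)[symmetric] m(1) by (rule module_homD(3)[OF g e(1) m(2)])
  also have "\<dots> = f y" using module_homD(3)[OF f e(1) y] ey by simp
  finally have "g (h y) = f y" .
  then show "compose (carrier P) g h x = f x"
   using x a y module_homD(3)[OF h(1) a(1) y] module_homD(3)[OF f a(1) y]
    module_homD(3)[OF g a(1) module_homD(1)[OF h(1) y]] by (simp add: compose_def)
 qed
 then show "\<exists>h\<in>module_hom A P M. compose (carrier P) g h = f" using h(1) by blast
qed

lemma projective_idem_gen:
 assumes "idem_gen A e P y" "P \<in> fd_modules A"
 shows "projective_module A P"
 unfolding projective_module_def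
proof (intro conjI ballI impI)
 fix M N g f assume *: "M \<in> fd_modules A" "N \<in> fd_modules A" "g \<in> module_hom A M N" "f \<in> module_hom A P N"
  "g ` carrier M = carrier N"
 have "lifting A P M N"
  by (rule lifting_idem_gen[OF assms(1)]) (use * in \<open>simp_all add: fd_modules_iff fdm_def\<close>)
 then show "\<exists>h\<in>module_hom A P M. compose (carrier P) g h = f" using * by (simp add: lifting_def)
qed (rule assms(2))

lemma fdm_regular:
 assumes "kfin A" shows "fdm A (regular_module A)"
proof -
 have "klinear (restrict_scalars A (regular_module A)) A (\<lambda>x. x)"
  by (simp add: klinear_def scal_one_mult)
 then have "kfin (restrict_scalars A (regular_module A))" by (rule kfin_inj) (simp_all add: assms)
 then show ?thesis using left_module_regular by (simp add: fdm_def)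
qed

text \<open>The left ideal \<open>A e\<close> with generator \<open>e\<close>, copied to
  \<open>'k vec\<close>.\<close>

lemma idem_gen_exists:
 assumes fin: "kfin A" and e: "e \<in> carrier A" "e \<otimes> e = e"
 shows "\<exists>P\<in>fd_modules A. \<exists>y. idem_gen A e P y"
proof -
 let ?R = "regular_module A"
 interpret R: left_module A ?R by (rule left_module_regular)
 let ?U = "(\<lambda>a. a *[?R] e) ` carrier A"
 have U: "submodule ?U A ?R" by (rule submodule_cyclic[OF left_module_regular]) (simp add: e)
 have "e \<in> ?U" using e by (intro image_eqI[of _ _ e]) simp_all
 then have "idem_gen A e (?R\<lparr>carrier := ?U\<rparr>) e"
  using e R.submodule_left_module[OF U] by (simp add: idem_gen_def cyclic_def)
 moreover obtain P f where P: "P \<in> fd_modules A" "f \<in> module_hom A (?R\<lparr>carrier := ?U\<rparr>) P"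
   "bij_betw f (carrier (?R\<lparr>carrier := ?U\<rparr>)) (carrier P)"
  using fd_modules_copy[OF fdm_submodule[OF fdm_regular[OF fin] U]] .
 ultimately have "idem_gen A e P (f e)"
  using P(1) by (intro idem_gen_iso[OF _ P(2,3)]) (simp_all add: fd_modules_iff fdm_def)
 then show ?thesis using P(1) by blast
qed

text \<open>By \<open>only\<close>, nonzero vectors fixed by \<open>e\<close> in simple modules have
  annihilators inside that of \<open>s\<close>. If a proper \<open>U\<close> mapped onto
  \<open>S\<close>, it would lie in a maximal submodule \<open>V\<close>. The coset of
  \<open>y\<close> is such a vector in the simple factor by \<open>V\<close>, so every
  \<open>a *[P] y\<close> in \<open>U\<close> satisfies \<open>a *[S] s = \<zero>[S]\<close>, and
  \<open>U\<close> maps to zero.\<close>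

lemma idem_gen_cover:
 assumes P: "idem_gen A e P y" "P \<in> fd_modules A" and S: "simple_module A S" "S \<in> fd_modules A"
  and s: "s \<in> carrier S" "s \<noteq> \<zero>[S]" "e *[S] s = s"
  and only: "\<And>T t a. [|T \<in> fd_modules A; simple_module A T; t \<in> carrier T; t \<noteq> \<zero>[T]; e *[T] t = t;
   a \<in> carrier A; a *[T] t = \<zero>[T]|] ==> a *[S] s = \<zero>[S]"
 shows "is_projective_cover A P S"
proof -
 have fP: "fdm A P" using P(2) fd_modules_iff by blast
 have lP: "left_module A P" and lS: "left_module A S" and e: "e \<in> carrier A" and cyc: "cyclic A P y"
  and ey: "e *[P] y = y"
  using P S by (auto simp: idem_gen_def simple_module_def)
 interpret P: left_module A P by (rule lP)
 interpret S: left_module A S by (rule lS)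
 have y: "y \<in> carrier P" using cyc by (simp add: cyclic_def)
 have "s \<in> hom_values A P y S" using s hom_values_idem_gen[OF P(1) lS] by simp
 then obtain p where p: "p \<in> module_hom A P S" "s = p y" by (rule hom_valuesE)
 have surj: "p ` carrier P = carrier S" by (rule hom_to_simple[OF S(1) lP p(1) y]) (use s p in simp)
 have "U = carrier P" if U: "submodule U A P" "p ` U = carrier S" for U
 proof (rule ccontr)
  assume ne: "U \<noteq> carrier P"
  obtain V where V: "submodule V A P \<and> U \<subseteq> V \<and> V \<noteq> carrier P \<and>
    (\<forall>W. submodule W A P --> V \<subseteq> W --> W \<noteq> carrier P --> W = V)"
   using exists_maximal_submodule[OF fP U(1) ne] ..
  have V1: "submodule V A P" and V2: "U \<subseteq> V" and V3: "V \<noteq> carrier P" using V by auto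
  have V4: "W = V" if "submodule W A P" "V \<subseteq> W" "W \<noteq> carrier P" for W using V that by auto
  let ?F = "factor_module P V" and ?q = "\<lambda>x\<in>carrier P. V +>\<^bsub>P\<^esub> x"
  have F: "fdm A ?F" by (rule fdm_factor(1)[OF fP V1])
  have lF: "left_module A ?F" using F by (simp add: fdm_def)
  have sF: "simple_module A ?F" by (rule simple_factor_maximal[OF lP V1 V3 V4])
  \<comment> \<open>The factor module has sets as elements, but \<open>only\<close> speaks of
    modules on \<open>'k vec\<close>.\<close>
  obtain T \<phi> where T: "T \<in> fd_modules A" and \<phi>: "\<phi> \<in> module_hom A ?F T" "bij_betw \<phi> (carrier ?F) (carrier T)"
   using fd_modules_copy[OF F] .
  have lT: "left_module A T" using T fd_modules_iff by (simp add: fdm_def)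
  interpret TT: left_module A T by (rule lT)
  have sT: "simple_module A T" by (rule simple_module_iso[OF sF lT \<phi>])
  let ?g = "compose (carrier P) \<phi> ?q"
  have g: "?g \<in> module_hom A P T" by (rule module_hom_compose[OF coset_hom[OF lP V1] \<phi>(1) lP])
  have g0: "?g x = \<zero>[T] \<longleftrightarrow> x \<in> V" if x: "x \<in> carrier P" for x
  proof -
   have qx: "?q x \<in> carrier ?F" using x by simp
   have "\<phi> (?q x) = \<zero>[T] \<longleftrightarrow> \<phi> (?q x) = \<phi> \<zero>[?F]" using module_hom_zero[OF \<phi>(1) lF lT] by simp
   also have "\<dots> \<longleftrightarrow> ?q x = \<zero>[?F]"
   proof -
    interpret F: left_module A ?F by (rule lF)
    have "inj_on \<phi> (carrier ?F)" using \<phi>(2) by (simp add: bij_betw_def)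
    then show ?thesis using qx F.M.zero_closed by (rule inj_on_eq_iff)
   qed
   also have "\<dots> \<longleftrightarrow> x \<in> V" using coset_eq_zero_iff[OF lP V1 x] x by simp
   finally show ?thesis using x by (simp add: compose_def)
  qed
  define t where "t = ?g y"
  have t: "t \<in> carrier T" unfolding t_def by (rule module_homD(1)[OF g y])
  have et: "e *[T] t = t" unfolding t_def using module_homD(3)[OF g e y] ey by simp
  have t0: "t \<noteq> \<zero>[T]"
  proof
   assume "t = \<zero>[T]"
   then have "y \<in> V" using g0[OF y] by (simp only: t_def)
   have "carrier P \<subseteq> V"
   proof
    fix z assume "z \<in> carrier P"
    with cyc obtain a where "a \<in> carrier A" "z = a *[P] y" by (rule cyclicE)
    then show "z \<in> V" using V1 \<open>y \<in> V\<close> by (simp add: P.submodule_iff)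
   qed
   then show False using V1 V3 by (auto simp: P.submodule_iff)
  qed
  have "p z = \<zero>[S]" if z: "z \<in> U" for z
  proof -
   have zc: "z \<in> carrier P" using z U(1) by (auto simp: P.submodule_iff)
   with cyc obtain a where a: "a \<in> carrier A" "z = a *[P] y" by (rule cyclicE)
   have "?g z = \<zero>[T]" using g0[OF zc] z V2 by blast
   then have "a *[T] t = \<zero>[T]" unfolding t_def a(2) using module_homD(3)[OF g a(1) y] by simp
   then have "a *[S] s = \<zero>[S]" by (rule only[OF T sT t t0 et a(1)])
   then show ?thesis using module_homD(3)[OF p(1) a(1) y] a(2) p(2) by simp
  qed
  moreover have "s \<in> p ` U" using U(2) s(1) by simp
  ultimately show False using s(2) by auto
 qed
 then show ?thesis
  unfolding is_projective_cover_def
  using projective_idem_gen[OF P] p(1) surj by blast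
qed

end

section \<open>The three quiver algebras\<close>

text \<open>
 \<open>alt u n\<close> is the alternating path of length \<open>n\<close> from \<open>u\<close> that avoids the loops. In all three
 algebras a basis is given by the alternating paths of length at most \<open>N\<close> and the loops; the
 square of the loop at \<open>u\<close> equals \<open>alt u N\<close>, and all other paths vanish.
\<close>

primrec alt :: "nat \<Rightarrow> nat \<Rightarrow> arrow list" where
 "alt u 0 = []"
| "alt u (Suc n) = (if u = 1 then Mu else Nu) # alt (3 - u) n"

definition loop :: "nat \<Rightarrow> arrow"
 where "loop u = (if u = 1 then Alpha else Beta)"

definition swp :: "nat \<Rightarrow> nat \<Rightarrow> nat"
 where "swp u k = (if even k then u else 3 - u)"

lemma length_alt [simp]: "length (alt u n) = n"
 by (induction n arbitrary: u) auto

lemma loop_notin_alt [simp]: "Alpha \<notin> set (alt u n)" "Beta \<notin> set (alt u n)"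
 by (induction n arbitrary: u) auto

text \<open>\<open>N\<close> is 2 for A(2,1,2) and 4 for the other two algebras. Being even, it
  makes \<open>alt u N\<close> a closed path, as the square of the loop is.\<close>

locale alt_quiver =
 fixes Q :: "(nat, arrow) pre_digraph" and R :: "(nat \<times> arrow list \<Rightarrow> 'k::field) set" and N :: nat
 assumes vertsQ: "verts Q = {1, 2}" and arcsQ: "{Alpha, Mu, Nu} \<subseteq> arcs Q"
  and tailQ: "tail Q = arrow_tail" and headQ: "head Q = arrow_head"
  and N: "even N" "2 \<le> N"
begin

abbreviation "PA \<equiv> path_algebra Q :: ('k, nat \<times> arrow list \<Rightarrow> 'k) module"
abbreviation "I \<equiv> genideal PA R"
abbreviation "A \<equiv> bound_quiver_algebra Q R"

text \<open>At basis paths, the coefficients of the class of \<open>f\<close>: the double loop is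
  folded into \<open>alt u N\<close>, to which it is congruent.\<close>

definition coord :: "(nat \<times> arrow list \<Rightarrow> 'k) \<Rightarrow> nat \<times> arrow list \<Rightarrow> 'k"
 where "coord f = (\<lambda>(u, es). f (u, es) + (if es = alt u N then f (u, [loop u, loop u]) else 0))"

definition basis_paths :: "(nat \<times> arrow list) set"
 where "basis_paths = {(u, alt u n) |u n. u \<in> {1, 2} \<and> n \<le> N} \<union> {(u, [loop u]) |u. u \<in> {1, 2} \<and> loop u \<in> arcs Q}"

text \<open>A description of the ideal of relations by coordinates. That it is an ideal and contains
  the relations makes the classes of the basis paths independent; \<open>path_cases\<close> makes
  them span.\<close>

definition J :: "(nat \<times> arrow list \<Rightarrow> 'k) set"
 where "J = {f \<in> carrier PA. \<forall>b\<in>basis_paths. coord f b = 0}"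

lemma finQ: "finite (verts Q)" and headsQ: "e \<in> arcs Q ==> head Q e \<in> verts Q"
 by (simp_all add: vertsQ headQ) (cases e; simp)

sublocale PA: kalg PA
 by (rule kalg_path_algebra[OF finQ headsQ])

lemma elem_closed: "(u, es) \<in> paths Q ==> (path_elem u es :: _ \<Rightarrow> 'k) \<in> carrier PA"
 by (rule path_elem_closed[OF finQ headsQ])

lemma elem_mult:
 "path_elem u xs **[PA] path_elem v ys = (if v = path_end Q u xs then path_elem u (xs @ ys) else (\<lambda>_. 0 :: 'k))"
 by (rule path_elem_mult[OF finQ headsQ])

lemma alt_path: "u \<in> {1, 2} ==> (u, alt u n) \<in> paths Q"
proof (induction n arbitrary: u)
 case (Suc n)
 then have "(3 - u, alt (3 - u) n) \<in> paths Q" by auto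
 then show ?case using Suc.prems arcsQ by (auto simp: paths_iff vertsQ tailQ headQ)
qed (auto simp: paths_iff vertsQ)

lemma path_end_alt: "u \<in> {1, 2} ==> path_end Q u (alt u n) = swp u n"
proof (induction n arbitrary: u)
 case (Suc n)
 then have "path_end Q (3 - u) (alt (3 - u) n) = swp (3 - u) n" by auto
 then show ?case using Suc.prems by (auto simp: path_end_def headQ swp_def split: if_splits)
qed (auto simp: path_end_def swp_def)

lemma swp_verts: "u \<in> {1, 2} ==> swp u n \<in> {1, 2}"
 by (auto simp: swp_def)

lemma take_alt: "k \<le> n ==> take k (alt u n) = alt u k"
proof (induction k arbitrary: u n)
 case (Suc k)
 then show ?case by (cases n) auto
qed simp

lemma drop_alt: "u \<in> {1, 2} ==> k \<le> n ==> drop k (alt u n) = alt (swp u k) (n - k)"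
proof (induction k arbitrary: u n)
 case (Suc k)
 then obtain m where m: "n = Suc m" by (cases n) auto
 have "drop k (alt (3 - u) m) = alt (swp (3 - u) k) (m - k)" using Suc m by auto
 moreover have "swp (3 - u) k = swp u (Suc k)" using Suc.prems by (auto simp: swp_def)
 ultimately show ?case using m by simp
qed (simp add: swp_def)

lemma alt_neq_loop [simp]: "alt u n \<noteq> [loop v]" "alt u n \<noteq> [loop v, loop w]" "[loop v] \<noteq> alt u n" "[loop v, loop w] \<noteq> alt u n"
proof -
 have s: "set (alt u n) \<subseteq> {Mu, Nu}" by (induction n arbitrary: u) auto
 have l: "loop w \<notin> {Mu, Nu}" for w by (simp add: loop_def)
 show a: "alt u n \<noteq> [loop v]"
 proof
  assume "alt u n = [loop v]"
  then show False using s l[of v] by simp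
 qed
 show b: "alt u n \<noteq> [loop v, loop w]"
 proof
  assume "alt u n = [loop v, loop w]"
  then show False using s l[of v] by simp
 qed
 show "[loop v] \<noteq> alt u n" "[loop v, loop w] \<noteq> alt u n" using a b by (simp_all add: eq_commute)
qed

text \<open>Prefixes and suffixes of an alternating path alternate, so a product at such a path sees
  only values at alternating paths.\<close>

lemma mult_alt:
 assumes "u \<in> {1, 2}"
 shows "(f **[PA] g) (u, alt u n) = (\<Sum>k\<le>n. f (u, alt u k) * g (swp u k, alt (swp u k) (n - k)))"
 unfolding path_algebra_mult using assms
 by (intro sum.cong) (simp_all add: take_alt drop_alt path_end_alt)

lemma end_loop: "u \<in> {1, 2} ==> path_end Q u [loop u] = u" "u \<in> {1, 2} ==> path_end Q u [loop u, loop u] = u"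
 by (auto simp: path_end_def headQ loop_def)

lemma mult_loop:
 assumes "u \<in> {1, 2}"
 shows "(f **[PA] g) (u, [loop u]) = f (u, []) * g (u, [loop u]) + f (u, [loop u]) * g (u, [])"
  "(f **[PA] g) (u, [loop u, loop u]) =
   f (u, []) * g (u, [loop u, loop u]) + f (u, [loop u]) * g (u, [loop u]) + f (u, [loop u, loop u]) * g (u, [])"
 using assms by (simp_all add: path_algebra_mult end_loop atMost_Suc numeral_2_eq_2 path_end_def[of Q u "[]"] add_ac)

text \<open>The form is uniform in \<open>u\<close> although \<open>one_loop_quiver\<close> has no
  arrow \<open>Beta\<close>: every member of the path algebra vanishes at lists of arrows that are
  not paths.\<close>

lemma J_iff:
 "f \<in> J \<longleftrightarrow> f \<in> carrier PA \<and> (\<forall>u\<in>{1, 2}. (\<forall>n<N. f (u, alt u n) = 0) \<and> f (u, [loop u]) = 0 \<and>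
  f (u, alt u N) + f (u, [loop u, loop u]) = 0)"
proof -
 have alt_inj: "alt u n = alt u m \<longleftrightarrow> n = m" for u n m by (metis length_alt)
 have co: "coord f (u, alt u n) = f (u, alt u n) + (if n = N then f (u, [loop u, loop u]) else 0)"
  "coord f (u, [loop u]) = f (u, [loop u])" for u n
  by (simp_all add: coord_def alt_inj)
 have nl: "f (u, [loop u]) = 0" if "f \<in> carrier PA" "loop u \<notin> arcs Q" for u
 proof (rule ccontr)
  assume "f (u, [loop u]) \<noteq> 0"
  then have "(u, [loop u]) \<in> paths Q" using that by auto
  then show False using that by (simp add: paths_iff)
 qed
 show ?thesis
 proof
  assume f: "f \<in> J"
  then have fc: "f \<in> carrier PA" and b: "\<And>p. p \<in> basis_paths ==> coord f p = 0" by (auto simp: J_def)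
  show "f \<in> carrier PA \<and> (\<forall>u\<in>{1, 2}. (\<forall>n<N. f (u, alt u n) = 0) \<and> f (u, [loop u]) = 0 \<and>
   f (u, alt u N) + f (u, [loop u, loop u]) = 0)"
  proof (intro conjI ballI allI impI fc)
   fix u :: nat assume u: "u \<in> {1, 2}"
   have *: "coord f (u, alt u n) = 0" if "n \<le> N" for n
    by (rule b) (use u that in \<open>auto simp: basis_paths_def\<close>)
   show "f (u, alt u n) = 0" if "n < N" for n using *[of n] that by (simp add: co)
   show "f (u, alt u N) + f (u, [loop u, loop u]) = 0" using *[of N] by (simp add: co)
   show "f (u, [loop u]) = 0"
   proof (cases "loop u \<in> arcs Q")
    case True
    then show ?thesis using b[of "(u, [loop u])"] u by (auto simp: basis_paths_def co)
   qed (rule nl[OF fc])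
  qed
 next
  assume r: "f \<in> carrier PA \<and> (\<forall>u\<in>{1, 2}. (\<forall>n<N. f (u, alt u n) = 0) \<and> f (u, [loop u]) = 0 \<and>
   f (u, alt u N) + f (u, [loop u, loop u]) = 0)"
  have "coord f p = 0" if p: "p \<in> basis_paths" for p
  proof -
   consider u n where "p = (u, alt u n)" "u \<in> {1, 2}" "n \<le> N" | u where "p = (u, [loop u])" "u \<in> {1, 2}"
    using p by (auto simp: basis_paths_def)
   then show ?thesis using r by cases (auto simp: co le_less)
  qed
  then show "f \<in> J" using r by (simp add: J_def)
 qed
qed

text \<open>A member of \<open>J\<close> vanishes at alternating paths shorter than \<open>N\<close>
  and at single loops. In a product only the value of the other factor at a trivial path survives,
  and it multiplies the values at \<open>alt u N\<close> and at the double loop alike, so their sum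
  stays zero.\<close>

lemma ideal_J: "ideal J PA"
proof (rule idealI)
 show "ring PA" by (rule PA.ring_axioms)
 show "subgroup J (add_monoid PA)"
 proof -
  have JD: "f \<in> carrier PA" "\<And>u n. [|u \<in> {1, 2}; n < N|] ==> f (u, alt u n) = 0"
   "\<And>u. u \<in> {1, 2} ==> f (u, [loop u]) = 0" "\<And>u. u \<in> {1, 2} ==> f (u, [loop u, loop u]) = - f (u, alt u N)"
   if f: "f \<in> J" for f
  proof -
   show "f \<in> carrier PA" using f unfolding J_iff by (elim conjE)
   have *: "(\<forall>n<N. f (u, alt u n) = 0) \<and> f (u, [loop u]) = 0 \<and> f (u, alt u N) + f (u, [loop u, loop u]) = 0"
    if "u \<in> {1, 2}" for u using f that unfolding J_iff by (elim conjE) (rule bspec)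
   show "f (u, alt u n) = 0" if "u \<in> {1, 2}" "n < N" for u n using *[OF that(1)] that(2) by simp
   show "f (u, [loop u]) = 0" if "u \<in> {1, 2}" for u using *[OF that] by simp
   have "f (u, alt u N) + f (u, [loop u, loop u]) = 0" if "u \<in> {1, 2}" for u using *[OF that] by simp
   then show "f (u, [loop u, loop u]) = - f (u, alt u N)" if "u \<in> {1, 2}" for u
    using that by (simp only: add_eq_0_iff)
  qed
  have cl: "f +[PA] g \<in> J" if f: "f \<in> J" and g: "g \<in> J" for f g
   unfolding J_iff
  proof (intro conjI ballI allI impI)
   show "f +[PA] g \<in> carrier PA" by (rule PA.a_closed[OF JD(1)[OF f] JD(1)[OF g]])
   fix u :: nat assume u: "u \<in> {1, 2}"
   show "(f +[PA] g) (u, alt u n) = 0" if "n < N" for n using JD(2)[OF f u that] JD(2)[OF g u that] by simp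
   show "(f +[PA] g) (u, [loop u]) = 0" using JD(3)[OF f u] JD(3)[OF g u] by simp
   show "(f +[PA] g) (u, alt u N) + (f +[PA] g) (u, [loop u, loop u]) = 0"
    using JD(4)[OF f u] JD(4)[OF g u] by simp
  qed
  have inv: "\<ominus>\<^bsub>PA\<^esub> f \<in> J" if f: "f \<in> J" for f
   unfolding J_iff
  proof (intro conjI ballI allI impI)
   note fc = JD(1)[OF f]
   have e: "\<ominus>\<^bsub>PA\<^esub> f = (\<lambda>p. - f p)" using PA.scale_minus_one[OF fc] by simp
   show "\<ominus>\<^bsub>PA\<^esub> f \<in> carrier PA" using fc by (rule PA.a_inv_closed)
   fix u :: nat assume u: "u \<in> {1, 2}"
   show "(\<ominus>\<^bsub>PA\<^esub> f) (u, alt u n) = 0" if "n < N" for n unfolding e using JD(2)[OF f u that] by simp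
   show "(\<ominus>\<^bsub>PA\<^esub> f) (u, [loop u]) = 0" unfolding e using JD(3)[OF f u] by simp
   show "(\<ominus>\<^bsub>PA\<^esub> f) (u, alt u N) + (\<ominus>\<^bsub>PA\<^esub> f) (u, [loop u, loop u]) = 0"
    unfolding e using JD(4)[OF f u] by simp
  qed
  have "subgroup J (add_monoid PA)"
  proof (rule subgroup.intro)
   show "J \<subseteq> carrier (add_monoid PA)" by (auto simp: J_iff)
   show "x **[add_monoid PA] y \<in> J" if "x \<in> J" "y \<in> J" for x y using cl[OF that] by simp
   have "\<zero>[PA] \<in> J" unfolding J_iff using PA.zero_closed by (intro conjI) simp_all
   then show "\<one>[add_monoid PA] \<in> J" by simp
   show "inv\<^bsub>add_monoid PA\<^esub> x \<in> J" if "x \<in> J" for x using inv[OF that] by (simp add: a_inv_def)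
  qed
  then show ?thesis .
 qed
next
 fix f g assume f: "f \<in> J" and g: "g \<in> carrier PA"
 have fc: "f \<in> carrier PA" using f unfolding J_iff by (elim conjE)
 have *: "(\<forall>n<N. f (u, alt u n) = 0) \<and> f (u, [loop u]) = 0 \<and> f (u, alt u N) + f (u, [loop u, loop u]) = 0"
  if "u \<in> {1, 2}" for u using f that unfolding J_iff by (elim conjE) (rule bspec)
 have f1: "f (u, alt u n) = 0" if "u \<in> {1, 2}" "n < N" for u n using *[OF that(1)] that(2) by simp
 have f2: "f (u, [loop u]) = 0" if "u \<in> {1, 2}" for u using *[OF that] by simp
 have "f (u, alt u N) + f (u, [loop u, loop u]) = 0" if "u \<in> {1, 2}" for u using *[OF that] by simp
 then have f3: "f (u, [loop u, loop u]) = - f (u, alt u N)" if "u \<in> {1, 2}" for u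
  using that by (simp only: add_eq_0_iff)
 have f0: "f (u, []) = 0" if "u \<in> {1, 2}" for u using f1[OF that, of 0] N by simp
 have Npos: "0 < N" using N by simp
 \<comment> \<open>For \<open>k > 0\<close> the factor \<open>f\<close> is evaluated at an
   alternating path of length less than \<open>N\<close>.\<close>
 have alt_l: "(g **[PA] f) (u, alt u n) = (if n = N then g (u, []) * f (u, alt u N) else 0)"
  if u: "u \<in> {1, 2}" and n: "n \<le> N" for u n
 proof -
  have "(g **[PA] f) (u, alt u n) = (\<Sum>k\<le>n. if k = 0 then (if n = N then g (u, []) * f (u, alt u N) else 0) else 0)"
   unfolding mult_alt[OF u]
  proof (rule sum.cong[OF refl])
   fix k assume "k \<in> {..n}"
   then show "g (u, alt u k) * f (swp u k, alt (swp u k) (n - k)) =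
     (if k = 0 then (if n = N then g (u, []) * f (u, alt u N) else 0) else 0)"
    using f1[OF swp_verts[OF u], of "n - k" k] n u by (cases "k = 0"; cases "n = N") (auto simp: swp_def)
  qed
  then show ?thesis by simp
 qed
 \<comment> \<open>Only \<open>k = N\<close> survives. The path has then returned to
   \<open>u\<close>, because \<open>N\<close> is even, and \<open>g\<close> is evaluated at the
   trivial path there.\<close>
 have alt_r: "(f **[PA] g) (u, alt u n) = (if n = N then f (u, alt u N) * g (u, []) else 0)"
  if u: "u \<in> {1, 2}" and n: "n \<le> N" for u n
 proof -
  have "(f **[PA] g) (u, alt u n) = (\<Sum>k\<le>n. if k = N then f (u, alt u N) * g (u, []) else 0)"
   unfolding mult_alt[OF u]
  proof (rule sum.cong[OF refl])
   fix k assume "k \<in> {..n}"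
   then show "f (u, alt u k) * g (swp u k, alt (swp u k) (n - k)) = (if k = N then f (u, alt u N) * g (u, []) else 0)"
    using f1[OF u, of k] n N(1) by (cases "k = N") (auto simp: swp_def)
  qed
  then show ?thesis using n by auto
 qed
 show "g **[PA] f \<in> J"
  unfolding J_iff
 proof (intro conjI ballI allI impI)
  show "g **[PA] f \<in> carrier PA" by (rule PA.m_closed[OF g fc])
  fix u :: nat assume u: "u \<in> {1, 2}"
  show "(g **[PA] f) (u, alt u n) = 0" if "n < N" for n using alt_l[OF u, of n] that by simp
  show "(g **[PA] f) (u, [loop u]) = 0" unfolding mult_loop[OF u] using f0[OF u] f2[OF u] by simp
  show "(g **[PA] f) (u, alt u N) + (g **[PA] f) (u, [loop u, loop u]) = 0"
   unfolding mult_loop[OF u] alt_l[OF u order_refl] using f0[OF u] f2[OF u] f3[OF u] by simp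
 qed
 show "f **[PA] g \<in> J"
  unfolding J_iff
 proof (intro conjI ballI allI impI)
  show "f **[PA] g \<in> carrier PA" by (rule PA.m_closed[OF fc g])
  fix u :: nat assume u: "u \<in> {1, 2}"
  show "(f **[PA] g) (u, alt u n) = 0" if "n < N" for n using alt_r[OF u, of n] that by simp
  show "(f **[PA] g) (u, [loop u]) = 0" unfolding mult_loop[OF u] using f0[OF u] f2[OF u] by simp
  show "(f **[PA] g) (u, alt u N) + (f **[PA] g) (u, [loop u, loop u]) = 0"
   unfolding mult_loop[OF u] alt_r[OF u order_refl] using f0[OF u] f2[OF u] f3[OF u] by simp
 qed
qed

end

text \<open>A common interface to the three sets of relations: \<open>R_J\<close> bounds the ideal
  from above, the other assumptions from below.\<close>

locale alt_quiver_rels = alt_quiver Q R N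
 for Q and R :: "(nat \<times> arrow list \<Rightarrow> 'k::field) set" and N +
 assumes R_J: "R \<subseteq> J"
  and rel_am: "path_elem 1 [Alpha, Mu] \<in> R" and rel_na: "path_elem 2 [Nu, Alpha] \<in> R"
  and rel_mb: "Beta \<in> arcs Q ==> path_elem 1 [Mu, Beta] \<in> R"
  and rel_bn: "Beta \<in> arcs Q ==> path_elem 2 [Beta, Nu] \<in> R"
  and rel_loop: "[|u \<in> {1, 2}; loop u \<in> arcs Q|] ==>
   path_elem u [loop u, loop u] \<ominus>\<^bsub>PA\<^esub> path_elem u (alt u N) \<in> R"
begin

lemma R_closed: "R \<subseteq> carrier PA"
 using R_J by (auto simp: J_def)

sublocale I: ideal I PA
 by (rule PA.genideal_ideal[OF R_closed])

lemma in_I: "r \<in> R ==> r \<in> I"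
 using PA.genideal_self[OF R_closed] by blast

lemma I_J: "I \<subseteq> J"
 by (rule PA.genideal_minimal[OF ideal_J R_J])

sublocale A: kalg A
 unfolding bound_quiver_algebra_def by (rule PA.kalg_quotient[OF I.ideal_axioms])

lemma I_minus: "[|x \<in> I; y \<in> I|] ==> x \<ominus>\<^bsub>PA\<^esub> y \<in> I"
 unfolding a_minus_def
 by (intro additive_subgroup.a_closed[OF ideal.axioms(1)[OF I.ideal_axioms]]
   additive_subgroup.a_inv_closed[OF ideal.axioms(1)[OF I.ideal_axioms]])

lemma I_zero: "(\<lambda>_. 0) \<in> I"
 using additive_subgroup.zero_closed[OF ideal.axioms(1)[OF I.ideal_axioms]] by (simp only: path_algebra_simps)

lemma elem_I_append:
 assumes p: "(u, xs @ ys @ zs) \<in> paths Q" and y: "path_elem (path_end Q u xs) ys \<in> I"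
 shows "path_elem u (xs @ ys @ zs) \<in> I"
proof -
 let ?v = "path_end Q u xs"
 have 1: "(u, xs) \<in> paths Q" "(?v, ys) \<in> paths Q" "(path_end Q ?v ys, zs) \<in> paths Q"
  using p by (simp_all add: paths_append[OF finQ headsQ])
 have "path_elem ?v (ys @ zs) = path_elem ?v ys **[PA] path_elem (path_end Q ?v ys) zs"
  by (simp add: elem_mult)
 also have "\<dots> \<in> I" by (rule I.I_r_closed[OF y elem_closed[OF 1(3)]])
 finally have 2: "path_elem ?v (ys @ zs) \<in> I" .
 have "path_elem u (xs @ ys @ zs) = path_elem u xs **[PA] path_elem ?v (ys @ zs)"
  by (simp add: elem_mult)
 also have "\<dots> \<in> I" by (rule I.I_l_closed[OF 2 elem_closed[OF 1(1)]])
 finally show ?thesis .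
qed

lemma elem_I_transfer:
 assumes "f \<ominus>\<^bsub>PA\<^esub> g \<in> I" "f \<in> carrier PA" "g \<in> carrier PA" "f \<in> I"
 shows "g \<in> I"
proof -
 have "g = f \<ominus>\<^bsub>PA\<^esub> (f \<ominus>\<^bsub>PA\<^esub> g)"
  using assms(2,3) by (simp add: PA.minus_eq PA.minus_add PA.a_assoc[symmetric] PA.r_neg del: path_algebra_simps)
 also have "\<dots> \<in> I" using assms(4,1) by (rule I_minus)
 finally show ?thesis .
qed

lemma loop_sq:
 assumes "u \<in> {1, 2}" "loop u \<in> arcs Q"
 shows "path_elem u [loop u, loop u] \<ominus>\<^bsub>PA\<^esub> path_elem u (alt u N) \<in> I"
  "(u, [loop u, loop u]) \<in> paths Q" "(u, [loop u]) \<in> paths Q"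
 using in_I[OF rel_loop[OF assms]] assms by (auto simp: paths_iff vertsQ tailQ headQ loop_def)

text \<open>Multiply the relation between the square of \<open>Alpha\<close> and
  \<open>alt 1 N\<close> by \<open>Mu\<close> on the right: the first term contains
  \<open>Alpha\<close> followed by \<open>Mu\<close>, a relation.\<close>

lemma alt_Suc_N_1: "path_elem 1 (alt 1 (Suc N)) \<in> I"
proof -
 have p: "(1, alt 1 N) \<in> paths Q" "(1, [Mu]) \<in> paths Q" "(1, [Alpha, Alpha]) \<in> paths Q" "(1, [Alpha, Alpha, Mu]) \<in> paths Q"
  using arcsQ alt_path[of 1 N] by (auto simp: paths_iff vertsQ tailQ headQ)
 have s: "path_elem 1 [Alpha, Alpha] \<ominus>\<^bsub>PA\<^esub> path_elem 1 (alt 1 N) \<in> I"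
  using loop_sq(1)[of 1] arcsQ by (simp add: loop_def)
 have e: "path_end Q 1 (alt 1 N) = 1" using path_end_alt[of 1 N] N by (simp add: swp_def)
 have app: "alt 1 N @ [Mu] = alt 1 (Suc N)"
 proof -
  have "alt 1 (Suc N) = take N (alt 1 (Suc N)) @ drop N (alt 1 (Suc N))" by simp
  also have "\<dots> = alt 1 N @ alt (swp 1 N) 1" by (subst take_alt, simp, subst drop_alt) simp_all
  finally show ?thesis using N by (simp add: swp_def)
 qed
 have "(path_elem 1 [Alpha, Alpha] \<ominus>\<^bsub>PA\<^esub> path_elem 1 (alt 1 N)) **[PA] path_elem 1 [Mu] \<in> I"
  by (rule I.I_r_closed[OF s elem_closed[OF p(2)]])
 also have "(path_elem 1 [Alpha, Alpha] \<ominus>\<^bsub>PA\<^esub> path_elem 1 (alt 1 N)) **[PA] path_elem 1 [Mu] =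
   path_elem 1 [Alpha, Alpha] **[PA] path_elem 1 [Mu] \<ominus>\<^bsub>PA\<^esub> path_elem 1 (alt 1 N) **[PA] path_elem 1 [Mu]"
  using elem_closed[OF p(1)] elem_closed[OF p(2)] elem_closed[OF p(3)]
  by (simp add: PA.minus_eq PA.l_distr PA.l_minus del: path_algebra_simps)
 also have "\<dots> = path_elem 1 [Alpha, Alpha, Mu] \<ominus>\<^bsub>PA\<^esub> path_elem 1 (alt 1 (Suc N))"
  unfolding elem_mult e app using app by (simp add: path_end_def headQ del: path_algebra_simps alt.simps)
 finally have d: "path_elem 1 [Alpha, Alpha, Mu] \<ominus>\<^bsub>PA\<^esub> path_elem 1 (alt 1 (Suc N)) \<in> I" .
 have i: "path_elem 1 [Alpha, Alpha, Mu] \<in> I"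
  using elem_I_append[of 1 "[Alpha]" "[Alpha, Mu]" "[]"] p(4) in_I[OF rel_am] by (simp add: path_end_def headQ)
 show ?thesis
  by (rule elem_I_transfer[OF d elem_closed[OF p(4)] elem_closed[OF alt_path] i]) simp
qed

text \<open>At vertex 2 the loop \<open>Alpha\<close> is used as well, since all three quivers have
  it: its square relation is multiplied by \<open>Nu\<close> on the left.\<close>

lemma alt_Suc_N: "u \<in> {1, 2} ==> path_elem u (alt u (Suc N)) \<in> I"
proof -
 have p: "(1, alt 1 N) \<in> paths Q" "(2, [Nu]) \<in> paths Q" "(1, [Alpha, Alpha]) \<in> paths Q" "(2, [Nu, Alpha, Alpha]) \<in> paths Q"
  using arcsQ alt_path[of 1 N] by (auto simp: paths_iff vertsQ tailQ headQ)
 have s: "path_elem 1 [Alpha, Alpha] \<ominus>\<^bsub>PA\<^esub> path_elem 1 (alt 1 N) \<in> I"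
  using loop_sq(1)[of 1] arcsQ by (simp add: loop_def)
 have app: "Nu # alt 1 N = alt 2 (Suc N)" by simp
 have e: "path_end Q 2 [Nu] = 1" by (simp add: path_end_def headQ)
 have "path_elem 2 [Nu] **[PA] (path_elem 1 [Alpha, Alpha] \<ominus>\<^bsub>PA\<^esub> path_elem 1 (alt 1 N)) \<in> I"
  by (rule I.I_l_closed[OF s elem_closed[OF p(2)]])
 also have "path_elem 2 [Nu] **[PA] (path_elem 1 [Alpha, Alpha] \<ominus>\<^bsub>PA\<^esub> path_elem 1 (alt 1 N)) =
   path_elem 2 [Nu] **[PA] path_elem 1 [Alpha, Alpha] \<ominus>\<^bsub>PA\<^esub> path_elem 2 [Nu] **[PA] path_elem 1 (alt 1 N)"
  using elem_closed[OF p(1)] elem_closed[OF p(2)] elem_closed[OF p(3)]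
  by (simp add: PA.minus_eq PA.r_distr PA.r_minus del: path_algebra_simps)
 also have "\<dots> = path_elem 2 [Nu, Alpha, Alpha] \<ominus>\<^bsub>PA\<^esub> path_elem 2 (alt 2 (Suc N))"
  unfolding elem_mult e app[symmetric] by (simp del: path_algebra_simps)
 finally have d: "path_elem 2 [Nu, Alpha, Alpha] \<ominus>\<^bsub>PA\<^esub> path_elem 2 (alt 2 (Suc N)) \<in> I" .
 have i: "path_elem 2 [Nu, Alpha, Alpha] \<in> I"
  using elem_I_append[of 2 "[]" "[Nu, Alpha]" "[Alpha]"] p(4) in_I[OF rel_na] by (simp add: path_end_def)
 have "path_elem 2 (alt 2 (Suc N)) \<in> I"
  by (rule elem_I_transfer[OF d elem_closed[OF p(4)] elem_closed[OF alt_path] i]) simp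
 then show "u \<in> {1, 2} ==> path_elem u (alt u (Suc N)) \<in> I" using alt_Suc_N_1 by auto
qed

lemma loop_alt_I:
 assumes "u \<in> {1, 2}" "(u, loop u # alt u (Suc m)) \<in> paths Q"
 shows "path_elem u (loop u # alt u (Suc m)) \<in> I"
proof (cases "u = 1")
 case True
 then show ?thesis
  using elem_I_append[of 1 "[]" "[Alpha, Mu]" "alt 2 m"] assms in_I[OF rel_am]
  by (simp add: path_end_def loop_def numeral_2_eq_2)
next
 case False
 then have u: "u = 2" using assms by simp
 have "Beta \<in> arcs Q" using assms u by (simp add: paths_iff loop_def)
 then show ?thesis
  using elem_I_append[of 2 "[]" "[Beta, Nu]" "alt 1 m"] assms in_I[OF rel_bn] u
  by (simp add: path_end_def loop_def)
qed

text \<open>Modulo \<open>I\<close> the cube is the loop followed by \<open>alt u N\<close>, whose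
  first arrow forms a relation with the loop.\<close>

lemma loop_cube:
 assumes "u \<in> {1, 2}" "loop u \<in> arcs Q"
 shows "path_elem u [loop u, loop u, loop u] \<in> I"
proof -
 have p: "(u, [loop u]) \<in> paths Q" "(u, [loop u, loop u]) \<in> paths Q" "(u, alt u N) \<in> paths Q"
  "(u, [loop u, loop u, loop u]) \<in> paths Q"
  using loop_sq[OF assms] alt_path[OF assms(1)] assms by (auto simp: paths_iff tailQ headQ loop_def)
 have pa: "(u, [loop u] @ alt u N) \<in> paths Q"
  using p by (simp only: paths_append[OF finQ headsQ] end_loop[OF assms(1)] simp_thms)
 obtain m where m: "N = Suc m" using N by (cases N) auto
 have ca: "path_elem u ([loop u] @ alt u N) \<in> I"
  using loop_alt_I[OF assms(1), of m] pa by (simp only: m append.simps)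
 have "path_elem u [loop u] **[PA] (path_elem u [loop u, loop u] \<ominus>\<^bsub>PA\<^esub> path_elem u (alt u N)) \<in> I"
  by (rule I.I_l_closed[OF loop_sq(1)[OF assms] elem_closed[OF p(1)]])
 also have "path_elem u [loop u] **[PA] (path_elem u [loop u, loop u] \<ominus>\<^bsub>PA\<^esub> path_elem u (alt u N)) =
   path_elem u [loop u] **[PA] path_elem u [loop u, loop u] \<ominus>\<^bsub>PA\<^esub> path_elem u [loop u] **[PA] path_elem u (alt u N)"
  using elem_closed[OF p(1)] elem_closed[OF p(2)] elem_closed[OF p(3)]
  by (simp add: PA.minus_eq PA.r_distr PA.r_minus del: path_algebra_simps)
 also have "\<dots> = path_elem u [loop u, loop u, loop u] \<ominus>\<^bsub>PA\<^esub> path_elem u ([loop u] @ alt u N)"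
  unfolding elem_mult end_loop[OF assms(1)] by (simp del: path_algebra_simps)
 finally have d: "path_elem u [loop u, loop u, loop u] \<ominus>\<^bsub>PA\<^esub> path_elem u ([loop u] @ alt u N) \<in> I" .
 have "(path_elem u [loop u, loop u, loop u] \<ominus>\<^bsub>PA\<^esub> path_elem u ([loop u] @ alt u N)) +[PA] path_elem u ([loop u] @ alt u N) \<in> I"
  using d ca by (rule I.a_closed)
 then show ?thesis
  using elem_closed[OF p(4)] elem_closed[OF pa]
  by (simp add: PA.minus_eq PA.a_assoc PA.l_neg del: path_algebra_simps append.simps)
qed

text \<open>Up to \<open>I\<close>, the normal forms are closed under putting an arrow in front: an
  alternating path vanishes once it has length \<open>N + 1\<close>, a loop vanishes at its third
  power, and every passage between a loop and another arrow is a relation.\<close>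

lemma path_cases:
 assumes "(u, es) \<in> paths Q"
 shows "path_elem u es \<in> I \<or> (\<exists>n\<le>N. es = alt u n) \<or> es = [loop u] \<or> es = [loop u, loop u]"
 using assms
proof (induction es arbitrary: u)
 case Nil
 then show ?case by (auto intro!: exI[of _ 0])
next
 case (Cons e es)
 have u: "u \<in> {1, 2}" and e: "e \<in> arcs Q" and te: "arrow_tail e = u"
  using Cons.prems by (auto simp: paths_iff vertsQ tailQ)
 define w where "w = arrow_head e"
 have pw: "(w, es) \<in> paths Q" and pe: "(u, [e]) \<in> paths Q" and ew: "path_end Q u [e] = w"
  using Cons.prems paths_append[OF finQ headsQ, of u "[e]" es] by (auto simp: path_end_def headQ w_def)
 have w: "w \<in> {1, 2}" by (cases e) (auto simp: w_def)
 have pre: "path_elem u (e # es) \<in> I" if "es = ys @ zs" "path_elem u (e # ys) \<in> I" for ys zs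
  using elem_I_append[of u "[]" "e # ys" zs] Cons.prems that by (simp add: path_end_def)
 from Cons.IH[OF pw] consider "path_elem w es \<in> I" | n where "n \<le> N" "es = alt w n" | "es = [loop w]" | "es = [loop w, loop w]"
  by blast
 then show ?case
 proof cases
  case 1
  then show ?thesis using elem_I_append[of u "[e]" es "[]"] Cons.prems ew by simp
 next
  case (2 n)
  show ?thesis
  proof (cases "e = loop u")
   case True
   then have "w = u" using te by (auto simp: w_def loop_def)
   show ?thesis
   proof (cases n)
    case 0
    then show ?thesis using 2 True by simp
   next
    case (Suc m)
    then show ?thesis using loop_alt_I[OF u, of m] Cons.prems 2 True \<open>w = u\<close> by simp
   qed
  next
   case False
   then have "e # es = alt u (Suc n)" using te 2 by (cases e) (auto simp: w_def loop_def)
   then show ?thesis using alt_Suc_N[OF u] 2 by (metis Suc_leI le_neq_implies_less)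
  qed
 next
  case 3
  show ?thesis
  proof (cases "e = loop u")
   case True
   then show ?thesis using 3 te by (auto simp: w_def loop_def)
  next
   case False
   have "Beta \<in> arcs Q" if "w = 2" using pw 3 that by (simp add: paths_iff loop_def)
   then show ?thesis using 3 te False in_I[OF rel_mb] in_I[OF rel_na] by (cases e) (auto simp: w_def loop_def)
  qed
 next
  case 4
  show ?thesis
  proof (cases "e = loop u")
   case True
   then show ?thesis using 4 te e loop_cube[OF u] by (auto simp: w_def loop_def split: if_splits)
  next
   case False
   have "Beta \<in> arcs Q" if "w = 2" using pw 4 that by (simp add: paths_iff loop_def)
   then have "path_elem u [e, loop w] \<in> I"
    using te False in_I[OF rel_mb] in_I[OF rel_na] by (cases e) (auto simp: w_def loop_def)
   then show ?thesis using pre[of "[loop w]" "[loop w]"] 4 by simp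
  qed
 qed
qed

end

lemma (in kalg) quotient_ops:
 assumes I: "ideal I A"
 shows "carrier (quotient_algebra A I) = (\<lambda>x. I +> x) ` carrier A"
  and "[|x \<in> carrier A; y \<in> carrier A|] ==> (I +> x) +[quotient_algebra A I] (I +> y) = I +> (x \<oplus> y)"
  and "[|x \<in> carrier A; y \<in> carrier A|] ==> (I +> x) **[quotient_algebra A I] (I +> y) = I +> (x \<otimes> y)"
  and "\<zero>[quotient_algebra A I] = I +> \<zero>" and "\<one>[quotient_algebra A I] = I +> \<one>"
  and "[|x \<in> carrier A; y \<in> carrier A|] ==> I +> x = I +> y \<longleftrightarrow> x \<ominus> y \<in> I"
proof -
 interpret I: ideal I A by fact
 show "carrier (quotient_algebra A I) = (\<lambda>x. I +> x) ` carrier A"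
  by (auto simp: quotient_algebra_def FactRing_def A_RCOSETS_def')
 show "(I +> x) +[quotient_algebra A I] (I +> y) = I +> (x \<oplus> y)" if "x \<in> carrier A" "y \<in> carrier A"
  using I.a_rcos_sum[OF that] by (simp add: quotient_algebra_def FactRing_def)
 show "(I +> x) **[quotient_algebra A I] (I +> y) = I +> (x \<otimes> y)" if "x \<in> carrier A" "y \<in> carrier A"
  using I.rcoset_mult_add[OF that] by (simp add: quotient_algebra_def FactRing_def)
 show "\<zero>[quotient_algebra A I] = I +> \<zero>"
  using a_coset_add_zero[OF I.a_subset] by (simp add: quotient_algebra_def FactRing_def)
 show "\<one>[quotient_algebra A I] = I +> \<one>" by (simp add: quotient_algebra_def FactRing_def)
 have "x \<ominus>\<^bsub>regular_module A\<^esub> y = x \<ominus> y"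
  by (simp add: a_minus_def a_inv_def m_inv_def)
 then show "I +> x = I +> y \<longleftrightarrow> x \<ominus> y \<in> I" if "x \<in> carrier A" "y \<in> carrier A"
  using coset_eq_iff[OF left_module_regular submodule_regular_ideal[OF I], of x y] that
  by (simp only: regular_coset regular_module_simps)
qed

lemma simple_hom_iso:
 assumes S: "simple_module A S" and T: "simple_module A T" and f: "f \<in> module_hom A S T"
  and x: "x \<in> carrier S" "f x \<noteq> \<zero>[T]"
 shows "module_iso A S T"
proof -
 have l: "left_module A S" "left_module A T" using S T simple_moduleD(1) by auto
 have k: "{y \<in> carrier S. f y = \<zero>[T]} = {\<zero>[S]} \<or> {y \<in> carrier S. f y = \<zero>[T]} = carrier S"
  by (rule simple_moduleD(3)[OF S module_hom_kernel_submodule[OF f l]])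
 have "x \<notin> {y \<in> carrier S. f y = \<zero>[T]}" using x by simp
 with k x(1) have k0: "{y \<in> carrier S. f y = \<zero>[T]} = {\<zero>[S]}" by metis
 show ?thesis
 proof (rule module_iso_by_surj[OF f l hom_to_simple[OF T l(1) f x]])
  fix y assume "y \<in> carrier S" "f y = \<zero>[T]"
  then have "y \<in> {y \<in> carrier S. f y = \<zero>[T]}" by simp
  then show "y = \<zero>[S]" unfolding k0 by simp
 qed
qed

context alt_quiver
begin

lemma PA_minus: "[|f \<in> carrier PA; g \<in> carrier PA|] ==> f \<ominus>\<^bsub>PA\<^esub> g = (\<lambda>p. f p - g p)"
 using PA.scale_minus_one[of g] by (simp add: PA.minus_eq flip: PA.scale_minus_one del: path_algebra_simps(1))

lemma path_elem_J:
 assumes p: "(u, es) \<in> paths Q" and n: "\<And>n. n \<le> N ==> es \<noteq> alt u n" "es \<noteq> [loop u]" "es \<noteq> [loop u, loop u]"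
 shows "path_elem u es \<in> J"
proof -
 have "(path_elem u es :: _ \<Rightarrow> 'k) (v, alt v n) = 0" if "n \<le> N" for v n using n(1)[OF that] by (auto simp: path_elem_def)
 moreover have "(path_elem u es :: _ \<Rightarrow> 'k) (v, [loop v]) = 0" "(path_elem u es :: _ \<Rightarrow> 'k) (v, [loop v, loop v]) = 0" for v
  using n(2,3) by (auto simp: path_elem_def)
 ultimately show ?thesis unfolding J_iff using elem_closed[OF p] by (simp del: path_algebra_simps)
qed

lemma loop_rel_J:
 assumes u: "u \<in> {1, 2}" and l: "loop u \<in> arcs Q"
 shows "path_elem u [loop u, loop u] \<ominus>\<^bsub>PA\<^esub> path_elem u (alt u N) \<in> J"
proof -
 have p: "(u, [loop u, loop u]) \<in> paths Q" "(u, alt u N) \<in> paths Q"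
  using u l alt_path[OF u] by (auto simp: paths_iff vertsQ tailQ headQ loop_def)
 note c = elem_closed[OF p(1)] elem_closed[OF p(2)]
 have alt_inj: "alt v n = alt v m \<longleftrightarrow> n = m" for v n m by (metis length_alt)
 have m: "path_elem u [loop u, loop u] \<ominus>\<^bsub>PA\<^esub> path_elem u (alt u N) \<in> carrier PA" using c by (rule PA.minus_closed)
 have e: "path_elem u [loop u, loop u] \<ominus>\<^bsub>PA\<^esub> path_elem u (alt u N) =
   (\<lambda>p. path_elem u [loop u, loop u] p - path_elem u (alt u N) p)" by (rule PA_minus[OF c])
 show ?thesis
  unfolding J_iff
 proof (rule conjI[OF m], unfold e, intro ballI conjI allI impI)
  fix v :: nat assume v: "v \<in> {1, 2}"
  show "path_elem u [loop u, loop u] (v, alt v n) - path_elem u (alt u N) (v, alt v n) = (0 :: 'k)" if "n < N" for n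
   using that by (cases "v = u") (simp_all add: path_elem_def alt_inj)
  show "path_elem u [loop u, loop u] (v, [loop v]) - path_elem u (alt u N) (v, [loop v]) = (0 :: 'k)"
   by (simp add: path_elem_def)
  show "path_elem u [loop u, loop u] (v, alt v N) - path_elem u (alt u N) (v, alt v N) +
    (path_elem u [loop u, loop u] (v, [loop v, loop v]) - path_elem u (alt u N) (v, [loop v, loop v])) = (0 :: 'k)"
   by (cases "v = u") (simp_all add: path_elem_def)
 qed
qed

end

section \<open>The path basis of the quiver algebras and their corners\<close>

context alt_quiver_rels
begin

definition cls :: "(nat \<times> arrow list \<Rightarrow> 'k) \<Rightarrow> (nat \<times> arrow list \<Rightarrow> 'k) set"
 where "cls f = I +>\<^bsub>PA\<^esub> f"

text \<open>The normal form of \<open>f\<close>, the combination of basis paths to which it is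
  congruent modulo \<open>I\<close>.\<close>

definition rep :: "(nat \<times> arrow list \<Rightarrow> 'k) \<Rightarrow> nat \<times> arrow list \<Rightarrow> 'k"
 where "rep f = (\<lambda>p. if p \<in> basis_paths then coord f p else 0)"

definition vert :: "nat \<Rightarrow> (nat \<times> arrow list \<Rightarrow> 'k) set"
 where "vert v = cls (path_elem v [])"

lemma path_class_cls: "path_class Q R u es = cls (path_elem u es)"
 by (simp add: path_class_def cls_def)

lemma cls_ops:
 "carrier A = cls ` carrier PA"
 "[|f \<in> carrier PA; g \<in> carrier PA|] ==> cls f +[A] cls g = cls (f +[PA] g)"
 "[|f \<in> carrier PA; g \<in> carrier PA|] ==> cls f **[A] cls g = cls (f **[PA] g)"
 "\<zero>[A] = cls \<zero>[PA]" "\<one>[A] = cls \<one>[PA]"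
 "[|f \<in> carrier PA; g \<in> carrier PA|] ==> cls f = cls g \<longleftrightarrow> f \<ominus>\<^bsub>PA\<^esub> g \<in> I"
 unfolding cls_def bound_quiver_algebra_def by (fact PA.quotient_ops[OF I.ideal_axioms])+

lemma cls_smult: "f \<in> carrier PA ==> c *[A] cls f = cls (c *[PA] f)"
 unfolding cls_def bound_quiver_algebra_def by (rule PA.quotient_coset_smult[OF I.ideal_axioms])

lemma cls_closed: "f \<in> carrier PA ==> cls f \<in> carrier A"
 unfolding cls_ops(1) by (rule imageI)

lemma basis_paths_eq:
 "basis_paths = (\<lambda>(u, n). (u, alt u n)) ` ({1, 2} \<times> {..N}) \<union> (\<lambda>u. (u, [loop u])) ` {u \<in> {1, 2}. loop u \<in> arcs Q}"
 unfolding basis_paths_def by (auto simp: image_iff)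

lemma finite_basis_paths: "finite basis_paths"
 unfolding basis_paths_eq by simp

lemma basis_paths_subset: "basis_paths \<subseteq> paths Q"
 using alt_path loop_sq(3) unfolding basis_paths_def by auto

lemma supported_closed:
 assumes "B \<subseteq> basis_paths" "\<And>p. p \<notin> B ==> g p = 0"
 shows "g \<in> carrier PA"
proof -
 have sub: "{p. g p \<noteq> 0} \<subseteq> B" using assms(2) by auto
 then have "finite {p. g p \<noteq> 0}" using finite_subset[OF _ finite_basis_paths] assms(1) by blast
 then show ?thesis using sub assms(1) basis_paths_subset by auto
qed

lemma rep_closed: "rep f \<in> carrier PA"
 by (rule supported_closed[of basis_paths]) (auto simp: rep_def)

lemma I_scale: "x \<in> I ==> c *[PA] x \<in> I"
 using I.I_l_closed[of x "c *[PA] \<one>[PA]"] PA.scal_one_mult[OF I.Icarr] PA.scal_one_closed by metis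

lemma double_loop_notin_basis: "(v, [loop v, loop v]) \<notin> basis_paths"
 by (auto simp: basis_paths_def)

lemma coord_elem_alt: "coord (path_elem u (alt u n)) p = path_elem u (alt u n) p"
 by (cases p) (auto simp: coord_def path_elem_def)

lemma coord_elem_loop: "coord (path_elem u [loop u]) p = path_elem u [loop u] p"
 by (cases p) (auto simp: coord_def path_elem_def)

text \<open>One case for each outcome of \<open>path_cases\<close>. A path in \<open>I\<close> has
  normal form zero because \<open>I\<close> lies in \<open>J\<close>; the double loop has normal
  form \<open>alt u N\<close>.\<close>

lemma elem_rep:
 assumes "(u, es) \<in> paths Q"
 shows "path_elem u es \<ominus>\<^bsub>PA\<^esub> rep (path_elem u es) \<in> I"
proof -
 have u: "u \<in> {1, 2}" using assms by (simp add: paths_iff vertsQ)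
 have c: "path_elem u es \<in> carrier PA" by (rule elem_closed[OF assms])
 have self: "path_elem u es \<ominus>\<^bsub>PA\<^esub> path_elem u es \<in> I" using c by (simp add: PA.minus_eq PA.r_neg del: path_algebra_simps)
 from path_cases[OF assms] consider "path_elem u es \<in> I" | n where "n \<le> N" "es = alt u n" | "es = [loop u]" | "es = [loop u, loop u]"
  by blast
 then show ?thesis
 proof cases
  case 1
  then have "coord (path_elem u es) b = 0" if "b \<in> basis_paths" for b using I_J that by (auto simp: J_def)
  then have "rep (path_elem u es) = \<zero>[PA]" by (auto simp: rep_def)
  then show ?thesis using I_minus[OF 1 I_zero] by simp
 next
  case (2 n)
  then have "(u, es) \<in> basis_paths" using u by (auto simp: basis_paths_def)
  then have "rep (path_elem u es) = path_elem u es"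
   using 2 by (auto simp: rep_def coord_elem_alt fun_eq_iff) (auto simp: path_elem_def)
  then show ?thesis using self by simp
 next
  case 3
  then have "(u, es) \<in> basis_paths" using u assms by (auto simp: basis_paths_def paths_iff)
  then have "rep (path_elem u es) = path_elem u es"
   using 3 by (auto simp: rep_def coord_elem_loop fun_eq_iff) (auto simp: path_elem_def)
  then show ?thesis using self by simp
 next
  case 4
  have l: "loop u \<in> arcs Q" using 4 assms by (simp add: paths_iff)
  have "rep (path_elem u es) = path_elem u (alt u N)"
  proof
   fix p :: "nat \<times> arrow list"
   obtain v fs where p: "p = (v, fs)" by (cases p)
   have a: "(v, fs) \<in> basis_paths" if "v = u" "fs = alt u N" using u that by (auto simp: basis_paths_def)
   have b: "fs \<noteq> [loop u, loop u]" if "v = u" "(v, fs) \<in> basis_paths" using double_loop_notin_basis that by auto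
   show "rep (path_elem u es) p = (path_elem u (alt u N) p :: 'k)"
    using a b unfolding p 4 rep_def coord_def path_elem_def by auto
  qed
  then show ?thesis using loop_sq(1)[OF u l] 4 by simp
 qed
qed

lemma PA_induct [consumes 1, case_names zero add]:
 assumes "f \<in> carrier PA" "P (\<lambda>_. 0)"
  and "\<And>c u es g. [|(u, es) \<in> paths Q; g \<in> carrier PA; P g|] ==> P ((c *[PA] path_elem u es) +[PA] g)"
 shows "P f"
proof (rule path_algebra_induct[where Q = Q and f = f and P = P, OF finQ])
 show "P ((c *[PA] path_elem u es) +[PA] g)" if "(u, es) \<in> paths Q" "g \<in> carrier PA" "P g" for c u es g
  by (rule assms(3)[OF that])
qed (fact headsQ assms)+

lemma rep_mod: "f \<in> carrier PA ==> f \<ominus>\<^bsub>PA\<^esub> rep f \<in> I"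
proof (induction f rule: PA_induct)
 case zero
 have "rep (\<lambda>_. 0) = (\<lambda>_. 0)" by (auto simp: rep_def coord_def)
 then show ?case using I_minus[OF I_zero I_zero] by (simp only:)
next
 case (add c u es g)
 let ?p = "path_elem u es :: nat \<times> arrow list \<Rightarrow> 'k"
 have p: "?p \<in> carrier PA" by (rule elem_closed[OF add.hyps(1)])
 have s: "(c *[PA] ?p) +[PA] g \<in> carrier PA" using p add.hyps(2) by (intro PA.a_closed PA.scal_closed)
 have d: "?p \<ominus>\<^bsub>PA\<^esub> rep ?p \<in> I" by (rule elem_rep[OF add.hyps(1)])
 have "(c *[PA] ?p) +[PA] g \<ominus>\<^bsub>PA\<^esub> rep ((c *[PA] ?p) +[PA] g) =
   (c *[PA] (?p \<ominus>\<^bsub>PA\<^esub> rep ?p)) +[PA] (g \<ominus>\<^bsub>PA\<^esub> rep g)"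
  unfolding PA_minus[OF s rep_closed] PA_minus[OF p rep_closed] PA_minus[OF add.hyps(2) rep_closed]
  by (auto simp: rep_def coord_def fun_eq_iff algebra_simps)
 also have "\<dots> \<in> I" using I_scale[OF d] add.IH by (rule I.a_closed)
 finally show ?case .
qed

lemma cls_rep: "f \<in> carrier PA ==> cls (rep f) = cls f"
 using iffD2[OF cls_ops(6)[OF _ rep_closed] rep_mod] by (rule sym)

text \<open>Coordinates descend to classes because \<open>I\<close> lies in \<open>J\<close>. This
  is the linear independence of the basis paths.\<close>

lemma cls_eq_coord:
 assumes "f \<in> carrier PA" "g \<in> carrier PA" "cls f = cls g" "b \<in> basis_paths"
 shows "coord f b = coord g b"
proof -
 have "f \<ominus>\<^bsub>PA\<^esub> g \<in> J" using cls_ops(6)[OF assms(1,2)] assms(3) I_J by blast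
 then have "coord (f \<ominus>\<^bsub>PA\<^esub> g) b = 0" using assms(4) by (simp add: J_def)
 moreover have "coord (\<lambda>p. f p - g p) b = coord f b - coord g b" by (cases b) (simp add: coord_def)
 ultimately show ?thesis unfolding PA_minus[OF assms(1,2)] by simp
qed

definition supported :: "(nat \<times> arrow list) set \<Rightarrow> (nat \<times> arrow list \<Rightarrow> 'k) set set"
 where "supported B = cls ` {g. \<forall>p. p \<notin> B --> g p = 0}"

text \<open>The classes of the paths in \<open>B\<close> are a basis. Independence is
  \<open>cls_eq_coord\<close>: on functions supported in basis paths \<open>coord\<close> reads off
  the values, since no double loop is a basis path.\<close>

lemma supported_kspace:
 assumes B: "B \<subseteq> basis_paths"
 shows "kspace (A\<lparr>carrier := supported B\<rparr>)" "kfin (A\<lparr>carrier := supported B\<rparr>)"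
  "kdim (A\<lparr>carrier := supported B\<rparr>) = card B"
proof -
 have cl: "g \<in> carrier PA" if "\<forall>p. p \<notin> B --> g p = 0" for g
  by (rule supported_closed[OF B]) (rule that[rule_format])
 let ?V = "A\<lparr>carrier := supported B\<rparr>"
 show V: "kspace ?V"
 proof (rule A.kspace_subset)
  show "supported B \<subseteq> carrier A" unfolding supported_def cls_ops(1) using cl by blast
  show "\<zero>[A] \<in> supported B" unfolding supported_def cls_ops(4) by (rule imageI) simp
 next
  fix x y assume "x \<in> supported B" "y \<in> supported B"
  then obtain f g where fg: "x = cls f" "y = cls g" "\<forall>p. p \<notin> B --> f p = 0" "\<forall>p. p \<notin> B --> g p = 0"
   unfolding supported_def by blast
  then have "x +[A] y = cls (f +[PA] g)" using cls_ops(2)[OF cl cl] by simp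
  also have "\<dots> \<in> supported B" unfolding supported_def using fg by (intro imageI) simp
  finally show "x +[A] y \<in> supported B" .
 next
  fix c x assume "x \<in> supported B"
  then obtain f where f: "x = cls f" "\<forall>p. p \<notin> B --> f p = 0" unfolding supported_def by blast
  then have "c *[A] x = cls (c *[PA] f)" using cls_smult[OF cl] by simp
  also have "\<dots> \<in> supported B" unfolding supported_def using f by (intro imageI) simp
  finally show "c *[A] x \<in> supported B" .
 qed
 interpret V: kspace ?V by (rule V)
 define v where "v = (\<lambda>(u, es). cls (path_elem u es :: _ \<Rightarrow> 'k))"
 have finB: "finite B" using finite_subset[OF B finite_basis_paths] .
 have vc: "v p \<in> carrier ?V" if p: "p \<in> B" for p
 proof -
  obtain u es where q: "p = (u, es)" by (cases p)
  have "cls (path_elem u es :: _ \<Rightarrow> 'k) \<in> supported B"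
   unfolding supported_def by (rule imageI) (use p q in \<open>auto simp: path_elem_def\<close>)
  then show ?thesis by (simp add: v_def q)
 qed
 have vs: "c *[?V] v p \<in> carrier ?V" if "p \<in> B" for p c using vc[OF that] by (rule V.scale_closed)
 have L: "lincomb ?V v F c = cls (\<lambda>p. if p \<in> F then c p else 0)" if "F \<subseteq> B" for F c
 proof -
  have "finite F" using that finB by (rule finite_subset)
  then show ?thesis using that
  proof (induction F rule: finite_induct)
   case empty
   have "lincomb ?V v {} c = \<zero>[A]" by (simp add: lincomb_def)
   then show ?case using cls_ops(4) by simp
  next
   case (insert q F)
   obtain u es where q: "q = (u, es)" by (cases q)
   have pq: "(path_elem u es :: _ \<Rightarrow> 'k) \<in> carrier PA"
    using insert.prems q B basis_paths_subset by (intro elem_closed) auto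
   have cF: "(\<lambda>p. if p \<in> F then c p else 0) \<in> carrier PA"
    by (rule cl) (use insert.prems in auto)
   have "lincomb ?V v (insert q F) c = c q *[?V] v q +[?V] lincomb ?V v F c"
    unfolding lincomb_def
   proof (rule V.finsum_insert[OF insert.hyps])
    show "(\<lambda>i. c i *[?V] v i) \<in> F \<rightarrow> carrier ?V" using insert.prems by (intro funcsetI vs) auto
    show "c q *[?V] v q \<in> carrier ?V" using insert.prems by (intro vs) auto
   qed
   also have "\<dots> = c q *[A] cls (path_elem u es) +[A] cls (\<lambda>p. if p \<in> F then c p else 0)"
    using insert.IH insert.prems by (simp add: v_def q)
   also have "\<dots> = cls ((c q *[PA] path_elem u es) +[PA] (\<lambda>p. if p \<in> F then c p else 0))"
    unfolding cls_smult[OF pq] by (rule cls_ops(2)[OF PA.scal_closed[OF pq] cF])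
   also have "(c q *[PA] path_elem u es) +[PA] (\<lambda>p. if p \<in> F then c p else 0) =
     (\<lambda>p. if p \<in> insert q F then c p else 0)"
    using insert.hyps by (auto simp: fun_eq_iff path_elem_def q)
   finally show ?case .
  qed
 qed
 have "finite_basis ?V v B"
  unfolding finite_basis_def bij_betw_def
 proof (intro conjI)
  show "v ` B \<subseteq> carrier ?V" by (rule image_subsetI) (rule vc)
  show "inj_on (lincomb ?V v B) (B \<rightarrow>\<^sub>E UNIV)"
  proof (rule inj_onI)
   fix c d assume cd: "c \<in> B \<rightarrow>\<^sub>E UNIV" "d \<in> B \<rightarrow>\<^sub>E UNIV" "lincomb ?V v B c = lincomb ?V v B d"
   let ?f = "\<lambda>c p. if p \<in> B then c p else (0::'k)"
   have eq: "cls (?f c) = cls (?f d)" using cd(3) unfolding L[OF subset_refl] .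
   have fc: "?f c \<in> carrier PA" for c by (rule cl) simp
   show "c = d"
   proof (rule PiE_ext[OF cd(1,2)])
    fix b assume b: "b \<in> B"
    have co: "coord (?f c) b = c b" for c
    proof -
     obtain u es where q: "b = (u, es)" by (cases b)
     have "(u, [loop u, loop u]) \<notin> B" using double_loop_notin_basis B by blast
     then show ?thesis using b by (simp add: coord_def q)
    qed
    have "coord (?f c) b = coord (?f d) b"
     using b B by (intro cls_eq_coord[OF fc fc eq]) blast
    then show "c b = d b" unfolding co .
   qed
  qed
  show "lincomb ?V v B ` (B \<rightarrow>\<^sub>E UNIV) = carrier ?V"
  proof (intro equalityI subsetI)
   fix x assume "x \<in> carrier ?V"
   then have "x \<in> supported B" by simp
   then obtain g where g: "x = cls g" "\<forall>p. p \<notin> B --> g p = 0" unfolding supported_def by blast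
   have "(\<lambda>p. if p \<in> B then restrict g B p else 0) = g"
   proof
    show "(if p \<in> B then restrict g B p else 0) = g p" for p using g(2)[rule_format, of p] by simp
   qed
   then have x: "x = lincomb ?V v B (restrict g B)" unfolding L[OF subset_refl] using g(1) by simp
   have "restrict g B \<in> B \<rightarrow>\<^sub>E UNIV" by (auto simp only: PiE_def Pi_def restrict_extensional)
   then show "x \<in> lincomb ?V v B ` (B \<rightarrow>\<^sub>E UNIV)" unfolding x by (rule imageI)
  next
   fix x assume "x \<in> lincomb ?V v B ` (B \<rightarrow>\<^sub>E UNIV)"
   then obtain c where x: "x = lincomb ?V v B c" by blast
   have "cls (\<lambda>p. if p \<in> B then c p else 0) \<in> supported B" unfolding supported_def by (rule imageI) simp
   then show "x \<in> carrier ?V" unfolding x L[OF subset_refl] by simp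
  qed
 qed (rule finB)
 from kdim_basis[OF V this] show "kfin ?V" "kdim ?V = card B" by simp_all
qed

lemma carrier_supported: "carrier A = supported basis_paths"
proof
 show "carrier A \<subseteq> supported basis_paths"
 proof
  fix x assume "x \<in> carrier A"
  then obtain f where "x = cls f" "f \<in> carrier PA" unfolding cls_ops(1) by blast
  then have x: "x = cls (rep f)" by (simp only: cls_rep)
  show "x \<in> supported basis_paths" unfolding supported_def x by (rule imageI) (simp add: rep_def)
 qed
 show "supported basis_paths \<subseteq> carrier A"
  unfolding supported_def
 proof (rule image_subsetI)
  fix g :: "nat \<times> arrow list \<Rightarrow> 'k" assume "g \<in> {g. \<forall>p. p \<notin> basis_paths --> g p = 0}"
  then have g: "\<forall>p. p \<notin> basis_paths --> g p = 0" by (rule CollectD)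
  show "cls g \<in> carrier A" by (rule cls_closed, rule supported_closed[OF subset_refl]) (rule g[rule_format])
 qed
qed

lemma kfin_A: "kfin A"
proof -
 have "A\<lparr>carrier := supported basis_paths\<rparr> = A" unfolding carrier_supported[symmetric] by simp
 then show ?thesis using supported_kspace(2)[OF subset_refl] by simp
qed

lemma elem_vert_closed: "v \<in> {1, 2} ==> (path_elem v [] :: _ \<Rightarrow> 'k) \<in> carrier PA"
 by (rule elem_closed) (simp add: paths_iff vertsQ)

lemma vert_closed: "v \<in> {1, 2} ==> vert v \<in> carrier A"
 unfolding vert_def by (rule cls_closed[OF elem_vert_closed])

lemma vert_mult: "[|v \<in> {1, 2}; w \<in> {1, 2}|] ==> vert v **[A] vert w = (if w = v then vert v else \<zero>[A])"
 unfolding vert_def cls_ops(3)[OF elem_vert_closed elem_vert_closed] elem_mult cls_ops(4)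
 by (simp add: path_end_def)

lemma vert_sum: "vert 1 +[A] vert 2 = \<one>[A]"
proof -
 have "path_elem 1 [] +[PA] path_elem 2 [] = \<one>[PA]" by (auto simp: path_elem_def vertsQ fun_eq_iff)
 then show ?thesis unfolding vert_def cls_ops(5) using cls_ops(2)[OF elem_vert_closed elem_vert_closed, of 1 2] by simp
qed

lemma elem_vert_mult:
 "(path_elem i [] **[PA] f) (u, es) = (if u = i then f (u, es) else (0::'k))"
 "(f **[PA] path_elem j []) (u, es) = (if path_end Q u es = j then f (u, es) else (0::'k))"
proof -
 have "(path_elem i [] **[PA] f) (u, es) = (\<Sum>k\<le>length es. if k = 0 then if u = i then f (u, es) else 0 else 0)"
  unfolding path_algebra_mult by (rule sum.cong) (auto simp: path_elem_def path_end_def)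
 then show "(path_elem i [] **[PA] f) (u, es) = (if u = i then f (u, es) else (0::'k))" by simp
 have "(f **[PA] path_elem j []) (u, es) =
   (\<Sum>k\<le>length es. if k = length es then if path_end Q u es = j then f (u, es) else 0 else 0)"
  unfolding path_algebra_mult by (rule sum.cong) (auto simp: path_elem_def)
 then show "(f **[PA] path_elem j []) (u, es) = (if path_end Q u es = j then f (u, es) else (0::'k))" by simp
qed

definition corner :: "nat \<Rightarrow> nat \<Rightarrow> (nat \<times> arrow list) set"
 where "corner i j = {(u, es) \<in> basis_paths. u = i \<and> path_end Q u es = j}"

text \<open>Multiplication by the idempotents of the vertices on both sides keeps exactly the paths
  from \<open>i\<close> to \<open>j\<close>.\<close>

lemma corner_supported:
 assumes ij: "i \<in> {1, 2}" "j \<in> {1, 2}"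
 shows "{X \<in> carrier A. vert i **[A] X = X \<and> X **[A] vert j = X} = supported (corner i j)"
proof (intro equalityI subsetI)
 note ei = elem_vert_closed[OF ij(1)] and ej = elem_vert_closed[OF ij(2)]
 {
  fix X assume "X \<in> {X \<in> carrier A. vert i **[A] X = X \<and> X **[A] vert j = X}"
  then have X: "X \<in> carrier A" "vert i **[A] X = X" "X **[A] vert j = X" by auto
  obtain f where f: "X = cls f" "f \<in> carrier PA" using X(1) unfolding cls_ops(1) by blast
  define h where "h = path_elem i [] **[PA] (f **[PA] path_elem j [])"
  have h: "h \<in> carrier PA" unfolding h_def using ei ej f(2) by (intro PA.m_closed)
  have "X = vert i **[A] (X **[A] vert j)" using X(2,3) by (simp only:)
  also have "\<dots> = cls h"
   unfolding f(1) vert_def h_def cls_ops(3)[OF f(2) ej] by (rule cls_ops(3)[OF ei PA.m_closed[OF f(2) ej]])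
  finally have "X = cls h" .
  then have Xr: "X = cls (rep h)" by (simp only: cls_rep[OF h])
  have "rep h p = 0" if p: "p \<notin> corner i j" for p
  proof (cases "p \<in> basis_paths")
   case True
   obtain u es where ue: "p = (u, es)" by (cases p)
   have hv: "h (u, fs) = (if u = i \<and> path_end Q u fs = j then f (u, fs) else 0)" for fs
    unfolding h_def elem_vert_mult by simp
   have "u \<in> {1, 2}" using True ue basis_paths_subset by (auto simp: paths_iff vertsQ)
   \<comment> \<open>Folding the double loop into \<open>alt u N\<close> does not mix corners, since
     both paths are closed.\<close>
   then have "path_end Q u (alt u N) = path_end Q u [loop u, loop u]"
    using path_end_alt[of u N] end_loop(2)[of u] N by (simp add: swp_def)
   then have "coord h (u, es) = 0" using p True ue by (auto simp: coord_def hv corner_def)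
   then show ?thesis using ue by (simp add: rep_def)
  qed (simp add: rep_def)
  then show "X \<in> supported (corner i j)" unfolding supported_def Xr by (intro imageI CollectI allI impI)
 next
  fix X assume "X \<in> supported (corner i j)"
  then obtain g where g: "X = cls g" "\<forall>p. p \<notin> corner i j --> g p = 0" unfolding supported_def by blast
  have gc: "g \<in> carrier PA"
  proof (rule supported_closed[of "corner i j"])
   show "corner i j \<subseteq> basis_paths" by (auto simp: corner_def)
   show "g p = 0" if "p \<notin> corner i j" for p using g(2)[rule_format, OF that] .
  qed
  have gz: "g (u, es) = 0" if "u \<noteq> i \<or> path_end Q u es \<noteq> j" for u es
   by (rule g(2)[rule_format]) (use that in \<open>auto simp: corner_def\<close>)
  have "path_elem i [] **[PA] g = g"
   by (rule path_fun_eqI, unfold elem_vert_mult) (simp add: gz)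
  moreover have "g **[PA] path_elem j [] = g"
   by (rule path_fun_eqI, unfold elem_vert_mult) (simp add: gz)
  ultimately show "X \<in> {X \<in> carrier A. vert i **[A] X = X \<and> X **[A] vert j = X}"
   using cls_ops(3)[OF ei gc] cls_ops(3)[OF gc ej] cls_closed[OF gc] g(1) by (simp add: vert_def del: path_algebra_simps)
 }
qed

lemma card_corner:
 assumes "i \<in> {1, 2}" "j \<in> {1, 2}"
 shows "card (corner i j) = card {n. n \<le> N \<and> swp i n = j} + (if i = j \<and> loop i \<in> arcs Q then 1 else 0)"
proof -
 let ?a = "(\<lambda>n. (i, alt i n)) ` {n. n \<le> N \<and> swp i n = j}"
 let ?l = "if i = j \<and> loop i \<in> arcs Q then {(i, [loop i])} else {}"
 have eq: "corner i j = ?a \<union> ?l"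
 proof (intro equalityI subsetI)
  fix p assume "p \<in> corner i j"
  then obtain es where p: "p = (i, es)" "(i, es) \<in> basis_paths" "path_end Q i es = j"
   unfolding corner_def by blast
  from p(2) consider n where "es = alt i n" "n \<le> N" | "es = [loop i]" "loop i \<in> arcs Q"
   unfolding basis_paths_def by blast
  then show "p \<in> ?a \<union> ?l"
  proof cases
   case (1 n)
   then have "swp i n = j" using p(3) path_end_alt[OF assms(1)] by simp
   then show ?thesis using 1 p(1) by (intro UnI1 image_eqI[of _ _ n]) simp_all
  next
   case 2
   then show ?thesis using p(1,3) end_loop(1)[OF assms(1)] by simp
  qed
 next
  fix p assume "p \<in> ?a \<union> ?l"
  then consider n where "p = (i, alt i n)" "n \<le> N" "swp i n = j" | "p = (i, [loop i])" "i = j" "loop i \<in> arcs Q"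
   by (auto split: if_splits)
  then show "p \<in> corner i j"
  proof cases
   case (1 n)
   then have "p \<in> basis_paths" using assms(1) unfolding basis_paths_def by blast
   then show ?thesis using 1 path_end_alt[OF assms(1)] unfolding corner_def by simp
  next
   case 2
   then have "p \<in> basis_paths" using assms(1) unfolding basis_paths_def by blast
   then show ?thesis using 2 end_loop(1)[OF assms(1)] unfolding corner_def by simp
  qed
 qed
 have dj: "?a \<inter> ?l = {}" by auto
 have "inj_on (\<lambda>n. (i, alt i n)) {n. n \<le> N \<and> swp i n = j}"
  by (rule inj_onI) (metis length_alt prod.inject)
 then have c: "card ?a = card {n. n \<le> N \<and> swp i n = j}" by (rule card_image)
 have "finite ?a" "finite ?l" by simp_all
 then have "card (corner i j) = card ?a + card ?l" unfolding eq using dj by (rule card_Un_disjoint)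
 then show ?thesis unfolding c by (cases "i = j \<and> loop i \<in> arcs Q") auto
qed

end

context kalg
begin

lemma smult_scal_one_comm:
 assumes "left_module A M" "a \<in> carrier A" "x \<in> carrier M"
 shows "a *[M] ((c \<odot> \<one>) *[M] x) = (c \<odot> \<one>) *[M] (a *[M] x)"
proof -
 interpret M: left_module A M by fact
 have k: "c \<odot> \<one> \<in> carrier A" by simp
 show ?thesis
  unfolding M.smult_assoc1[OF assms(2) k assms(3), symmetric] M.smult_assoc1[OF k assms(2,3), symmetric]
  unfolding scal_one_mult[OF assms(2)] mult_scal_one[OF assms(2)] ..
qed

lemma scal_smult:
 assumes "left_module A M" "a \<in> carrier A" "x \<in> carrier M"
 shows "(c \<odot> a) *[M] x = (c \<odot> \<one>) *[M] (a *[M] x)"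
proof -
 interpret M: left_module A M by fact
 have k: "c \<odot> \<one> \<in> carrier A" by simp
 show ?thesis
  unfolding M.smult_assoc1[OF k assms(2,3), symmetric] scal_one_mult[OF assms(2)] ..
qed

lemma scal_one_eq_zero:
 fixes M :: "('a, 'm) module"
 assumes M: "left_module A M" and x: "x \<in> carrier M" "(c \<odot> \<one>) *[M] x = \<zero>[M]" "x \<noteq> \<zero>[M]"
 shows "c = 0"
 using kspace.scale_eq_zero[OF kspace_restrict_scalars[OF M], of x c] x by simp

lemma line_simple:
 assumes T: "left_module A T" and x: "x \<in> carrier T" "x \<noteq> \<zero>[T]"
  and line: "\<And>y. y \<in> carrier T ==> \<exists>c. y = (c \<odot> \<one>) *[T] x"
 shows "simple_module A T" "scalar_endomorphisms A T"
proof -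
 interpret T: left_module A T by (rule T)
 interpret V: kspace "restrict_scalars A T" by (rule kspace_restrict_scalars[OF T])
 show "simple_module A T"
  unfolding simple_module_def
 proof (intro conjI allI impI T)
  show "carrier T \<noteq> {\<zero>[T]}" using x by blast
  fix U assume U: "submodule U A T"
  show "U = {\<zero>[T]} \<or> U = carrier T"
  proof (cases "U \<subseteq> {\<zero>[T]}")
   case True
   then show ?thesis using U unfolding T.submodule_iff by blast
  next
   case False
   then obtain u where u: "u \<in> U" "u \<noteq> \<zero>[T]" by blast
   have uT: "u \<in> carrier T" using u U unfolding T.submodule_iff by blast
   obtain c where c: "u = (c \<odot> \<one>) *[T] x" using line[OF uT] ..
   have "c \<noteq> 0" using u(2) V.scale_zero[of x] x(1) c by auto
   then have "x = (inverse c * c \<odot> \<one>) *[T] x" using V.scale_one[of x] x(1) by simp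
   also have "\<dots> = (inverse c \<odot> \<one>) *[T] u" using V.scale_assoc[of x "inverse c" c] x(1) c by simp
   finally have xu: "x = (inverse c \<odot> \<one>) *[T] u" .
   have sU: "a *[T] w \<in> U" if "a \<in> carrier A" "w \<in> U" for a w
    using U that unfolding T.submodule_iff by blast
   have xU: "x \<in> U" by (subst xu) (rule sU[OF _ u(1)], simp)
   have "carrier T \<subseteq> U"
   proof
    fix y assume "y \<in> carrier T"
    from line[OF this] obtain d where "y = (d \<odot> \<one>) *[T] x" ..
    then show "y \<in> U" using sU[OF _ xU, of "d \<odot> \<one>"] by simp
   qed
   then show ?thesis using U unfolding T.submodule_iff by blast
  qed
 qed
 show "scalar_endomorphisms A T"
  unfolding scalar_endomorphisms_def
 proof
  fix f assume f: "f \<in> module_hom A T T"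
  obtain c where c: "f x = (c \<odot> \<one>) *[T] x" using line[OF module_homD(1)[OF f x(1)]] ..
  have "f s = (c \<odot> \<one>) *[T] s" if s: "s \<in> carrier T" for s
  proof -
   obtain d where d: "s = (d \<odot> \<one>) *[T] x" using line[OF s] ..
   have "f s = (d \<odot> \<one>) *[T] ((c \<odot> \<one>) *[T] x)"
    unfolding d c[symmetric] by (rule module_homD(3)[OF f _ x(1)]) simp
   also have "\<dots> = (c \<odot> \<one>) *[T] s" unfolding d by (rule smult_scal_one_comm[OF T _ x(1)]) simp
   finally show ?thesis .
  qed
  then show "\<exists>c. \<forall>s\<in>carrier T. f s = (c \<odot> \<one>) *[T] s" by blast
 qed
qed

lemma simple_cyclic:
 assumes T: "simple_module A T" and y: "y \<in> carrier T" "y \<noteq> \<zero>[T]"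
 shows "cyclic A T y"
proof -
 interpret T: left_module A T by (rule simple_moduleD(1)[OF T])
 have s: "submodule ((\<lambda>a. a *[T] y) ` carrier A) A T" by (rule submodule_cyclic[OF simple_moduleD(1)[OF T] y(1)])
 have "y \<in> (\<lambda>a. a *[T] y) ` carrier A"
  by (rule image_eqI[of _ _ \<one>]) (use T.smult_one[OF y(1)] in simp_all)
 then have "(\<lambda>a. a *[T] y) ` carrier A \<noteq> {\<zero>[T]}" using y(2) by blast
 then have "(\<lambda>a. a *[T] y) ` carrier A = carrier T" using simple_moduleD(3)[OF T s] by blast
 then show ?thesis using y(1) by (simp add: cyclic_def)
qed

lemma one_dimensional_line:
 assumes T: "left_module A T" and d: "has_dim A T 1"
 shows "\<exists>x\<in>carrier T. x \<noteq> \<zero>[T] \<and> (\<forall>y\<in>carrier T. \<exists>c. y = (c \<odot> \<one>) *[T] x)"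
proof -
 let ?V = "restrict_scalars A T"
 have V: "kspace ?V" by (rule kspace_restrict_scalars[OF T])
 interpret V: kspace ?V by (rule V)
 interpret T: left_module A T by (rule T)
 obtain b where b: "finite_basis ?V b {..<1::nat}" using d unfolding has_dim_def by blast
 have b0: "b 0 \<in> carrier T" using b unfolding finite_basis_def by auto
 have l: "lincomb ?V b {..<1} c = (c 0 \<odot> \<one>) *[T] b 0" for c
 proof -
  have "lincomb ?V b {0} c = (c 0 \<odot> \<one>) *[T] b 0"
   unfolding lincomb_def using b0 V.scale_closed[of "b 0" "c 0"] by (subst V.finsum_insert) simp_all
  moreover have "{..<1::nat} = {0}" by auto
  ultimately show ?thesis by simp
 qed
 have line: "\<exists>c. y = (c \<odot> \<one>) *[T] b 0" if y: "y \<in> carrier T" for y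
  using lincomb_basis_coeff[OF V b, of y] y unfolding l by (intro exI[of _ "basis_coeff ?V b {..<1} y 0"]) simp
 have "b 0 \<noteq> \<zero>[T]"
 proof
  assume z: "b 0 = \<zero>[T]"
  have "y = \<zero>[T]" if y: "y \<in> carrier T" for y
  proof -
   obtain c where "y = (c \<odot> \<one>) *[T] b 0" using line[OF y] ..
   then show ?thesis using V.scale_zero_right[of c] z by simp
  qed
  then have "carrier ?V = {\<zero>[?V]}" using V.zero_closed by auto
  then show False using kdim_zero_space(2)[OF V] kdim_basis(2)[OF V b] by simp
 qed
 then show ?thesis using b0 line by blast
qed

text \<open>The identification of \<open>e A e'\<close> with \<open>Hom(A e, A e')\<close> sends
  \<open>X\<close> to \<open>X *[P'] y'\<close>; its injectivity is the annihilator condition of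
  \<open>idem_gen\<close>.\<close>

lemma hom_dim_idem_gen:
 assumes fin: "kfin A" and P: "idem_gen A e P y" and P': "idem_gen A e' P' y'"
 shows "hom_dim A P y P' = kdim (A\<lparr>carrier := {X \<in> carrier A. e \<otimes> X = X \<and> X \<otimes> e' = X}\<rparr>)"
proof -
 have l: "left_module A P'" and e': "e' \<in> carrier A" "e' \<otimes> e' = e'" "e' *[P'] y' = y'" and c: "cyclic A P' y'"
  and ann: "\<And>a. [|a \<in> carrier A; a *[P'] y' = \<zero>[P']|] ==> a \<otimes> e' = \<zero>"
  using P' by (auto simp: idem_gen_def)
 have e: "e \<in> carrier A" "e \<otimes> e = e" using P by (auto simp: idem_gen_def)
 have lP: "left_module A P" and yP: "y \<in> carrier P" using P by (auto simp: idem_gen_def cyclic_def)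
 interpret P': left_module A P' by (rule l)
 have y': "y' \<in> carrier P'" using c by (simp add: cyclic_def)
 let ?C = "{X \<in> carrier A. e \<otimes> X = X \<and> X \<otimes> e' = X}"
 let ?W = "(restrict_scalars A P')\<lparr>carrier := hom_values A P y P'\<rparr>"
 have V: "kspace (A\<lparr>carrier := ?C\<rparr>)"
  by (rule kspace_subset) (use e e' in \<open>auto simp: l_distr r_distr scal_mult_l scal_mult_r\<close>)
 have finV: "kfin (A\<lparr>carrier := ?C\<rparr>)"
  by (rule kfin_inj[OF _ _ fin, of _ "\<lambda>x. x"]) (auto simp: klinear_def)
 have W: "kspace ?W" by (rule kspace_hom_values[OF lP l yP])
 note hv = hom_values_idem_gen[OF P l]
 have lin: "klinear (A\<lparr>carrier := ?C\<rparr>) ?W (\<lambda>X. X *[P'] y')"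
  unfolding klinear_def hv
 proof (intro conjI ballI allI)
  show "(\<lambda>X. X *[P'] y') ` carrier (A\<lparr>carrier := ?C\<rparr>) \<subseteq>
    carrier ((restrict_scalars A P')\<lparr>carrier := {z \<in> carrier P'. e *[P'] z = z}\<rparr>)"
   using e y' by (auto simp: P'.smult_assoc1[symmetric] intro: P'.smult_closed)
 qed (use y' in \<open>simp_all add: P'.smult_l_distr scal_smult[OF l]\<close>)
 have "bij_betw (\<lambda>X. X *[P'] y') (carrier (A\<lparr>carrier := ?C\<rparr>)) (carrier ?W)"
  unfolding bij_betw_def
 proof
  show "inj_on (\<lambda>X. X *[P'] y') (carrier (A\<lparr>carrier := ?C\<rparr>))"
   unfolding klinear_inj_iff[OF V W lin]
  proof (intro ballI impI)
   fix X assume "X \<in> carrier (A\<lparr>carrier := ?C\<rparr>)" "X *[P'] y' = \<zero>[?W]"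
   then have "X \<in> carrier A" "X \<otimes> e' = X" "X \<otimes> e' = \<zero>" using ann by auto
   then show "X = \<zero>[A\<lparr>carrier := ?C\<rparr>]" by simp
  qed
  show "(\<lambda>X. X *[P'] y') ` carrier (A\<lparr>carrier := ?C\<rparr>) = carrier ?W"
  proof
   show "(\<lambda>X. X *[P'] y') ` carrier (A\<lparr>carrier := ?C\<rparr>) \<subseteq> carrier ?W" using lin by (simp add: klinear_def)
   show "carrier ?W \<subseteq> (\<lambda>X. X *[P'] y') ` carrier (A\<lparr>carrier := ?C\<rparr>)"
   proof
    fix z assume "z \<in> carrier ?W"
    then have z: "z \<in> carrier P'" "e *[P'] z = z" by (simp_all add: hv)
    obtain a where a: "a \<in> carrier A" "z = a *[P'] y'" using c z(1) by (rule cyclicE)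
    have "e \<otimes> (a \<otimes> e') \<in> carrier (A\<lparr>carrier := ?C\<rparr>)"
     using e e' a(1) by (simp add: m_assoc[symmetric]) (simp add: m_assoc)
    moreover have "z = (e \<otimes> (a \<otimes> e')) *[P'] y'"
     using e e' a z y' by (simp add: P'.smult_assoc1)
    ultimately show "z \<in> (\<lambda>X. X *[P'] y') ` carrier (A\<lparr>carrier := ?C\<rparr>)" by (rule rev_image_eqI)
   qed
  qed
 qed
 from kdim_iso(2)[OF V W lin this finV] show ?thesis by (simp add: hom_dim_def)
qed

end

section \<open>Simple modules of the quiver algebras and their projective covers\<close>

context alt_quiver_rels
begin

definition vertex_vector :: "((nat \<times> arrow list \<Rightarrow> 'k) set, 'm) module \<Rightarrow> nat \<Rightarrow> 'm \<Rightarrow> bool"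
 where "vertex_vector T v y \<longleftrightarrow> y \<in> carrier T \<and>
  (\<forall>w\<in>{1, 2}. vert w *[T] y = (if w = v then y else \<zero>[T])) \<and>
  (\<forall>a\<in>arcs Q. path_class Q R (tail Q a) [a] *[T] y = \<zero>[T])"

lemma arc_path: "a \<in> arcs Q ==> (tail Q a, [a]) \<in> paths Q"
 by (cases a) (auto simp: paths_iff vertsQ tailQ)

lemma vertex_path_action:
 assumes T: "left_module A T" and y: "vertex_vector T v y" and p: "(u, es) \<in> paths Q"
 shows "cls (path_elem u es) *[T] y = (if (u, es) = (v, []) then y else \<zero>[T])"
proof (cases es rule: rev_cases)
 case Nil
 have "u \<in> {1, 2}" using p by (simp add: paths_iff vertsQ)
 then have "vert u *[T] y = (if u = v then y else \<zero>[T])" using y unfolding vertex_vector_def by blast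
 then show ?thesis using Nil by (simp add: vert_def)
next
 case (snoc xs a)
 interpret T: left_module A T by (rule T)
 have yT: "y \<in> carrier T" using y by (simp add: vertex_vector_def)
 have xs: "(u, xs) \<in> paths Q" and a: "a \<in> arcs Q" "tail Q a = path_end Q u xs"
  using p snoc by (auto simp: paths_iff is_chain_append)
 have ca: "path_elem (tail Q a) [a] \<in> carrier PA" by (rule elem_closed[OF arc_path[OF a(1)]])
 have cx: "path_elem u xs \<in> carrier PA" by (rule elem_closed[OF xs])
 \<comment> \<open>Modules are left modules and paths are composed from left to right, so the last
   arrow acts first, and it already kills \<open>y\<close>.\<close>
 have "path_elem u es = path_elem u xs **[PA] path_elem (tail Q a) [a]"
  unfolding elem_mult using snoc a(2) by simp
 then have "cls (path_elem u es) *[T] y = (cls (path_elem u xs) **[A] cls (path_elem (tail Q a) [a])) *[T] y"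
  by (simp only: cls_ops(3)[OF cx ca])
 also have "\<dots> = cls (path_elem u xs) *[T] (cls (path_elem (tail Q a) [a]) *[T] y)"
  by (rule T.smult_assoc1[OF cls_closed[OF cx] cls_closed[OF ca] yT])
 also have "cls (path_elem (tail Q a) [a]) *[T] y = \<zero>[T]"
  using y a(1) unfolding vertex_vector_def path_class_cls by blast
 also have "cls (path_elem u xs) *[T] \<zero>[T] = \<zero>[T]" by (rule T.smult_zero[OF cls_closed[OF cx]])
 finally show ?thesis using snoc by simp
qed

text \<open>All paths except the trivial one at \<open>v\<close> kill \<open>y\<close>, so the
  action is by a scalar.\<close>

lemma vertex_action:
 assumes T: "left_module A T" and y: "vertex_vector T v y" and f: "f \<in> carrier PA"
 shows "cls f *[T] y = (f (v, []) *[A] \<one>[A]) *[T] y"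
 using f
proof (induction f rule: PA_induct)
 interpret T: left_module A T by (rule T)
 have yT: "y \<in> carrier T" using y by (simp add: vertex_vector_def)
 {
  case zero
  have "cls (\<lambda>_. 0) = \<zero>[A]" unfolding cls_ops(4) by simp
  then show ?case using yT by simp
 next
  case (add c u es g)
  let ?p = "path_elem u es :: nat \<times> arrow list \<Rightarrow> 'k"
  have p: "?p \<in> carrier PA" by (rule elem_closed[OF add.hyps(1)])
  have cp: "cls ?p \<in> carrier A" and cg: "cls g \<in> carrier A" using cls_closed p add.hyps(2) by blast+
  have "cls ((c *[PA] ?p) +[PA] g) *[T] y = (c *[A] cls ?p +[A] cls g) *[T] y"
   unfolding cls_smult[OF p] cls_ops(2)[OF PA.scal_closed[OF p] add.hyps(2)] ..
  also have "\<dots> = (c *[A] cls ?p) *[T] y +[T] cls g *[T] y"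
   by (rule T.smult_l_distr[OF A.scal_closed[OF cp] cg yT])
  also have "(c *[A] cls ?p) *[T] y = ((c * ?p (v, [])) *[A] \<one>[A]) *[T] y"
   unfolding A.scal_smult[OF T cp yT] vertex_path_action[OF T y add.hyps(1)]
   using yT by (auto simp: path_elem_def)
  also have "cls g *[T] y = (g (v, []) *[A] \<one>[A]) *[T] y" by (rule add.IH)
  also have "((c * ?p (v, [])) *[A] \<one>[A]) *[T] y +[T] (g (v, []) *[A] \<one>[A]) *[T] y =
    (((c *[PA] ?p) +[PA] g) (v, []) *[A] \<one>[A]) *[T] y"
   using yT by (simp add: A.scal_l_distr T.smult_l_distr)
  finally show ?case .
 }
qed

text \<open>A longest path that does not kill \<open>t\<close> produces a vector that every arrow
  kills. A longest one exists because paths outside \<open>I\<close> have length at most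
  \<open>N\<close>.\<close>

lemma exists_vertex_vector:
 assumes T: "left_module A T" and t: "t \<in> carrier T" "t \<noteq> \<zero>[T]"
 shows "\<exists>v\<in>{1, 2}. \<exists>y. vertex_vector T v y \<and> y \<noteq> \<zero>[T]"
proof -
 interpret T: left_module A T by (rule T)
 define X where "X = (\<lambda>k. \<exists>u es. (u, es) \<in> paths Q \<and> length es = k \<and> cls (path_elem u es) *[T] t \<noteq> \<zero>[T])"
 have "\<exists>v\<in>{1, 2}. vert v *[T] t \<noteq> \<zero>[T]"
 proof (rule ccontr)
  assume "\<not> ?thesis"
  then have "vert 1 *[T] t +[T] vert 2 *[T] t = \<zero>[T]" by simp
  moreover have "vert 1 *[T] t +[T] vert 2 *[T] t = t"
   using T.smult_l_distr[OF vert_closed vert_closed t(1), of 1 2] T.smult_one[OF t(1)] unfolding vert_sum by simp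
  ultimately show False using t by simp
 qed
 then obtain v where v: "v \<in> {1, 2}" "vert v *[T] t \<noteq> \<zero>[T]" by blast
 have X0: "X 0" unfolding X_def
  by (rule exI[of _ v], rule exI[of _ "[]"]) (use v in \<open>simp add: vert_def paths_iff vertsQ\<close>)
 have XN: "k \<le> N" if Xk: "X k" for k
 proof -
  obtain u es where p: "(u, es) \<in> paths Q" "length es = k" "cls (path_elem u es) *[T] t \<noteq> \<zero>[T]"
   using Xk unfolding X_def by blast
  have "path_elem u es \<notin> I"
  proof
   assume i: "path_elem u es \<in> I"
   have "path_elem u es \<ominus>\<^bsub>PA\<^esub> (\<lambda>_. 0) \<in> I" by (rule I_minus[OF i I_zero])
   then have "cls (path_elem u es) = cls \<zero>[PA]"
    using cls_ops(6)[OF elem_closed[OF p(1)] PA.zero_closed] by simp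
   then show False using p(3) T.zero_smult[OF t(1)] unfolding cls_ops(4)[symmetric] by simp
  qed
  then show ?thesis using path_cases[OF p(1)] p(2) N by auto
 qed
 define k where "k = Greatest X"
 have Xk: "X k" unfolding k_def by (rule GreatestI_nat[where P = X and k = 0 and b = N, OF X0 XN])
 have max: "\<not> X (Suc k)"
 proof
  assume "X (Suc k)"
  then have "Suc k \<le> k" unfolding k_def by (rule Greatest_le_nat[where P = X and b = N, OF _ XN])
  then show False by simp
 qed
 obtain u es where p: "(u, es) \<in> paths Q" "length es = k" "cls (path_elem u es) *[T] t \<noteq> \<zero>[T]"
  using Xk unfolding X_def by blast
 have u: "u \<in> {1, 2}" using p(1) by (simp add: paths_iff vertsQ)
 define y where "y = cls (path_elem u es) *[T] t"
 have pc: "path_elem u es \<in> carrier PA" by (rule elem_closed[OF p(1)])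
 have yT: "y \<in> carrier T" unfolding y_def by (rule T.smult_closed[OF cls_closed[OF pc] t(1)])
 have act: "cls (path_elem w xs) *[T] y = (if u = path_end Q w xs then cls (path_elem w (xs @ es)) *[T] t else \<zero>[T])"
  if "(w, xs) \<in> paths Q" for w xs
 proof -
  have wc: "path_elem w xs \<in> carrier PA" by (rule elem_closed[OF that])
  have "cls (path_elem w xs) *[T] y = cls (path_elem w xs **[PA] path_elem u es) *[T] t"
   unfolding y_def cls_ops(3)[OF wc pc, symmetric]
   by (rule T.smult_assoc1[OF cls_closed[OF wc] cls_closed[OF pc] t(1), symmetric])
  moreover have "cls (\<lambda>_. 0) *[T] t = \<zero>[T]" using T.zero_smult[OF t(1)] unfolding cls_ops(4) by simp
  ultimately show ?thesis unfolding elem_mult by simp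
 qed
 \<comment> \<open>The path acts from the left, so the result belongs to its starting vertex
   \<open>u\<close>; an arrow acting nontrivially on it would give a longer path.\<close>
 have "vertex_vector T u y"
  unfolding vertex_vector_def
 proof (intro conjI ballI yT)
  fix w :: nat assume "w \<in> {1, 2}"
  then have "(w, []) \<in> paths Q" by (simp add: paths_iff vertsQ)
  from act[OF this] show "vert w *[T] y = (if w = u then y else \<zero>[T])"
   by (auto simp: vert_def path_end_def y_def)
 next
  fix a assume a: "a \<in> arcs Q"
  have "cls (path_elem (tail Q a) (a # es)) *[T] t = \<zero>[T]" if h: "u = head Q a"
  proof (rule ccontr)
   assume n: "cls (path_elem (tail Q a) (a # es)) *[T] t \<noteq> \<zero>[T]"
   have "(tail Q a, a # es) \<in> paths Q" using p(1) arc_path[OF a] h by (auto simp: paths_iff)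
   then have "X (Suc k)" unfolding X_def using n p(2) by (intro exI[of _ "tail Q a"] exI[of _ "a # es"]) simp
   then show False using max by simp
  qed
  then show "path_class Q R (tail Q a) [a] *[T] y = \<zero>[T]"
   unfolding path_class_cls act[OF arc_path[OF a]] by (simp add: path_end_def)
 qed
 then show ?thesis using u p(3) unfolding y_def by blast
qed

lemma simple_vertex_line:
 assumes T: "simple_module A T" and y: "vertex_vector T v y" "y \<noteq> \<zero>[T]" and z: "z \<in> carrier T"
 shows "\<exists>c. z = (c *[A] \<one>[A]) *[T] y"
proof -
 have yT: "y \<in> carrier T" using y by (simp add: vertex_vector_def)
 obtain a where a: "a \<in> carrier A" "z = a *[T] y" using A.simple_cyclic[OF T yT y(2)] z by (rule cyclicE)
 obtain f where "a = cls f" "f \<in> carrier PA" using a(1) unfolding cls_ops(1) by blast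
 then show ?thesis using vertex_action[OF simple_moduleD(1)[OF T] y(1), of f] a(2) by blast
qed

text \<open>By \<open>vertex_action\<close> the class of \<open>f\<close> kills a nonzero vertex
  vector at \<open>v\<close> exactly if \<open>f (v, []) = 0\<close>, a condition that does not
  involve the module.\<close>

lemma vertex_annihilator:
 assumes T: "left_module A T" and y: "vertex_vector T v y" "y \<noteq> \<zero>[T]"
  and T': "left_module A T'" and y': "vertex_vector T' v y'"
  and a: "a \<in> carrier A" "a *[T] y = \<zero>[T]"
 shows "a *[T'] y' = \<zero>[T']"
proof -
 interpret T': left_module A T' by (rule T')
 have yT: "y \<in> carrier T" "y' \<in> carrier T'" using y y' by (simp_all add: vertex_vector_def)
 obtain f where f: "a = cls f" "f \<in> carrier PA" using a(1) unfolding cls_ops(1) by blast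
 have "f (v, []) = 0"
  using A.scal_one_eq_zero[OF T yT(1), of "f (v, [])"] vertex_action[OF T y(1) f(2)] a(2) f(1) y(2) by simp
 then show ?thesis using vertex_action[OF T' y' f(2)] f(1) yT(2) A.scale_zero[OF A.one_closed] by simp
qed

lemma vertex_iso:
 assumes T: "simple_module A T" "vertex_vector T v y" "y \<noteq> \<zero>[T]"
  and T': "simple_module A T'" "vertex_vector T' v y'" "y' \<noteq> \<zero>[T']"
 shows "module_iso A T T'"
proof -
 have l: "left_module A T" "left_module A T'" using T(1) T'(1) simple_moduleD(1) by blast+
 have y: "y \<in> carrier T" "y' \<in> carrier T'" using T(2) T'(2) by (simp_all add: vertex_vector_def)
 have "\<exists>f\<in>module_hom A T T'. f y = y'"
  by (rule A.module_hom_from_cyclic[OF l(1) A.simple_cyclic[OF T(1) y(1) T(3)] l(2) y(2)])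
   (rule vertex_annihilator[OF l(1) T(2,3) l(2) T'(2)])
 then obtain f where f: "f \<in> module_hom A T T'" "f y = y'" ..
 show ?thesis by (rule simple_hom_iso[OF T(1) T'(1) f(1) y(1)]) (use f(2) T'(3) in simp)
qed

lemma simple_at_vertex:
 assumes "simple_at Q R v S" "x \<in> carrier S"
 shows "vertex_vector S v x"
 using assms unfolding simple_at_def vertex_vector_def vert_def path_class_cls vertsQ by blast

lemma simple_at_facts:
 assumes S: "simple_at Q R v S"
 shows "left_module A S" "simple_module A S" "scalar_endomorphisms A S" "\<exists>x\<in>carrier S. x \<noteq> \<zero>[S]"
proof -
 show l: "left_module A S" using S by (simp add: simple_at_def)
 have d: "has_dim A S 1" using S by (simp add: simple_at_def)
 obtain x where x: "x \<in> carrier S" "x \<noteq> \<zero>[S]" "\<And>y. y \<in> carrier S ==> \<exists>c. y = (c *[A] \<one>[A]) *[S] x"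
  using A.one_dimensional_line[OF l d] by blast
 show "simple_module A S" by (rule A.line_simple(1)[OF l x])
 show "scalar_endomorphisms A S" by (rule A.line_simple(2)[OF l x])
 show "\<exists>x\<in>carrier S. x \<noteq> \<zero>[S]" using x by blast
qed

lemma simple_at_not_iso:
 assumes S: "simple_at Q R 1 S" and S': "simple_at Q R 2 S'"
 shows "\<not> module_iso A S S'"
proof
 assume "module_iso A S S'"
 then obtain f where f: "f \<in> module_hom A S S'" "bij_betw f (carrier S) (carrier S')" unfolding module_iso_def ..
 note l = simple_at_facts(1)[OF S] simple_at_facts(1)[OF S']
 obtain x where x: "x \<in> carrier S" "x \<noteq> \<zero>[S]" using simple_at_facts(4)[OF S] ..
 have fx: "f x \<in> carrier S'" by (rule module_homD(1)[OF f(1) x(1)])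
 have "vert 1 *[S] x = x" "vert 1 *[S'] f x = \<zero>[S']"
  using simple_at_vertex[OF S x(1)] simple_at_vertex[OF S' fx] by (auto simp: vertex_vector_def)
 then have "f x = \<zero>[S']" using module_homD(3)[OF f(1) vert_closed x(1), of 1] by simp
 moreover have "f \<zero>[S] = \<zero>[S']" by (rule module_hom_zero[OF f(1) l])
 moreover have "\<zero>[S] \<in> carrier S" using l(1) by (simp add: left_module_def abelian_group.axioms abelian_monoid.zero_closed)
 ultimately show False using x inj_onD[OF bij_betw_imp_inj_on[OF f(2)], of x "\<zero>[S]"] by simp
qed

lemma vertex_iso_simple_at:
 assumes T: "simple_module A T" "vertex_vector T v y" "y \<noteq> \<zero>[T]" and U: "simple_at Q R v U"
 shows "module_iso A T U"
proof -
 obtain x where x: "x \<in> carrier U" "x \<noteq> \<zero>[U]" using simple_at_facts(4)[OF U] ..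
 show ?thesis by (rule vertex_iso[OF T simple_at_facts(2)[OF U] simple_at_vertex[OF U x(1)] x(2)])
qed

text \<open>A simple module contains a nonzero vertex vector, and its vertex determines the
  isomorphism class.\<close>

lemma simple_classification:
 assumes S: "simple_at Q R 1 S" and S': "simple_at Q R 2 S'" and T: "simple_module A T"
 shows "module_iso A T S \<or> module_iso A T S'"
proof -
 interpret T: left_module A T by (rule simple_moduleD(1)[OF T])
 obtain t where t: "t \<in> carrier T" "t \<noteq> \<zero>[T]" using simple_moduleD(2)[OF T] T.zero_closed by blast
 obtain v y where v: "v \<in> {1, 2}" "vertex_vector T v y" "y \<noteq> \<zero>[T]"
  using exists_vertex_vector[OF simple_moduleD(1)[OF T] t] by blast
 from v(1) have "v = 1 \<or> v = 2" by simp
 then show ?thesis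
  using vertex_iso_simple_at[OF T v(2,3), of S] vertex_iso_simple_at[OF T v(2,3), of S'] S S' by blast
qed

text \<open>The annihilator condition of \<open>idem_gen_cover\<close> holds because a simple module
  is a line spanned by a vertex vector: a nonzero vector fixed by \<open>vert v\<close> is a
  multiple of it, so it belongs to \<open>v\<close> and has the annihilator of
  \<open>s\<close>.\<close>

lemma vertex_cover:
 assumes v: "v \<in> {1, 2}" and S: "simple_at Q R v S" "S \<in> fd_modules A"
  and P: "idem_gen A (vert v) P y" "P \<in> fd_modules A"
 shows "is_projective_cover A P S"
proof -
 obtain s where s: "s \<in> carrier S" "s \<noteq> \<zero>[S]" using simple_at_facts(4)[OF S(1)] ..
 note sv = simple_at_vertex[OF S(1) s(1)]
 have "vert v *[S] s = (if v = v then s else \<zero>[S])" using sv v unfolding vertex_vector_def by blast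
 then have vs: "vert v *[S] s = s" by simp
 show ?thesis
 proof (rule A.idem_gen_cover[OF P simple_at_facts(2)[OF S(1)] S(2) s vs])
  fix T :: "((nat \<times> arrow list \<Rightarrow> 'k) set, 'k vec) module" and t a
  assume T: "T \<in> fd_modules A" "simple_module A T" and t: "t \<in> carrier T" "t \<noteq> \<zero>[T]" "vert v *[T] t = t"
   and a: "a \<in> carrier A" "a *[T] t = \<zero>[T]"
  note lT = simple_moduleD(1)[OF T(2)]
  interpret T: left_module A T by (rule lT)
  obtain w y' where w: "w \<in> {1, 2}" "vertex_vector T w y'" "y' \<noteq> \<zero>[T]"
   using exists_vertex_vector[OF lT t(1,2)] by blast
  have y': "y' \<in> carrier T" using w(2) by (simp add: vertex_vector_def)
  obtain c where c: "t = (c *[A] \<one>[A]) *[T] y'" using simple_vertex_line[OF T(2) w(2,3) t(1)] ..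
  have vy: "vert v *[T] y' = (if v = w then y' else \<zero>[T])" using w(2) v unfolding vertex_vector_def by blast
  have tv: "t = (c *[A] \<one>[A]) *[T] (vert v *[T] y')"
   using t(3) A.smult_scal_one_comm[OF lT vert_closed[OF v] y', of c] unfolding c by simp
  have "w = v"
  proof (rule ccontr)
   assume "w \<noteq> v"
   then have "t = \<zero>[T]" using tv vy A.scal_one_closed T.smult_zero by simp
   then show False using t(2) by simp
  qed
  then have wv: "vertex_vector T v y'" using w(2) by simp
  have "(c *[A] \<one>[A]) *[T] (a *[T] y') = \<zero>[T]"
   using a(2) A.smult_scal_one_comm[OF lT a(1) y', of c] unfolding c by simp
  moreover have "c \<noteq> 0"
  proof
   assume "c = 0"
   then have "t = \<zero>[T]" using c y' A.scale_zero[OF A.one_closed] by simp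
   then show False using t(2) by simp
  qed
  ultimately have "a *[T] y' = \<zero>[T]"
   using A.scal_one_eq_zero[OF lT T.smult_closed[OF a(1) y'], of c] by blast
  then show "a *[S] s = \<zero>[S]"
   by (rule vertex_annihilator[OF lT wv w(3) simple_at_facts(1)[OF S(1)] sv a(1)])
 qed
qed

lemma vertex_hom_dim:
 assumes "i \<in> {1, 2}" "j \<in> {1, 2}" "idem_gen A (vert i) P y" "idem_gen A (vert j) P' y'"
 shows "hom_dim A P y P' = card (corner i j)"
 unfolding A.hom_dim_idem_gen[OF kfin_A assms(3,4)] corner_supported[OF assms(1,2)]
 by (rule supported_kspace(3)) (auto simp: corner_def)

end

section \<open>Morita equivalences\<close>

lemma fd_left_module: "M \<in> fd_modules A ==> left_module A M"
 by (simp add: fd_modules_def)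

lemma left_module_zero_closed: "left_module A M ==> \<zero>[M] \<in> carrier M"
 using left_module.submodule_zero[of A M] left_module.submodule_iff[of A M "{\<zero>[M]}"] by simp

lemma module_hom_inclusion:
 assumes "left_module A M" "submodule U A M"
 shows "(\<lambda>x\<in>U. x) \<in> module_hom A (M\<lparr>carrier := U\<rparr>) M"
proof -
 have "(\<lambda>x\<in>carrier (M\<lparr>carrier := U\<rparr>). x) \<in> module_hom A (M\<lparr>carrier := U\<rparr>) (M\<lparr>carrier := U\<rparr>)"
  by (rule module_hom_id[OF left_module.submodule_left_module[OF assms]])
 moreover have "U \<subseteq> carrier M"
  using assms(2) unfolding left_module.submodule_iff[OF assms(1)] by (rule conjunct1)
 ultimately have "(\<lambda>x\<in>carrier (M\<lparr>carrier := U\<rparr>). x) \<in> module_hom A (M\<lparr>carrier := U\<rparr>) M"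
  using module_hom_submodule_iff[where U = U and M = M and A = A and P = "M\<lparr>carrier := U\<rparr>" and f = "\<lambda>x\<in>carrier (M\<lparr>carrier := U\<rparr>). x"] by (simp only:)
 then show ?thesis by simp
qed

lemma module_hom_add:
 assumes P: "left_module A P" and M: "left_module A M" and f: "f \<in> module_hom A P M" and g: "g \<in> module_hom A P M"
 shows "(\<lambda>x\<in>carrier P. f x +[M] g x) \<in> module_hom A P M"
proof (rule module_homI)
 interpret M: left_module A M by (rule M)
 fix u assume u: "u \<in> carrier P"
 note fu = module_homD(1)[OF f u] and gu = module_homD(1)[OF g u]
 show "f u +[M] g u \<in> carrier M" by (rule M.M.a_closed[OF fu gu])
 show "f (u +[P] v) +[M] g (u +[P] v) = (f u +[M] g u) +[M] (f v +[M] g v)" if v: "v \<in> carrier P" for v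
 proof -
  note fv = module_homD(1)[OF f v] and gv = module_homD(1)[OF g v]
  show ?thesis
   unfolding module_homD(2)[OF f u v] module_homD(2)[OF g u v] M.M.a_assoc[OF fu fv M.M.a_closed[OF gu gv]]
    M.M.a_assoc[OF fu gu M.M.a_closed[OF fv gv]] M.M.a_lcomm[OF fv gu gv] ..
 qed
 show "f (a *[P] u) +[M] g (a *[P] u) = a *[M] (f u +[M] g u)" if a: "a \<in> carrier A" for a
  unfolding module_homD(3)[OF f a u] module_homD(3)[OF g a u] M.smult_r_distr[OF a fu gu] ..
qed (rule P)

context kalg
begin

lemma module_hom_scale:
 assumes P: "left_module A P" and M: "left_module A M" and f: "f \<in> module_hom A P M"
 shows "(\<lambda>x\<in>carrier P. (c \<odot> \<one>) *[M] f x) \<in> module_hom A P M"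
proof (rule module_homI)
 interpret M: left_module A M by (rule M)
 fix u assume u: "u \<in> carrier P"
 note fu = module_homD(1)[OF f u]
 have k: "c \<odot> \<one> \<in> carrier A" by simp
 show "(c \<odot> \<one>) *[M] f u \<in> carrier M" by (rule M.smult_closed[OF k fu])
 show "(c \<odot> \<one>) *[M] f (u +[P] v) = (c \<odot> \<one>) *[M] f u +[M] (c \<odot> \<one>) *[M] f v" if v: "v \<in> carrier P" for v
  unfolding module_homD(2)[OF f u v] by (rule M.smult_r_distr[OF k fu module_homD(1)[OF f v]])
 show "(c \<odot> \<one>) *[M] f (a *[P] u) = a *[M] ((c \<odot> \<one>) *[M] f u)" if a: "a \<in> carrier A" for a
  unfolding module_homD(3)[OF f a u] smult_scal_one_comm[OF M a fu] ..
qed (rule P)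

text \<open>An equivalence of categories does not see elements, so surjectivity is expressed by
  cancellation. The converse tests the projection onto the cokernel, copied to
  \<open>'k vec\<close>.\<close>

lemma surj_iff_epi:
 assumes M: "M \<in> fd_modules A" and N: "N \<in> fd_modules A" and f: "f \<in> module_hom A M N"
 shows "f ` carrier M = carrier N \<longleftrightarrow> (\<forall>L\<in>fd_modules A. \<forall>g\<in>module_hom A N L.
  (\<forall>x\<in>carrier M. g (f x) = \<zero>[L]) --> (\<forall>y\<in>carrier N. g y = \<zero>[L]))" (is "?l = ?r")
proof
 assume s: ?l
 show ?r
 proof (intro ballI impI)
  fix L g y assume z: "\<forall>x\<in>carrier M. g (f x) = \<zero>[L]" and "y \<in> carrier N"
  then have "y \<in> f ` carrier M" using s by simp
  then obtain x where "x \<in> carrier M" "y = f x" ..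
  then show "g y = \<zero>[L]" using z by simp
 qed
next
 assume r: ?r
 have lM: "left_module A M" and lN: "left_module A N" using M N fd_left_module by blast+
 let ?U = "f ` carrier M"
 have U: "submodule ?U A N"
  by (rule module_hom_image_submodule[OF f lM lN left_module.submodule_carrier[OF lM]])
 have UN: "?U \<subseteq> carrier N" using U unfolding left_module.submodule_iff[OF lN] by (rule conjunct1)
 let ?W = "factor_module N ?U"
 have W: "fdm A ?W" by (rule fdm_factor(1)[OF iffD1[OF fd_modules_iff N] U])
 have lW: "left_module A ?W" using W by (simp add: fdm_def)
 obtain L h where L: "L \<in> fd_modules A" "h \<in> module_hom A ?W L" "bij_betw h (carrier ?W) (carrier L)"
  using W by (rule fd_modules_copy)
 let ?c = "\<lambda>x\<in>carrier N. ?U +>\<^bsub>N\<^esub> x"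
 have c: "?c \<in> module_hom A N ?W" by (rule coset_hom[OF lN U])
 have g: "compose (carrier N) h ?c \<in> module_hom A N L" by (rule module_hom_compose[OF c L(2) lN])
 have h0: "h \<zero>[?W] = \<zero>[L]" by (rule module_hom_zero[OF L(2) lW fd_left_module[OF L(1)]])
 have gy: "compose (carrier N) h ?c y = h (?U +>\<^bsub>N\<^esub> y)" if "y \<in> carrier N" for y
  using that by (simp add: compose_def)
 have fz: "\<forall>x\<in>carrier M. compose (carrier N) h ?c (f x) = \<zero>[L]"
 proof
  fix x assume x: "x \<in> carrier M"
  have fx: "f x \<in> carrier N" by (rule module_homD(1)[OF f x])
  have "?U +>\<^bsub>N\<^esub> f x = ?U" using coset_eq_zero_iff[OF lN U fx] x by blast
  then show "compose (carrier N) h ?c (f x) = \<zero>[L]" using gy[OF fx] h0 by simp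
 qed
 have z: "\<forall>y\<in>carrier N. compose (carrier N) h ?c y = \<zero>[L]"
  by (rule mp[OF bspec[OF bspec[OF r L(1)] g] fz])
 have "y \<in> ?U" if y: "y \<in> carrier N" for y
 proof -
  have cy: "?U +>\<^bsub>N\<^esub> y \<in> carrier ?W" using y by simp
  have "h (?U +>\<^bsub>N\<^esub> y) = h \<zero>[?W]" using z[rule_format, OF y] gy[OF y] h0 by simp
  then have "?U +>\<^bsub>N\<^esub> y = \<zero>[?W]"
   by (rule inj_onD[OF bij_betw_imp_inj_on[OF L(3)] _ cy left_module_zero_closed[OF lW]])
  then show ?thesis using coset_eq_zero_iff[OF lN U y] by simp
 qed
 then show ?l using UN by blast
qed

text \<open>Simplicity in terms of homomorphisms, fit for transport along an equivalence. The
  converse tests the inclusions of submodules.\<close>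

lemma simple_iff_surj:
 assumes S: "S \<in> fd_modules A"
 shows "simple_module A S \<longleftrightarrow> carrier S \<noteq> {\<zero>[S]} \<and> (\<forall>M\<in>fd_modules A. \<forall>f\<in>module_hom A M S.
  (\<forall>x\<in>carrier M. f x = \<zero>[S]) \<or> f ` carrier M = carrier S)" (is "?l = ?r")
proof
 assume s: ?l
 show ?r
 proof (intro conjI ballI)
  show "carrier S \<noteq> {\<zero>[S]}" by (rule simple_moduleD(2)[OF s])
  fix M f assume M: "M \<in> fd_modules A" and f: "f \<in> module_hom A M S"
  show "(\<forall>x\<in>carrier M. f x = \<zero>[S]) \<or> f ` carrier M = carrier S"
  proof (cases "\<forall>x\<in>carrier M. f x = \<zero>[S]")
   case False
   then obtain x where "x \<in> carrier M" "f x \<noteq> \<zero>[S]" by blast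
   then have "f ` carrier M = carrier S" by (rule hom_to_simple[OF s fd_left_module[OF M] f])
   then show ?thesis ..
  qed (rule disjI1)
 qed
next
 assume r: ?r
 have l: "left_module A S" by (rule fd_left_module[OF S])
 show ?l
  unfolding simple_module_def
 proof (intro conjI allI impI l)
  show "carrier S \<noteq> {\<zero>[S]}" using r by (rule conjunct1)
  fix U assume U: "submodule U A S"
  have Ud: "S\<lparr>carrier := U\<rparr> \<in> fd_modules A"
   unfolding fd_modules_iff by (rule fdm_submodule[OF iffD1[OF fd_modules_iff S] U])
  have "(\<forall>x\<in>carrier (S\<lparr>carrier := U\<rparr>). (\<lambda>x\<in>U. x) x = \<zero>[S]) \<or> (\<lambda>x\<in>U. x) ` carrier (S\<lparr>carrier := U\<rparr>) = carrier S"
   by (rule bspec[OF bspec[OF conjunct2[OF r] Ud] module_hom_inclusion[OF l U]])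
  then have "U \<subseteq> {\<zero>[S]} \<or> U = carrier S"
  proof
   assume "\<forall>x\<in>carrier (S\<lparr>carrier := U\<rparr>). (\<lambda>x\<in>U. x) x = \<zero>[S]"
   then have "U \<subseteq> {\<zero>[S]}" by (intro subsetI) simp
   then show ?thesis ..
  next
   assume "(\<lambda>x\<in>U. x) ` carrier (S\<lparr>carrier := U\<rparr>) = carrier S"
   then show ?thesis by simp
  qed
  then show "U = {\<zero>[S]} \<or> U = carrier S"
  proof
   assume "U \<subseteq> {\<zero>[S]}"
   moreover have "{\<zero>[S]} \<subseteq> U" using U unfolding left_module.submodule_iff[OF l] by simp
   ultimately have "U = {\<zero>[S]}" by (rule equalityI)
   then show ?thesis ..
  qed (rule disjI2)
 qed
qed

end

text \<open>The functor goes from modules over the block \<open>B\<close> to modules over the quiver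
  algebra \<open>A\<close>, whereas the facts about covers and simple modules are carried from
  \<open>A\<close> back to \<open>B\<close>.\<close>

locale morita = A: kalg A + B: kalg B
 for A :: "('k::field, 'a) module" and B :: "('k, 'b) module" +
 fixes Fo :: "('b, 'k vec) module \<Rightarrow> ('a, 'k vec) module"
  and Fm :: "('b, 'k vec) module \<Rightarrow> ('b, 'k vec) module \<Rightarrow> ('k vec \<Rightarrow> 'k vec) \<Rightarrow> 'k vec \<Rightarrow> 'k vec"
 assumes equiv: "morita_equivalence B A Fo Fm"
begin

lemmas equiv' = equiv[unfolded morita_equivalence_def]
lemmas Fo_closed = equiv'[THEN conjunct1, rule_format]
lemmas Fm_id = equiv'[THEN conjunct2, THEN conjunct1, rule_format]
lemmas Fm_comp = equiv'[THEN conjunct2, THEN conjunct2, THEN conjunct1, rule_format]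
lemmas Fm_add = equiv'[THEN conjunct2, THEN conjunct2, THEN conjunct2, THEN conjunct1, rule_format]
lemmas Fm_scale = equiv'[THEN conjunct2, THEN conjunct2, THEN conjunct2, THEN conjunct2, THEN conjunct1, rule_format]
lemmas Fm_bij = equiv'[THEN conjunct2, THEN conjunct2, THEN conjunct2, THEN conjunct2, THEN conjunct2, THEN conjunct1, rule_format]
lemmas ess_surj = equiv'[THEN conjunct2, THEN conjunct2, THEN conjunct2, THEN conjunct2, THEN conjunct2, THEN conjunct2, rule_format]

lemma Fm_closed:
 assumes "M \<in> fd_modules B" "N \<in> fd_modules B" "f \<in> module_hom B M N"
 shows "Fm M N f \<in> module_hom A (Fo M) (Fo N)"
 using bij_betwE[OF Fm_bij[OF assms(1,2)]] assms(3) by blast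

lemma Fm_inj:
 assumes "M \<in> fd_modules B" "N \<in> fd_modules B" "f \<in> module_hom B M N" "g \<in> module_hom B M N" "Fm M N f = Fm M N g"
 shows "f = g"
 by (rule inj_onD[OF bij_betw_imp_inj_on[OF Fm_bij[OF assms(1,2)]] assms(5,3,4)])

lemma Fm_full:
 assumes "M \<in> fd_modules B" "N \<in> fd_modules B" "h \<in> module_hom A (Fo M) (Fo N)"
 shows "\<exists>f\<in>module_hom B M N. Fm M N f = h"
proof -
 have "h \<in> Fm M N ` module_hom B M N" using Fm_bij[OF assms(1,2)] assms(3) by (simp add: bij_betw_def)
 then show ?thesis by blast
qed

text \<open>The zero homomorphism is its own multiple by the scalar 0, so this follows from
  \<open>Fm_scale\<close>.\<close>

lemma Fm_zero:
 assumes M: "M \<in> fd_modules B" and N: "N \<in> fd_modules B"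
 shows "Fm M N (\<lambda>x\<in>carrier M. \<zero>[N]) = (\<lambda>x\<in>carrier (Fo M). \<zero>[Fo N])"
proof -
 let ?z = "\<lambda>x\<in>carrier M. \<zero>[N]"
 have l: "left_module B M" "left_module B N" "left_module A (Fo M)" "left_module A (Fo N)"
  using M N Fo_closed fd_left_module by blast+
 have z: "?z \<in> module_hom B M N" by (rule module_hom_zero_map[OF l(1,2)])
 have 0: "(0 *[B] \<one>[B]) *[N] \<zero>[N] = \<zero>[N]" by (rule left_module.smult_zero[OF l(2)]) simp
 have "(\<lambda>x\<in>carrier M. (0 *[B] \<one>[B]) *[N] ?z x) = ?z"
  by (rule restrict_ext) (simp only: restrict_apply' 0)
 then have "Fm M N ?z = (\<lambda>x\<in>carrier (Fo M). (0 *[A] \<one>[A]) *[Fo N] Fm M N ?z x)"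
  using Fm_scale[OF M N z, of 0] by (simp only:)
 also have "\<dots> = (\<lambda>x\<in>carrier (Fo M). \<zero>[Fo N])"
 proof (rule restrict_ext)
  fix x assume "x \<in> carrier (Fo M)"
  then have "Fm M N ?z x \<in> carrier (Fo N)" by (rule module_homD(1)[OF Fm_closed[OF M N z]])
  then show "(0 *[A] \<one>[A]) *[Fo N] Fm M N ?z x = \<zero>[Fo N]"
   unfolding A.scale_zero[OF A.one_closed] by (rule left_module.zero_smult[OF l(4)])
 qed
 finally show ?thesis .
qed

lemma hom_zero_iff:
 assumes M: "M \<in> fd_modules B" and N: "N \<in> fd_modules B" and f: "f \<in> module_hom B M N"
 shows "(\<forall>x\<in>carrier (Fo M). Fm M N f x = \<zero>[Fo N]) \<longleftrightarrow> (\<forall>x\<in>carrier M. f x = \<zero>[N])"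
proof -
 have l: "left_module B M" "left_module B N" "left_module A (Fo M)" "left_module A (Fo N)"
  using M N Fo_closed fd_left_module by blast+
 note z = module_hom_zero_map[OF l(1,2)] and z' = module_hom_zero_map[OF l(3,4)]
 show ?thesis
 proof
  assume "\<forall>x\<in>carrier (Fo M). Fm M N f x = \<zero>[Fo N]"
  then have "Fm M N f = (\<lambda>x\<in>carrier (Fo M). \<zero>[Fo N])"
   by (intro module_hom_eqI[OF Fm_closed[OF M N f] z']) simp
  then have e: "f = (\<lambda>x\<in>carrier M. \<zero>[N])" by (intro Fm_inj[OF M N f z]) (simp only: Fm_zero[OF M N])
  show "\<forall>x\<in>carrier M. f x = \<zero>[N]" unfolding e by simp
 next
  assume "\<forall>x\<in>carrier M. f x = \<zero>[N]"
  then have e: "f = (\<lambda>x\<in>carrier M. \<zero>[N])" by (intro module_hom_eqI[OF f z]) simp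
  show "\<forall>x\<in>carrier (Fo M). Fm M N f x = \<zero>[Fo N]" unfolding e Fm_zero[OF M N] by simp
 qed
qed

lemma comp_zero_iff:
 assumes L: "L \<in> fd_modules B" and M: "M \<in> fd_modules B" and N: "N \<in> fd_modules B"
  and f: "f \<in> module_hom B L M" and g: "g \<in> module_hom B M N"
 shows "(\<forall>x\<in>carrier (Fo L). Fm M N g (Fm L M f x) = \<zero>[Fo N]) \<longleftrightarrow> (\<forall>x\<in>carrier L. g (f x) = \<zero>[N])"
 using hom_zero_iff[OF L N module_hom_compose[OF f g fd_left_module[OF L]]]
 unfolding Fm_comp[OF L M N f g] by (simp add: compose_def)

lemma ess_surj_hom:
 assumes L': "L' \<in> fd_modules A"
 shows "\<exists>L\<in>fd_modules B. \<exists>\<phi>\<in>module_hom A (Fo L) L'. bij_betw \<phi> (carrier (Fo L)) (carrier L')"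
 using ess_surj[OF L'] unfolding module_iso_def .

text \<open>From right to left, a test homomorphism out of \<open>Fo N\<close> need not end in a
  module of the form \<open>Fo L\<close>; its target is first replaced by an isomorphic one of that
  form.\<close>

lemma surj_iff:
 assumes M: "M \<in> fd_modules B" and N: "N \<in> fd_modules B" and f: "f \<in> module_hom B M N"
 shows "Fm M N f ` carrier (Fo M) = carrier (Fo N) \<longleftrightarrow> f ` carrier M = carrier N" (is "?l = ?r")
proof
 assume s: ?l
 show ?r
  unfolding B.surj_iff_epi[OF M N f]
 proof (intro ballI impI)
  fix L g y assume L: "L \<in> fd_modules B" and g: "g \<in> module_hom B N L"
   and z: "\<forall>x\<in>carrier M. g (f x) = \<zero>[L]" and y: "y \<in> carrier N"
  from z have "\<forall>x\<in>carrier (Fo M). Fm N L g (Fm M N f x) = \<zero>[Fo L]" using comp_zero_iff[OF M N L f g] by blast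
  then have "\<forall>y\<in>carrier (Fo N). Fm N L g y = \<zero>[Fo L]" unfolding s[symmetric] by blast
  then have "\<forall>y\<in>carrier N. g y = \<zero>[L]" by (rule iffD1[OF hom_zero_iff[OF N L g]])
  then show "g y = \<zero>[L]" using y by (rule bspec)
 qed
next
 assume s: ?r
 show ?l
  unfolding A.surj_iff_epi[OF Fo_closed[OF M] Fo_closed[OF N] Fm_closed[OF M N f]]
 proof (intro ballI impI)
  fix L' g' y assume L': "L' \<in> fd_modules A" and g': "g' \<in> module_hom A (Fo N) L'"
   and z: "\<forall>x\<in>carrier (Fo M). g' (Fm M N f x) = \<zero>[L']" and y: "y \<in> carrier (Fo N)"
  from ess_surj_hom[OF L'] obtain L where "L \<in> fd_modules B \<and> (\<exists>\<phi>\<in>module_hom A (Fo L) L'. bij_betw \<phi> (carrier (Fo L)) (carrier L'))" by blast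
  then obtain \<phi> where L: "L \<in> fd_modules B" and p: "\<phi> \<in> module_hom A (Fo L) L'" "bij_betw \<phi> (carrier (Fo L)) (carrier L')"
   by blast
  note lL = fd_left_module[OF Fo_closed[OF L]] and lL' = fd_left_module[OF L'] and lN = fd_left_module[OF Fo_closed[OF N]]
  obtain \<psi> where q: "\<psi> \<in> module_hom A L' (Fo L)" "bij_betw \<psi> (carrier L') (carrier (Fo L))"
   "\<And>x. x \<in> carrier (Fo L) ==> \<psi> (\<phi> x) = x" "\<And>y. y \<in> carrier L' ==> \<phi> (\<psi> y) = y"
  proof (rule module_hom_inverse[OF p lL lL'])
   fix g assume a: "g \<in> module_hom A L' (Fo L)" "bij_betw g (carrier L') (carrier (Fo L))"
    "\<And>x. x \<in> carrier (Fo L) ==> g (\<phi> x) = x" "\<And>y. y \<in> carrier L' ==> \<phi> (g y) = y"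
   show thesis by (rule that[OF a])
  qed
  have q0: "\<psi> \<zero>[L'] = \<zero>[Fo L]" by (rule module_hom_zero[OF q(1) lL' lL])
  have c: "compose (carrier (Fo N)) \<psi> g' \<in> module_hom A (Fo N) (Fo L)" by (rule module_hom_compose[OF g' q(1) lN])
  from Fm_full[OF N L c] obtain g where g: "g \<in> module_hom B N L" "Fm N L g = compose (carrier (Fo N)) \<psi> g'" ..
  have gv: "Fm N L g y = \<psi> (g' y)" if "y \<in> carrier (Fo N)" for y using that unfolding g(2) by (simp add: compose_def)
  have "\<forall>x\<in>carrier (Fo M). Fm N L g (Fm M N f x) = \<zero>[Fo L]"
  proof
   fix x assume x: "x \<in> carrier (Fo M)"
   show "Fm N L g (Fm M N f x) = \<zero>[Fo L]"
    using gv[OF module_homD(1)[OF Fm_closed[OF M N f] x]] z[rule_format, OF x] q0 by simp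
  qed
  then have "\<forall>x\<in>carrier M. g (f x) = \<zero>[L]" using comp_zero_iff[OF M N L f g(1)] by blast
  then have "\<forall>y\<in>carrier N. g y = \<zero>[L]" unfolding s[symmetric] by blast
  then have "Fm N L g y = \<zero>[Fo L]" using hom_zero_iff[OF N L g(1)] y by blast
  then have "\<psi> (g' y) = \<zero>[Fo L]" using gv[OF y] by simp
  then have "\<phi> (\<psi> (g' y)) = \<zero>[L']" using module_hom_zero[OF p(1) lL lL'] by simp
  then show "g' y = \<zero>[L']" using q(4)[OF module_homD(1)[OF g' y]] by simp
 qed
qed

lemma nonzero_iff:
 assumes M: "M \<in> fd_modules B"
 shows "carrier (Fo M) \<noteq> {\<zero>[Fo M]} \<longleftrightarrow> carrier M \<noteq> {\<zero>[M]}"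
proof -
 have "(\<lambda>x\<in>carrier M. x) \<in> module_hom B M M" by (rule module_hom_id[OF fd_left_module[OF M]])
 from hom_zero_iff[OF M M this]
 have "(\<forall>x\<in>carrier (Fo M). x = \<zero>[Fo M]) \<longleftrightarrow> (\<forall>x\<in>carrier M. x = \<zero>[M])"
  unfolding Fm_id[OF M] by simp
 then show ?thesis
  using left_module_zero_closed[OF fd_left_module[OF M]] left_module_zero_closed[OF fd_left_module[OF Fo_closed[OF M]]]
  by blast
qed

lemma simple_iff:
 assumes S: "S \<in> fd_modules B"
 shows "simple_module A (Fo S) \<longleftrightarrow> simple_module B S"
proof
 assume s: "simple_module A (Fo S)"
 show "simple_module B S"
  unfolding B.simple_iff_surj[OF S]
 proof (intro conjI ballI)
  show "carrier S \<noteq> {\<zero>[S]}" using nonzero_iff[OF S] simple_moduleD(2)[OF s] by blast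
  fix M f assume M: "M \<in> fd_modules B" and f: "f \<in> module_hom B M S"
  have "(\<forall>x\<in>carrier (Fo M). Fm M S f x = \<zero>[Fo S]) \<or> Fm M S f ` carrier (Fo M) = carrier (Fo S)"
   using s Fo_closed[OF M] Fm_closed[OF M S f] unfolding A.simple_iff_surj[OF Fo_closed[OF S]] by blast
  then show "(\<forall>x\<in>carrier M. f x = \<zero>[S]) \<or> f ` carrier M = carrier S"
   unfolding hom_zero_iff[OF M S f] surj_iff[OF M S f] .
 qed
next
 assume s: "simple_module B S"
 show "simple_module A (Fo S)"
  unfolding A.simple_iff_surj[OF Fo_closed[OF S]]
 proof (intro conjI ballI)
  show "carrier (Fo S) \<noteq> {\<zero>[Fo S]}" using nonzero_iff[OF S] simple_moduleD(2)[OF s] by blast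
  fix M' f' assume M': "M' \<in> fd_modules A" and f': "f' \<in> module_hom A M' (Fo S)"
  from ess_surj_hom[OF M'] obtain M where "M \<in> fd_modules B \<and> (\<exists>\<phi>\<in>module_hom A (Fo M) M'. bij_betw \<phi> (carrier (Fo M)) (carrier M'))" by blast
  then obtain \<phi> where M: "M \<in> fd_modules B" and p: "\<phi> \<in> module_hom A (Fo M) M'" "bij_betw \<phi> (carrier (Fo M)) (carrier M')"
   by blast
  have "compose (carrier (Fo M)) f' \<phi> \<in> module_hom A (Fo M) (Fo S)"
   by (rule module_hom_compose[OF p(1) f' fd_left_module[OF Fo_closed[OF M]]])
  from Fm_full[OF M S this] obtain f where f: "f \<in> module_hom B M S" "Fm M S f = compose (carrier (Fo M)) f' \<phi>" ..
  have fv: "Fm M S f x = f' (\<phi> x)" if "x \<in> carrier (Fo M)" for x using that unfolding f(2) by (simp add: compose_def)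
  have im: "\<phi> ` carrier (Fo M) = carrier M'" using p(2) by (simp add: bij_betw_def)
  have "(\<forall>x\<in>carrier M. f x = \<zero>[S]) \<or> f ` carrier M = carrier S"
   using s M f(1) unfolding B.simple_iff_surj[OF S] by blast
  then have "(\<forall>x\<in>carrier (Fo M). Fm M S f x = \<zero>[Fo S]) \<or> Fm M S f ` carrier (Fo M) = carrier (Fo S)"
   unfolding hom_zero_iff[OF M S f(1)] surj_iff[OF M S f(1)] .
  then show "(\<forall>x\<in>carrier M'. f' x = \<zero>[Fo S]) \<or> f' ` carrier M' = carrier (Fo S)"
  proof
   assume z: "\<forall>x\<in>carrier (Fo M). Fm M S f x = \<zero>[Fo S]"
   have "\<forall>x\<in>carrier M'. f' x = \<zero>[Fo S]" unfolding im[symmetric] using z fv by simp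
   then show ?thesis ..
  next
   assume "Fm M S f ` carrier (Fo M) = carrier (Fo S)"
   then have "f' ` carrier M' = carrier (Fo S)" unfolding im[symmetric] image_image using fv by simp
   then show ?thesis ..
  qed
 qed
qed

text \<open>Between simple modules, an isomorphism exists as soon as a nonzero homomorphism does,
  and the functor preserves and reflects nonzero homomorphisms.\<close>

lemma simple_iso_iff:
 assumes S: "S \<in> fd_modules B" "simple_module B S" and T: "T \<in> fd_modules B" "simple_module B T"
 shows "module_iso A (Fo S) (Fo T) \<longleftrightarrow> module_iso B S T"
proof -
 have *: "module_iso X M N \<longleftrightarrow> (\<exists>f\<in>module_hom X M N. \<not> (\<forall>x\<in>carrier M. f x = \<zero>[N]))"
  if M: "simple_module X M" and N: "simple_module X N"
  for X :: "('k, 'x) module" and M :: "('x, 'k vec) module" and N :: "('x, 'k vec) module"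
 proof
  assume "module_iso X M N"
  then obtain f where f: "f \<in> module_hom X M N" "bij_betw f (carrier M) (carrier N)" unfolding module_iso_def ..
  have "\<not> (\<forall>x\<in>carrier M. f x = \<zero>[N])"
  proof
   assume z: "\<forall>x\<in>carrier M. f x = \<zero>[N]"
   have "carrier N = f ` carrier M" using f(2) by (simp add: bij_betw_def)
   then have "carrier N = {\<zero>[N]}" using z left_module_zero_closed[OF simple_moduleD(1)[OF N]] by auto
   then show False using simple_moduleD(2)[OF N] by simp
  qed
  then show "\<exists>f\<in>module_hom X M N. \<not> (\<forall>x\<in>carrier M. f x = \<zero>[N])" using f(1) by blast
 next
  assume "\<exists>f\<in>module_hom X M N. \<not> (\<forall>x\<in>carrier M. f x = \<zero>[N])"
  then obtain f x where "f \<in> module_hom X M N" "x \<in> carrier M" "f x \<noteq> \<zero>[N]" by blast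
  then show "module_iso X M N" by (rule simple_hom_iso[OF M N])
 qed
 have "simple_module A (Fo S)" "simple_module A (Fo T)" using S T simple_iff by blast+
 from *[OF this] have l: "module_iso A (Fo S) (Fo T) \<longleftrightarrow>
  (\<exists>f\<in>module_hom A (Fo S) (Fo T). \<not> (\<forall>x\<in>carrier (Fo S). f x = \<zero>[Fo T]))" .
 show ?thesis
  unfolding l *[OF S(2) T(2)]
 proof
  assume "\<exists>f\<in>module_hom A (Fo S) (Fo T). \<not> (\<forall>x\<in>carrier (Fo S). f x = \<zero>[Fo T])"
  then obtain h where h: "h \<in> module_hom A (Fo S) (Fo T)" "\<not> (\<forall>x\<in>carrier (Fo S). h x = \<zero>[Fo T])" ..
  from Fm_full[OF S(1) T(1) h(1)] obtain f where f: "f \<in> module_hom B S T" "Fm S T f = h" ..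
  have "\<not> (\<forall>x\<in>carrier S. f x = \<zero>[T])" using hom_zero_iff[OF S(1) T(1) f(1)] h(2) unfolding f(2) by blast
  then show "\<exists>f\<in>module_hom B S T. \<not> (\<forall>x\<in>carrier S. f x = \<zero>[T])" using f(1) by (rule bexI)
 next
  assume "\<exists>f\<in>module_hom B S T. \<not> (\<forall>x\<in>carrier S. f x = \<zero>[T])"
  then obtain f where f: "f \<in> module_hom B S T" "\<not> (\<forall>x\<in>carrier S. f x = \<zero>[T])" ..
  then have "\<not> (\<forall>x\<in>carrier (Fo S). Fm S T f x = \<zero>[Fo T])" using hom_zero_iff[OF S(1) T(1) f(1)] by blast
  then show "\<exists>f\<in>module_hom A (Fo S) (Fo T). \<not> (\<forall>x\<in>carrier (Fo S). f x = \<zero>[Fo T])"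
   using Fm_closed[OF S(1) T(1) f(1)] by (rule bexI)
 qed
qed

text \<open>The functor is linear and faithful, so an endomorphism whose image is a scalar is that
  scalar.\<close>

lemma scalar_endomorphisms_reflect:
 assumes S: "S \<in> fd_modules B" and e: "scalar_endomorphisms A (Fo S)"
 shows "scalar_endomorphisms B S"
 unfolding scalar_endomorphisms_def
proof
 fix f assume f: "f \<in> module_hom B S S"
 note l = fd_left_module[OF S]
 have id: "(\<lambda>x\<in>carrier S. x) \<in> module_hom B S S" by (rule module_hom_id[OF l])
 from e Fm_closed[OF S S f] obtain c where c: "\<forall>s\<in>carrier (Fo S). Fm S S f s = (c *[A] \<one>[A]) *[Fo S] s"
  unfolding scalar_endomorphisms_def by blast
 let ?g = "\<lambda>x\<in>carrier S. (c *[B] \<one>[B]) *[S] (\<lambda>x\<in>carrier S. x) x"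
 have g: "?g \<in> module_hom B S S" by (rule B.module_hom_scale[OF l l id])
 have "Fm S S ?g = Fm S S f"
  unfolding Fm_scale[OF S S id] Fm_id[OF S]
 proof
  fix x
  show "(\<lambda>x\<in>carrier (Fo S). (c *[A] \<one>[A]) *[Fo S] (\<lambda>x\<in>carrier (Fo S). x) x) x = Fm S S f x"
   using c module_homD(4)[OF Fm_closed[OF S S f]] by (cases "x \<in> carrier (Fo S)") (auto simp: extensional_def)
 qed
 then have e: "?g = f" by (rule Fm_inj[OF S S g f])
 have "f s = (c *[B] \<one>[B]) *[S] s" if "s \<in> carrier S" for s using fun_cong[OF e, of s] that by simp
 then show "\<exists>c. \<forall>s\<in>carrier S. f s = (c *[B] \<one>[B]) *[S] s" by blast
qed

lemma projective_reflect:
 assumes P: "P \<in> fd_modules B" and proj: "projective_module A (Fo P)"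
 shows "projective_module B P"
 unfolding projective_module_def
proof (intro conjI ballI impI P)
 fix M N g f assume M: "M \<in> fd_modules B" and N: "N \<in> fd_modules B" and g: "g \<in> module_hom B M N"
  and f: "f \<in> module_hom B P N" and s: "g ` carrier M = carrier N"
 have "Fm M N g ` carrier (Fo M) = carrier (Fo N)" using s surj_iff[OF M N g] by blast
 from projective_moduleD[OF proj Fo_closed[OF M] Fo_closed[OF N] Fm_closed[OF M N g] Fm_closed[OF P N f] this]
 obtain h' where h': "h' \<in> module_hom A (Fo P) (Fo M)" "compose (carrier (Fo P)) (Fm M N g) h' = Fm P N f" ..
 from Fm_full[OF P M h'(1)] obtain h where h: "h \<in> module_hom B P M" "Fm P M h = h'" ..
 have "Fm P N (compose (carrier P) g h) = Fm P N f" unfolding Fm_comp[OF P M N h(1) g] h(2) h'(2) ..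
 then have "compose (carrier P) g h = f"
  by (rule Fm_inj[OF P N module_hom_compose[OF h(1) g fd_left_module[OF P]] f])
 then show "\<exists>h\<in>module_hom B P M. compose (carrier P) g h = f" using h(1) by (rule bexI)
qed

lemma cover_reflect:
 assumes P: "P \<in> fd_modules B" and S: "S \<in> fd_modules B" and c: "is_projective_cover A (Fo P) (Fo S)"
 shows "is_projective_cover B P S"
proof -
 have proj: "projective_module A (Fo P)" using c by (simp add: is_projective_cover_def)
 obtain p' where p': "p' \<in> module_hom A (Fo P) (Fo S)" "p' ` carrier (Fo P) = carrier (Fo S)"
  and sup': "\<forall>U. submodule U A (Fo P) \<and> p' ` U = carrier (Fo S) --> U = carrier (Fo P)"
  using c unfolding is_projective_cover_def by (elim conjE bexE)
 from Fm_full[OF P S p'(1)] obtain p where p: "p \<in> module_hom B P S" "Fm P S p = p'" ..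
 have sp: "p ` carrier P = carrier S" using surj_iff[OF P S p(1)] p'(2) unfolding p(2) by blast
 note lP = fd_left_module[OF P]
 have sup: "U = carrier P" if U: "submodule U B P" and pU: "p ` U = carrier S" for U
 proof -
  \<comment> \<open>A submodule \<open>U\<close> enters the functor through its inclusion
    \<open>?i\<close>; the image of \<open>Fm ?M P ?i\<close> is the submodule of
    \<open>Fo P\<close> to which \<open>sup'\<close> applies.\<close>
  let ?M = "P\<lparr>carrier := U\<rparr>" and ?i = "\<lambda>x\<in>U. x"
  have M: "?M \<in> fd_modules B"
   unfolding B.fd_modules_iff by (rule B.fdm_submodule[OF iffD1[OF B.fd_modules_iff P] U])
  have i: "?i \<in> module_hom B ?M P" by (rule module_hom_inclusion[OF lP U])
  have c: "compose (carrier ?M) p ?i \<in> module_hom B ?M S"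
   by (rule module_hom_compose[OF i p(1) fd_left_module[OF M]])
  have "compose (carrier ?M) p ?i ` carrier ?M = p ` U" by (auto simp: compose_def image_iff)
  then have "compose (carrier ?M) p ?i ` carrier ?M = carrier S" unfolding pU .
  then have "Fm ?M S (compose (carrier ?M) p ?i) ` carrier (Fo ?M) = carrier (Fo S)" using surj_iff[OF M S c] by blast
  then have "compose (carrier (Fo ?M)) p' (Fm ?M P ?i) ` carrier (Fo ?M) = carrier (Fo S)"
   unfolding Fm_comp[OF M P S i p(1)] p(2) .
  moreover have "compose (carrier (Fo ?M)) p' (Fm ?M P ?i) ` carrier (Fo ?M) = p' ` (Fm ?M P ?i ` carrier (Fo ?M))"
   by (auto simp: compose_def image_iff)
  ultimately have s: "p' ` (Fm ?M P ?i ` carrier (Fo ?M)) = carrier (Fo S)" by simp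
  note lM = fd_left_module[OF Fo_closed[OF M]]
  have "submodule (Fm ?M P ?i ` carrier (Fo ?M)) A (Fo P)"
   by (rule module_hom_image_submodule[OF Fm_closed[OF M P i] lM fd_left_module[OF Fo_closed[OF P]] left_module.submodule_carrier[OF lM]])
  from sup'[rule_format, OF conjI, OF this s] have "?i ` carrier ?M = carrier P" using surj_iff[OF M P i] by blast
  then show ?thesis by simp
 qed
 show ?thesis
  unfolding is_projective_cover_def
  by (intro conjI bexI[of _ p] projective_reflect[OF P proj] sp p(1) allI impI) (rule sup; simp)
qed

text \<open>\<open>Fm\<close> is a linear bijection between spaces of homomorphisms. As these are
  represented by values at generators, it is rewritten as a map \<open>\<Phi>\<close> from values at
  \<open>x\<close> to values at \<open>y\<close>; a homomorphism is determined by its value at a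
  generator.\<close>

lemma hom_dim_eq:
 assumes P: "P \<in> fd_modules B" "cyclic B P x" and y: "cyclic A (Fo P) y" and M: "M \<in> fd_modules B"
 shows "hom_dim B P x M = hom_dim A (Fo P) y (Fo M)"
proof -
 note lP = fd_left_module[OF P(1)] and lM = fd_left_module[OF M]
 note lP' = fd_left_module[OF Fo_closed[OF P(1)]] and lM' = fd_left_module[OF Fo_closed[OF M]]
 have x: "x \<in> carrier P" and yc: "y \<in> carrier (Fo P)" using P(2) y by (simp_all add: cyclic_def)
 let ?V = "(restrict_scalars B M)\<lparr>carrier := hom_values B P x M\<rparr>"
 let ?W = "(restrict_scalars A (Fo M))\<lparr>carrier := hom_values A (Fo P) y (Fo M)\<rparr>"
 have V: "kspace ?V" by (rule B.kspace_hom_values[OF lP lM x])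
 have W: "kspace ?W" by (rule A.kspace_hom_values[OF lP' lM' yc])
 have finV: "kfin ?V" by (rule B.kfin_hom_values[OF _ x]) (rule iffD1[OF B.fd_modules_iff M])
 have determined: "f = g" if "f \<in> module_hom X Q N" "g \<in> module_hom X Q N" "cyclic X Q z" "f z = g z"
  for X :: "('k, 'x) module" and Q N :: "('x, 'k vec) module" and f g z
 proof (rule module_hom_eqI[OF that(1,2)])
  fix w assume "w \<in> carrier Q"
  with that(3) obtain a where a: "a \<in> carrier X" "w = a *[Q] z" by (rule cyclicE)
  have z: "z \<in> carrier Q" using that(3) by (simp add: cyclic_def)
  show "f w = g w" unfolding a(2) module_homD(3)[OF that(1) a(1) z] module_homD(3)[OF that(2) a(1) z] that(4) ..
 qed
 define \<Phi> where "\<Phi> = (\<lambda>z. Fm P M (SOME f. f \<in> module_hom B P M \<and> f x = z) y)"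
 have Phi: "\<Phi> (f x) = Fm P M f y" if f: "f \<in> module_hom B P M" for f
 proof -
  let ?g = "SOME g. g \<in> module_hom B P M \<and> g x = f x"
  have g: "?g \<in> module_hom B P M \<and> ?g x = f x" by (rule someI[of _ f]) (use f in simp)
  have "?g = f" by (rule determined[OF conjunct1[OF g] f P(2) conjunct2[OF g]])
  then show ?thesis unfolding \<Phi>_def by (rule arg_cong)
 qed
 have lin: "klinear ?V ?W \<Phi>"
  unfolding klinear_def
 proof (intro conjI ballI allI)
  show "\<Phi> ` carrier ?V \<subseteq> carrier ?W"
  proof (rule image_subsetI)
   fix z assume "z \<in> carrier ?V"
   then have "z \<in> hom_values B P x M" by simp
   then obtain f where f: "f \<in> module_hom B P M" "z = f x" by (rule hom_valuesE)
   have "\<Phi> z \<in> hom_values A (Fo P) y (Fo M)"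
    unfolding f(2) Phi[OF f(1)] by (rule hom_valuesI[OF Fm_closed[OF P(1) M f(1)] refl])
   then show "\<Phi> z \<in> carrier ?W" by simp
  qed
 next
  fix z w assume "z \<in> carrier ?V" "w \<in> carrier ?V"
  then have zw: "z \<in> hom_values B P x M" "w \<in> hom_values B P x M" by simp_all
  obtain f where f: "f \<in> module_hom B P M" "z = f x" using zw(1) by (rule hom_valuesE)
  obtain g where g: "g \<in> module_hom B P M" "w = g x" using zw(2) by (rule hom_valuesE)
  let ?s = "\<lambda>x\<in>carrier P. f x +[M] g x"
  have s: "?s \<in> module_hom B P M" by (rule module_hom_add[OF lP lM f(1) g(1)])
  have "\<Phi> (?s x) = Fm P M f y +[Fo M] Fm P M g y"
   unfolding Phi[OF s] Fm_add[OF P(1) M f(1) g(1)] using yc by simp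
  then show "\<Phi> (z +[?V] w) = \<Phi> z +[?W] \<Phi> w"
   unfolding f(2) g(2) using x Phi[OF f(1)] Phi[OF g(1)] by simp
 next
  fix c z assume "z \<in> carrier ?V"
  then have "z \<in> hom_values B P x M" by simp
  then obtain f where f: "f \<in> module_hom B P M" "z = f x" by (rule hom_valuesE)
  let ?s = "\<lambda>x\<in>carrier P. (c *[B] \<one>[B]) *[M] f x"
  have s: "?s \<in> module_hom B P M" by (rule B.module_hom_scale[OF lP lM f(1)])
  have "\<Phi> (?s x) = (c *[A] \<one>[A]) *[Fo M] Fm P M f y"
   unfolding Phi[OF s] Fm_scale[OF P(1) M f(1)] using yc by simp
  then show "\<Phi> (c *[?V] z) = c *[?W] \<Phi> z"
   unfolding f(2) using x Phi[OF f(1)] by simp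
 qed
 have "bij_betw \<Phi> (carrier ?V) (carrier ?W)"
  unfolding bij_betw_def
 proof
  show "inj_on \<Phi> (carrier ?V)"
  proof (rule inj_onI)
   fix z w assume "z \<in> carrier ?V" "w \<in> carrier ?V" and e: "\<Phi> z = \<Phi> w"
   then have zw: "z \<in> hom_values B P x M" "w \<in> hom_values B P x M" by simp_all
   obtain f where f: "f \<in> module_hom B P M" "z = f x" using zw(1) by (rule hom_valuesE)
   obtain g where g: "g \<in> module_hom B P M" "w = g x" using zw(2) by (rule hom_valuesE)
   have "Fm P M f y = Fm P M g y" using e unfolding f(2) g(2) Phi[OF f(1)] Phi[OF g(1)] .
   then have "Fm P M f = Fm P M g"
    by (rule determined[OF Fm_closed[OF P(1) M f(1)] Fm_closed[OF P(1) M g(1)] y])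
   then have "f = g" by (rule Fm_inj[OF P(1) M f(1) g(1)])
   then show "z = w" unfolding f(2) g(2) by simp
  qed
  show "\<Phi> ` carrier ?V = carrier ?W"
  proof
   show "\<Phi> ` carrier ?V \<subseteq> carrier ?W" using lin by (simp add: klinear_def)
   show "carrier ?W \<subseteq> \<Phi> ` carrier ?V"
   proof
    fix w assume "w \<in> carrier ?W"
    then have "w \<in> hom_values A (Fo P) y (Fo M)" by simp
    then obtain h where h: "h \<in> module_hom A (Fo P) (Fo M)" "w = h y" by (rule hom_valuesE)
    from Fm_full[OF P(1) M h(1)] obtain f where f: "f \<in> module_hom B P M" "Fm P M f = h" ..
    have "w = \<Phi> (f x)" unfolding Phi[OF f(1)] f(2) h(2) ..
    moreover have "f x \<in> carrier ?V" using hom_valuesI[OF f(1) refl] by simp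
    ultimately show "w \<in> \<Phi> ` carrier ?V" by (rule image_eqI)
   qed
  qed
 qed
 from kdim_iso(2)[OF V W lin this finV] show ?thesis by (simp add: hom_dim_def)
qed

end

text \<open>What the later arguments use about a simple module and its cover. The generator
  \<open>x\<close> is carried along because \<open>hom_dim\<close> is measured at it.\<close>

definition cover_data ::
 "('k::field, 'a) module \<Rightarrow> ('a, 'k vec) module \<Rightarrow> ('a, 'k vec) module \<Rightarrow> 'k vec \<Rightarrow> bool"
 where "cover_data A S P x \<longleftrightarrow> S \<in> fd_modules A \<and> simple_module A S \<and> scalar_endomorphisms A S \<and>
  is_projective_cover A P S \<and> cyclic A P x \<and>
  (\<exists>p\<in>module_hom A P S. p ` carrier P = carrier S \<and> p x \<noteq> \<zero>[S] \<and>
   (\<forall>U. submodule U A P \<and> p ` U = carrier S --> U = carrier P))"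

context kalg
begin

lemma cover_data_exists:
 assumes c: "is_projective_cover A P S" and S: "S \<in> fd_modules A" "simple_module A S" "scalar_endomorphisms A S"
 shows "\<exists>x. cover_data A S P x"
proof -
 obtain p where p: "p \<in> module_hom A P S" "p ` carrier P = carrier S"
  and sup: "\<forall>U. submodule U A P \<and> p ` U = carrier S --> U = carrier P"
  using c unfolding is_projective_cover_def by (elim conjE bexE)
 have proj: "projective_module A P" using c by (simp add: is_projective_cover_def)
 have "\<exists>s\<in>carrier S. s \<noteq> \<zero>[S]"
  using simple_moduleD(2)[OF S(2)] left_module_zero_closed[OF simple_moduleD(1)[OF S(2)]] by blast
 then obtain x where x: "x \<in> carrier P" "p x \<noteq> \<zero>[S]" unfolding p(2)[symmetric] by blast
 have "cyclic A P x"
  by (rule cover_cyclic[OF proj S(2,3) p _ x]) (rule sup[rule_format], rule conjI)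
 then show ?thesis unfolding cover_data_def using S c p x(2) sup by (intro exI[of _ x] conjI bexI[of _ p])
qed

lemma cover_data_comp_mult:
 assumes c: "cover_data A S P x" and M: "fdm A M"
 shows "comp_mult A M S = hom_dim A P x M"
proof -
 obtain p where p: "p \<in> module_hom A P S" "p ` carrier P = carrier S" "p x \<noteq> \<zero>[S]"
  and sup: "\<forall>U. submodule U A P \<and> p ` U = carrier S --> U = carrier P"
  using c unfolding cover_data_def by (elim conjE bexE)
 have S: "simple_module A S" "scalar_endomorphisms A S" and proj: "projective_module A P" and x: "x \<in> carrier P"
  using c by (auto simp: cover_data_def is_projective_cover_def cyclic_def)
 show ?thesis
  by (rule comp_mult_eq_hom_dim[OF proj S p(1,2) _ x p(3) M]) (rule sup[rule_format], rule conjI)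
qed

lemma cover_data_proj:
 assumes "cover_data A S P x"
 shows "projective_module A P" "P \<in> fd_modules A" "fdm A P" "cyclic A P x" "simple_module A S" "S \<in> fd_modules A"
  "is_projective_cover A P S"
 using assms fd_modules_iff by (auto simp: cover_data_def is_projective_cover_def projective_module_def)

text \<open>\<open>cartan_matrix\<close> refers to the chosen cover
  \<open>projective_cover A S\<close>, which uniqueness of covers replaces by
  \<open>P\<close>.\<close>

lemma cover_data_cartan:
 assumes c: "cover_data A S P x" and c': "cover_data A S' P' x'"
 shows "comp_mult A (projective_cover A S) S' = hom_dim A P' x' P"
proof -
 have pc: "is_projective_cover A (projective_cover A S) S"
  unfolding projective_cover_def by (rule someI[where P = "\<lambda>P. is_projective_cover A P S", OF cover_data_proj(7)[OF c]])
 then have "projective_cover A S \<in> fd_modules A" by (simp add: is_projective_cover_def projective_module_def)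
 then have f: "fdm A (projective_cover A S)" by (simp add: fd_modules_iff)
 have iso: "module_iso A (projective_cover A S) P"
  by (rule projective_cover_unique[OF pc cover_data_proj(7)[OF c] cover_data_proj(6)[OF c]])
 have lP: "left_module A P" using cover_data_proj(3)[OF c] by (simp add: fdm_def)
 show ?thesis
  unfolding cover_data_comp_mult[OF c' f]
  by (rule hom_dim_iso[OF cover_data_proj(1,4)[OF c'] f lP iso])
qed

end

text \<open>The interface between the quiver side and the cellular side; the Cartan matrix has rows
  \<open>a, b\<close> and \<open>b, c\<close>.\<close>

definition block_data ::
 "('k::field, 'a) module \<Rightarrow> ('a, 'k vec) module \<Rightarrow> ('a, 'k vec) module \<Rightarrow> nat \<Rightarrow> nat \<Rightarrow> nat \<Rightarrow> bool"
 where "block_data B S\<^sub>1 S\<^sub>2 a b c \<longleftrightarrow> complete_simples B [S\<^sub>1, S\<^sub>2] \<and>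
  (\<exists>P\<^sub>1 x\<^sub>1 P\<^sub>2 x\<^sub>2. cover_data B S\<^sub>1 P\<^sub>1 x\<^sub>1 \<and> cover_data B S\<^sub>2 P\<^sub>2 x\<^sub>2 \<and> hom_dim B P\<^sub>1 x\<^sub>1 P\<^sub>1 = a \<and>
   hom_dim B P\<^sub>1 x\<^sub>1 P\<^sub>2 = b \<and> hom_dim B P\<^sub>2 x\<^sub>2 P\<^sub>1 = b \<and> hom_dim B P\<^sub>2 x\<^sub>2 P\<^sub>2 = c)"

lemma (in kalg) block_data_cartan:
 assumes "block_data A S\<^sub>1 S\<^sub>2 a b c"
 shows "cartan_matrix A [S\<^sub>1, S\<^sub>2] = mat_of_rows_list 2 [[a, b], [b, c]]"
proof -
 obtain P\<^sub>1 x\<^sub>1 P\<^sub>2 x\<^sub>2 where d: "cover_data A S\<^sub>1 P\<^sub>1 x\<^sub>1" "cover_data A S\<^sub>2 P\<^sub>2 x\<^sub>2"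
  and h: "hom_dim A P\<^sub>1 x\<^sub>1 P\<^sub>1 = a" "hom_dim A P\<^sub>1 x\<^sub>1 P\<^sub>2 = b" "hom_dim A P\<^sub>2 x\<^sub>2 P\<^sub>1 = b" "hom_dim A P\<^sub>2 x\<^sub>2 P\<^sub>2 = c"
  using assms unfolding block_data_def by (elim conjE exE)
 have e: "comp_mult A (projective_cover A S\<^sub>1) S\<^sub>1 = a" "comp_mult A (projective_cover A S\<^sub>1) S\<^sub>2 = b"
  "comp_mult A (projective_cover A S\<^sub>2) S\<^sub>1 = b" "comp_mult A (projective_cover A S\<^sub>2) S\<^sub>2 = c"
  unfolding cover_data_cartan[OF d(1) d(1)] cover_data_cartan[OF d(1) d(2)] cover_data_cartan[OF d(2) d(1)]
   cover_data_cartan[OF d(2) d(2)] by (fact h)+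
 show ?thesis
  unfolding cartan_matrix_def mat_of_rows_list_def
  by (rule eq_matI) (auto simp: less_Suc_eq numeral_2_eq_2 e)
qed

context alt_quiver_rels
begin

text \<open>Over the quiver algebra the cover is generated by \<open>vert v\<close>; by essential
  surjectivity some \<open>B\<close>-module is sent to a copy of it.\<close>

lemma cover_at:
 assumes B: "morita A B Fo Fm" and v: "v \<in> {1, 2}" and S: "S \<in> fd_modules B" "simple_at Q R v (Fo S)"
 shows "\<exists>P x y. cover_data B S P x \<and> idem_gen A (vert v) (Fo P) y"
proof -
 interpret M: morita A B Fo Fm by (rule B)
 obtain P' y' where P': "P' \<in> fd_modules A" "idem_gen A (vert v) P' y'"
  using A.idem_gen_exists[OF kfin_A vert_closed[OF v]] vert_mult[OF v v] by auto
 obtain P \<phi> where P: "P \<in> fd_modules B" "\<phi> \<in> module_hom A (Fo P) P'" "bij_betw \<phi> (carrier (Fo P)) (carrier P')"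
  using M.ess_surj_hom[OF P'(1)] by (elim bexE)
 note l = fd_left_module[OF M.Fo_closed[OF P(1)]]
 obtain \<psi> where q: "\<psi> \<in> module_hom A P' (Fo P)" "bij_betw \<psi> (carrier P') (carrier (Fo P))"
  by (rule module_hom_inverse[OF P(2,3) l fd_left_module[OF P'(1)]])
 have y: "idem_gen A (vert v) (Fo P) (\<psi> y')" by (rule idem_gen_iso[OF P'(2) q l])
 have "is_projective_cover A (Fo P) (Fo S)"
  by (rule vertex_cover[OF v S(2) M.Fo_closed[OF S(1)] y M.Fo_closed[OF P(1)]])
 then have c: "is_projective_cover B P S" by (rule M.cover_reflect[OF P(1) S(1)])
 have s: "simple_module B S" using M.simple_iff[OF S(1)] simple_at_facts(2)[OF S(2)] by (rule iffD1)
 have e: "scalar_endomorphisms B S" by (rule M.scalar_endomorphisms_reflect[OF S(1) simple_at_facts(3)[OF S(2)]])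
 show ?thesis using M.B.cover_data_exists[OF c S(1) s e] y by blast
qed

theorem morita_block_data:
 assumes B: "kalg B" and equiv: "morita_equivalent_ordered B Q R [1, 2] [S\<^sub>1, S\<^sub>2]"
  and c: "card (corner 1 1) = a" "card (corner 1 2) = b" "card (corner 2 1) = b" "card (corner 2 2) = c"
 shows "block_data B S\<^sub>1 S\<^sub>2 a b c"
proof -
 obtain Fo Fm where F: "morita_equivalence B A Fo Fm"
  and la: "list_all2 (\<lambda>v S. S \<in> fd_modules B \<and> simple_at Q R v (Fo S)) [1, 2] [S\<^sub>1, S\<^sub>2]"
  using equiv unfolding morita_equivalent_ordered_def by (elim exE conjE)
 have S: "S\<^sub>1 \<in> fd_modules B" "simple_at Q R 1 (Fo S\<^sub>1)" "S\<^sub>2 \<in> fd_modules B" "simple_at Q R 2 (Fo S\<^sub>2)"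
  using la by simp_all
 have m: "morita A B Fo Fm"
  by (intro morita.intro morita_axioms.intro A.kalg_axioms B F)
 interpret M: morita A B Fo Fm by (rule m)
 obtain P\<^sub>1 x\<^sub>1 y\<^sub>1 where P1: "cover_data B S\<^sub>1 P\<^sub>1 x\<^sub>1" "idem_gen A (vert 1) (Fo P\<^sub>1) y\<^sub>1"
  using cover_at[OF m _ S(1,2)] by auto
 obtain P\<^sub>2 x\<^sub>2 y\<^sub>2 where P2: "cover_data B S\<^sub>2 P\<^sub>2 x\<^sub>2" "idem_gen A (vert 2) (Fo P\<^sub>2) y\<^sub>2"
  using cover_at[OF m _ S(3,4)] by auto
 have h: "hom_dim B P x P' = card (corner i j)"
  if "i \<in> {1, 2}" "j \<in> {1, 2}" "cover_data B S P x" "cover_data B S' P' x'"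
   "idem_gen A (vert i) (Fo P) y" "idem_gen A (vert j) (Fo P') y'" for i j S S' P x P' x' y y'
 proof -
  have "cyclic A (Fo P) y" using that(5) by (simp add: idem_gen_def)
  from M.hom_dim_eq[OF M.B.cover_data_proj(2,4)[OF that(3)] this M.B.cover_data_proj(2)[OF that(4)]]
  show ?thesis unfolding vertex_hom_dim[OF that(1,2,5,6)] .
 qed
 have s: "simple_module B S\<^sub>1" "simple_module B S\<^sub>2"
  using M.B.cover_data_proj(5) P1(1) P2(1) by blast+
 have ni: "\<not> module_iso B S\<^sub>1 S\<^sub>2"
  using simple_at_not_iso[OF S(2,4)] M.simple_iso_iff[OF S(1) s(1) S(3) s(2)] by blast
 have ni': "\<not> module_iso B S\<^sub>2 S\<^sub>1"
 proof
  assume "module_iso B S\<^sub>2 S\<^sub>1"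
  then have "module_iso B S\<^sub>1 S\<^sub>2" by (rule module_iso_sym[OF _ fd_left_module[OF S(3)] fd_left_module[OF S(1)]])
  then show False using ni by contradiction
 qed
 have "complete_simples B [S\<^sub>1, S\<^sub>2]"
  unfolding complete_simples_def
 proof (intro conjI ballI allI impI)
  fix T assume "T \<in> set [S\<^sub>1, S\<^sub>2]"
  then have "T = S\<^sub>1 \<or> T = S\<^sub>2" by simp
  then show "T \<in> fd_modules B" "simple_module B T" using S(1,3) s by (elim disjE; simp)+
 next
  fix i j assume "i < length [S\<^sub>1, S\<^sub>2]" "j < length [S\<^sub>1, S\<^sub>2]" "i \<noteq> j"
  then have "i = 0 \<and> j = 1 \<or> i = 1 \<and> j = 0" by auto
  then show "\<not> module_iso B ([S\<^sub>1, S\<^sub>2] ! i) ([S\<^sub>1, S\<^sub>2] ! j)" using ni ni' by auto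
 next
  fix T assume T: "T \<in> fd_modules B" "simple_module B T"
  then have "simple_module A (Fo T)" using M.simple_iff by blast
  from simple_classification[OF S(2,4) this] show "\<exists>S\<in>set [S\<^sub>1, S\<^sub>2]. module_iso B T S"
   using M.simple_iso_iff[OF T S(1) s(1)] M.simple_iso_iff[OF T S(3) s(2)] by auto
 qed
 moreover have "hom_dim B P\<^sub>1 x\<^sub>1 P\<^sub>1 = a" unfolding c(1)[symmetric] by (rule h[OF _ _ P1(1) P1(1) P1(2) P1(2)]) simp_all
 moreover have "hom_dim B P\<^sub>1 x\<^sub>1 P\<^sub>2 = b" unfolding c(2)[symmetric] by (rule h[OF _ _ P1(1) P2(1) P1(2) P2(2)]) simp_all
 moreover have "hom_dim B P\<^sub>2 x\<^sub>2 P\<^sub>1 = b" unfolding c(3)[symmetric] by (rule h[OF _ _ P2(1) P1(1) P2(2) P1(2)]) simp_all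
 moreover have "hom_dim B P\<^sub>2 x\<^sub>2 P\<^sub>2 = c" unfolding c(4)[symmetric] by (rule h[OF _ _ P2(1) P2(1) P2(2) P2(2)]) simp_all
 ultimately show ?thesis unfolding block_data_def using P1(1) P2(1) by blast
qed

end

section \<open>The three algebras as instances\<close>

lemma alt_values:
 "alt 1 2 = [Mu, Nu]" "alt 2 2 = [Nu, Mu]" "alt 1 4 = [Mu, Nu, Mu, Nu]" "alt 2 4 = [Nu, Mu, Nu, Mu]"
 by (simp_all add: eval_nat_numeral)

lemma alt_quiver_two_loop: "[|even N; 2 \<le> N|] ==> alt_quiver two_loop_quiver N"
 by unfold_locales (auto simp: two_loop_quiver_def)

lemma alt_quiver_one_loop: "[|even N; 2 \<le> N|] ==> alt_quiver one_loop_quiver N"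
 by unfold_locales (auto simp: one_loop_quiver_def)

lemma (in alt_quiver) mixed_path_J:
 assumes "(u, es) \<in> paths Q" "length es = 2" "loop u \<in> set es \<or> loop (3 - u) \<in> set es" "es \<noteq> [loop u, loop u]"
 shows "path_elem u es \<in> J"
proof (rule path_elem_J[OF assms(1) _ _ assms(4)])
 show "es \<noteq> alt u n" for n
 proof
  assume "es = alt u n"
  moreover have "loop w \<notin> set (alt u n)" for w by (simp add: loop_def)
  ultimately show False using assms(3) by simp
 qed
 show "es \<noteq> [loop u]" using assms(2) by auto
qed

lemma alt_quiver_rels_212: "alt_quiver_rels two_loop_quiver (rels_212 :: (nat \<times> arrow list \<Rightarrow> 'k::field) set) 2"
proof -
 interpret alt_quiver two_loop_quiver "rels_212 :: (nat \<times> arrow list \<Rightarrow> 'k) set" 2 by (rule alt_quiver_two_loop) simp_all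
 note q = two_loop_quiver_def paths_iff
 have J: "path_elem 1 [Alpha, Mu] \<in> J" "path_elem 1 [Mu, Beta] \<in> J" "path_elem 2 [Beta, Nu] \<in> J" "path_elem 2 [Nu, Alpha] \<in> J"
  by (rule mixed_path_J; simp add: q loop_def)+
 have L: "path_elem 1 [Alpha, Alpha] \<ominus>\<^bsub>PA\<^esub> path_elem 1 [Mu, Nu] \<in> J"
  "path_elem 2 [Beta, Beta] \<ominus>\<^bsub>PA\<^esub> path_elem 2 [Nu, Mu] \<in> J"
  using loop_rel_J[of 1] loop_rel_J[of 2] unfolding alt_values by (simp_all add: loop_def two_loop_quiver_def)
 show ?thesis
  by unfold_locales (use J L in \<open>auto simp: rels_212_def Let_def loop_def alt_values simp del: path_algebra_simps alt.simps One_nat_def\<close>)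
qed

lemma alt_quiver_rels_222: "alt_quiver_rels two_loop_quiver (rels_222 :: (nat \<times> arrow list \<Rightarrow> 'k::field) set) 4"
proof -
 interpret alt_quiver two_loop_quiver "rels_222 :: (nat \<times> arrow list \<Rightarrow> 'k) set" 4 by (rule alt_quiver_two_loop) simp_all
 note q = two_loop_quiver_def paths_iff
 have J: "path_elem 1 [Alpha, Mu] \<in> J" "path_elem 1 [Mu, Beta] \<in> J" "path_elem 2 [Beta, Nu] \<in> J" "path_elem 2 [Nu, Alpha] \<in> J"
  by (rule mixed_path_J; simp add: q loop_def)+
 have L: "path_elem 1 [Alpha, Alpha] \<ominus>\<^bsub>PA\<^esub> path_elem 1 [Mu, Nu, Mu, Nu] \<in> J"
  "path_elem 2 [Beta, Beta] \<ominus>\<^bsub>PA\<^esub> path_elem 2 [Nu, Mu, Nu, Mu] \<in> J"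
  using loop_rel_J[of 1] loop_rel_J[of 2] unfolding alt_values by (simp_all add: loop_def two_loop_quiver_def)
 show ?thesis
  by unfold_locales (use J L in \<open>auto simp: rels_222_def Let_def loop_def alt_values simp del: path_algebra_simps alt.simps One_nat_def\<close>)
qed

lemma alt_quiver_rels_221: "alt_quiver_rels one_loop_quiver (rels_221 :: (nat \<times> arrow list \<Rightarrow> 'k::field) set) 4"
proof -
 interpret alt_quiver one_loop_quiver "rels_221 :: (nat \<times> arrow list \<Rightarrow> 'k) set" 4 by (rule alt_quiver_one_loop) simp_all
 note q = one_loop_quiver_def paths_iff
 have J: "path_elem 1 [Alpha, Mu] \<in> J" "path_elem 2 [Nu, Alpha] \<in> J"
  by (rule mixed_path_J; simp add: q loop_def)+
 \<comment> \<open>The two relations of length five exceed \<open>N = 4\<close>, so no alternating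
   basis path equals them.\<close>
 have n: "es \<noteq> alt u n" if l: "length es = 5" "n \<le> 4" for es u n
 proof
  assume "es = alt u n"
  then have "length es = n" by simp
  then show False using l by simp
 qed
 have J5: "path_elem 1 [Mu, Nu, Mu, Nu, Mu] \<in> J" "path_elem 2 [Nu, Mu, Nu, Mu, Nu] \<in> J"
  by (rule path_elem_J; (rule n)?; simp add: q)+
 have L: "path_elem 1 [Alpha, Alpha] \<ominus>\<^bsub>PA\<^esub> path_elem 1 [Mu, Nu, Mu, Nu] \<in> J"
  using loop_rel_J[of 1] unfolding alt_values by (simp add: loop_def one_loop_quiver_def)
 show ?thesis
  by unfold_locales (use J J5 L in \<open>auto simp: rels_221_def Let_def loop_def alt_values one_loop_quiver_def simp del: path_algebra_simps alt.simps One_nat_def\<close>)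
qed

lemma swp_counts:
 assumes "i \<in> {1, 2}" "j \<in> {1, 2}"
 shows "card {n. n \<le> 2 \<and> swp i n = j} = (if i = j then 2 else 1)"
  and "card {n. n \<le> 4 \<and> swp i n = j} = (if i = j then 3 else 2)"
proof -
 have 2: "n \<le> 2 \<longleftrightarrow> n = 0 \<or> n = 1 \<or> n = 2" and 4: "n \<le> 4 \<longleftrightarrow> n = 0 \<or> n = 1 \<or> n = 2 \<or> n = 3 \<or> n = 4" for n :: nat by auto
 have "{n. n \<le> 2 \<and> swp i n = j} = (if i = j then {0, 2} else {1})"
  using assms unfolding 2 by (auto simp: swp_def)
 then show "card {n. n \<le> 2 \<and> swp i n = j} = (if i = j then 2 else 1)" by simp
 have "{n. n \<le> 4 \<and> swp i n = j} = (if i = j then {0, 2, 4} else {1, 3})"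
  using assms unfolding 4 by (auto simp: swp_def)
 then show "card {n. n \<le> 4 \<and> swp i n = j} = (if i = j then 3 else 2)" by simp
qed

text \<open>At each vertex there are the alternating closed paths of lengths 0 and 2 and the loop;
  in each direction between the vertices there is one arrow.\<close>

lemma block_data_212:
 assumes "kalg B" "morita_equivalent_ordered B two_loop_quiver rels_212 [1, 2] [S\<^sub>1, S\<^sub>2]"
 shows "block_data B S\<^sub>1 S\<^sub>2 3 1 3"
 by (rule alt_quiver_rels.morita_block_data[OF alt_quiver_rels_212 assms];
   subst alt_quiver_rels.card_corner[OF alt_quiver_rels_212]; simp add: swp_counts two_loop_quiver_def loop_def)

text \<open>At each vertex there are the alternating closed paths of lengths 0, 2 and 4, with a loop
  at vertex 1 only; between the vertices the lengths are 1 and 3.\<close>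

lemma block_data_221:
 assumes "kalg B" "morita_equivalent_ordered B one_loop_quiver rels_221 [1, 2] [S\<^sub>1, S\<^sub>2]"
 shows "block_data B S\<^sub>1 S\<^sub>2 4 2 3"
 by (rule alt_quiver_rels.morita_block_data[OF alt_quiver_rels_221 assms];
   subst alt_quiver_rels.card_corner[OF alt_quiver_rels_221]; simp add: swp_counts one_loop_quiver_def loop_def)

lemma block_data_222:
 assumes "kalg B" "morita_equivalent_ordered B two_loop_quiver rels_222 [1, 2] [S\<^sub>1, S\<^sub>2]"
 shows "block_data B S\<^sub>1 S\<^sub>2 4 2 4"
 by (rule alt_quiver_rels.morita_block_data[OF alt_quiver_rels_222 assms];
   subst alt_quiver_rels.card_corner[OF alt_quiver_rels_222]; simp add: swp_counts two_loop_quiver_def loop_def)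

section \<open>Cellular algebras\<close>

context
 fixes V :: "('k::field, 'v) module" and v :: "'i \<Rightarrow> 'v" and I :: "'i set"
 assumes V: "kspace V" and fin: "finite I" and vc: "\<And>i. i \<in> I ==> v i \<in> carrier V"
begin

interpretation V: kspace V by (rule V)

lemma lincomb_in_carrier: "lincomb V v I c \<in> carrier V"
 unfolding lincomb_def by (intro V.finsum_closed funcsetI V.scale_closed vc)

lemma functional_lincomb:
 assumes add: "\<And>x y. [|x \<in> carrier V; y \<in> carrier V|] ==> f (x +[V] y) = f x + (f y :: 'k)"
  and scale: "\<And>c x. x \<in> carrier V ==> f (c *[V] x) = c * f x"
 shows "f (lincomb V v I c) = (\<Sum>i\<in>I. c i * f (v i))"
proof -
 have z: "f \<zero>[V] = 0" using scale[of "\<zero>[V]" 0] by simp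
 have "f (\<Oplus>\<^bsub>V\<^esub>i\<in>F. c i *[V] v i) = (\<Sum>i\<in>F. c i * f (v i))" if "F \<subseteq> I" for F
 proof -
  have "finite F" using that fin by (rule finite_subset)
  then show ?thesis using that
  proof (induction F rule: finite_induct)
   case empty
   then show ?case using z by simp
  next
   case (insert q F)
   have q: "v q \<in> carrier V" and F: "(\<lambda>i. c i *[V] v i) \<in> F \<rightarrow> carrier V"
    using insert.prems vc by auto
   have "(\<Oplus>\<^bsub>V\<^esub>i\<in>insert q F. c i *[V] v i) = c q *[V] v q +[V] (\<Oplus>\<^bsub>V\<^esub>i\<in>F. c i *[V] v i)"
    by (rule V.finsum_insert[OF insert.hyps F V.scale_closed[OF q]])
   then show ?case
    using add[OF V.scale_closed[OF q] V.finsum_closed[OF F]] scale[OF q] insert by simp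
  qed
 qed
 from this[OF subset_refl] show ?thesis unfolding lincomb_def .
qed

end

lemma basis_coeff_basis:
 assumes V: "kspace V" and b: "finite_basis V v I" and i: "i \<in> I" and j: "j \<in> I"
 shows "basis_coeff V v I (v j) i = (if i = j then 1 else 0)"
proof -
 interpret V: kspace V by (rule V)
 have vc: "v i \<in> carrier V" if "i \<in> I" for i by (rule basis_closed[OF V b that])
 have "lincomb V v I (\<lambda>i. if i = j then 1 else 0) = v j"
 proof (rule basis_coeff_eqI[OF V b lincomb_closed[OF V b] vc[OF j]])
  fix k assume k: "k \<in> I"
  have "basis_coeff V v I (lincomb V v I (\<lambda>i. if i = j then 1 else 0)) k =
    (\<Sum>i\<in>I. (if i = j then 1 else 0) * basis_coeff V v I (v i) k)"
   by (rule functional_lincomb[OF V basis_finite[OF V b] vc])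
    (simp_all add: basis_coeff_add[OF V b] basis_coeff_scale[OF V b] k)
  also have "\<dots> = (\<Sum>i\<in>I. if i = j then basis_coeff V v I (v i) k else 0)"
   by (rule sum.cong) auto
  also have "\<dots> = basis_coeff V v I (v j) k" using j basis_finite[OF V b] by simp
  finally show "basis_coeff V v I (lincomb V v I (\<lambda>i. if i = j then 1 else 0)) k = basis_coeff V v I (v j) k" .
 qed
 then show ?thesis using basis_coeff_lincomb[OF V b i, of "\<lambda>i. if i = j then 1 else 0"] by simp
qed

section \<open>Structure constants and cell ideals\<close>

locale cellular = kalg B for B :: "('k::field, 'a) module" (structure) +
 fixes D :: "('l, 't, 'a) cell_structure"
 assumes datum: "cell_datum B D"
begin

abbreviation "X \<equiv> cells D"
abbreviation "T \<equiv> tableaux D"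
abbreviation "C \<equiv> cell_basis D"
abbreviation "st \<equiv> star D"

definition below :: "'l \<Rightarrow> 'l \<Rightarrow> bool" (infix "\<preceq>" 50)
 where "m \<preceq> l \<longleftrightarrow> (m, l) \<in> cell_order D"

definition cb :: "'l \<times> 't \<times> 't \<Rightarrow> 'a"
 where "cb = (\<lambda>(l, s, t). C l s t)"

definition Idx :: "('l \<times> 't \<times> 't) set"
 where "Idx = (SIGMA l:X. T l \<times> T l)"

definition coef :: "'a \<Rightarrow> 'l \<Rightarrow> 't \<Rightarrow> 't \<Rightarrow> 'k"
 where "coef x l s t = basis_coeff B cb Idx x (l, s, t)"

lemma finX: "finite X" and finT: "l \<in> X ==> finite (T l)" and T_nonempty: "l \<in> X ==> T l \<noteq> {}"
 and basis: "finite_basis B cb Idx"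
 using datum unfolding cell_datum_def cb_def Idx_def by blast+

lemma order_facts: "m \<preceq> l ==> m \<in> X \<and> l \<in> X" "l \<in> X ==> l \<preceq> l" "[|k \<preceq> m; m \<preceq> l|] ==> k \<preceq> l" "[|m \<preceq> l; l \<preceq> m|] ==> m = l"
 using datum unfolding cell_datum_def partial_order_on_def preorder_on_def refl_on_def trans_def antisym_def below_def
 by blast+

lemma star_closed [simp]: "a \<in> carrier B ==> st a \<in> carrier B"
 and star_star [simp]: "a \<in> carrier B ==> st (st a) = a"
 and star_scale: "a \<in> carrier B ==> st (c \<odot> a) = c \<odot> st a"
 and star_add: "[|a \<in> carrier B; b \<in> carrier B|] ==> st (a \<oplus> b) = st a \<oplus> st b"
 and star_mult: "[|a \<in> carrier B; b \<in> carrier B|] ==> st (a \<otimes> b) = st b \<otimes> st a"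
 and star_C: "[|l \<in> X; s \<in> T l; t \<in> T l|] ==> st (C l s t) = C l t s"
 and coeffs_exist: "[|l \<in> X; a \<in> carrier B|] ==> \<exists>r. cell_coeffs B D l a r"
 using datum unfolding cell_datum_def by blast+

lemma C_closed: "[|l \<in> X; s \<in> T l; t \<in> T l|] ==> C l s t \<in> carrier B"
 using basis_closed[OF kspace_axioms basis, of "(l, s, t)"] by (simp add: cb_def Idx_def)

lemma coef_add: "[|x \<in> carrier B; y \<in> carrier B; l \<in> X; s \<in> T l; t \<in> T l|] ==> coef (x \<oplus> y) l s t = coef x l s t + coef y l s t"
 unfolding coef_def by (rule basis_coeff_add[OF kspace_axioms basis]) (auto simp: Idx_def)

lemma coef_scale: "[|x \<in> carrier B; l \<in> X; s \<in> T l; t \<in> T l|] ==> coef (c \<odot> x) l s t = c * coef x l s t"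
 unfolding coef_def by (rule basis_coeff_scale[OF kspace_axioms basis]) (auto simp: Idx_def)

lemma coef_C: "[|l \<in> X; s \<in> T l; t \<in> T l; m \<in> X; u \<in> T m; v \<in> T m|] ==>
  coef (C m u v) l s t = (if l = m \<and> s = u \<and> t = v then 1 else 0)"
 using basis_coeff_basis[OF kspace_axioms basis, of "(l, s, t)" "(m, u, v)"] by (simp add: coef_def cb_def Idx_def)

lemma coef_zero: "[|l \<in> X; s \<in> T l; t \<in> T l|] ==> coef \<zero> l s t = 0"
 using coef_scale[of \<zero> l s t 0] by simp

lemma coef_eqI:
 assumes "x \<in> carrier B" "y \<in> carrier B" "\<And>l s t. [|l \<in> X; s \<in> T l; t \<in> T l|] ==> coef x l s t = coef y l s t"
 shows "x = y"
 by (rule basis_coeff_eqI[OF kspace_axioms basis assms(1,2)])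
  (use assms(3) in \<open>auto simp: Idx_def coef_def\<close>)

lemma coef_expand:
 assumes x: "x \<in> carrier B"
  and add: "\<And>x y. [|x \<in> carrier B; y \<in> carrier B|] ==> f (x \<oplus> y) = f x + (f y :: 'k)"
  and scale: "\<And>c x. x \<in> carrier B ==> f (c \<odot> x) = c * f x"
 shows "f x = (\<Sum>m\<in>X. \<Sum>u\<in>T m. \<Sum>v\<in>T m. coef x m u v * f (C m u v))"
proof -
 have "f x = f (lincomb B cb Idx (basis_coeff B cb Idx x))"
  by (simp add: lincomb_basis_coeff[OF kspace_axioms basis x])
 also have "\<dots> = (\<Sum>i\<in>Idx. basis_coeff B cb Idx x i * f (cb i))"
  by (rule functional_lincomb[OF kspace_axioms basis_finite[OF kspace_axioms basis] basis_closed[OF kspace_axioms basis]])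
   (simp_all add: add scale)
 also have "\<dots> = (\<Sum>m\<in>X. \<Sum>(u, v)\<in>T m \<times> T m. coef x m u v * f (C m u v))"
  unfolding Idx_def using finX finT by (subst sum.Sigma) (auto simp: cb_def coef_def Idx_def intro!: sum.cong)
 also have "\<dots> = (\<Sum>m\<in>X. \<Sum>u\<in>T m. \<Sum>v\<in>T m. coef x m u v * f (C m u v))"
  by (simp add: sum.cartesian_product)
 finally show ?thesis .
qed

lemma lower_span_coef:
 assumes x: "x \<in> lower_span B D l" and i: "m \<in> X" "u \<in> T m" "v \<in> T m" "coef x m u v \<noteq> 0"
 shows "m \<preceq> l \<and> m \<noteq> l"
proof -
 define L where "L = {(m, s, t). m \<in> X \<and> (m, l) \<in> cell_order D \<and> m \<noteq> l \<and> s \<in> T m \<and> t \<in> T m}"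
 have L: "L \<subseteq> Idx" by (auto simp: L_def Idx_def)
 have finL: "finite L" by (rule finite_subset[OF L basis_finite[OF kspace_axioms basis]])
 obtain k where "x = lincomb B cb L k"
  using x unfolding lower_span_def Let_def L_def[symmetric] cb_def[symmetric] by blast
 then have "basis_coeff B cb Idx x (m, u, v) = (\<Sum>j\<in>L. k j * basis_coeff B cb Idx (cb j) (m, u, v))"
  by (simp only:) (rule functional_lincomb[OF kspace_axioms finL],
   use L basis_closed[OF kspace_axioms basis] basis_coeff_add[OF kspace_axioms basis] basis_coeff_scale[OF kspace_axioms basis] i
   in \<open>auto simp: Idx_def\<close>)
 with i(4) have "(\<Sum>j\<in>L. k j * basis_coeff B cb Idx (cb j) (m, u, v)) \<noteq> 0" by (simp add: coef_def)
 then obtain j where j: "j \<in> L" "k j * basis_coeff B cb Idx (cb j) (m, u, v) \<noteq> 0"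
  using sum.neutral[of L "\<lambda>j. k j * basis_coeff B cb Idx (cb j) (m, u, v)"] by blast
 have "(m, u, v) \<in> Idx" "j \<in> Idx" using i j L by (auto simp: Idx_def)
 then have "j = (m, u, v)" using j(2) basis_coeff_basis[OF kspace_axioms basis, of "(m, u, v)" j] by (auto split: if_splits)
 then show ?thesis using j(1) by (simp add: L_def below_def)
qed

lemma lower_span_closed: "x \<in> lower_span B D l ==> x \<in> carrier B"
proof -
 define L where "L = {(m, s, t). m \<in> X \<and> (m, l) \<in> cell_order D \<and> m \<noteq> l \<and> s \<in> T m \<and> t \<in> T m}"
 have L: "L \<subseteq> Idx" by (auto simp: L_def Idx_def)
 have finL: "finite L" by (rule finite_subset[OF L basis_finite[OF kspace_axioms basis]])
 assume "x \<in> lower_span B D l"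
 then obtain k where "x = lincomb B cb L k"
  unfolding lower_span_def Let_def L_def[symmetric] cb_def[symmetric] by blast
 then show ?thesis using lincomb_in_carrier[OF kspace_axioms finL, of cb k] L basis_closed[OF kspace_axioms basis] by blast
qed

text \<open>The coefficients of Graham and Lehrer, chosen exactly as in \<open>cell_module\<close>;
  on \<open>T l\<close> they are determined, by \<open>mult_C\<close>.\<close>

definition r :: "'l \<Rightarrow> 'a \<Rightarrow> 't \<Rightarrow> 't \<Rightarrow> 'k"
 where "r l a = (SOME r. cell_coeffs B D l a r)"

text \<open>The cell axiom in coordinates: the product differs from its leading combination by an
  element of \<open>lower_span\<close>, whose coordinates sit strictly below
  \<open>l\<close>.\<close>

lemma mult_C:
 assumes a: "a \<in> carrier B" and l: "l \<in> X" and s: "s \<in> T l" and t: "t \<in> T l"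
 shows "[|u \<in> T l; v \<in> T l|] ==> coef (a \<otimes> C l s t) l u v = (if v = t then r l a u s else 0)"
  and "[|m \<in> X; u \<in> T m; v \<in> T m; coef (a \<otimes> C l s t) m u v \<noteq> 0|] ==> m \<preceq> l"
proof -
 let ?L = "lincomb B (\<lambda>s'. C l s' t) (T l) (\<lambda>s'. r l a s' s)"
 have "cell_coeffs B D l a (r l a)" unfolding r_def by (rule someI_ex[OF coeffs_exist[OF l a]])
 then have d: "a \<otimes> C l s t \<ominus> ?L \<in> lower_span B D l" using s t unfolding cell_coeffs_def by blast
 have ac: "a \<otimes> C l s t \<in> carrier B" using a C_closed[OF l s t] by simp
 have vc: "C l s' t \<in> carrier B" if "s' \<in> T l" for s' using C_closed[OF l that t] .
 have Lc: "?L \<in> carrier B" by (rule lincomb_in_carrier[OF kspace_axioms finT[OF l] vc])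
 have coefL: "coef ?L m u v = (\<Sum>s'\<in>T l. r l a s' s * coef (C l s' t) m u v)" if "m \<in> X" "u \<in> T m" "v \<in> T m" for m u v
  by (rule functional_lincomb[OF kspace_axioms finT[OF l] vc]) (simp_all add: coef_add coef_scale that)
 have "a \<otimes> C l s t = (a \<otimes> C l s t \<ominus> ?L) \<oplus> ?L"
  using ac Lc by (simp add: minus_eq a_assoc l_neg)
 then have e: "coef (a \<otimes> C l s t) m u v = coef (a \<otimes> C l s t \<ominus> ?L) m u v + coef ?L m u v" if "m \<in> X" "u \<in> T m" "v \<in> T m" for m u v
  using coef_add[OF lower_span_closed[OF d] Lc that] by simp
 show "coef (a \<otimes> C l s t) l u v = (if v = t then r l a u s else 0)" if u: "u \<in> T l" "v \<in> T l"
 proof -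
  have "coef (a \<otimes> C l s t \<ominus> ?L) l u v = 0" using lower_span_coef[OF d l u] by blast
  moreover have "coef ?L l u v = (\<Sum>s'\<in>T l. if s' = u then (if v = t then r l a u s else 0) else 0)"
   unfolding coefL[OF l u] by (rule sum.cong) (use l t u in \<open>auto simp: coef_C\<close>)
  ultimately show ?thesis using e[OF l u] u finT[OF l] by simp
 qed
 show "m \<preceq> l" if m: "m \<in> X" "u \<in> T m" "v \<in> T m" "coef (a \<otimes> C l s t) m u v \<noteq> 0"
 proof (cases "coef (a \<otimes> C l s t \<ominus> ?L) m u v = 0")
  case False
  then show ?thesis using lower_span_coef[OF d m(1-3)] by blast
 next
  case True
  then have "coef ?L m u v \<noteq> 0" using e[OF m(1-3)] m(4) by simp
  then have "\<exists>s'\<in>T l. coef (C l s' t) m u v \<noteq> 0" unfolding coefL[OF m(1-3)] by (metis (no_types, lifting) mult_zero_right sum.neutral)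
  then have "m = l" using coef_C[OF m(1-3) l _ t] by (metis (full_types))
  then show ?thesis using order_facts(2)[OF l] by simp
 qed
qed

definition lower_set :: "'l set \<Rightarrow> bool"
 where "lower_set F \<longleftrightarrow> F \<subseteq> X \<and> (\<forall>l\<in>F. \<forall>m. m \<preceq> l --> m \<in> F)"

text \<open>For a lower set \<open>F\<close> this is the cell ideal spanned by the
  \<open>C l s t\<close> with \<open>l\<close> in \<open>F\<close>.\<close>

definition part :: "'l set \<Rightarrow> 'a set"
 where "part F = {x \<in> carrier B. \<forall>m\<in>X. m \<notin> F --> (\<forall>u\<in>T m. \<forall>v\<in>T m. coef x m u v = 0)}"

lemma partD: "x \<in> part F ==> x \<in> carrier B" "[|x \<in> part F; m \<in> X; m \<notin> F; u \<in> T m; v \<in> T m|] ==> coef x m u v = 0"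
 by (simp_all add: part_def)

lemma partI: "[|x \<in> carrier B; \<And>m u v. [|m \<in> X; m \<notin> F; u \<in> T m; v \<in> T m|] ==> coef x m u v = 0|] ==> x \<in> part F"
 by (simp add: part_def)

lemma C_part: "[|l \<in> X; l \<in> F; s \<in> T l; t \<in> T l|] ==> C l s t \<in> part F"
 by (rule partI) (auto simp: C_closed coef_C)

lemma coef_mult_expand:
 assumes a: "a \<in> carrier B" and x: "x \<in> carrier B" and i: "m \<in> X" "u \<in> T m" "v \<in> T m"
 shows "coef (a \<otimes> x) m u v = (\<Sum>n\<in>X. \<Sum>s\<in>T n. \<Sum>t\<in>T n. coef x n s t * coef (a \<otimes> C n s t) m u v)"
 by (rule coef_expand[OF x, where f = "\<lambda>x. coef (a \<otimes> x) m u v"])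
  (use a i in \<open>simp_all add: r_distr coef_add scal_mult_r coef_scale\<close>)

lemma part_mult_l:
 assumes F: "lower_set F" and x: "x \<in> part F" and a: "a \<in> carrier B"
 shows "a \<otimes> x \<in> part F"
proof (rule partI)
 show "a \<otimes> x \<in> carrier B" using a partD(1)[OF x] by simp
 fix m u v assume m: "m \<in> X" "m \<notin> F" "u \<in> T m" "v \<in> T m"
 have "coef x n s t * coef (a \<otimes> C n s t) m u v = 0" if n: "n \<in> X" "s \<in> T n" "t \<in> T n" for n s t
 proof (cases "n \<in> F")
  case True
  then have "\<not> m \<preceq> n" using F m(2) unfolding lower_set_def by blast
  then have "coef (a \<otimes> C n s t) m u v = 0" using mult_C(2)[OF a n m(1,3,4)] by blast
  then show ?thesis by simp
 next
  case False
  then show ?thesis using partD(2)[OF x n(1) False n(2,3)] by simp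
 qed
 then show "coef (a \<otimes> x) m u v = 0" unfolding coef_mult_expand[OF a partD(1)[OF x] m(1,3,4)] by (simp add: sum.neutral)
qed

lemma coef_star:
 assumes x: "x \<in> carrier B" and i: "m \<in> X" "u \<in> T m" "v \<in> T m"
 shows "coef (st x) m u v = coef x m v u"
proof -
 have "coef (st x) m u v = (\<Sum>n\<in>X. \<Sum>s\<in>T n. \<Sum>t\<in>T n. coef x n s t * coef (st (C n s t)) m u v)"
  by (rule coef_expand[OF x, where f = "\<lambda>x. coef (st x) m u v"])
   (use i in \<open>simp_all add: star_add coef_add star_scale coef_scale\<close>)
 also have "\<dots> = (\<Sum>n\<in>X. \<Sum>s\<in>T n. \<Sum>t\<in>T n. coef x n s t * coef (C n s t) m v u)"
  by (intro sum.cong refl) (use i in \<open>auto simp: star_C coef_C\<close>)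
 also have "\<dots> = coef x m v u"
  by (rule coef_expand[OF x, where f = "\<lambda>x. coef x m v u", symmetric]) (use i in \<open>simp_all add: coef_add coef_scale\<close>)
 finally show ?thesis .
qed

lemma star_part: "x \<in> part F ==> st x \<in> part F"
 by (rule partI) (auto simp: partD coef_star)

text \<open>The involution turns right multiplication into left multiplication and preserves the
  span of each cell.\<close>

lemma part_mult_r:
 assumes F: "lower_set F" and x: "x \<in> part F" and a: "a \<in> carrier B"
 shows "x \<otimes> a \<in> part F"
proof -
 have "x \<otimes> a = st (st a \<otimes> st x)" using a partD(1)[OF x] by (simp add: star_mult)
 then show ?thesis using star_part[OF part_mult_l[OF F star_part[OF x] star_closed[OF a]]] by simp
qed

text \<open>A basis element of cell \<open>n\<close> contributes to cell \<open>l\<close> only if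
  \<open>l \<preceq> n\<close>, and maximality of \<open>l\<close> in \<open>F\<close> leaves
  \<open>n = l\<close>.\<close>

lemma coef_mult_l:
 assumes x: "x \<in> part F" and a: "a \<in> carrier B" and l: "l \<in> X" and max: "\<And>m. [|m \<in> F; l \<preceq> m|] ==> m = l"
  and u: "u \<in> T l" "v \<in> T l"
 shows "coef (a \<otimes> x) l u v = (\<Sum>s\<in>T l. r l a u s * coef x l s v)"
proof -
 have "(\<Sum>s\<in>T n. \<Sum>t\<in>T n. coef x n s t * coef (a \<otimes> C n s t) l u v) =
   (if n = l then \<Sum>s\<in>T l. r l a u s * coef x l s v else 0)" if n: "n \<in> X" for n
 proof (cases "n = l")
  case True
  have "(\<Sum>t\<in>T l. coef x l s t * coef (a \<otimes> C l s t) l u v) = r l a u s * coef x l s v" if s: "s \<in> T l" for s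
  proof -
   have "(\<Sum>t\<in>T l. coef x l s t * coef (a \<otimes> C l s t) l u v) = (\<Sum>t\<in>T l. if t = v then coef x l s v * r l a u s else 0)"
    by (rule sum.cong) (use u l s in \<open>auto simp: mult_C(1)[OF a l s]\<close>)
   then show ?thesis using u finT[OF l] by simp
  qed
  then show ?thesis using True by simp
 next
  case False
  have z: "coef x n s t * coef (a \<otimes> C n s t) l u v = 0" if s: "s \<in> T n" "t \<in> T n" for s t
  proof (cases "n \<in> F")
   case True
   then have "\<not> l \<preceq> n" using max False by blast
   then have "coef (a \<otimes> C n s t) l u v = 0" using mult_C(2)[OF a n s l u] by blast
   then show ?thesis by simp
  next
   case f: False
   then show ?thesis using partD(2)[OF x n f s] by simp
  qed
  have "(\<Sum>s\<in>T n. \<Sum>t\<in>T n. coef x n s t * coef (a \<otimes> C n s t) l u v) = 0"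
   by (intro sum.neutral ballI) (rule z)
  then show ?thesis using False by simp
 qed
 then show ?thesis unfolding coef_mult_expand[OF a partD(1)[OF x] l u] using l finX by simp
qed

text \<open>\<open>star\<close> exchanges the two indices, so right multiplication by
  \<open>a\<close> acts on the second index as \<open>st a\<close> acts on the first. This is how
  \<open>st e'\<close> enters the dimension formula.\<close>

lemma coef_mult_r:
 assumes x: "x \<in> part F" and a: "a \<in> carrier B" and l: "l \<in> X" and max: "\<And>m. [|m \<in> F; l \<preceq> m|] ==> m = l"
  and u: "u \<in> T l" "v \<in> T l"
 shows "coef (x \<otimes> a) l u v = (\<Sum>t\<in>T l. r l (st a) v t * coef x l u t)"
proof -
 have xc: "x \<in> carrier B" by (rule partD(1)[OF x])
 have "coef (x \<otimes> a) l u v = coef (st (st a \<otimes> st x)) l u v" using a xc by (simp add: star_mult)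
 also have "\<dots> = coef (st a \<otimes> st x) l v u" by (rule coef_star[OF _ l u]) (use a xc in simp)
 also have "\<dots> = (\<Sum>t\<in>T l. r l (st a) v t * coef (st x) l t u)"
  by (rule coef_mult_l[OF star_part[OF x] star_closed[OF a] l max u(2,1)])
 also have "\<dots> = (\<Sum>t\<in>T l. r l (st a) v t * coef x l u t)"
  by (rule sum.cong) (use l u xc in \<open>simp_all add: coef_star\<close>)
 finally show ?thesis .
qed

text \<open>Written as a coefficient, \<open>r\<close> inherits linearity from \<open>coef\<close>
  and multiplicativity from the associativity of \<open>B\<close>.\<close>

lemma r_eq: "[|a \<in> carrier B; l \<in> X; u \<in> T l; s \<in> T l; t \<in> T l|] ==> r l a u s = coef (a \<otimes> C l s t) l u t"
 by (simp add: mult_C(1))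

lemma r_one: "[|l \<in> X; u \<in> T l; s \<in> T l|] ==> r l \<one> u s = (if u = s then 1 else 0)"
 using r_eq[of \<one> l u s s] by (simp add: C_closed coef_C)

lemma r_add: "[|a \<in> carrier B; b \<in> carrier B; l \<in> X; u \<in> T l; s \<in> T l|] ==> r l (a \<oplus> b) u s = r l a u s + r l b u s"
 using r_eq[of _ l u s s] C_closed[of l s s] by (simp add: l_distr coef_add)

lemma r_scale: "[|a \<in> carrier B; l \<in> X; u \<in> T l; s \<in> T l|] ==> r l (c \<odot> a) u s = c * r l a u s"
 using r_eq[of _ l u s s] C_closed[of l s s] by (simp add: scal_mult_l coef_scale)

definition down :: "'l \<Rightarrow> 'l set" where "down l = {m. m \<preceq> l}"

lemma lower_set_down: "lower_set (down l)"
 using order_facts unfolding lower_set_def down_def by blast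

lemma down_max: "[|m \<in> down l; l \<preceq> m|] ==> m = l"
 using order_facts unfolding down_def by blast

lemma C_down: "[|l \<in> X; s \<in> T l; t \<in> T l|] ==> C l s t \<in> part (down l)"
 by (rule C_part) (auto simp: down_def order_facts)

text \<open>Associativity applied to \<open>C l s s\<close> inside the cell ideal of
  \<open>down l\<close>, where \<open>l\<close> is maximal.\<close>

lemma r_mult:
 assumes a: "a \<in> carrier B" and b: "b \<in> carrier B" and l: "l \<in> X" and u: "u \<in> T l" and s: "s \<in> T l"
 shows "r l (a \<otimes> b) u s = (\<Sum>v\<in>T l. r l a u v * r l b v s)"
proof -
 have c: "C l s s \<in> carrier B" by (rule C_closed[OF l s s])
 have "r l (a \<otimes> b) u s = coef (a \<otimes> (b \<otimes> C l s s)) l u s" using r_eq[of "a \<otimes> b" l u s s] a b c l u s by (simp add: m_assoc)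
 also have "\<dots> = (\<Sum>v\<in>T l. r l a u v * coef (b \<otimes> C l s s) l v s)"
  by (rule coef_mult_l[OF part_mult_l[OF lower_set_down C_down[OF l s s] b] a l down_max u s])
 also have "\<dots> = (\<Sum>v\<in>T l. r l a u v * r l b v s)" by (rule sum.cong) (use r_eq[OF b l _ s s] in simp_all)
 finally show ?thesis .
qed

text \<open>On its own cell module \<open>C l s t\<close> has rank at most one. In
  \<open>C l s t \<otimes> C l w w\<close>, computed as a right multiplication, the first index
  remains \<open>s\<close> in cell \<open>l\<close>.\<close>

lemma r_C:
 assumes l: "l \<in> X" "s \<in> T l" "t \<in> T l" "u \<in> T l" "w \<in> T l" and "u \<noteq> s"
 shows "r l (C l s t) u w = 0"
proof -
 have "r l (C l s t) u w = coef (C l s t \<otimes> C l w w) l u w" using r_eq[of "C l s t" l u w w] l by (simp add: C_closed)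
 also have "\<dots> = (\<Sum>t'\<in>T l. r l (st (C l w w)) w t' * coef (C l s t) l u t')"
  by (rule coef_mult_r[OF C_down C_closed _ down_max]) (use l in simp_all)
 also have "\<dots> = 0" by (rule sum.neutral) (use assms in \<open>simp add: coef_C\<close>)
 finally show ?thesis .
qed

section \<open>Cell modules\<close>

abbreviation "W \<equiv> cell_module B D"

lemma W_simps:
 "carrier (W l) = {x. \<forall>s. s \<notin> T l --> x s = 0}" "\<zero>[W l] = (\<lambda>_. 0)" "x +[W l] y = (\<lambda>s. x s + y s)"
 "a *[W l] x = (\<lambda>s'. if s' \<in> T l then \<Sum>s\<in>T l. r l a s' s * x s else 0)"
 unfolding cell_module_def r_def by simp_all

lemma left_module_W:
 assumes l: "l \<in> X"
 shows "left_module B (W l)"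
proof -
 have ab: "abelian_group (W l)"
 proof (rule abelian_groupI)
  show "\<exists>y\<in>carrier (W l). y +[W l] x = \<zero>[W l]" if "x \<in> carrier (W l)" for x
   by (rule bexI[of _ "\<lambda>s. - x s"]) (use that in \<open>auto simp: W_simps\<close>)
 qed (auto simp: W_simps add.assoc add.commute)
 show ?thesis
 proof (rule left_module.intro[OF ring_axioms ab], unfold_locales)
  fix a b x y assume a: "a \<in> carrier B" and x: "x \<in> carrier (W l)"
  show "a *[W l] x \<in> carrier (W l)" by (simp add: W_simps)
  show "(a \<oplus> b) *[W l] x = a *[W l] x +[W l] b *[W l] x" if "b \<in> carrier B"
   using a that l by (auto simp: W_simps r_add sum.distrib algebra_simps)
  show "a *[W l] (x +[W l] y) = a *[W l] x +[W l] a *[W l] y"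
   by (auto simp: W_simps sum.distrib algebra_simps)
  show "(a \<otimes> b) *[W l] x = a *[W l] (b *[W l] x)" if b: "b \<in> carrier B"
  proof
   fix u
   have "(\<Sum>s\<in>T l. (\<Sum>v\<in>T l. r l a u v * r l b v s) * x s) = (\<Sum>v\<in>T l. r l a u v * (\<Sum>s\<in>T l. r l b v s * x s))"
    unfolding sum_distrib_right sum_distrib_left by (subst sum.swap) (simp add: mult.assoc)
   then show "((a \<otimes> b) *[W l] x) u = (a *[W l] (b *[W l] x)) u"
    using a b l by (simp add: W_simps r_mult)
  qed
 next
  fix x assume x: "x \<in> carrier (W l)"
  show "\<one> *[W l] x = x"
  proof
   fix u
   have "(\<Sum>s\<in>T l. r l \<one> u s * x s) = (\<Sum>s\<in>T l. if s = u then x u else 0)" if "u \<in> T l"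
    by (rule sum.cong) (use l that in \<open>auto simp: r_one\<close>)
   then show "(\<one> *[W l] x) u = x u" using x finT[OF l] by (auto simp: W_simps)
  qed
 qed
qed

lemma W_scale:
 assumes l: "l \<in> X" and x: "x \<in> carrier (W l)"
 shows "(c \<odot> \<one>) *[W l] x = (\<lambda>s. c * x s)"
proof
 fix u
 have "(\<Sum>s\<in>T l. r l (c \<odot> \<one>) u s * x s) = (\<Sum>s\<in>T l. if s = u then c * x u else 0)" if "u \<in> T l"
  by (rule sum.cong) (use l that in \<open>auto simp: r_one r_scale\<close>)
 then show "((c \<odot> \<one>) *[W l] x) u = c * x u" using x finT[OF l] by (auto simp: W_simps)
qed

lemma fdm_W:
 assumes l: "l \<in> X"
 shows "fdm B (W l)"
proof -
 obtain e where e: "bij_betw e {0..<card (T l)} (T l)" using ex_bij_betw_nat_finite[OF finT[OF l]] by blast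
 define f where "f = (\<lambda>x i. if i < card (T l) then x (e i) else (0::'k))"
 have "kembedding (restrict_scalars B (W l)) (card (T l)) f"
  unfolding kembedding_def
 proof (intro conjI ballI allI)
  show "f ` carrier (restrict_scalars B (W l)) \<subseteq> coord_space (card (T l))" by (auto simp: f_def coord_space_def)
  show "inj_on f (carrier (restrict_scalars B (W l)))"
  proof (rule inj_onI)
   fix x y assume "x \<in> carrier (restrict_scalars B (W l))" "y \<in> carrier (restrict_scalars B (W l))" and eq: "f x = f y"
   then have xy: "x s = 0" "y s = 0" if "s \<notin> T l" for s using that by (simp_all add: W_simps)
   show "x = y"
   proof
    fix s
    show "x s = y s"
    proof (cases "s \<in> T l")
     case True
     then have "s \<in> e ` {0..<card (T l)}" using e by (simp add: bij_betw_def)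
     then obtain i where "i < card (T l)" "s = e i" by auto
     then show ?thesis using fun_cong[OF eq, of i] by (simp add: f_def)
    qed (simp add: xy)
   qed
  qed
  fix x assume x: "x \<in> carrier (restrict_scalars B (W l))"
  show "f (x +[restrict_scalars B (W l)] y) = f x + f y" for y
   by (auto simp: f_def W_simps fun_eq_iff plus_fun_apply)
  show "f (c *[restrict_scalars B (W l)] x) = fun_scale c (f x)" for c
   using W_scale[OF l, of x c] x by (auto simp: f_def fun_scale_def fun_eq_iff)
 qed
 then show ?thesis unfolding fdm_def kfin_def using left_module_W[OF l] by blast
qed

lemma kfin_B: "kfin B"
 by (rule kdim_basis(1)[OF kspace_axioms basis])

end

section \<open>Tensor products of function spaces and the dimension of corners\<close>

definition fun_space :: "('i \<Rightarrow> 'k::field) set \<Rightarrow> ('k, 'i \<Rightarrow> 'k) module"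
 where "fun_space U = \<lparr>carrier = U, mult = undefined, one = undefined, zero = (\<lambda>_. 0),
  add = (\<lambda>x y s. x s + y s), smult = (\<lambda>c x s. c * x s)\<rparr>"

lemma fun_space_simps [simp]:
 "carrier (fun_space U) = U" "\<zero>[fun_space U] = (\<lambda>_. 0)" "x +[fun_space U] y = (\<lambda>s. x s + y s)"
 "c *[fun_space U] x = (\<lambda>s. c * x s)"
 by (simp_all add: fun_space_def)

lemma kspace_fun_space:
 assumes 0: "(\<lambda>_. 0) \<in> U" and add: "\<And>x y. [|x \<in> U; y \<in> U|] ==> (\<lambda>s. x s + y s) \<in> U"
  and scale: "\<And>c x. x \<in> U ==> (\<lambda>s. c * x s) \<in> U"
 shows "kspace (fun_space U)"
proof -
 have "abelian_group (fun_space U)"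
 proof (rule abelian_groupI)
  show "\<exists>y\<in>carrier (fun_space U). y +[fun_space U] x = \<zero>[fun_space U]" if "x \<in> carrier (fun_space U)" for x
   by (rule bexI[of _ "\<lambda>s. - 1 * x s"]) (use that scale[of x "- 1"] in auto)
 qed (use 0 add in \<open>auto simp: add.assoc add.commute\<close>)
 then show ?thesis
  by (intro kspace.intro kspace_axioms.intro) (use scale in \<open>auto simp: algebra_simps\<close>)
qed

text \<open>\<open>M\<close> is the tensor product of \<open>U\<close> and \<open>U'\<close>,
  realised as functions of two arguments with columns in \<open>U\<close> and rows in
  \<open>U'\<close>; products of basis functions form a basis. The family \<open>E\<close> holds the
  columns of a projection onto \<open>U\<close>.\<close>

lemma tensor_dim:
 fixes U U' :: "('t \<Rightarrow> 'k::field) set"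
 assumes fin: "finite T" and U: "kspace (fun_space U)" and U': "kspace (fun_space U')"
  and finU: "kfin (fun_space U)" and finU': "kfin (fun_space U')"
  and E: "\<And>s. s \<in> T ==> E s \<in> U" "\<And>u s'. u \<in> U ==> u s' = (\<Sum>s\<in>T. u s * E s s')"
  and M: "M = {g. (\<forall>t. (\<lambda>s. g (s, t)) \<in> U) \<and> (\<forall>s. (\<lambda>t. g (s, t)) \<in> U')}"
 shows "kspace (fun_space M)" "kdim (fun_space M) = kdim (fun_space U) * kdim (fun_space U')"
proof -
 interpret U: kspace "fun_space U" by (rule U)
 interpret U': kspace "fun_space U'" by (rule U')
 note cl = U.a_closed[simplified] U.scale_closed[simplified] U.zero_closed[simplified]
  U'.a_closed[simplified] U'.scale_closed[simplified] U'.zero_closed[simplified]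
 have kM: "kspace (fun_space M)"
  unfolding M by (rule kspace_fun_space) (auto intro: cl)
 define d d' where "d = kdim (fun_space U)" and "d' = kdim (fun_space U')"
 obtain v where v: "finite_basis (fun_space U) v {..<d}" using kfin_finite_basis[OF U finU] unfolding d_def by blast
 obtain w where w: "finite_basis (fun_space U') w {..<d'}" using kfin_finite_basis[OF U' finU'] unfolding d'_def by blast
 have vU: "v i \<in> U" if "i < d" for i using basis_closed[OF U v, of i] that by simp
 have wU: "w j \<in> U'" if "j < d'" for j using basis_closed[OF U' w, of j] that by simp
 have lin: "lincomb (fun_space Y) y I c s = (\<Sum>i\<in>I. c i * y i s)"
  if "kspace (fun_space Y)" "finite I" "\<And>i. i \<in> I ==> y i \<in> Y"
  for Y :: "('x \<Rightarrow> 'k) set" and y and I :: "'j set" and c s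
  by (rule functional_lincomb[OF that(1,2)]) (use that(3) in simp_all)
 have linU: "lincomb (fun_space U) v {..<d} c s = (\<Sum>i<d. c i * v i s)" for c s
  by (rule lin[OF U]) (simp_all add: vU)
 have linU': "lincomb (fun_space U') w {..<d'} c s = (\<Sum>j<d'. c j * w j s)" for c s
  by (rule lin[OF U']) (simp_all add: wU)
 let ?I = "{..<d} \<times> {..<d'}"
 define b where "b = (\<lambda>(i, j) (s, t). v i s * w j t)"
 have bM: "b p \<in> M" if pI: "p \<in> ?I" for p
 proof -
  obtain i j where p: "p = (i, j)" "i < d" "j < d'" using pI by auto
  have "(\<lambda>s. w j t * v i s) \<in> U" for t by (rule cl(2)[OF vU[OF p(2)]])
  moreover have "(\<lambda>t. v i s * w j t) \<in> U'" for s by (rule cl(5)[OF wU[OF p(3)]])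
  ultimately show ?thesis unfolding M b_def p(1) by (simp add: mult.commute)
 qed
 have linM: "lincomb (fun_space M) b ?I c (s, t) = (\<Sum>i<d. (\<Sum>j<d'. c (i, j) * w j t) * v i s)" for c s t
 proof -
  have "lincomb (fun_space M) b ?I c (s, t) = (\<Sum>p\<in>?I. c p * b p (s, t))" by (rule lin[OF kM _ bM]) simp_all
  also have "\<dots> = (\<Sum>i<d. \<Sum>j<d'. c (i, j) * b (i, j) (s, t))" by (simp add: sum.cartesian_product)
  finally show ?thesis by (simp add: b_def sum_distrib_right sum_distrib_left mult_ac)
 qed
 have "finite_basis (fun_space M) b ?I"
  unfolding finite_basis_def bij_betw_def
 proof (intro conjI)
  show "b ` ?I \<subseteq> carrier (fun_space M)" by (rule image_subsetI) (simp only: fun_space_simps bM)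
  show "inj_on (lincomb (fun_space M) b ?I) (?I \<rightarrow>\<^sub>E UNIV)"
  proof (rule inj_onI)
   fix c c' assume c: "c \<in> ?I \<rightarrow>\<^sub>E UNIV" "c' \<in> ?I \<rightarrow>\<^sub>E UNIV" and eq: "lincomb (fun_space M) b ?I c = lincomb (fun_space M) b ?I c'"
   show "c = c'"
   proof (rule PiE_ext[OF c])
    fix p assume "p \<in> ?I"
    then obtain i j where p: "p = (i, j)" "i < d" "j < d'" by auto
    have row: "(\<Sum>j<d'. c (i, j) * w j t) = (\<Sum>j<d'. c' (i, j) * w j t)" for t
    proof -
     have "lincomb (fun_space U) v {..<d} (\<lambda>i. \<Sum>j<d'. c (i, j) * w j t) =
       lincomb (fun_space U) v {..<d} (\<lambda>i. \<Sum>j<d'. c' (i, j) * w j t)"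
     proof
      fix s
      show "lincomb (fun_space U) v {..<d} (\<lambda>i. \<Sum>j<d'. c (i, j) * w j t) s =
        lincomb (fun_space U) v {..<d} (\<lambda>i. \<Sum>j<d'. c' (i, j) * w j t) s"
       using fun_cong[OF eq, of "(s, t)"] unfolding linM linU .
     qed
     then show ?thesis
      using basis_coeff_lincomb[OF U v, of i "\<lambda>i. \<Sum>j<d'. c (i, j) * w j t"]
       basis_coeff_lincomb[OF U v, of i "\<lambda>i. \<Sum>j<d'. c' (i, j) * w j t"] p(2) by simp
    qed
    have "lincomb (fun_space U') w {..<d'} (\<lambda>j. c (i, j)) = lincomb (fun_space U') w {..<d'} (\<lambda>j. c' (i, j))"
     by (rule ext) (simp only: linU' row)
    then show "c p = c' p"
     using basis_coeff_lincomb[OF U' w, of j "\<lambda>j. c (i, j)"] basis_coeff_lincomb[OF U' w, of j "\<lambda>j. c' (i, j)"] p by simp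
   qed
  qed
  show "lincomb (fun_space M) b ?I ` (?I \<rightarrow>\<^sub>E UNIV) = carrier (fun_space M)"
  proof (intro equalityI subsetI)
   fix x assume "x \<in> lincomb (fun_space M) b ?I ` (?I \<rightarrow>\<^sub>E UNIV)"
   then obtain c where "x = lincomb (fun_space M) b ?I c" by blast
   then show "x \<in> carrier (fun_space M)"
    using lincomb_in_carrier[OF kM _ , of ?I b c] bM by simp
  next
   fix g assume "g \<in> carrier (fun_space M)"
   then have g: "\<And>t. (\<lambda>s. g (s, t)) \<in> U" "\<And>s. (\<lambda>t. g (s, t)) \<in> U'" by (simp_all add: M)
   define \<phi> where "\<phi> = (\<lambda>i u. basis_coeff (fun_space U) v {..<d} u i)"
   define h where "h = (\<lambda>i t. \<phi> i (\<lambda>s. g (s, t)))"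
   have gh: "g (s, t) = (\<Sum>i<d. h i t * v i s)" for s t
   proof -
    have "lincomb (fun_space U) v {..<d} (basis_coeff (fun_space U) v {..<d} (\<lambda>s. g (s, t))) s = g (s, t)"
     using lincomb_basis_coeff[OF U v, of "\<lambda>s. g (s, t)"] g(1)[of t] by simp
    then show ?thesis unfolding linU h_def \<phi>_def by (rule sym)
   qed
   \<comment> \<open>\<open>h i\<close> collects coordinate \<open>i\<close> of all columns. Since
     \<open>E\<close> writes a column as a combination with its own entries as coefficients,
     \<open>h i\<close> is a combination of the rows of \<open>g\<close> with weights
     \<open>\<phi> i (E s)\<close>.\<close>
   have hU: "h i \<in> U'" if i: "i < d" for i
   proof -
    have "h i t = (\<Sum>s\<in>T. g (s, t) * \<phi> i (E s))" for t
    proof -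
     have "(\<lambda>s. g (s, t)) = lincomb (fun_space U) E T (\<lambda>s. g (s, t))"
     proof
      fix s
      have "lincomb (fun_space U) E T (\<lambda>s. g (s, t)) s = (\<Sum>s'\<in>T. g (s', t) * E s' s)"
       by (rule lin[OF U fin E(1)])
      then show "g (s, t) = lincomb (fun_space U) E T (\<lambda>s. g (s, t)) s" using E(2)[OF g(1)[of t], of s] by simp
     qed
     moreover have "\<phi> i (lincomb (fun_space U) E T (\<lambda>s. g (s, t))) = (\<Sum>s\<in>T. g (s, t) * \<phi> i (E s))"
     proof (rule functional_lincomb[OF U fin])
      show "\<phi> i (x +[fun_space U] y) = \<phi> i x + \<phi> i y" if "x \<in> carrier (fun_space U)" "y \<in> carrier (fun_space U)" for x y
       unfolding \<phi>_def by (rule basis_coeff_add[OF U v that]) (use i in simp)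
      show "\<phi> i (c *[fun_space U] x) = c * \<phi> i x" if "x \<in> carrier (fun_space U)" for c x
       unfolding \<phi>_def by (rule basis_coeff_scale[OF U v that]) (use i in simp)
     qed (simp add: E(1))
     ultimately show ?thesis by (simp only: h_def)
    qed
    then have hs: "h i t = (\<Sum>s\<in>T. \<phi> i (E s) * g (s, t))" for t by (simp add: mult.commute)
    have "h i = lincomb (fun_space U') (\<lambda>s t. g (s, t)) T (\<lambda>s. \<phi> i (E s))"
    proof
     fix t
     have "lincomb (fun_space U') (\<lambda>s t. g (s, t)) T (\<lambda>s. \<phi> i (E s)) t = (\<Sum>s\<in>T. \<phi> i (E s) * g (s, t))"
      by (rule lin[OF U' fin g(2)])
     then show "h i t = lincomb (fun_space U') (\<lambda>s t. g (s, t)) T (\<lambda>s. \<phi> i (E s)) t" using hs by simp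
    qed
    then show ?thesis using lincomb_in_carrier[OF U' fin, of "\<lambda>s t. g (s, t)" "\<lambda>s. \<phi> i (E s)"] g(2) by simp
   qed
   define c where "c = (\<lambda>(i, j). basis_coeff (fun_space U') w {..<d'} (h i) j)"
   have hc: "h i t = (\<Sum>j<d'. c (i, j) * w j t)" if i: "i < d" for i t
   proof -
    have "lincomb (fun_space U') w {..<d'} (basis_coeff (fun_space U') w {..<d'} (h i)) t = h i t"
     using lincomb_basis_coeff[OF U' w, of "h i"] hU[OF i] by simp
    then show ?thesis unfolding linU' c_def by simp
   qed
   have "g = lincomb (fun_space M) b ?I (restrict c ?I)"
   proof
    fix p :: "'t \<times> 't"
    obtain s t where p: "p = (s, t)" by (cases p)
    have "g (s, t) = (\<Sum>i<d. (\<Sum>j<d'. c (i, j) * w j t) * v i s)"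
     unfolding gh by (rule sum.cong) (simp_all add: hc)
    also have "\<dots> = (\<Sum>i<d. (\<Sum>j<d'. restrict c ?I (i, j) * w j t) * v i s)"
     by (intro sum.cong refl arg_cong2[of _ _ _ _ times]) simp_all
    finally show "g p = lincomb (fun_space M) b ?I (restrict c ?I) p" unfolding p linM .
   qed
   moreover have "restrict c ?I \<in> ?I \<rightarrow>\<^sub>E UNIV" by (auto simp only: PiE_def Pi_def restrict_extensional)
   ultimately show "g \<in> lincomb (fun_space M) b ?I ` (?I \<rightarrow>\<^sub>E UNIV)" by (rule image_eqI)
  qed
 qed simp
 from kdim_basis[OF kM this] show "kspace (fun_space M)" "kdim (fun_space M) = kdim (fun_space U) * kdim (fun_space U')"
  using kM by (simp_all add: d_def d'_def)
qed

context cellular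
begin

definition eW :: "'l \<Rightarrow> 'a \<Rightarrow> ('t \<Rightarrow> 'k) set"
 where "eW l e = {w \<in> carrier (W l). e *[W l] w = w}"

lemma eW_I: "[|\<And>s. s \<notin> T l ==> x s = 0; \<And>u. u \<in> T l ==> (\<Sum>s\<in>T l. r l e u s * x s) = x u|] ==> x \<in> eW l e"
 by (auto simp: eW_def W_simps fun_eq_iff)

lemma eW_D:
 assumes "x \<in> eW l e"
 shows "s \<notin> T l ==> x s = 0" "u \<in> T l ==> (\<Sum>s\<in>T l. r l e u s * x s) = x u"
proof -
 have x: "\<And>s. s \<notin> T l ==> x s = 0" "e *[W l] x = x" using assms by (auto simp: eW_def W_simps)
 show "s \<notin> T l ==> x s = 0" by (rule x(1))
 show "u \<in> T l ==> (\<Sum>s\<in>T l. r l e u s * x s) = x u" using fun_cong[OF x(2), of u] by (simp add: W_simps)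
qed

definition ed :: "'l \<Rightarrow> 'a \<Rightarrow> nat"
 where "ed l e = kdim (fun_space (eW l e))"

lemma eW_space: "kspace (fun_space (eW l e))"
proof (rule kspace_fun_space)
 show "(\<lambda>_. 0) \<in> eW l e" by (rule eW_I) simp_all
 show "(\<lambda>s. x s + y s) \<in> eW l e" if x: "x \<in> eW l e" and y: "y \<in> eW l e" for x y
  by (rule eW_I) (simp_all add: eW_D[OF x] eW_D[OF y] distrib_left sum.distrib)
 show "(\<lambda>s. c * x s) \<in> eW l e" if x: "x \<in> eW l e" for c x
 proof (rule eW_I)
  show "c * x s = 0" if "s \<notin> T l" for s using eW_D(1)[OF x that] by simp
  fix u assume u: "u \<in> T l"
  have "(\<Sum>s\<in>T l. r l e u s * (c * x s)) = c * (\<Sum>s\<in>T l. r l e u s * x s)"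
   unfolding sum_distrib_left by (rule sum.cong) simp_all
  then show "(\<Sum>s\<in>T l. r l e u s * (c * x s)) = c * x u" using eW_D(2)[OF x u] by simp
 qed
qed

text \<open>Two presentations of \<open>e W l\<close> have the same dimension: as a space of
  functions, for \<open>tensor_dim\<close>, and as a subspace of the module, for
  \<open>hom_dim\<close>.\<close>

lemma ed_restrict_scalars:
 assumes l: "l \<in> X" and e: "e \<in> carrier B"
 shows "kfin (fun_space (eW l e))"
  "kdim ((restrict_scalars B (W l))\<lparr>carrier := {w \<in> carrier (W l). e *[W l] w = w}\<rparr>) = ed l e"
proof -
 let ?V = "(restrict_scalars B (W l))\<lparr>carrier := eW l e\<rparr>"
 note S = eW_space[of l e]
 interpret S: kspace "fun_space (eW l e)" by (rule S)
 have sub: "x \<in> carrier (W l)" if "x \<in> eW l e" for x using that by (simp add: eW_def)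
 have sc: "(c \<odot> \<one>) *[W l] x = (\<lambda>s. c * x s)" if "x \<in> eW l e" for c x by (rule W_scale[OF l sub[OF that]])
 have V: "kspace ?V"
 proof (rule kspace.kspace_subset[OF kspace_restrict_scalars[OF left_module_W[OF l]]])
  show "eW l e \<subseteq> carrier (restrict_scalars B (W l))" using sub by auto
  show "\<zero>[restrict_scalars B (W l)] \<in> eW l e" using S.zero_closed by (simp add: W_simps)
  show "x +[restrict_scalars B (W l)] y \<in> eW l e" if "x \<in> eW l e" "y \<in> eW l e" for x y
   using S.a_closed[of x y] that by (simp add: W_simps)
  show "c *[restrict_scalars B (W l)] x \<in> eW l e" if "x \<in> eW l e" for c x
   using S.scale_closed[of x c] that by (simp add: sc)
 qed
 have finV: "kfin ?V"
  by (rule kfin_inj[of _ "restrict_scalars B (W l)" "\<lambda>x. x"])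
   (use fdm_W[OF l] sub in \<open>auto simp: klinear_def fdm_def\<close>)
 have lin: "klinear ?V (fun_space (eW l e)) (\<lambda>x. x)"
  unfolding klinear_def
 proof (intro conjI ballI allI)
  show "x +[?V] y = x +[fun_space (eW l e)] y" for x y by (simp add: W_simps)
  show "c *[?V] x = c *[fun_space (eW l e)] x" if "x \<in> carrier ?V" for c x using that by (simp add: sc)
 qed simp
 from kdim_iso[OF V S lin _ finV] have "kfin (fun_space (eW l e))" "kdim ?V = ed l e"
  by (simp_all add: bij_betw_def ed_def)
 then show "kfin (fun_space (eW l e))"
  "kdim ((restrict_scalars B (W l))\<lparr>carrier := {w \<in> carrier (W l). e *[W l] w = w}\<rparr>) = ed l e"
  by (simp_all add: eW_def)
qed

definition corner_part :: "'l set \<Rightarrow> 'a \<Rightarrow> 'a \<Rightarrow> 'a set"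
 where "corner_part F e e' = {x \<in> part F. e \<otimes> x = x \<and> x \<otimes> e' = x}"

lemma part_closed:
 "\<zero> \<in> part F" "[|x \<in> part F; y \<in> part F|] ==> x \<oplus> y \<in> part F" "x \<in> part F ==> c \<odot> x \<in> part F"
 by (auto simp: part_def coef_zero coef_add coef_scale)

lemma corner_part_space:
 assumes "e \<in> carrier B" "e' \<in> carrier B"
 shows "kspace (B\<lparr>carrier := corner_part F e e'\<rparr>)" "kfin (B\<lparr>carrier := corner_part F e e'\<rparr>)"
proof -
 show "kspace (B\<lparr>carrier := corner_part F e e'\<rparr>)"
  by (rule kspace_subset)
   (use assms in \<open>auto simp: corner_part_def part_closed partD(1) l_distr r_distr scal_mult_l scal_mult_r\<close>)
 show "kfin (B\<lparr>carrier := corner_part F e e'\<rparr>)"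
  by (rule kfin_inj[of _ B "\<lambda>x. x"]) (auto simp: klinear_def kfin_B corner_part_def partD(1))
qed

text \<open>The coefficients at the maximal cell \<open>l\<close> form a matrix whose columns are
  fixed by \<open>e\<close> and whose rows are fixed by \<open>st e'\<close>. Such matrices are
  counted by \<open>tensor_dim\<close>, and the kernel of the map to them is the corner of
  \<open>F - {l}\<close>.\<close>

lemma corner_part_step:
 assumes e: "e \<in> carrier B" "e \<otimes> e = e" and e': "e' \<in> carrier B" "e' \<otimes> e' = e'"
  and F: "lower_set F" and l: "l \<in> F" and max: "\<And>m. [|m \<in> F; l \<preceq> m|] ==> m = l"
 shows "kdim (B\<lparr>carrier := corner_part F e e'\<rparr>) =
  kdim (B\<lparr>carrier := corner_part (F - {l}) e e'\<rparr>) + ed l e * ed l (st e')"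
proof -
 have lX: "l \<in> X" using F l by (auto simp: lower_set_def)
 note finl = finT[OF lX]
 let ?V = "B\<lparr>carrier := corner_part F e e'\<rparr>"
 let ?U = "eW l e" and ?U' = "eW l (st e')"
 define M where "M = {g. (\<forall>t. (\<lambda>s. g (s, t)) \<in> ?U) \<and> (\<forall>s. (\<lambda>t. g (s, t)) \<in> ?U')}"
 \<comment> \<open>Column \<open>s\<close> of the matrix of \<open>e\<close> on the cell module. As
   \<open>e\<close> is idempotent, its columns are fixed by \<open>e\<close>, and it reproduces
   every member of \<open>?U\<close>.\<close>
 define E where "E = (\<lambda>s u. if u \<in> T l then r l e u s else 0)"
 have "E s \<in> ?U" if s: "s \<in> T l" for s
 proof (rule eW_I)
  fix u assume u: "u \<in> T l"
  have "(\<Sum>v\<in>T l. r l e u v * E s v) = (\<Sum>v\<in>T l. r l e u v * r l e v s)" by (rule sum.cong) (simp_all add: E_def)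
  also have "\<dots> = r l e u s" using r_mult[OF e(1) e(1) lX u s] e(2) by simp
  finally show "(\<Sum>v\<in>T l. r l e u v * E s v) = E s u" using u by (simp add: E_def)
 qed (simp add: E_def)
 moreover have "u s' = (\<Sum>s\<in>T l. u s * E s s')" if u: "u \<in> ?U" for u s'
  using eW_D[OF u, of s'] by (cases "s' \<in> T l") (simp_all add: E_def mult.commute)
 ultimately have M: "kspace (fun_space M)" "kdim (fun_space M) = ed l e * ed l (st e')"
  using tensor_dim[OF finl eW_space eW_space ed_restrict_scalars(1)[OF lX e(1)] ed_restrict_scalars(1)[OF lX star_closed[OF e'(1)]] _ _ M_def, of E]
  by (simp_all add: ed_def)
 note V = corner_part_space[OF e(1) e'(1), of F]
 define p where "p = (\<lambda>x (s, t). if s \<in> T l \<and> t \<in> T l then coef x l s t else 0)"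
 have xc: "x \<in> part F" "e \<otimes> x = x" "x \<otimes> e' = x" "x \<in> carrier B" if "x \<in> corner_part F e e'" for x
  using that partD(1) by (auto simp: corner_part_def)
 have pM: "p x \<in> M" if x: "x \<in> corner_part F e e'" for x
  unfolding M_def
 proof (intro CollectI conjI allI)
  show "(\<lambda>s. p x (s, t)) \<in> ?U" for t
  proof (rule eW_I)
   show "p x (s, t) = 0" if "s \<notin> T l" for s using that by (simp add: p_def)
   fix u assume u: "u \<in> T l"
   show "(\<Sum>s\<in>T l. r l e u s * p x (s, t)) = p x (u, t)"
   proof (cases "t \<in> T l")
    case True
    have "(\<Sum>s\<in>T l. r l e u s * p x (s, t)) = (\<Sum>s\<in>T l. r l e u s * coef x l s t)"
     by (rule sum.cong) (simp_all add: p_def True)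
    also have "\<dots> = coef (e \<otimes> x) l u t" by (rule coef_mult_l[OF xc(1)[OF x] e(1) lX max u True, symmetric])
    finally show ?thesis using u True xc(2)[OF x] by (simp add: p_def)
   qed (simp add: p_def)
  qed
  show "(\<lambda>t. p x (s, t)) \<in> ?U'" for s
  proof (rule eW_I)
   show "p x (s, t) = 0" if "t \<notin> T l" for t using that by (simp add: p_def)
   fix u assume u: "u \<in> T l"
   show "(\<Sum>t\<in>T l. r l (st e') u t * p x (s, t)) = p x (s, u)"
   proof (cases "s \<in> T l")
    case True
    have "(\<Sum>t\<in>T l. r l (st e') u t * p x (s, t)) = (\<Sum>t\<in>T l. r l (st e') u t * coef x l s t)"
     by (rule sum.cong) (simp_all add: p_def True)
    also have "\<dots> = coef (x \<otimes> e') l s u" by (rule coef_mult_r[OF xc(1)[OF x] e'(1) lX max True u, symmetric])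
    finally show ?thesis using u True xc(3)[OF x] by (simp add: p_def)
   qed (simp add: p_def)
  qed
 qed
 have lin: "klinear ?V (fun_space M) p"
  unfolding klinear_def
 proof (intro conjI ballI allI)
  show "p ` carrier ?V \<subseteq> carrier (fun_space M)" using pM by auto
  show "p (x +[?V] y) = p x +[fun_space M] p y" if "x \<in> carrier ?V" "y \<in> carrier ?V" for x y
   using that xc(4) lX by (auto simp: p_def coef_add fun_eq_iff)
  show "p (c *[?V] x) = c *[fun_space M] p x" if "x \<in> carrier ?V" for c x
   using that xc(4) lX by (auto simp: p_def coef_scale fun_eq_iff)
 qed
 have surj: "p ` carrier ?V = carrier (fun_space M)"
 proof
  show "p ` carrier ?V \<subseteq> carrier (fun_space M)" using pM by auto
  show "carrier (fun_space M) \<subseteq> p ` carrier ?V"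
  proof
   fix g assume "g \<in> carrier (fun_space M)"
   then have g: "\<And>t. (\<lambda>s. g (s, t)) \<in> ?U" "\<And>s. (\<lambda>t. g (s, t)) \<in> ?U'" by (simp_all add: M_def)
   let ?c = "\<lambda>(s, t). C l s t" and ?I = "T l \<times> T l"
   have cc: "?c i \<in> carrier B" if "i \<in> ?I" for i using that C_closed[OF lX] by auto
   have finI: "finite ?I" using finl by simp
   define x0 where "x0 = lincomb B ?c ?I g"
   have x0: "x0 \<in> carrier B" unfolding x0_def by (rule lincomb_in_carrier[OF kspace_axioms finI cc])
   have co: "coef x0 m u v = (\<Sum>i\<in>?I. g i * coef (?c i) m u v)" if m: "m \<in> X" "u \<in> T m" "v \<in> T m" for m u v
    unfolding x0_def by (rule functional_lincomb[OF kspace_axioms finI cc]) (simp_all add: coef_add coef_scale m)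
   have x0p: "x0 \<in> part F"
   proof (rule partI[OF x0])
    fix m u v assume m: "m \<in> X" "m \<notin> F" "u \<in> T m" "v \<in> T m"
    then have "m \<noteq> l" using l by blast
    then show "coef x0 m u v = 0" unfolding co[OF m(1,3,4)]
     by (intro sum.neutral) (use m lX in \<open>auto simp: coef_C\<close>)
   qed
   have x0l: "coef x0 l u v = g (u, v)" if u: "u \<in> T l" "v \<in> T l" for u v
   proof -
    have "coef x0 l u v = (\<Sum>i\<in>?I. if i = (u, v) then g (u, v) else 0)"
     unfolding co[OF lX u] by (rule sum.cong) (use u lX in \<open>auto simp: coef_C split: if_splits\<close>)
    then show ?thesis using u finI by simp
   qed
   \<comment> \<open>\<open>x0\<close> has the right coefficients but need not lie in the corner.
     Multiplying by the idempotents does not change the coefficients at \<open>l\<close>, since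
     columns and rows of \<open>g\<close> are fixed by them.\<close>
   let ?x = "e \<otimes> (x0 \<otimes> e')"
   have r1: "x0 \<otimes> e' \<in> part F" by (rule part_mult_r[OF F x0p e'(1)])
   have "?x \<in> part F" by (rule part_mult_l[OF F r1 e(1)])
   moreover have "e \<otimes> ?x = ?x" "?x \<otimes> e' = ?x"
    using e e' x0 m_assoc[of e e "x0 \<otimes> e'"] by (simp_all add: m_assoc)
   ultimately have xV: "?x \<in> carrier ?V" by (simp add: corner_part_def)
   have "g = p ?x"
   proof
    fix q :: "'t \<times> 't"
    obtain u v where q: "q = (u, v)" by (cases q)
    show "g q = p ?x q"
    proof (cases "u \<in> T l \<and> v \<in> T l")
     case True
     have "coef ?x l u v = (\<Sum>s\<in>T l. r l e u s * coef (x0 \<otimes> e') l s v)"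
      by (rule coef_mult_l[OF r1 e(1) lX max]) (use True in simp_all)
     also have "\<dots> = (\<Sum>s\<in>T l. r l e u s * g (s, v))"
     proof (rule sum.cong[OF refl])
      fix s assume s: "s \<in> T l"
      have "coef (x0 \<otimes> e') l s v = (\<Sum>t\<in>T l. r l (st e') v t * coef x0 l s t)"
       by (rule coef_mult_r[OF x0p e'(1) lX max s]) (use True in simp_all)
      also have "\<dots> = (\<Sum>t\<in>T l. r l (st e') v t * g (s, t))" by (rule sum.cong) (simp_all add: x0l s)
      also have "\<dots> = g (s, v)" using eW_D(2)[OF g(2)[of s], of v] True by simp
      finally show "r l e u s * coef (x0 \<otimes> e') l s v = r l e u s * g (s, v)" by simp
     qed
     also have "\<dots> = g (u, v)" using eW_D(2)[OF g(1)[of v], of u] True by simp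
     finally show ?thesis using True q by (simp add: p_def)
    next
     case False
     then show ?thesis using eW_D(1)[OF g(1)[of v], of u] eW_D(1)[OF g(2)[of u], of v] q by (auto simp: p_def)
    qed
   qed
   then show "g \<in> p ` carrier ?V" using xV by (rule image_eqI)
  qed
 qed
 have ker: "{x \<in> carrier ?V. p x = \<zero>[fun_space M]} = corner_part (F - {l}) e e'"
 proof (intro equalityI subsetI)
  fix x assume "x \<in> {x \<in> carrier ?V. p x = \<zero>[fun_space M]}"
  then have x: "x \<in> corner_part F e e'" and px: "p x = (\<lambda>_. 0)" by simp_all
  have "coef x l u v = 0" if "u \<in> T l" "v \<in> T l" for u v using fun_cong[OF px, of "(u, v)"] that by (simp add: p_def)
  then have "x \<in> part (F - {l})" using partD(2)[OF xc(1)[OF x]] xc(4)[OF x] by (intro partI) blast+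
  then show "x \<in> corner_part (F - {l}) e e'" using x by (simp add: corner_part_def)
 next
  fix x assume x: "x \<in> corner_part (F - {l}) e e'"
  then have xp: "x \<in> part (F - {l})" by (simp add: corner_part_def)
  then have "x \<in> part F" using partD(1)[OF xp] partD(2)[OF xp] by (intro partI) blast+
  moreover have "p x = (\<lambda>_. 0)"
   using partD(2)[OF xp lX] by (auto simp: p_def fun_eq_iff)
  ultimately show "x \<in> {x \<in> carrier ?V. p x = \<zero>[fun_space M]}" using x by (simp add: corner_part_def)
 qed
 from rank_nullity(2)[OF V(1) M(1) lin surj V(2)] show ?thesis unfolding ker M(2) by simp
qed

lemma exists_maximal:
 assumes "F \<subseteq> X" "F \<noteq> {}"
 shows "\<exists>l\<in>F. \<forall>m\<in>F. l \<preceq> m --> m = l"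
proof -
 let ?f = "\<lambda>l. card (down l)"
 have fd: "finite (down l)" for l by (rule finite_subset[OF _ finX]) (auto simp: down_def order_facts)
 have fin: "finite (?f ` F)" using assms(1) finX finite_subset by blast
 then have "Max (?f ` F) \<in> ?f ` F" using assms(2) by (intro Max_in) auto
 then obtain l where l: "l \<in> F" "?f l = Max (?f ` F)" by auto
 have "m = l" if m: "m \<in> F" "l \<preceq> m" for m
 proof (rule ccontr)
  assume "m \<noteq> l"
  then have "m \<notin> down l" "m \<in> down m" using order_facts m unfolding down_def by blast+
  moreover have "down l \<subseteq> down m" using order_facts(3) m(2) unfolding down_def by blast
  ultimately have "down l \<subset> down m" by blast
  then have "?f l < ?f m" by (rule psubset_card_mono[OF fd])
  moreover have "?f m \<le> ?f l" unfolding l(2) using fin m(1) by (intro Max_ge) auto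
  ultimately show False by simp
 qed
 then show ?thesis using l(1) by blast
qed

text \<open>The cells are removed one at a time, always a maximal one, so that a lower set
  remains.\<close>

lemma corner_part_dim:
 assumes e: "e \<in> carrier B" "e \<otimes> e = e" and e': "e' \<in> carrier B" "e' \<otimes> e' = e'" and F: "lower_set F"
 shows "kdim (B\<lparr>carrier := corner_part F e e'\<rparr>) = (\<Sum>l\<in>F. ed l e * ed l (st e'))"
proof -
 have "finite F" using F finX finite_subset unfolding lower_set_def by blast
 then show ?thesis using F
 proof (induction F rule: finite_psubset_induct)
  case (psubset F)
  show ?case
  proof (cases "F = {}")
   case True
   have "x = \<zero>" if "x \<in> part {}" for x
    using partD[OF that] by (intro coef_eqI) (auto simp: coef_zero)
   then have "corner_part {} e e' = {\<zero>}" using e e' by (auto simp: corner_part_def part_closed)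
   then have "kdim (B\<lparr>carrier := corner_part {} e e'\<rparr>) = 0"
    using kdim_zero_space(2)[OF corner_part_space(1)[OF e(1) e'(1)], of "{}"] by simp
   then show ?thesis using True by simp
  next
   case False
   have FX: "F \<subseteq> X" using psubset.prems by (simp add: lower_set_def)
   obtain l where l: "l \<in> F" "\<forall>m\<in>F. l \<preceq> m --> m = l" using exists_maximal[OF FX False] ..
   have ls: "lower_set (F - {l})" using psubset.prems l unfolding lower_set_def by blast
   have "kdim (B\<lparr>carrier := corner_part F e e'\<rparr>) =
     kdim (B\<lparr>carrier := corner_part (F - {l}) e e'\<rparr>) + ed l e * ed l (st e')"
    by (rule corner_part_step[OF e e' psubset.prems l(1)]) (use l(2) in blast)
   also have "kdim (B\<lparr>carrier := corner_part (F - {l}) e e'\<rparr>) = (\<Sum>l\<in>F - {l}. ed l e * ed l (st e'))"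
    by (rule psubset.IH[OF _ ls]) (use l(1) in blast)
   finally show ?thesis using l(1) psubset.hyps(1) by (simp add: sum.remove add.commute)
  qed
 qed
qed

theorem cellular_hom_dim:
 assumes P: "idem_gen B e P y" and P': "idem_gen B e' P' y'"
 shows "hom_dim B P y P' = (\<Sum>l\<in>X. ed l e * ed l (st e'))"
proof -
 have e: "e \<in> carrier B" "e \<otimes> e = e" "e' \<in> carrier B" "e' \<otimes> e' = e'" using P P' by (simp_all add: idem_gen_def)
 have "part X = carrier B" by (auto simp: part_def)
 then have "{x \<in> carrier B. e \<otimes> x = x \<and> x \<otimes> e' = x} = corner_part X e e'" by (simp add: corner_part_def)
 moreover have "lower_set X" using order_facts unfolding lower_set_def by blast
 ultimately show ?thesis
  unfolding hom_dim_idem_gen[OF kfin_B P P'] using corner_part_dim[OF e] by simp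
qed

lemma hom_dim_W:
 assumes P: "idem_gen B e P y" and l: "l \<in> X"
 shows "hom_dim B P y (W l) = ed l e"
proof -
 have e: "e \<in> carrier B" using P by (simp add: idem_gen_def)
 show ?thesis
  unfolding hom_dim_def hom_values_idem_gen[OF P left_module_W[OF l]] by (rule ed_restrict_scalars(2)[OF l e])
qed

end

context
 fixes V :: "('k::field, 'v) module" and v :: "'i \<Rightarrow> 'v" and I :: "'i set" and Z
 assumes V: "kspace V" and fin: "finite I"
  and Z: "Z \<subseteq> carrier V" "\<zero>[V] \<in> Z" "\<And>x y. [|x \<in> Z; y \<in> Z|] ==> x +[V] y \<in> Z" "\<And>c x. x \<in> Z ==> c *[V] x \<in> Z"
  and vc: "\<And>i. i \<in> I ==> v i \<in> carrier V"
begin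

interpretation V: kspace V by (rule V)

lemma lincomb_in_subspace:
 assumes c: "\<And>i. [|i \<in> I; c i \<noteq> 0|] ==> v i \<in> Z"
 shows "lincomb V v I c \<in> Z"
proof -
 have "(\<Oplus>\<^bsub>V\<^esub>i\<in>F. c i *[V] v i) \<in> Z" if "F \<subseteq> I" for F
 proof -
  have "finite F" using that fin by (rule finite_subset)
  then show ?thesis using that
  proof (induction F rule: finite_induct)
   case empty
   then show ?case using Z(2) by simp
  next
   case (insert q F)
   have q: "v q \<in> carrier V" and F: "(\<lambda>i. c i *[V] v i) \<in> F \<rightarrow> carrier V"
    using insert.prems vc by auto
   have "c q *[V] v q \<in> Z"
   proof (cases "c q = 0")
    case True
    then show ?thesis using Z(2) q by simp
   next
    case False
    then show ?thesis using Z(4) c insert.prems by simp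
   qed
   then have "c q *[V] v q +[V] (\<Oplus>\<^bsub>V\<^esub>i\<in>F. c i *[V] v i) \<in> Z"
    using insert.IH insert.prems by (intro Z(3)) simp_all
   then show ?case using V.finsum_insert[OF insert.hyps F V.scale_closed[OF q]] by simp
  qed
 qed
 from this[OF subset_refl] show ?thesis unfolding lincomb_def .
qed

end

section \<open>Primitive idempotents and the simple modules to which they belong\<close>

context kalg
begin

text \<open>The surjection from the regular module that sends \<open>a\<close> to
  \<open>a *[P] x\<close> splits by projectivity; the section sends \<open>x\<close> to the
  idempotent.\<close>

lemma cover_idempotent:
 assumes fin: "kfin A" and c: "cover_data A S P x"
 shows "\<exists>e. idem_gen A e P x"
proof -
 note P = cover_data_proj[OF c]
 have lP: "left_module A P" using P(3) by (simp add: fdm_def)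
 interpret P: left_module A P by (rule lP)
 have x: "x \<in> carrier P" using P(4) by (simp add: cyclic_def)
 let ?R = "regular_module A"
 let ?g = "\<lambda>a\<in>carrier ?R. a *[P] x"
 have g: "?g \<in> module_hom A ?R P" by (rule module_hom_from_regular[OF lP x])
 have surj: "?g ` carrier ?R = carrier P"
 proof
  show "?g ` carrier ?R \<subseteq> carrier P" using module_homD(1)[OF g] by blast
  show "carrier P \<subseteq> ?g ` carrier ?R" using P(4) unfolding cyclic_def by simp
 qed
 have id: "(\<lambda>y\<in>carrier P. y) \<in> module_hom A P P" by (rule module_hom_id[OF lP])
 have "\<exists>h\<in>module_hom A P ?R. compose (carrier P) ?g h = (\<lambda>y\<in>carrier P. y)"
  using projective_lifting[OF P(1) fdm_regular[OF fin] P(3)] g id surj unfolding lifting_def by blast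
 then obtain h where h: "h \<in> module_hom A P ?R" "compose (carrier P) ?g h = (\<lambda>y\<in>carrier P. y)" ..
 have e: "h x \<in> carrier A" using module_homD(1)[OF h(1) x] by simp
 have ex: "h x *[P] x = x" using fun_cong[OF h(2), of x] x e by (simp add: compose_def)
 have hm: "h (a *[P] x) = a \<otimes> h x" if "a \<in> carrier A" for a using module_homD(3)[OF h(1) that x] by simp
 have h0: "h \<zero>[P] = \<zero>" using module_hom_zero[OF h(1) lP left_module_regular] by simp
 have "idem_gen A (h x) P x"
  unfolding idem_gen_def
 proof (intro conjI ballI impI lP e ex P(4))
  show "h x \<otimes> h x = h x" using hm[OF e] ex by simp
  show "a \<otimes> h x = \<zero>" if "a \<in> carrier A" "a *[P] x = \<zero>[P]" for a using hm[OF that(1)] that(2) h0 by simp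
 qed
 then show ?thesis ..
qed

lemma cover_data_hom_dim_simple:
 assumes c: "cover_data A S P x" and T: "simple_module A T"
 shows "hom_dim A P x T = (if module_iso A T S then 1 else 0)"
proof -
 obtain p where p: "p \<in> module_hom A P S" "p ` carrier P = carrier S" "p x \<noteq> \<zero>[S]"
  and sup: "\<forall>U. submodule U A P \<and> p ` U = carrier S --> U = carrier P"
  using c unfolding cover_data_def by (elim conjE bexE)
 have S: "simple_module A S" "scalar_endomorphisms A S" and proj: "projective_module A P" and x: "x \<in> carrier P"
  using c by (auto simp: cover_data_def is_projective_cover_def cyclic_def)
 show ?thesis
  by (rule cover_hom_dim_simple[OF proj S p(1,2) _ x p(3) T]) (rule sup[rule_format], rule conjI)
qed

text \<open>
 The element \<open>s\<close> spans \<open>e S\<close>; an element of \<open>A\<close> that does not kill it has, up to \<open>e\<close>, a left inverse,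
 because it generates the projective cover.
\<close>

definition top_vector :: "'a \<Rightarrow> ('a, 'm) module \<Rightarrow> 'm \<Rightarrow> bool"
 where "top_vector e S s \<longleftrightarrow> left_module A S \<and> s \<in> carrier S \<and> s \<noteq> \<zero>[S] \<and> e *[S] s = s \<and>
  (\<forall>b\<in>carrier A. b *[S] s \<noteq> \<zero>[S] --> (\<exists>z\<in>carrier A. z \<otimes> b \<otimes> e = e)) \<and>
  (\<forall>s'\<in>carrier S. e *[S] s' = s' --> (\<exists>c. s' = (c \<odot> \<one>) *[S] s))"

lemma exists_top_vector:
 assumes c: "cover_data A S P x" and i: "idem_gen A e P x"
 shows "\<exists>s. top_vector e S s"
proof -
 obtain p where p: "p \<in> module_hom A P S" "p ` carrier P = carrier S" "p x \<noteq> \<zero>[S]"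
  and sup: "\<forall>U. submodule U A P \<and> p ` U = carrier S --> U = carrier P"
  using c unfolding cover_data_def by (elim conjE bexE)
 have S: "simple_module A S" "scalar_endomorphisms A S" and proj: "projective_module A P" and x: "x \<in> carrier P"
  using c by (auto simp: cover_data_def is_projective_cover_def cyclic_def)
 have lP: "left_module A P" and e: "e \<in> carrier A" "e \<otimes> e = e" "e *[P] x = x"
  and ann: "\<And>a. [|a \<in> carrier A; a *[P] x = \<zero>[P]|] ==> a \<otimes> e = \<zero>" using i by (simp_all add: idem_gen_def)
 have lS: "left_module A S" by (rule simple_moduleD(1)[OF S(1)])
 interpret P: left_module A P by (rule lP)
 interpret S: left_module A S by (rule lS)
 have sc: "p x \<in> carrier S" by (rule module_homD(1)[OF p(1) x])
 have es: "e *[S] p x = p x" using module_homD(3)[OF p(1) e(1) x] e(3) by simp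
 \<comment> \<open>\<open>b *[P] x\<close> is not in the kernel of \<open>p\<close>, so it generates
   \<open>P\<close> and some \<open>z\<close> brings it back to \<open>x\<close>. Then
   \<open>z \<otimes> b\<close> and \<open>e\<close> act alike on \<open>x\<close>, hence agree
   after right multiplication by \<open>e\<close>.\<close>
 have inv: "\<exists>z\<in>carrier A. z \<otimes> b \<otimes> e = e" if b: "b \<in> carrier A" "b *[S] p x \<noteq> \<zero>[S]" for b
 proof -
  have bx: "b *[P] x \<in> carrier P" by (rule P.smult_closed[OF b(1) x])
  let ?U = "(\<lambda>a. a *[P] (b *[P] x)) ` carrier A"
  have U: "submodule ?U A P" by (rule submodule_cyclic[OF lP bx])
  have pU: "submodule (p ` ?U) A S" by (rule module_hom_image_submodule[OF p(1) lP lS U])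
  have "b *[P] x \<in> ?U" by (rule image_eqI[of _ _ \<one>]) (use P.smult_one[OF bx] in simp_all)
  then have "p (b *[P] x) \<in> p ` ?U" by (rule imageI)
  then have "p ` ?U \<noteq> {\<zero>[S]}" using b(2) module_homD(3)[OF p(1) b(1) x] by auto
  then have "p ` ?U = carrier S" using simple_moduleD(3)[OF S(1) pU] by blast
  then have "?U = carrier P" using sup U by blast
  then have "x \<in> ?U" using x by simp
  then obtain z where z: "z \<in> carrier A" "x = z *[P] (b *[P] x)" by (rule imageE)
  have "(z \<otimes> b \<oplus> (\<ominus> \<one>) \<otimes> e) *[P] x = z *[P] (b *[P] x) +[P] (\<ominus> \<one>) *[P] (e *[P] x)"
   using z(1) b(1) e(1) x by (simp add: P.smult_l_distr P.smult_assoc1)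
  also have "\<dots> = x +[P] (\<ominus> \<one>) *[P] x" by (simp only: z(2)[symmetric] e(3))
  also have "\<dots> = \<zero>[P]" unfolding P.minus_one_smult[OF x] by (rule P.M.r_neg[OF x])
  finally have "(z \<otimes> b \<oplus> (\<ominus> \<one>) \<otimes> e) *[P] x = \<zero>[P]" .
  then have "(z \<otimes> b \<oplus> (\<ominus> \<one>) \<otimes> e) \<otimes> e = \<zero>" using z(1) b(1) e(1) by (intro ann) simp_all
  then have "z \<otimes> b \<otimes> e \<oplus> \<ominus> e = \<zero>" using z(1) b(1) e(1,2) by (simp add: l_distr m_assoc l_minus)
  then have "z \<otimes> b \<otimes> e = e" using z(1) b(1) e(1) minus_eq_zero_iff[of "z \<otimes> b \<otimes> e" e] by (simp add: minus_eq)
  then show ?thesis using z(1) by blast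
 qed
 have line: "\<exists>c. s' = (c \<odot> \<one>) *[S] p x" if s': "s' \<in> carrier S" "e *[S] s' = s'" for s'
 proof (cases "s' = \<zero>[S]")
  case True
  then show ?thesis using sc by (intro exI[of _ 0]) simp
 next
  case False
  have "s' \<in> hom_values A P x S" unfolding hom_values_idem_gen[OF i lS] using s' by simp
  then obtain f where f: "f \<in> module_hom A P S" "s' = f x" by (rule hom_valuesE)
  have "f x \<noteq> \<zero>[S]" using f(2) False by simp
  then obtain \<theta> where t: "\<theta> \<in> module_hom A S S" "\<forall>z\<in>carrier P. \<theta> (p z) = f z"
   using cover_hom_factor[OF proj S p(1,2) _ x p(3) S(1) f(1) x] sup by blast
  obtain c where c: "\<forall>s\<in>carrier S. \<theta> s = (c \<odot> \<one>) *[S] s" using S(2) t(1) unfolding scalar_endomorphisms_def by blast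
  have "f x = (c \<odot> \<one>) *[S] p x" using t(2)[rule_format, OF x] c[rule_format, OF sc] by (rule trans[OF sym])
  then show ?thesis unfolding f(2) ..
 qed
 have "top_vector e S (p x)" unfolding top_vector_def using lS sc p(3) es inv line by blast
 then show ?thesis ..
qed

lemma top_simple:
 assumes S: "complete_simples A [S\<^sub>1, S\<^sub>2]" and M: "fdm A M" "carrier M \<noteq> {\<zero>[M]}"
 shows "\<exists>U. submodule U A M \<and> U \<noteq> carrier M \<and> simple_module A (factor_module M U) \<and>
  (module_iso A (factor_module M U) S\<^sub>1 \<or> module_iso A (factor_module M U) S\<^sub>2)"
proof -
 have lM: "left_module A M" using M(1) by (simp add: fdm_def)
 have "{\<zero>[M]} \<noteq> carrier M" using M(2) by blast
 from exists_maximal_submodule[OF M(1) left_module.submodule_zero[OF lM] this]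
 obtain U where U: "submodule U A M" "U \<noteq> carrier M"
  and max: "\<forall>V. submodule V A M --> U \<subseteq> V --> V \<noteq> carrier M --> V = U" by (elim exE conjE)
 let ?N = "factor_module M U"
 have sN: "simple_module A ?N" by (rule simple_factor_maximal[OF lM U]) (rule max[rule_format])
 have lN: "left_module A ?N" by (rule simple_moduleD(1)[OF sN])
 obtain N f where N: "N \<in> fd_modules A" "f \<in> module_hom A ?N N" "bij_betw f (carrier ?N) (carrier N)"
  using fdm_factor(1)[OF M(1) U(1)] by (rule fd_modules_copy)
 have sN': "simple_module A N" by (rule simple_module_iso[OF sN fd_left_module[OF N(1)] N(2,3)])
 have iso: "module_iso A ?N N" unfolding module_iso_def using N(2,3) by blast
 have "\<exists>S\<in>set [S\<^sub>1, S\<^sub>2]. module_iso A N S" using S N(1) sN' unfolding complete_simples_def by blast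
 then have "module_iso A N S\<^sub>1 \<or> module_iso A N S\<^sub>2" by simp
 then have "module_iso A ?N S\<^sub>1 \<or> module_iso A ?N S\<^sub>2"
 proof
  assume "module_iso A N S\<^sub>1"
  from module_iso_trans[OF iso this lN] show ?thesis ..
 next
  assume "module_iso A N S\<^sub>2"
  from module_iso_trans[OF iso this lN] show ?thesis ..
 qed
 then show ?thesis using U sN by blast
qed

lemma hom_dim_factor:
 assumes P: "projective_module A P" "cyclic A P x" and M: "fdm A M" and U: "submodule U A M"
  and S: "left_module A S" and iso: "module_iso A (factor_module M U) S"
 shows "hom_dim A P x M = hom_dim A P x (M\<lparr>carrier := U\<rparr>) + hom_dim A P x S"
proof -
 have lM: "left_module A M" using M by (simp add: fdm_def)
 have lP: "left_module A P" using P(1) by (simp add: projective_module_def fd_modules_def)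
 note fN = fdm_factor(1)[OF M U]
 have lN: "left_module A (factor_module M U)" using fN by (simp add: fdm_def)
 show ?thesis
  using hom_dim_exact[OF lP P(2) M lN coset_hom[OF lM U] coset_hom_surj[OF lM U] projective_lifting[OF P(1) M fN]]
  unfolding coset_hom_kernel[OF lM U] hom_dim_iso[OF P fN S iso] .
qed

text \<open>Both sides are additive along a simple factor of \<open>M\<close>, and they agree on
  \<open>S\<^sub>1\<close> and \<open>S\<^sub>2\<close>. It is applied to the projective module
  generated by \<open>st e\<close>, whose simple factors are not known in advance.\<close>

lemma hom_dim_additive:
 assumes S: "complete_simples A [S\<^sub>1, S\<^sub>2]" and c1: "cover_data A S\<^sub>1 P\<^sub>1 x\<^sub>1" and c2: "cover_data A S\<^sub>2 P\<^sub>2 x\<^sub>2"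
  and P: "projective_module A P" "cyclic A P x"
 shows "fdm A M ==> hom_dim A P x M =
  hom_dim A P x S\<^sub>1 * hom_dim A P\<^sub>1 x\<^sub>1 M + hom_dim A P x S\<^sub>2 * hom_dim A P\<^sub>2 x\<^sub>2 M"
proof (induction "mdim A M" arbitrary: M rule: less_induct)
 case less
 note M = less.prems
 have lM: "left_module A M" using M by (simp add: fdm_def)
 note Q1 = cover_data_proj[OF c1] and Q2 = cover_data_proj[OF c2]
 have lS: "left_module A S\<^sub>1" "left_module A S\<^sub>2" using simple_moduleD(1) Q1(5) Q2(5) by blast+
 show ?case
 proof (cases "carrier M = {\<zero>[M]}")
  case True
  have z: "hom_dim A Q y M = 0" if "projective_module A Q" "cyclic A Q y" for Q y
  proof (rule hom_dim_zero)
   show "left_module A Q" using that(1) by (simp add: projective_module_def fd_modules_def)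
   show y: "y \<in> carrier Q" using that(2) by (simp add: cyclic_def)
   show "f y = \<zero>[M]" if "f \<in> module_hom A Q M" for f using module_homD(1)[OF that y] True by simp
  qed (rule lM)
  show ?thesis using z[OF P] z[OF Q1(1,4)] z[OF Q2(1,4)] by simp
 next
  case False
  from top_simple[OF S M False] obtain U where U: "submodule U A M" "U \<noteq> carrier M"
   and iso: "module_iso A (factor_module M U) S\<^sub>1 \<or> module_iso A (factor_module M U) S\<^sub>2" by blast
  have IH: "hom_dim A P x (M\<lparr>carrier := U\<rparr>) = hom_dim A P x S\<^sub>1 * hom_dim A P\<^sub>1 x\<^sub>1 (M\<lparr>carrier := U\<rparr>) +
    hom_dim A P x S\<^sub>2 * hom_dim A P\<^sub>2 x\<^sub>2 (M\<lparr>carrier := U\<rparr>)"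
   by (rule less.hyps[OF mdim_submodule_less[OF M U] fdm_submodule[OF M U(1)]])
  have n: "\<not> module_iso A S\<^sub>1 S\<^sub>2" "\<not> module_iso A S\<^sub>2 S\<^sub>1"
   using S unfolding complete_simples_def by (auto simp: less_Suc_eq)
  have h: "hom_dim A P\<^sub>1 x\<^sub>1 S\<^sub>1 = 1" "hom_dim A P\<^sub>1 x\<^sub>1 S\<^sub>2 = 0" "hom_dim A P\<^sub>2 x\<^sub>2 S\<^sub>1 = 0" "hom_dim A P\<^sub>2 x\<^sub>2 S\<^sub>2 = 1"
   using cover_data_hom_dim_simple[OF c1 Q1(5)] cover_data_hom_dim_simple[OF c1 Q2(5)]
    cover_data_hom_dim_simple[OF c2 Q1(5)] cover_data_hom_dim_simple[OF c2 Q2(5)] n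
    module_iso_refl[OF lS(1)] module_iso_refl[OF lS(2)] by simp_all
  from iso show ?thesis
  proof
   assume i: "module_iso A (factor_module M U) S\<^sub>1"
   show ?thesis
    unfolding hom_dim_factor[OF P M U(1) lS(1) i] hom_dim_factor[OF Q1(1,4) M U(1) lS(1) i]
     hom_dim_factor[OF Q2(1,4) M U(1) lS(1) i] IH h by (simp add: algebra_simps)
  next
   assume i: "module_iso A (factor_module M U) S\<^sub>2"
   show ?thesis
    unfolding hom_dim_factor[OF P M U(1) lS(2) i] hom_dim_factor[OF Q1(1,4) M U(1) lS(2) i]
     hom_dim_factor[OF Q2(1,4) M U(1) lS(2) i] IH h by (simp add: algebra_simps)
  qed
 qed
qed

text \<open>A nonzero module has a simple factor module. For cell modules this excludes zero rows of
  the decomposition matrix.\<close>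

lemma hom_dim_pos:
 assumes S: "complete_simples A [S\<^sub>1, S\<^sub>2]" and c1: "cover_data A S\<^sub>1 P\<^sub>1 x\<^sub>1" and c2: "cover_data A S\<^sub>2 P\<^sub>2 x\<^sub>2"
  and M: "fdm A M" "carrier M \<noteq> {\<zero>[M]}"
 shows "hom_dim A P\<^sub>1 x\<^sub>1 M + hom_dim A P\<^sub>2 x\<^sub>2 M \<noteq> 0"
proof -
 note Q1 = cover_data_proj[OF c1] and Q2 = cover_data_proj[OF c2]
 have lS: "left_module A S\<^sub>1" "left_module A S\<^sub>2" using simple_moduleD(1) Q1(5) Q2(5) by blast+
 from top_simple[OF S M] obtain U where U: "submodule U A M"
  and iso: "module_iso A (factor_module M U) S\<^sub>1 \<or> module_iso A (factor_module M U) S\<^sub>2" by blast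
 from iso show ?thesis
 proof
  assume i: "module_iso A (factor_module M U) S\<^sub>1"
  show ?thesis
   unfolding hom_dim_factor[OF Q1(1,4) M(1) U lS(1) i] cover_data_hom_dim_simple[OF c1 Q1(5)]
   using module_iso_refl[OF lS(1)] by simp
 next
  assume i: "module_iso A (factor_module M U) S\<^sub>2"
  show ?thesis
   unfolding hom_dim_factor[OF Q2(1,4) M(1) U lS(2) i] cover_data_hom_dim_simple[OF c2 Q2(5)]
   using module_iso_refl[OF lS(2)] by simp
 qed
qed

end

section \<open>The rank argument and the effect of the involution on idempotents\<close>

context cellular
begin

lemma span_induct:
 assumes b: "b \<in> carrier B" and Z: "Z \<subseteq> carrier B" "\<zero> \<in> Z" "\<And>x y. [|x \<in> Z; y \<in> Z|] ==> x \<oplus> y \<in> Z"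
   "\<And>c x. x \<in> Z ==> c \<odot> x \<in> Z"
  and C: "\<And>m u v. [|m \<in> X; u \<in> T m; v \<in> T m; coef b m u v \<noteq> 0|] ==> C m u v \<in> Z"
 shows "b \<in> Z"
proof -
 have "lincomb B cb Idx (basis_coeff B cb Idx b) \<in> Z"
 proof (rule lincomb_in_subspace[OF kspace_axioms basis_finite[OF kspace_axioms basis] Z basis_closed[OF kspace_axioms basis]])
  fix i assume i: "i \<in> Idx" "basis_coeff B cb Idx b i \<noteq> 0"
  obtain m u v where q: "i = (m, u, v)" by (cases i)
  show "cb i \<in> Z" using C[of m u v] i by (simp add: q cb_def coef_def Idx_def)
 qed
 then show ?thesis by (simp add: lincomb_basis_coeff[OF kspace_axioms basis b])
qed

lemma exists_minimal:
 assumes "F \<subseteq> X" "F \<noteq> {}"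
 shows "\<exists>l\<in>F. \<forall>m\<in>F. m \<preceq> l --> m = l"
proof -
 let ?f = "\<lambda>l. card (down l)"
 have fd: "finite (down l)" for l by (rule finite_subset[OF _ finX]) (auto simp: down_def order_facts)
 have fin: "finite (?f ` F)" using assms(1) finX finite_subset by blast
 then have "Min (?f ` F) \<in> ?f ` F" using assms(2) by (intro Min_in) auto
 then obtain l where l: "l \<in> F" "?f l = Min (?f ` F)" by auto
 have "m = l" if m: "m \<in> F" "m \<preceq> l" for m
 proof (rule ccontr)
  assume "m \<noteq> l"
  then have "l \<notin> down m" "l \<in> down l" using order_facts m unfolding down_def by blast+
  moreover have "down m \<subseteq> down l" using order_facts(3) m(2) unfolding down_def by blast
  ultimately have "down m \<subset> down l" by blast
  then have "?f m < ?f l" by (rule psubset_card_mono[OF fd])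
  moreover have "?f l \<le> ?f m" unfolding l(2) using fin m(1) by (intro Min_le) auto
  ultimately show False by simp
 qed
 then show ?thesis using l(1) by blast
qed

text \<open>For a cell \<open>l\<close> that is minimal with this property, some
  \<open>e \<otimes> C l u v\<close> does not kill \<open>s\<close>, so it has a left inverse up to
  \<open>e\<close>. Then \<open>C l u v\<close> is injective on \<open>e W l\<close> but has rank at
  most one on \<open>W l\<close>, so \<open>e W l\<close> is at most a line; minimality of
  \<open>l\<close> makes it nonzero.\<close>

lemma exists_ed_eq_one:
 assumes e: "e \<in> carrier B" "e \<otimes> e = e" and s: "top_vector e S s"
 shows "\<exists>l\<in>X. ed l e = 1"
proof -
 have lS: "left_module B S" and sS: "s \<in> carrier S" "s \<noteq> \<zero>[S]" "e *[S] s = s"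
  and inv: "\<And>b. [|b \<in> carrier B; b *[S] s \<noteq> \<zero>[S]|] ==> \<exists>z\<in>carrier B. z \<otimes> b \<otimes> e = e"
  using s unfolding top_vector_def by blast+
 interpret S: left_module B S by (rule lS)
 \<comment> \<open>A subspace that does not contain \<open>e\<close>, so some basis element lies
   outside it.\<close>
 define Z where "Z = {b \<in> carrier B. (e \<otimes> b) *[S] s = \<zero>[S]}"
 have Zs: "Z \<subseteq> carrier B" "\<zero> \<in> Z" "\<And>x y. [|x \<in> Z; y \<in> Z|] ==> x \<oplus> y \<in> Z" "\<And>c x. x \<in> Z ==> c \<odot> x \<in> Z"
 proof -
  show "Z \<subseteq> carrier B" "\<zero> \<in> Z" using e sS by (auto simp: Z_def)
  show "x \<oplus> y \<in> Z" if "x \<in> Z" "y \<in> Z" for x y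
   using that e sS by (simp add: Z_def r_distr S.smult_l_distr)
  show "c \<odot> x \<in> Z" if "x \<in> Z" for c x
   using that e sS by (simp add: Z_def scal_mult_r scal_smult[OF lS])
 qed
 define G where "G = {m \<in> X. \<exists>u\<in>T m. \<exists>v\<in>T m. C m u v \<notin> Z}"
 have "G \<noteq> {}"
 proof
  assume "G = {}"
  then have "e \<in> Z" by (intro span_induct[OF e(1) Zs]) (auto simp: G_def)
  then show False using e sS by (simp add: Z_def)
 qed
 moreover have "G \<subseteq> X" by (auto simp: G_def)
 ultimately obtain l where l: "l \<in> G" and min: "\<forall>m\<in>G. m \<preceq> l --> m = l" using exists_minimal by blast
 obtain u v where lX: "l \<in> X" and uv: "u \<in> T l" "v \<in> T l" "C l u v \<notin> Z" using l by (auto simp: G_def)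
 have Cc: "C l u v \<in> carrier B" by (rule C_closed[OF lX uv(1,2)])
 define Y where "Y = e \<otimes> C l u v"
 have Y: "Y \<in> carrier B" "e \<otimes> Y = Y" using e Cc m_assoc[of e e "C l u v"] by (simp_all add: Y_def)
 have Ys: "Y *[S] s \<noteq> \<zero>[S]" using uv(3) Cc by (simp add: Z_def Y_def)
 obtain z where z: "z \<in> carrier B" "z \<otimes> Y \<otimes> e = e" using inv[OF Y(1) Ys] ..
 note lW = left_module_W[OF lX]
 interpret W: left_module B "W l" by (rule lW)
 note finl = finT[OF lX]
 \<comment> \<open>Otherwise \<open>e\<close> acts as zero on \<open>W l\<close>, and
   \<open>Y\<close> has no coefficient at \<open>l\<close>. It is then a combination of basis
   elements of lower cells, which lie in \<open>Z\<close> by minimality, in contradiction to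
   \<open>Ys\<close>.\<close>
 have "\<exists>w\<in>eW l e. w \<noteq> (\<lambda>_. 0)"
 proof (rule ccontr)
  assume "\<not> ?thesis"
  then have triv: "w = (\<lambda>_. 0)" if "w \<in> eW l e" for w using that by blast
  have r0: "r l e a b = 0" if ab: "a \<in> T l" "b \<in> T l" for a b
  proof -
   have "(\<lambda>a. if a \<in> T l then r l e a b else 0) \<in> eW l e"
   proof (rule eW_I)
    fix c assume c: "c \<in> T l"
    have "(\<Sum>a\<in>T l. r l e c a * (if a \<in> T l then r l e a b else 0)) = (\<Sum>a\<in>T l. r l e c a * r l e a b)"
     by (rule sum.cong) simp_all
    then show "(\<Sum>a\<in>T l. r l e c a * (if a \<in> T l then r l e a b else 0)) = (if c \<in> T l then r l e c b else 0)"
     using r_mult[OF e(1) e(1) lX c ab(2)] e(2) c by simp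
   qed simp
   from fun_cong[OF triv[OF this], of a] show ?thesis using ab by simp
  qed
  have "Y \<in> Z"
  proof (rule span_induct[OF Y(1) Zs])
   fix m a b assume m: "m \<in> X" "a \<in> T m" "b \<in> T m" "coef Y m a b \<noteq> 0"
   have "m \<preceq> l" using mult_C(2)[OF e(1) lX uv(1,2) m(1-3)] m(4) by (simp add: Y_def)
   moreover have "m \<noteq> l"
   proof
    assume "m = l"
    then show False using mult_C(1)[OF e(1) lX uv(1,2), of a b] r0[of a u] m uv by (auto simp: Y_def split: if_splits)
   qed
   ultimately have "m \<notin> G" using min by blast
   then show "C m a b \<in> Z" using m by (auto simp: G_def)
  qed
  then show False using Ys Y by (simp add: Z_def)
 qed
 then obtain w0 where w0: "w0 \<in> eW l e" "w0 \<noteq> (\<lambda>_. 0)" by blast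
 \<comment> \<open>By \<open>r_C\<close> this is the only coordinate that \<open>C l u v\<close>
   produces. A vector of \<open>e W l\<close> with \<open>c w = 0\<close> is killed by
   \<open>C l u v\<close>, and then it is zero, as
   \<open>z \<otimes> Y \<otimes> e = e\<close>.\<close>
 define c where "c = (\<lambda>w. \<Sum>a\<in>T l. r l (C l u v) u a * w a)"
 have c0: "w = (\<lambda>_. 0)" if w: "w \<in> eW l e" "c w = 0" for w
 proof -
  have wc: "w \<in> carrier (W l)" "e *[W l] w = w" using w(1) by (simp_all add: eW_def)
  have "C l u v *[W l] w = (\<lambda>_. 0)"
  proof
   fix a
   show "(C l u v *[W l] w) a = 0"
   proof (cases "a \<in> T l \<and> a \<noteq> u")
    case True
    then have "(\<Sum>b\<in>T l. r l (C l u v) a b * w b) = 0" using r_C[OF lX uv(1,2)] by (intro sum.neutral) simp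
    then show ?thesis by (simp add: W_simps)
   next
    case False
    then show ?thesis using w(2) by (auto simp: W_simps c_def)
   qed
  qed
  then have Cw: "C l u v *[W l] w = \<zero>[W l]" by (simp add: W_simps(2))
  have "w = (z \<otimes> Y \<otimes> e) *[W l] w" using wc(2) z(2) by simp
  also have "\<dots> = z *[W l] (e *[W l] (C l u v *[W l] w))"
   using z(1) Y(1) e(1) Cc wc by (simp add: W.smult_assoc1 W.smult_closed Y_def)
  also have "\<dots> = \<zero>[W l]" unfolding Cw using z(1) e(1) by simp
  finally show ?thesis by (simp add: W_simps(2))
 qed
 have cw0: "c w0 \<noteq> 0" using c0[OF w0(1)] w0(2) by blast
 note sp = eW_space[of l e]
 interpret E: kspace "fun_space (eW l e)" by (rule sp)
 have "kdim (fun_space (eW l e)) = 1"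
 proof (rule kdim_one_dimensional(2)[OF sp])
  show "w0 \<in> carrier (fun_space (eW l e))" "w0 \<noteq> \<zero>[fun_space (eW l e)]" using w0 by simp_all
  fix y assume "y \<in> carrier (fun_space (eW l e))"
  then have y: "y \<in> eW l e" by simp
  let ?k = "c y / c w0"
  have d: "(\<lambda>a. y a + (- ?k) * w0 a) \<in> eW l e"
   using E.a_closed[of y "\<lambda>a. (- ?k) * w0 a"] E.scale_closed[of w0 "- ?k"] y w0(1) by simp
  have "c (\<lambda>a. y a + (- ?k) * w0 a) = c y + (- ?k) * c w0"
   unfolding c_def sum_distrib_left sum.distrib[symmetric] by (rule sum.cong) (simp_all add: algebra_simps)
  also have "\<dots> = 0" using cw0 by simp
  finally have "(\<lambda>a. y a + (- ?k) * w0 a) = (\<lambda>_. 0)" by (rule c0[OF d])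
  then have "y a = ?k * w0 a" for a using fun_cong[of "\<lambda>a. y a + (- ?k) * w0 a" "\<lambda>_. 0" a] by (simp add: add_eq_0_iff)
  then show "\<exists>k. y = k *[fun_space (eW l e)] w0" by (intro exI[of _ ?k]) (simp add: fun_eq_iff)
 qed
 then show ?thesis using lX by (auto simp: ed_def)
qed

text \<open>As \<open>M\<close> kills \<open>s\<close>, the element \<open>e - M\<close> fixes
  \<open>s\<close> and is invertible in \<open>e B e\<close>. The involution makes
  \<open>st e - st M\<close> invertible in the corner of \<open>st e\<close>, yet it kills
  \<open>t\<close>.\<close>

lemma star_fixed_zero:
 fixes V :: "('a, 'v) module"
 assumes e: "e \<in> carrier B" "e \<otimes> e = e" and s: "top_vector e S s"
  and M: "M \<in> carrier B" "e \<otimes> M = M" "M \<otimes> e = M" "M *[S] s = \<zero>[S]"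
  and V: "left_module B V" and t: "t \<in> carrier V" "st e *[V] t = t" "st M *[V] t = t"
 shows "t = \<zero>[V]"
proof -
 have lS: "left_module B S" and sS: "s \<in> carrier S" "s \<noteq> \<zero>[S]" "e *[S] s = s"
  and inv: "\<And>b. [|b \<in> carrier B; b *[S] s \<noteq> \<zero>[S]|] ==> \<exists>z\<in>carrier B. z \<otimes> b \<otimes> e = e"
  using s unfolding top_vector_def by blast+
 interpret S: left_module B S by (rule lS)
 interpret V: left_module B V by (rule V)
 define L where "L = e \<oplus> (- 1) \<odot> M"
 have mM: "(- 1) \<odot> M \<in> carrier B" using M(1) by simp
 have L: "L \<in> carrier B" "e \<otimes> L = L" "L \<otimes> e = L"
  using e M mM by (simp_all add: L_def r_distr l_distr scal_mult_r scal_mult_l)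
 have M0: "((- 1) \<odot> M) *[S] s = \<zero>[S]"
  unfolding scal_smult[OF lS M(1) sS(1)] M(4) by (rule S.smult_zero) simp
 have Ls: "L *[S] s = s" using e(1) mM sS M0 by (simp add: L_def S.smult_l_distr)
 then have "L *[S] s \<noteq> \<zero>[S]" using sS by simp
 from inv[OF L(1) this] obtain z where z: "z \<in> carrier B" "z \<otimes> L \<otimes> e = e" ..
 have zL: "z \<otimes> L = e" using z L e by (simp add: m_assoc)
 \<comment> \<open>A left inverse of \<open>L\<close> inside \<open>e B e\<close>. It fixes
   \<open>s\<close>, so it has a left inverse itself, and is therefore a two-sided inverse of
   \<open>L\<close>.\<close>
 define z' where "z' = e \<otimes> z \<otimes> e"
 have z': "z' \<in> carrier B" "z' \<otimes> e = z'" "e \<otimes> z' = z'" using z(1) e by (simp_all add: z'_def m_assoc[symmetric]) (simp_all add: m_assoc e)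
 have zl: "z' \<otimes> L = e" using z(1) e L zL by (simp add: z'_def m_assoc)
 have zs: "z' *[S] s = s"
 proof -
  have "z' *[S] s = z' *[S] (L *[S] s)" unfolding Ls ..
  also have "\<dots> = (z' \<otimes> L) *[S] s" by (rule S.smult_assoc1[OF z'(1) L(1) sS(1), symmetric])
  finally show ?thesis unfolding zl sS(3) .
 qed
 then have "z' *[S] s \<noteq> \<zero>[S]" using sS by simp
 from inv[OF z'(1) this] obtain y where y: "y \<in> carrier B" "y \<otimes> z' \<otimes> e = e" ..
 have yz: "y \<otimes> z' = e" using y z' e by (simp add: m_assoc)
 have "L = y \<otimes> e"
 proof -
  have "L = (y \<otimes> z') \<otimes> L" unfolding yz L(2) ..
  also have "\<dots> = y \<otimes> (z' \<otimes> L)" by (rule m_assoc[OF y(1) z'(1) L(1)])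
  finally show ?thesis unfolding zl .
 qed
 then have Lz: "L \<otimes> z' = e" using y(1) e z' yz by (simp add: m_assoc)
 have sM: "st L = st e \<oplus> (- 1) \<odot> st M" using e(1) M(1) mM by (simp add: L_def star_add star_scale)
 have stM: "st M \<in> carrier B" using M(1) by simp
 have "((- 1) \<odot> st M) *[V] t = \<ominus>\<^bsub>V\<^esub> t"
  unfolding scal_smult[OF V stM t(1)] t(3)
  using kspace.scale_minus_one[OF kspace_restrict_scalars[OF V], of t] t(1)
  by (simp add: a_inv_def m_inv_def)
 then have "st L *[V] t = t +[V] \<ominus>\<^bsub>V\<^esub> t"
  unfolding sM using V.smult_l_distr[OF star_closed[OF e(1)] scal_closed[OF stM] t(1), of "- 1"] t(2) by simp
 then have L0: "st L *[V] t = \<zero>[V]" using V.M.r_neg[OF t(1)] by simp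
 have "t = (st z' \<otimes> st L) *[V] t" using t(2) Lz star_mult[OF L(1) z'(1)] by simp
 also have "\<dots> = st z' *[V] (st L *[V] t)" by (rule V.smult_assoc1) (use z' L t in simp_all)
 also have "\<dots> = \<zero>[V]" unfolding L0 by (rule V.smult_zero) (use z' in simp)
 finally show ?thesis .
qed

text \<open>\<open>e B e\<close> acts on \<open>s\<close> by scalars. Write \<open>t'\<close> as
  \<open>a *[V] t\<close>, compress \<open>st a\<close> to \<open>e B e\<close>, and subtract the
  scalar \<open>c\<close> by which the result acts on \<open>s\<close>; this gives \<open>N\<close>
  with \<open>N *[S] s = \<zero>[S]\<close>, and \<open>u = st N *[V] t\<close> is \<open>t'\<close>
  minus \<open>c\<close> times \<open>t\<close>. If \<open>u\<close> were nonzero, simplicity of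
  \<open>V\<close> would lead from \<open>u\<close> back to \<open>t\<close>, against
  \<open>star_fixed_zero\<close>.\<close>

lemma star_line:
 assumes e: "e \<in> carrier B" "e \<otimes> e = e" and s: "top_vector e S s" and V: "simple_module B V"
  and t: "t \<in> carrier V" "t \<noteq> \<zero>[V]" "st e *[V] t = t" and t': "t' \<in> carrier V" "st e *[V] t' = t'"
 shows "\<exists>c. t' = (c \<odot> \<one>) *[V] t"
proof -
 have lS: "left_module B S" and sS: "s \<in> carrier S" "s \<noteq> \<zero>[S]" "e *[S] s = s"
  and line: "\<And>s'. [|s' \<in> carrier S; e *[S] s' = s'|] ==> \<exists>c. s' = (c \<odot> \<one>) *[S] s"
  using s unfolding top_vector_def by blast+
 have lV: "left_module B V" by (rule simple_moduleD(1)[OF V])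
 interpret S: left_module B S by (rule lS)
 interpret V: left_module B V by (rule lV)
 let ?E = "st e"
 have E: "?E \<in> carrier B" "?E \<otimes> ?E = ?E" using e star_mult[OF e(1) e(1)] by simp_all
 have corner: "\<exists>N\<in>carrier B. e \<otimes> N = N \<and> N \<otimes> e = N \<and> st N = ?E \<otimes> a \<otimes> ?E" if a: "a \<in> carrier B" for a
 proof
  let ?N = "e \<otimes> st a \<otimes> e"
  show "?N \<in> carrier B" using e a by simp
  show "e \<otimes> ?N = ?N \<and> ?N \<otimes> e = ?N \<and> st ?N = ?E \<otimes> a \<otimes> ?E"
   using e a E by (simp add: m_assoc[symmetric] star_mult) (simp add: m_assoc e star_mult)
 qed
 have es: "\<exists>c. N *[S] s = (c \<odot> \<one>) *[S] s" if N: "N \<in> carrier B" "e \<otimes> N = N" for N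
  by (rule line) (use N e sS in \<open>simp_all add: S.smult_closed S.smult_assoc1[symmetric]\<close>)
 obtain a where a: "a \<in> carrier B" "t' = a *[V] t" using simple_cyclic[OF V t(1,2)] t'(1) by (rule cyclicE)
 obtain N1 where N1: "N1 \<in> carrier B" "e \<otimes> N1 = N1" "N1 \<otimes> e = N1" "st N1 = ?E \<otimes> a \<otimes> ?E" using corner[OF a(1)] by blast
 obtain c where c: "N1 *[S] s = (c \<odot> \<one>) *[S] s" using es[OF N1(1,2)] ..
 define N where "N = N1 \<oplus> (- c) \<odot> e"
 have N: "N \<in> carrier B" "e \<otimes> N = N" "N \<otimes> e = N"
  using e N1 by (simp_all add: N_def r_distr l_distr scal_mult_r scal_mult_l)
 interpret SK: kspace "restrict_scalars B S" by (rule kspace_restrict_scalars[OF lS])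
 interpret VK: kspace "restrict_scalars B V" by (rule kspace_restrict_scalars[OF lV])
 have Ns: "N *[S] s = \<zero>[S]"
 proof -
  have "N *[S] s = (c \<odot> \<one>) *[S] s +[S] ((- c) \<odot> \<one>) *[S] s"
   using N1(1) e(1) sS by (simp add: N_def S.smult_l_distr c scal_smult[OF lS e(1)])
  also have "\<dots> = ((c + - c) \<odot> \<one>) *[S] s" using SK.scale_l_distr[of s c "- c"] sS by simp
  also have "\<dots> = \<zero>[S]" using SK.scale_zero[of s] sS by simp
  finally show ?thesis .
 qed
 define u where "u = st N *[V] t"
 have N1t: "st N1 *[V] t = t'"
  unfolding N1(4) using E a t t' by (simp add: V.smult_assoc1 V.smult_closed)
 have ut: "u = t' +[V] ((- c) \<odot> \<one>) *[V] t"
  unfolding u_def N_def using N1(1) e(1) t E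
  by (simp add: star_add star_scale V.smult_l_distr N1t scal_smult[OF lV E(1)])
 have "u = \<zero>[V]"
 proof (rule ccontr)
  assume u0: "u \<noteq> \<zero>[V]"
  have uc: "u \<in> carrier V" unfolding u_def using N(1) t by (simp add: V.smult_closed)
  have Eu: "?E *[V] u = u"
  proof -
   have "?E \<otimes> st N = st N" using star_mult[OF N(1) e(1)] N(3) by simp
   then show ?thesis unfolding u_def using V.smult_assoc1[OF E(1) star_closed[OF N(1)] t(1)] by simp
  qed
  obtain b where b: "b \<in> carrier B" "t = b *[V] u" using simple_cyclic[OF V uc u0] t(1) by (rule cyclicE)
  obtain N2 where N2: "N2 \<in> carrier B" "e \<otimes> N2 = N2" "N2 \<otimes> e = N2" "st N2 = ?E \<otimes> b \<otimes> ?E" using corner[OF b(1)] by blast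
  obtain c' where c': "N2 *[S] s = (c' \<odot> \<one>) *[S] s" using es[OF N2(1,2)] ..
  \<comment> \<open>The involution reverses products: \<open>st (N \<otimes> N2)\<close> applies
    first \<open>st N\<close>, which gives \<open>u\<close>, and then \<open>st N2\<close>, which
    leads back to \<open>t\<close>. On \<open>s\<close> the product is zero, since \<open>N2\<close>
    acts by a scalar and \<open>N\<close> kills \<open>s\<close>.\<close>
  have M: "N \<otimes> N2 \<in> carrier B" "e \<otimes> (N \<otimes> N2) = N \<otimes> N2" "(N \<otimes> N2) \<otimes> e = N \<otimes> N2"
   using N N2 e m_assoc[OF e(1) N(1) N2(1)] by (simp_all add: m_assoc)
  have Ms: "(N \<otimes> N2) *[S] s = \<zero>[S]"
   unfolding S.smult_assoc1[OF N(1) N2(1) sS(1)] c' smult_scal_one_comm[OF lS N(1) sS(1)] Ns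
   by (rule S.smult_zero) simp
  have "st (N \<otimes> N2) *[V] t = st N2 *[V] u"
   using N(1) N2(1) t by (simp add: star_mult V.smult_assoc1 u_def)
  also have "\<dots> = ?E *[V] (b *[V] (?E *[V] u))"
   unfolding N2(4) using E b(1) uc by (simp add: V.smult_assoc1 V.smult_closed)
  also have "\<dots> = t" unfolding Eu b(2)[symmetric] by (rule t(3))
  finally have "t = \<zero>[V]" by (rule star_fixed_zero[OF e s M Ms lV t(1,3)])
  then show False using t(2) by contradiction
 qed
 then have z: "t' +[V] ((- c) \<odot> \<one>) *[V] t = \<zero>[V]" using ut by simp
 have kc: "(k \<odot> \<one>) *[V] t \<in> carrier V" for k using VK.scale_closed[of t k] t(1) by simp
 have "t' = t' +[V] ((- c + c) \<odot> \<one>) *[V] t" using VK.scale_zero[of t] t(1) t'(1) by simp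
 also have "\<dots> = t' +[V] (((- c) \<odot> \<one>) *[V] t +[V] (c \<odot> \<one>) *[V] t)"
  using VK.scale_l_distr[of t "- c" c] t(1) by simp
 also have "\<dots> = (c \<odot> \<one>) *[V] t"
  using V.M.a_assoc[OF t'(1) kc kc, of "- c" c] z kc[of c] by simp
 finally show ?thesis ..
qed

text \<open>So each simple module occurs at most once at the top of the projective module generated
  by \<open>st e\<close>.\<close>

lemma star_hom_dim_le_one:
 assumes e: "e \<in> carrier B" "e \<otimes> e = e" and s: "top_vector e S s" and V: "simple_module B V" and fin: "fdm B V"
  and P: "idem_gen B (st e) P y"
 shows "hom_dim B P y V \<le> 1"
proof -
 have lV: "left_module B V" by (rule simple_moduleD(1)[OF V])
 have lP: "left_module B P" and yP: "y \<in> carrier P" using P by (simp_all add: idem_gen_def cyclic_def)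
 let ?V = "(restrict_scalars B V)\<lparr>carrier := hom_values B P y V\<rparr>"
 note hv = hom_values_idem_gen[OF P lV]
 have K: "kspace ?V" by (rule kspace_hom_values[OF lP lV yP])
 show ?thesis
 proof (cases "\<exists>t\<in>carrier V. st e *[V] t = t \<and> t \<noteq> \<zero>[V]")
  case True
  then obtain t where t: "t \<in> carrier V" "st e *[V] t = t" "t \<noteq> \<zero>[V]" by blast
  have "kdim ?V = 1"
  proof (rule kdim_one_dimensional(2)[OF K])
   show "t \<in> carrier ?V" "t \<noteq> \<zero>[?V]" using t by (simp_all add: hv)
   show "\<exists>c. t' = c *[?V] t" if "t' \<in> carrier ?V" for t'
    using star_line[OF e s V t(1,3,2), of t'] that by (simp add: hv)
  qed
  then show ?thesis by (simp add: hom_dim_def)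
 next
  case False
  have "\<zero>[V] \<in> carrier ?V" using kspace.axioms(1)[OF K] abelian_group.axioms abelian_monoid.zero_closed[of ?V] by (simp add: abelian_group_def)
  then have "carrier ?V = {\<zero>[?V]}" using False by (auto simp: hv)
  then have "kdim ?V = 0" by (rule kdim_zero_space(2)[OF K])
  then show ?thesis by (simp add: hom_dim_def)
 qed
qed

text \<open>With \<open>m, n\<close> and \<open>m', n'\<close> the multiplicities for
  \<open>st e1\<close> and \<open>st e2\<close>, the Cartan numbers become linear expressions in the
  scalar products \<open>g11\<close>, \<open>g12\<close>, \<open>g22\<close> of the columns. The
  inequalities \<open>b < a\<close> and \<open>b < c\<close> leave only \<open>m = n' = 1\<close>
  and \<open>n = m' = 0\<close>.\<close>

lemma decomposition_columns:
 assumes d: "block_data B S\<^sub>1 S\<^sub>2 a b c" and ba: "b < a" "b < c"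
 shows "\<exists>d\<^sub>1 d\<^sub>2. (\<forall>l\<in>X. comp_mult B (W l) S\<^sub>1 = d\<^sub>1 l \<and> comp_mult B (W l) S\<^sub>2 = d\<^sub>2 l \<and> d\<^sub>1 l + d\<^sub>2 l \<noteq> 0) \<and>
  (\<exists>l\<in>X. d\<^sub>1 l = 1) \<and> (\<exists>l\<in>X. d\<^sub>2 l = (1::nat)) \<and>
  (\<Sum>l\<in>X. d\<^sub>1 l * d\<^sub>1 l) = a \<and> (\<Sum>l\<in>X. d\<^sub>1 l * d\<^sub>2 l) = b \<and> (\<Sum>l\<in>X. d\<^sub>2 l * d\<^sub>2 l) = c"
proof -
 have S: "complete_simples B [S\<^sub>1, S\<^sub>2]" using d by (simp add: block_data_def)
 obtain P\<^sub>1 x\<^sub>1 P\<^sub>2 x\<^sub>2 where c1: "cover_data B S\<^sub>1 P\<^sub>1 x\<^sub>1" and c2: "cover_data B S\<^sub>2 P\<^sub>2 x\<^sub>2"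
  and h: "hom_dim B P\<^sub>1 x\<^sub>1 P\<^sub>1 = a" "hom_dim B P\<^sub>1 x\<^sub>1 P\<^sub>2 = b" "hom_dim B P\<^sub>2 x\<^sub>2 P\<^sub>1 = b" "hom_dim B P\<^sub>2 x\<^sub>2 P\<^sub>2 = c"
  using d unfolding block_data_def by (elim conjE exE)
 obtain e1 where i1: "idem_gen B e1 P\<^sub>1 x\<^sub>1" using cover_idempotent[OF kfin_B c1] ..
 obtain e2 where i2: "idem_gen B e2 P\<^sub>2 x\<^sub>2" using cover_idempotent[OF kfin_B c2] ..
 obtain s1 where s1: "top_vector e1 S\<^sub>1 s1" using exists_top_vector[OF c1 i1] ..
 obtain s2 where s2: "top_vector e2 S\<^sub>2 s2" using exists_top_vector[OF c2 i2] ..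
 have e1: "e1 \<in> carrier B" "e1 \<otimes> e1 = e1" and e2: "e2 \<in> carrier B" "e2 \<otimes> e2 = e2"
  using i1 i2 by (simp_all add: idem_gen_def)
 note Q1 = cover_data_proj[OF c1] and Q2 = cover_data_proj[OF c2]
 have fS: "fdm B S\<^sub>1" "fdm B S\<^sub>2" using Q1(6) Q2(6) by (simp_all add: fd_modules_iff)
 let ?d1 = "\<lambda>l. ed l e1" and ?d2 = "\<lambda>l. ed l e2"
 have D: "hom_dim B P\<^sub>1 x\<^sub>1 (W l) = ?d1 l" "hom_dim B P\<^sub>2 x\<^sub>2 (W l) = ?d2 l" if "l \<in> X" for l
  using hom_dim_W[OF i1 that] hom_dim_W[OF i2 that] by simp_all
 have cols: "comp_mult B (W l) S\<^sub>1 = ?d1 l" "comp_mult B (W l) S\<^sub>2 = ?d2 l" "?d1 l + ?d2 l \<noteq> 0" if l: "l \<in> X" for l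
 proof -
  show "comp_mult B (W l) S\<^sub>1 = ?d1 l" "comp_mult B (W l) S\<^sub>2 = ?d2 l"
   unfolding cover_data_comp_mult[OF c1 fdm_W[OF l]] cover_data_comp_mult[OF c2 fdm_W[OF l]] by (fact D[OF l])+
  obtain t where t: "t \<in> T l" using T_nonempty[OF l] by blast
  have "(\<lambda>s. if s = t then 1 else 0) \<in> carrier (W l)" using t by (auto simp: W_simps)
  moreover have "(\<lambda>s. if s = t then 1 else 0) \<noteq> \<zero>[W l]" by (auto simp: W_simps fun_eq_iff)
  ultimately have "carrier (W l) \<noteq> {\<zero>[W l]}" by blast
  from hom_dim_pos[OF S c1 c2 fdm_W[OF l] this] show "?d1 l + ?d2 l \<noteq> 0" unfolding D[OF l] .
 qed
 \<comment> \<open>The module generated by \<open>st e\<close> is projective but need not be one of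
   the two covers; its homomorphisms into cell modules are counted through the simple
   modules.\<close>
 have starred: "\<exists>m n. m \<le> 1 \<and> n \<le> 1 \<and> (\<forall>l\<in>X. ed l (st e) = m * ?d1 l + n * ?d2 l)"
  if e: "e \<in> carrier B" "e \<otimes> e = e" and s: "top_vector e S' s'" for e S' s'
 proof -
  have E: "st e \<in> carrier B" "st e \<otimes> st e = st e" using e star_mult[OF e(1) e(1)] by simp_all
  obtain P y where P: "P \<in> fd_modules B" "idem_gen B (st e) P y" using idem_gen_exists[OF kfin_B E] by blast
  have pP: "projective_module B P" "cyclic B P y" using projective_idem_gen[OF P(2,1)] P(2) by (simp_all add: idem_gen_def)
  have eq: "ed l (st e) = hom_dim B P y S\<^sub>1 * ?d1 l + hom_dim B P y S\<^sub>2 * ?d2 l" if l: "l \<in> X" for l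
   using hom_dim_additive[OF S c1 c2 pP fdm_W[OF l]] unfolding D[OF l] hom_dim_W[OF P(2) l] .
  have "hom_dim B P y S\<^sub>1 \<le> 1" "hom_dim B P y S\<^sub>2 \<le> 1"
   using star_hom_dim_le_one[OF e s Q1(5) fS(1) P(2)] star_hom_dim_le_one[OF e s Q2(5) fS(2) P(2)] by simp_all
  then show ?thesis
   by (intro exI[of _ "hom_dim B P y S\<^sub>1"] exI[of _ "hom_dim B P y S\<^sub>2"] conjI ballI eq)
 qed
 define g11 g12 g22 where "g11 = (\<Sum>l\<in>X. ?d1 l * ?d1 l)" and "g12 = (\<Sum>l\<in>X. ?d1 l * ?d2 l)" and "g22 = (\<Sum>l\<in>X. ?d2 l * ?d2 l)"
 obtain m n where m: "m \<le> 1" "n \<le> 1" and m_eq: "\<forall>l\<in>X. ed l (st e1) = m * ?d1 l + n * ?d2 l"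
  using starred[OF e1 s1] by (elim exE conjE)
 obtain m' n' where m': "m' \<le> 1" "n' \<le> 1" and m'_eq: "\<forall>l\<in>X. ed l (st e2) = m' * ?d1 l + n' * ?d2 l"
  using starred[OF e2 s2] by (elim exE conjE)
 have split: "(\<Sum>l\<in>X. f l * ed l E) = m * (\<Sum>l\<in>X. f l * ?d1 l) + n * (\<Sum>l\<in>X. f l * ?d2 l)"
  if "\<And>l. l \<in> X ==> ed l E = m * ?d1 l + n * ?d2 l" for f :: "'l \<Rightarrow> nat" and E m n
 proof -
  have "(\<Sum>l\<in>X. f l * ed l E) = (\<Sum>l\<in>X. m * (f l * ?d1 l) + n * (f l * ?d2 l))"
   by (rule sum.cong) (simp_all add: that algebra_simps)
  then show ?thesis by (simp add: sum.distrib sum_distrib_left)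
 qed
 have g21: "(\<Sum>l\<in>X. ?d2 l * ?d1 l) = g12" unfolding g12_def by (rule sum.cong) simp_all
 have A: "a = m * g11 + n * g12" "b = m' * g11 + n' * g12" "b = m * g12 + n * g22" "c = m' * g12 + n' * g22"
 proof -
  show "a = m * g11 + n * g12"
   unfolding h(1)[symmetric] cellular_hom_dim[OF i1 i1] g11_def g12_def by (rule split) (rule m_eq[rule_format])
  show "b = m' * g11 + n' * g12"
   unfolding h(2)[symmetric] cellular_hom_dim[OF i1 i2] g11_def g12_def by (rule split) (rule m'_eq[rule_format])
  show "b = m * g12 + n * g22"
   unfolding h(3)[symmetric] cellular_hom_dim[OF i2 i1] g21[symmetric] g22_def by (rule split) (rule m_eq[rule_format])
  show "c = m' * g12 + n' * g22"
   unfolding h(4)[symmetric] cellular_hom_dim[OF i2 i2] g21[symmetric] g22_def by (rule split) (rule m'_eq[rule_format])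
 qed
 \<comment> \<open>For the exchanged case \<open>m = n' = 0\<close>, \<open>n = m' = 1\<close>,
   where \<open>g11 = g22 = b\<close> and \<open>g12 = a = c\<close>. The other cases contradict
   \<open>b < a\<close> or \<open>b < c\<close> directly.\<close>
 have am_gm: "2 * (x * y) \<le> x * x + y * y" for x y :: nat
 proof -
  have "0 \<le> (int x - int y) * (int x - int y)" by simp
  then have "int (2 * (x * y)) \<le> int (x * x + y * y)" by (simp add: algebra_simps)
  then show ?thesis by (simp only: of_nat_le_iff)
 qed
 have "2 * g12 \<le> g11 + g22"
  unfolding g11_def g12_def g22_def sum_distrib_left sum.distrib[symmetric] by (rule sum_mono) (rule am_gm)
 moreover have "m = 0 \<or> m = 1" "n = 0 \<or> n = 1" "m' = 0 \<or> m' = 1" "n' = 0 \<or> n' = 1" using m(1,2) m'(1,2) by auto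
 ultimately have "g11 = a \<and> g12 = b \<and> g22 = c" using A ba by (elim disjE; simp?; linarith?)
 moreover have "\<exists>l\<in>X. ?d1 l = 1" "\<exists>l\<in>X. ?d2 l = 1"
  using exists_ed_eq_one[OF e1 s1] exists_ed_eq_one[OF e2 s2] by simp_all
 ultimately show ?thesis using cols unfolding g11_def g12_def g22_def by (intro exI[of _ ?d1] exI[of _ ?d2]) simp
qed

end

section \<open>From the scalar products of the columns to the matrix\<close>

lemma column_le_one:
 fixes d :: "'l \<Rightarrow> nat"
 assumes fin: "finite X" and one: "\<exists>l\<in>X. d l = 1" and sq: "(\<Sum>l\<in>X. d l * d l) \<le> 4" and l: "l \<in> X"
 shows "d l \<le> 1"
proof (rule ccontr)
 assume n: "\<not> d l \<le> 1"
 obtain k where k: "k \<in> X" "d k = 1" using one ..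
 have kl: "k \<noteq> l" using n k by auto
 \<comment> \<open>An entry of at least 2 besides an entry 1 makes the sum of squares at least
   5.\<close>
 have "(\<Sum>l\<in>{k, l}. d l * d l) \<le> (\<Sum>l\<in>X. d l * d l)" by (rule sum_mono2) (use fin k l in auto)
 then have "1 + d l * d l \<le> 4" using sq kl k(2) by simp
 moreover have "2 * 2 \<le> d l * d l" using n by (intro mult_le_mono) auto
 ultimately show False by simp
qed

text \<open>With entries 0 and 1 and no zero row only three rows are possible, and the scalar
  products count them: \<open>b\<close> rows contain two ones, and the squares of the columns give
  the others.\<close>

lemma rows_up_to_order:
 fixes d\<^sub>1 d\<^sub>2 :: "'l \<Rightarrow> nat"
 assumes fin: "finite X" and le: "\<And>l. l \<in> X ==> d\<^sub>1 l \<le> 1" "\<And>l. l \<in> X ==> d\<^sub>2 l \<le> 1"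
  and nz: "\<And>l. l \<in> X ==> d\<^sub>1 l + d\<^sub>2 l \<noteq> 0"
  and sq: "(\<Sum>l\<in>X. d\<^sub>1 l * d\<^sub>1 l) = a" "(\<Sum>l\<in>X. d\<^sub>1 l * d\<^sub>2 l) = b" "(\<Sum>l\<in>X. d\<^sub>2 l * d\<^sub>2 l) = c"
 shows "\<exists>ls. distinct ls \<and> set ls = X \<and>
  map (\<lambda>l. [d\<^sub>1 l, d\<^sub>2 l]) ls = replicate (a - b) [1, 0] @ replicate b [1, 1] @ replicate (c - b) [0, 1]"
proof -
 define Y where "Y = (\<lambda>i j. {l \<in> X. d\<^sub>1 l = i \<and> d\<^sub>2 l = j})"
 have finY: "finite (Y i j)" for i j using fin by (simp add: Y_def)
 have v: "d\<^sub>1 l = 0 \<or> d\<^sub>1 l = 1" "d\<^sub>2 l = 0 \<or> d\<^sub>2 l = 1" if "l \<in> X" for l using le[OF that] by auto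
 have XY: "X = Y 1 0 \<union> Y 1 1 \<union> Y 0 1"
 proof (intro equalityI subsetI)
  fix l assume l: "l \<in> X"
  show "l \<in> Y 1 0 \<union> Y 1 1 \<union> Y 0 1" using v[OF l] nz[OF l] l by (auto simp: Y_def)
 qed (auto simp: Y_def)
 have card: "(\<Sum>l\<in>X. f l) = card A" if "A \<subseteq> X" "\<And>l. l \<in> X ==> f l = (if l \<in> A then 1 else 0)" for f A
 proof -
  have "(\<Sum>l\<in>X. f l) = (\<Sum>l\<in>X. if l \<in> A then 1 else 0)" by (rule sum.cong) (simp_all add: that(2))
  also have "\<dots> = card (X \<inter> A)" using fin by (simp add: sum.If_cases)
  finally show ?thesis using that(1) by (simp add: Int_absorb1)
 qed
 have 1: "card (Y 1 1) = b"
  unfolding sq(2)[symmetric]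
 proof (rule card[symmetric])
  show "Y 1 1 \<subseteq> X" by (auto simp: Y_def)
  show "d\<^sub>1 l * d\<^sub>2 l = (if l \<in> Y 1 1 then 1 else 0)" if "l \<in> X" for l
   using v[OF that] that by (auto simp: Y_def)
 qed
 have "card (Y 1 0 \<union> Y 1 1) = a"
  unfolding sq(1)[symmetric]
 proof (rule card[symmetric])
  show "Y 1 0 \<union> Y 1 1 \<subseteq> X" by (auto simp: Y_def)
  show "d\<^sub>1 l * d\<^sub>1 l = (if l \<in> Y 1 0 \<union> Y 1 1 then 1 else 0)" if "l \<in> X" for l
   using v[OF that] that by (auto simp: Y_def)
 qed
 moreover have "card (Y 1 0 \<union> Y 1 1) = card (Y 1 0) + card (Y 1 1)"
  by (rule card_Un_disjoint[OF finY finY]) (auto simp: Y_def)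
 ultimately have 2: "card (Y 1 0) = a - b" using 1 by simp
 have "card (Y 0 1 \<union> Y 1 1) = c"
  unfolding sq(3)[symmetric]
 proof (rule card[symmetric])
  show "Y 0 1 \<union> Y 1 1 \<subseteq> X" by (auto simp: Y_def)
  show "d\<^sub>2 l * d\<^sub>2 l = (if l \<in> Y 0 1 \<union> Y 1 1 then 1 else 0)" if "l \<in> X" for l
   using v[OF that] that by (auto simp: Y_def)
 qed
 moreover have "card (Y 0 1 \<union> Y 1 1) = card (Y 0 1) + card (Y 1 1)"
  by (rule card_Un_disjoint[OF finY finY]) (auto simp: Y_def)
 ultimately have 3: "card (Y 0 1) = c - b" using 1 by simp
 have L: "\<exists>ls. set ls = Y i j \<and> distinct ls \<and> map (\<lambda>l. [d\<^sub>1 l, d\<^sub>2 l]) ls = replicate (card (Y i j)) [i, j]" for i j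
 proof -
  obtain ls where ls: "set ls = Y i j" "distinct ls" using finite_distinct_list[OF finY] by blast
  have "length ls = card (Y i j)" using distinct_card[OF ls(2)] ls(1) by simp
  moreover have "map (\<lambda>l. [d\<^sub>1 l, d\<^sub>2 l]) ls = map (\<lambda>_. [i, j]) ls" by (rule map_cong) (use ls(1) in \<open>auto simp: Y_def\<close>)
  ultimately show ?thesis using ls by (intro exI[of _ ls] conjI) (simp_all add: map_replicate_const)
 qed
 obtain l1 where l1: "set l1 = Y 1 0" "distinct l1" "map (\<lambda>l. [d\<^sub>1 l, d\<^sub>2 l]) l1 = replicate (card (Y 1 0)) [1, 0]" using L[of 1 0] by (elim exE conjE)
 obtain l2 where l2: "set l2 = Y 1 1" "distinct l2" "map (\<lambda>l. [d\<^sub>1 l, d\<^sub>2 l]) l2 = replicate (card (Y 1 1)) [1, 1]" using L[of 1 1] by (elim exE conjE)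
 obtain l3 where l3: "set l3 = Y 0 1" "distinct l3" "map (\<lambda>l. [d\<^sub>1 l, d\<^sub>2 l]) l3 = replicate (card (Y 0 1)) [0, 1]" using L[of 0 1] by (elim exE conjE)
 have "distinct (l1 @ l2 @ l3)" using l1 l2 l3 by (auto simp: Y_def)
 moreover have "set (l1 @ l2 @ l3) = X" using l1(1) l2(1) l3(1) XY by auto
 ultimately show ?thesis using l1(3) l2(3) l3(3) unfolding 1 2 3 by (intro exI[of _ "l1 @ l2 @ l3"]) simp
qed

text \<open>The bounds by 4 serve \<open>column_le_one\<close>, the strict inequalities
  \<open>decomposition_columns\<close>; the three Cartan matrices satisfy both.\<close>

theorem (in cellular) cellular_decomposition_matrix:
 assumes d: "block_data B S\<^sub>1 S\<^sub>2 a b c" and ba: "b < a" "b < c" "a \<le> 4" "c \<le> 4"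
 shows "has_decomposition_matrix B D [S\<^sub>1, S\<^sub>2]
  (mat_of_rows_list 2 (replicate (a - b) [1, 0] @ replicate b [1, 1] @ replicate (c - b) [0, 1]))"
proof -
 obtain d\<^sub>1 d\<^sub>2 where cm: "\<forall>l\<in>X. comp_mult B (W l) S\<^sub>1 = d\<^sub>1 l \<and> comp_mult B (W l) S\<^sub>2 = d\<^sub>2 l \<and> d\<^sub>1 l + d\<^sub>2 l \<noteq> 0"
  and one: "\<exists>l\<in>X. d\<^sub>1 l = 1" "\<exists>l\<in>X. d\<^sub>2 l = (1::nat)"
  and sq: "(\<Sum>l\<in>X. d\<^sub>1 l * d\<^sub>1 l) = a" "(\<Sum>l\<in>X. d\<^sub>1 l * d\<^sub>2 l) = b" "(\<Sum>l\<in>X. d\<^sub>2 l * d\<^sub>2 l) = c"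
  using decomposition_columns[OF d ba(1,2)] by (elim exE conjE)
 have le: "d\<^sub>1 l \<le> 1" "d\<^sub>2 l \<le> 1" if "l \<in> X" for l
  using column_le_one[OF finX one(1) _ that] column_le_one[OF finX one(2) _ that] sq ba by simp_all
 have nz: "d\<^sub>1 l + d\<^sub>2 l \<noteq> 0" if "l \<in> X" for l using bspec[OF cm that] by (elim conjE)
 have "\<exists>ls. distinct ls \<and> set ls = X \<and>
  map (\<lambda>l. [d\<^sub>1 l, d\<^sub>2 l]) ls = replicate (a - b) [1, 0] @ replicate b [1, 1] @ replicate (c - b) [0, 1]"
  by (rule rows_up_to_order[OF finX _ _ _ sq]) (fact le nz)+
 then obtain ls where ls: "distinct ls" "set ls = X"
  and rows: "map (\<lambda>l. [d\<^sub>1 l, d\<^sub>2 l]) ls = replicate (a - b) [1, 0] @ replicate b [1, 1] @ replicate (c - b) [0, 1]"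
  by (elim exE conjE)
 have "decomposition_matrix B D ls [S\<^sub>1, S\<^sub>2] = mat_of_rows_list 2 (map (\<lambda>l. [d\<^sub>1 l, d\<^sub>2 l]) ls)"
 proof (rule eq_matI)
  fix i j assume "i < dim_row (mat_of_rows_list 2 (map (\<lambda>l. [d\<^sub>1 l, d\<^sub>2 l]) ls))"
   and "j < dim_col (mat_of_rows_list 2 (map (\<lambda>l. [d\<^sub>1 l, d\<^sub>2 l]) ls))"
  then have i: "i < length ls" and j: "j = 0 \<or> j = 1" by (auto simp: mat_of_rows_list_def)
  have "ls ! i \<in> X" using i ls(2) by auto
  then show "decomposition_matrix B D ls [S\<^sub>1, S\<^sub>2] $$ (i, j) = mat_of_rows_list 2 (map (\<lambda>l. [d\<^sub>1 l, d\<^sub>2 l]) ls) $$ (i, j)"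
   using i j bspec[OF cm, of "ls ! i"] by (auto simp: decomposition_matrix_def mat_of_rows_list_def)
 qed (simp_all add: decomposition_matrix_def mat_of_rows_list_def)
 then show ?thesis unfolding has_decomposition_matrix_def rows[symmetric] using ls by blast
qed

theorem mainTheorem2:
  fixes H B :: "('k::alg_closed_field, 'k free set) module"
    and S\<^sub>1 S\<^sub>2 :: "('k free set, 'k vec) module"
  assumes "CHAR('k) \<noteq> 2"
    and "H \<in> classical_hecke_algebras" and "B \<in> block_algebras H"
    and "tame B" and "\<not> finite_representation_type B"
  shows
    "(morita_equivalent_ordered B two_loop_quiver rels_212 [1, 2] [S\<^sub>1, S\<^sub>2] \<longrightarrow>
       complete_simples B [S\<^sub>1, S\<^sub>2] \<and>
       cartan_matrix B [S\<^sub>1, S\<^sub>2] = mat_of_rows_list 2 [[3, 1], [1, 3]] \<and>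
       (\<forall>D :: ('l, 't, 'k free set) cell_structure. cell_datum B D \<longrightarrow>
         has_decomposition_matrix B D [S\<^sub>1, S\<^sub>2]
           (mat_of_rows_list 2 [[1, 0], [1, 0], [1, 1], [0, 1], [0, 1]]))) \<and>
     (morita_equivalent_ordered B one_loop_quiver rels_221 [1, 2] [S\<^sub>1, S\<^sub>2] \<longrightarrow>
       complete_simples B [S\<^sub>1, S\<^sub>2] \<and>
       cartan_matrix B [S\<^sub>1, S\<^sub>2] = mat_of_rows_list 2 [[4, 2], [2, 3]] \<and>
       (\<forall>D :: ('l, 't, 'k free set) cell_structure. cell_datum B D \<longrightarrow>
         has_decomposition_matrix B D [S\<^sub>1, S\<^sub>2]
           (mat_of_rows_list 2 [[1, 0], [1, 0], [1, 1], [1, 1], [0, 1]]))) \<and>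
     (morita_equivalent_ordered B two_loop_quiver rels_222 [1, 2] [S\<^sub>1, S\<^sub>2] \<longrightarrow>
       complete_simples B [S\<^sub>1, S\<^sub>2] \<and>
       cartan_matrix B [S\<^sub>1, S\<^sub>2] = mat_of_rows_list 2 [[4, 2], [2, 4]] \<and>
       (\<forall>D :: ('l, 't, 'k free set) cell_structure. cell_datum B D \<longrightarrow>
         has_decomposition_matrix B D [S\<^sub>1, S\<^sub>2]
           (mat_of_rows_list 2 [[1, 0], [1, 0], [1, 1], [1, 1], [0, 1], [0, 1]])))"
proof -
 have B: "kalg B" by (rule kalg.kalg_block[OF kalg_hecke[OF assms(2)] assms(3)])
 have dec: "has_decomposition_matrix B D [S\<^sub>1, S\<^sub>2]
   (mat_of_rows_list 2 (replicate (a - b) [1, 0] @ replicate b [1, 1] @ replicate (c - b) [0, 1]))"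
  if "block_data B S\<^sub>1 S\<^sub>2 a b c" "b < a" "b < c" "a \<le> 4" "c \<le> 4" "cell_datum B D"
  for a b c and D :: "('l, 't, 'k free set) cell_structure"
 proof -
  interpret cellular B D by (intro cellular.intro cellular_axioms.intro B that(6))
  show ?thesis by (rule cellular_decomposition_matrix[OF that(1-5)])
 qed
 have all: "complete_simples B [S\<^sub>1, S\<^sub>2] \<and> cartan_matrix B [S\<^sub>1, S\<^sub>2] = mat_of_rows_list 2 [[a, b], [b, c]] \<and>
   (\<forall>D :: ('l, 't, 'k free set) cell_structure. cell_datum B D --> has_decomposition_matrix B D [S\<^sub>1, S\<^sub>2]
    (mat_of_rows_list 2 (replicate (a - b) [1, 0] @ replicate b [1, 1] @ replicate (c - b) [0, 1])))"
  if d: "block_data B S\<^sub>1 S\<^sub>2 a b c" and "b < a" "b < c" "a \<le> 4" "c \<le> 4" for a b c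
  using dec[OF that] kalg.block_data_cartan[OF B d] d unfolding block_data_def by blast
 \<comment> \<open>The row counts \<open>a - b\<close>, \<open>b\<close>, \<open>c - b\<close> are
   2, 1, 2 for A(2,1,2), then 2, 2, 1 for A(2,2,1) and 2, 2, 2 for A(2,2,2).\<close>
 have rep: "replicate (3 - 1) x = [x, x]" "replicate (4 - 2) x = [x, x]" "replicate (3 - 2) x = [x]"
  "replicate 1 x = [x]" "replicate 2 x = [x, x]" for x :: "nat list"
  by (simp_all add: eval_nat_numeral)
 note rs = rep append.simps
 show ?thesis
 proof (intro conjI[of "_ --> _"] impI)
  assume "morita_equivalent_ordered B two_loop_quiver rels_212 [1, 2] [S\<^sub>1, S\<^sub>2]"
  from all[OF block_data_212[OF B this], unfolded rs] show "complete_simples B [S\<^sub>1, S\<^sub>2] \<and>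
    cartan_matrix B [S\<^sub>1, S\<^sub>2] = mat_of_rows_list 2 [[3, 1], [1, 3]] \<and>
    (\<forall>D :: ('l, 't, 'k free set) cell_structure. cell_datum B D -->
     has_decomposition_matrix B D [S\<^sub>1, S\<^sub>2]
      (mat_of_rows_list 2 [[1, 0], [1, 0], [1, 1], [0, 1], [0, 1]]))" by simp
 next
  assume "morita_equivalent_ordered B one_loop_quiver rels_221 [1, 2] [S\<^sub>1, S\<^sub>2]"
  from all[OF block_data_221[OF B this], unfolded rs] show "complete_simples B [S\<^sub>1, S\<^sub>2] \<and>
    cartan_matrix B [S\<^sub>1, S\<^sub>2] = mat_of_rows_list 2 [[4, 2], [2, 3]] \<and>
    (\<forall>D :: ('l, 't, 'k free set) cell_structure. cell_datum B D -->
     has_decomposition_matrix B D [S\<^sub>1, S\<^sub>2]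
      (mat_of_rows_list 2 [[1, 0], [1, 0], [1, 1], [1, 1], [0, 1]]))" by simp
 next
  assume "morita_equivalent_ordered B two_loop_quiver rels_222 [1, 2] [S\<^sub>1, S\<^sub>2]"
  from all[OF block_data_222[OF B this], unfolded rs] show "complete_simples B [S\<^sub>1, S\<^sub>2] \<and>
    cartan_matrix B [S\<^sub>1, S\<^sub>2] = mat_of_rows_list 2 [[4, 2], [2, 4]] \<and>
    (\<forall>D :: ('l, 't, 'k free set) cell_structure. cell_datum B D -->
     has_decomposition_matrix B D [S\<^sub>1, S\<^sub>2]
      (mat_of_rows_list 2 [[1, 0], [1, 0], [1, 1], [1, 1], [0, 1], [0, 1]]))" by simp
 qed
qed

end
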